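(* Let $\mathbf{k}$ be an algebraically closed field of characteristic $p\ge 5$. Then the $p$-adic dimensions $\mathrm{Dim}_\pm$ are not multiplicative in general: for each choice of sign $\pm$ there exist a symmetric tensor category $\mathcal{C}$ over $\mathbf{k}$ and objects $X,Y\in\mathcal{C}$ such that $\mathrm{Dim}_\pm(X\otimes Y)\ne\mathrm{Dim}_\pm(X)\,\mathrm{Dim}_\pm(Y)$.
   Context: A symmetric tensor category over $\mathbf{k}$ is a $\mathbf{k}$-linear locally finite abelian rigid symmetric monoidal category with $\mathbf{k}$-bilinear tensor product and $\mathrm{End}(\mathbf{1})=\mathbf{k}$. The dimension of $X$ is $\dim(X):=\mathrm{ev}_X\circ c_{X,X^*}\circ\mathrm{coev}_X\in\mathbf{k}$, where $c$ is the commutativity constraint. $S^nX$ is the object of $S_n$-coinvariants of $X^{\otimes n}$, i.e. the degree $n$ part of the quotient $SX$ of the tensor algebra $TX$ by the two-sided ideal generated by the image of $c_{X,X}-1$. $\wedge^nX$ is the degree $n$ part of the quotient $\wedge X$ of $TX$ by the two-sided ideal generated by the kernel of $c_{X,X}-1$. For $t=\sum_{j\ge0}t_jp^j\in\mathbb{Z}_p$ with digits $t_j\in\{0,\dots,p-1\}$, $(1+z)^t:=\prod_{j\ge0}(1+z^{p^j})^{t_j}\in\mathbb{F}_p[[z]]$. The $p$-adic dimensions $\mathrm{Dim}_\pm(X)\in\mathbb{Z}_p$ are the unique $p$-adic integers (they are known to exist) such that $$\sum_{j\ge0}\dim(S^jX)z^j=(1-z)^{-\mathrm{Dim}_+(X)},\qquad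 \sum_{j\ge0}\dim(\wedge^jX)z^j=(1+z)^{\mathrm{Dim}_-(X)}.$$ *)

theory Defs
  imports
    "HOL-Computational_Algebra.Computational_Algebra"
    "HOL-Analysis.Infinite_Products"
    "Jordan_Normal_Form.Matrix"
begin

section \<open>Linear categories with a tensor product\<close>

text \<open>
  Operations need only make sense on the carriers \<open>Obj\<close> and \<open>Mor\<close>. Composition is written in
  applicative order: \<open>g \<cdot> f\<close> is \<open>f\<close> followed by \<open>g\<close>.
\<close>

record ('o, 'm, 'k) tensor_cat =
  Obj :: "'o set"
  Mor :: "'m set"
  Dom :: "'m \<Rightarrow> 'o"
  Cod :: "'m \<Rightarrow> 'o"
  Id :: "'o \<Rightarrow> 'm" ("\<i>\<d>\<index>")
  Comp :: "'m \<Rightarrow> 'm \<Rightarrow> 'm" (infixr "\<cdot>\<index>" 60)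
  ZeroM :: "'o \<Rightarrow> 'o \<Rightarrow> 'm" ("\<z>\<index>")
  Add :: "'m \<Rightarrow> 'm \<Rightarrow> 'm" (infixl "\<boxplus>\<index>" 55)
  Scale :: "'k \<Rightarrow> 'm \<Rightarrow> 'm" (infixr "\<star>\<index>" 58)
  Unit :: "'o" ("\<I>\<index>")
  TensorO :: "'o \<Rightarrow> 'o \<Rightarrow> 'o" (infixr "\<boxtimes>\<index>" 70)
  TensorM :: "'m \<Rightarrow> 'm \<Rightarrow> 'm" (infixr "\<boxdot>\<index>" 70)
  Assoc :: "'o \<Rightarrow> 'o \<Rightarrow> 'o \<Rightarrow> 'm"
  LUnit :: "'o \<Rightarrow> 'm"
  RUnit :: "'o \<Rightarrow> 'm"
  Braid :: "'o \<Rightarrow> 'o \<Rightarrow> 'm"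

definition hom :: "('o,'m,'k) tensor_cat \<Rightarrow> 'o \<Rightarrow> 'o \<Rightarrow> 'm set" where
  "hom C X Y = {f \<in> Mor C. Dom C f = X \<and> Cod C f = Y}"

definition inverse_pair :: "('o,'m,'k) tensor_cat \<Rightarrow> 'm \<Rightarrow> 'm \<Rightarrow> bool" where
  "inverse_pair C f g \<longleftrightarrow> f \<in> Mor C \<and> g \<in> hom C (Cod C f) (Dom C f) \<and>
     g \<cdot>\<^bsub>C\<^esub> f = \<i>\<d>\<^bsub>C\<^esub> (Dom C f) \<and> f \<cdot>\<^bsub>C\<^esub> g = \<i>\<d>\<^bsub>C\<^esub> (Cod C f)"

definition iso_mor :: "('o,'m,'k) tensor_cat \<Rightarrow> 'm \<Rightarrow> bool" where
  "iso_mor C f \<longleftrightarrow> (\<exists>g. inverse_pair C f g)"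

definition inv_mor :: "('o,'m,'k) tensor_cat \<Rightarrow> 'm \<Rightarrow> 'm" where
  "inv_mor C f = (THE g. inverse_pair C f g)"

definition mono_mor :: "('o,'m,'k) tensor_cat \<Rightarrow> 'm \<Rightarrow> bool" where
  "mono_mor C f \<longleftrightarrow> f \<in> Mor C \<and>
     (\<forall>Z. \<forall>g\<in>hom C Z (Dom C f). \<forall>h\<in>hom C Z (Dom C f). f \<cdot>\<^bsub>C\<^esub> g = f \<cdot>\<^bsub>C\<^esub> h \<longrightarrow> g = h)"

definition epi_mor :: "('o,'m,'k) tensor_cat \<Rightarrow> 'm \<Rightarrow> bool" where
  "epi_mor C f \<longleftrightarrow> f \<in> Mor C \<and>
     (\<forall>Z. \<forall>g\<in>hom C (Cod C f) Z. \<forall>h\<in>hom C (Cod C f) Z. g \<cdot>\<^bsub>C\<^esub> f = h \<cdot>\<^bsub>C\<^esub> f \<longrightarrow> g = h)"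

definition zero_obj :: "('o,'m,'k) tensor_cat \<Rightarrow> 'o \<Rightarrow> bool" where
  "zero_obj C Z \<longleftrightarrow> Z \<in> Obj C \<and>
     (\<forall>X\<in>Obj C. (\<exists>!f. f \<in> hom C Z X) \<and> (\<exists>!f. f \<in> hom C X Z))"

definition biproduct ::
  "('o,'m,'k) tensor_cat \<Rightarrow> 'o \<Rightarrow> 'o \<Rightarrow> 'o \<Rightarrow> 'm \<Rightarrow> 'm \<Rightarrow> 'm \<Rightarrow> 'm \<Rightarrow> bool" where
  "biproduct C X Y P i1 i2 p1 p2 \<longleftrightarrow>
     i1 \<in> hom C X P \<and> i2 \<in> hom C Y P \<and> p1 \<in> hom C P X \<and> p2 \<in> hom C P Y \<and>
     p1 \<cdot>\<^bsub>C\<^esub> i1 = \<i>\<d>\<^bsub>C\<^esub> X \<and> p2 \<cdot>\<^bsub>C\<^esub> i2 = \<i>\<d>\<^bsub>C\<^esub> Y \<and>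
     p1 \<cdot>\<^bsub>C\<^esub> i2 = \<z>\<^bsub>C\<^esub> Y X \<and> p2 \<cdot>\<^bsub>C\<^esub> i1 = \<z>\<^bsub>C\<^esub> X Y \<and>
     (i1 \<cdot>\<^bsub>C\<^esub> p1) \<boxplus>\<^bsub>C\<^esub> (i2 \<cdot>\<^bsub>C\<^esub> p2) = \<i>\<d>\<^bsub>C\<^esub> P"

definition is_kernel :: "('o,'m,'k) tensor_cat \<Rightarrow> 'm \<Rightarrow> 'm \<Rightarrow> bool" where
  "is_kernel C k f \<longleftrightarrow> f \<in> Mor C \<and> k \<in> hom C (Dom C k) (Dom C f) \<and>
     f \<cdot>\<^bsub>C\<^esub> k = \<z>\<^bsub>C\<^esub> (Dom C k) (Cod C f) \<and>
     (\<forall>Z. \<forall>h\<in>hom C Z (Dom C f). f \<cdot>\<^bsub>C\<^esub> h = \<z>\<^bsub>C\<^esub> Z (Cod C f) \<longrightarrow>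
        (\<exists>!u. u \<in> hom C Z (Dom C k) \<and> k \<cdot>\<^bsub>C\<^esub> u = h))"

definition is_cokernel :: "('o,'m,'k) tensor_cat \<Rightarrow> 'm \<Rightarrow> 'm \<Rightarrow> bool" where
  "is_cokernel C q f \<longleftrightarrow> f \<in> Mor C \<and> q \<in> hom C (Cod C f) (Cod C q) \<and>
     q \<cdot>\<^bsub>C\<^esub> f = \<z>\<^bsub>C\<^esub> (Dom C f) (Cod C q) \<and>
     (\<forall>Z. \<forall>h\<in>hom C (Cod C f) Z. h \<cdot>\<^bsub>C\<^esub> f = \<z>\<^bsub>C\<^esub> (Dom C f) Z \<longrightarrow>
        (\<exists>!u. u \<in> hom C (Cod C q) Z \<and> u \<cdot>\<^bsub>C\<^esub> q = h))"

definition simple_obj :: "('o,'m,'k) tensor_cat \<Rightarrow> 'o \<Rightarrow> bool" where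
  "simple_obj C S \<longleftrightarrow> S \<in> Obj C \<and> \<not> zero_obj C S \<and>
     (\<forall>m. mono_mor C m \<and> Cod C m = S \<longrightarrow> zero_obj C (Dom C m) \<or> iso_mor C m)"

text \<open>Existence of a finite filtration with simple subquotients.\<close>

inductive finite_length :: "('o,'m,'k) tensor_cat \<Rightarrow> 'o \<Rightarrow> bool" for C where
  zero: "zero_obj C X \<Longrightarrow> finite_length C X"
| extend: "finite_length C Y \<Longrightarrow> simple_obj C S \<Longrightarrow> f \<in> hom C Y X \<Longrightarrow> g \<in> hom C X S \<Longrightarrow>
     is_kernel C f g \<Longrightarrow> is_cokernel C g f \<Longrightarrow> finite_length C X"

inductive_set mor_span :: "('o,'m,'k) tensor_cat \<Rightarrow> 'o \<Rightarrow> 'o \<Rightarrow> 'm set \<Rightarrow> 'm set" for C X Y B where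
  zero: "\<z>\<^bsub>C\<^esub> X Y \<in> mor_span C X Y B"
| step: "b \<in> B \<Longrightarrow> f \<in> mor_span C X Y B \<Longrightarrow> (a \<star>\<^bsub>C\<^esub> b) \<boxplus>\<^bsub>C\<^esub> f \<in> mor_span C X Y B"

text \<open>
  \<open>Xd\<close> is a left dual of \<open>X\<close>, with evaluation \<open>ev : Xd \<otimes> X \<rightarrow> 1\<close> and coevaluation
  \<open>coev : 1 \<rightarrow> X \<otimes> Xd\<close>. The last two clauses are the zig-zag identities; there \<open>X\<close> and \<open>Xd\<close>
  are identified with \<open>1 \<otimes> X\<close> etc. by the unit constraints, which have been moved to one side each.
\<close>

definition left_dual :: "('o,'m,'k) tensor_cat \<Rightarrow> 'o \<Rightarrow> 'o \<Rightarrow> 'm \<Rightarrow> 'm \<Rightarrow> bool" where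
  "left_dual C X Xd ev coev \<longleftrightarrow> X \<in> Obj C \<and> Xd \<in> Obj C \<and>
     ev \<in> hom C (Xd \<boxtimes>\<^bsub>C\<^esub> X) \<I>\<^bsub>C\<^esub> \<and> coev \<in> hom C \<I>\<^bsub>C\<^esub> (X \<boxtimes>\<^bsub>C\<^esub> Xd) \<and>
     RUnit C X \<cdot>\<^bsub>C\<^esub> (\<i>\<d>\<^bsub>C\<^esub> X \<boxdot>\<^bsub>C\<^esub> ev) \<cdot>\<^bsub>C\<^esub> Assoc C X Xd X \<cdot>\<^bsub>C\<^esub> (coev \<boxdot>\<^bsub>C\<^esub> \<i>\<d>\<^bsub>C\<^esub> X) = LUnit C X \<and>
     LUnit C Xd \<cdot>\<^bsub>C\<^esub> (ev \<boxdot>\<^bsub>C\<^esub> \<i>\<d>\<^bsub>C\<^esub> Xd) \<cdot>\<^bsub>C\<^esub> inv_mor C (Assoc C Xd X Xd) \<cdot>\<^bsub>C\<^esub> (\<i>\<d>\<^bsub>C\<^esub> Xd \<boxdot>\<^bsub>C\<^esub> coev)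
       = RUnit C Xd"


section \<open>Symmetric tensor categories\<close>

locale tc_category =
  fixes C :: "('o,'m,'k::field) tensor_cat" (structure)
  assumes dom_obj: "f \<in> Mor C \<Longrightarrow> Dom C f \<in> Obj C"
    and cod_obj: "f \<in> Mor C \<Longrightarrow> Cod C f \<in> Obj C"
    and id_hom: "X \<in> Obj C \<Longrightarrow> \<i>\<d> X \<in> hom C X X"
    and comp_hom: "f \<in> hom C X Y \<Longrightarrow> g \<in> hom C Y Z \<Longrightarrow> g \<cdot> f \<in> hom C X Z"
    and id_left: "f \<in> hom C X Y \<Longrightarrow> \<i>\<d> Y \<cdot> f = f"
    and id_right: "f \<in> hom C X Y \<Longrightarrow> f \<cdot> \<i>\<d> X = f"
    and comp_assoc: "f \<in> hom C W X \<Longrightarrow> g \<in> hom C X Y \<Longrightarrow> h \<in> hom C Y Z \<Longrightarrow>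
      (h \<cdot> g) \<cdot> f = h \<cdot> (g \<cdot> f)"

locale tc_linear = tc_category +
  assumes zero_hom: "X \<in> Obj C \<Longrightarrow> Y \<in> Obj C \<Longrightarrow> \<z> X Y \<in> hom C X Y"
    and add_hom: "f \<in> hom C X Y \<Longrightarrow> g \<in> hom C X Y \<Longrightarrow> f \<boxplus> g \<in> hom C X Y"
    and scale_hom: "f \<in> hom C X Y \<Longrightarrow> a \<star> f \<in> hom C X Y"
    and add_assoc: "f \<in> hom C X Y \<Longrightarrow> g \<in> hom C X Y \<Longrightarrow> h \<in> hom C X Y \<Longrightarrow>
      (f \<boxplus> g) \<boxplus> h = f \<boxplus> (g \<boxplus> h)"
    and add_commute: "f \<in> hom C X Y \<Longrightarrow> g \<in> hom C X Y \<Longrightarrow> f \<boxplus> g = g \<boxplus> f"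
    and add_zero: "f \<in> hom C X Y \<Longrightarrow> f \<boxplus> \<z> X Y = f"
    and add_inverse: "f \<in> hom C X Y \<Longrightarrow> \<exists>g\<in>hom C X Y. f \<boxplus> g = \<z> X Y"
    and scale_one: "f \<in> hom C X Y \<Longrightarrow> 1 \<star> f = f"
    and scale_scale: "f \<in> hom C X Y \<Longrightarrow> a \<star> (b \<star> f) = (a * b) \<star> f"
    and scale_add_left: "f \<in> hom C X Y \<Longrightarrow> (a + b) \<star> f = (a \<star> f) \<boxplus> (b \<star> f)"
    and scale_add_right: "f \<in> hom C X Y \<Longrightarrow> g \<in> hom C X Y \<Longrightarrow> a \<star> (f \<boxplus> g) = (a \<star> f) \<boxplus> (a \<star> g)"
    and comp_add_left: "f \<in> hom C X Y \<Longrightarrow> g \<in> hom C Y Z \<Longrightarrow> h \<in> hom C Y Z \<Longrightarrow>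
      (g \<boxplus> h) \<cdot> f = (g \<cdot> f) \<boxplus> (h \<cdot> f)"
    and comp_add_right: "f \<in> hom C X Y \<Longrightarrow> g \<in> hom C X Y \<Longrightarrow> h \<in> hom C Y Z \<Longrightarrow>
      h \<cdot> (f \<boxplus> g) = (h \<cdot> f) \<boxplus> (h \<cdot> g)"
    and comp_scale_left: "f \<in> hom C X Y \<Longrightarrow> g \<in> hom C Y Z \<Longrightarrow> (a \<star> g) \<cdot> f = a \<star> (g \<cdot> f)"
    and comp_scale_right: "f \<in> hom C X Y \<Longrightarrow> g \<in> hom C Y Z \<Longrightarrow> g \<cdot> (a \<star> f) = a \<star> (g \<cdot> f)"

locale tc_abelian = tc_linear +
  assumes ex_zero_obj: "\<exists>Z. zero_obj C Z"
    and ex_biproduct: "X \<in> Obj C \<Longrightarrow> Y \<in> Obj C \<Longrightarrow> \<exists>P i1 i2 p1 p2. biproduct C X Y P i1 i2 p1 p2"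
    and ex_kernel: "f \<in> Mor C \<Longrightarrow> \<exists>k. is_kernel C k f"
    and ex_cokernel: "f \<in> Mor C \<Longrightarrow> \<exists>q. is_cokernel C q f"
    and mono_is_kernel: "mono_mor C f \<Longrightarrow> \<exists>g. is_kernel C f g"
    and epi_is_cokernel: "epi_mor C f \<Longrightarrow> \<exists>g. is_cokernel C f g"

locale tc_locally_finite = tc_abelian +
  assumes hom_finite_dim: "X \<in> Obj C \<Longrightarrow> Y \<in> Obj C \<Longrightarrow>
      \<exists>B. finite B \<and> B \<subseteq> hom C X Y \<and> hom C X Y \<subseteq> mor_span C X Y B"
    and obj_finite_length: "X \<in> Obj C \<Longrightarrow> finite_length C X"

locale tc_monoidal = tc_category +
  assumes unit_obj: "\<I> \<in> Obj C"
    and tensor_obj: "X \<in> Obj C \<Longrightarrow> Y \<in> Obj C \<Longrightarrow> X \<boxtimes> Y \<in> Obj C"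
    and tensor_hom: "f \<in> hom C X X' \<Longrightarrow> g \<in> hom C Y Y' \<Longrightarrow> f \<boxdot> g \<in> hom C (X \<boxtimes> Y) (X' \<boxtimes> Y')"
    and tensor_id: "X \<in> Obj C \<Longrightarrow> Y \<in> Obj C \<Longrightarrow> \<i>\<d> X \<boxdot> \<i>\<d> Y = \<i>\<d> (X \<boxtimes> Y)"
    and tensor_comp: "f \<in> hom C X X' \<Longrightarrow> f' \<in> hom C X' X'' \<Longrightarrow> g \<in> hom C Y Y' \<Longrightarrow> g' \<in> hom C Y' Y'' \<Longrightarrow>
      (f' \<cdot> f) \<boxdot> (g' \<cdot> g) = (f' \<boxdot> g') \<cdot> (f \<boxdot> g)"
    and assoc_hom: "X \<in> Obj C \<Longrightarrow> Y \<in> Obj C \<Longrightarrow> Z \<in> Obj C \<Longrightarrow>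
      Assoc C X Y Z \<in> hom C ((X \<boxtimes> Y) \<boxtimes> Z) (X \<boxtimes> (Y \<boxtimes> Z))"
    and assoc_iso: "X \<in> Obj C \<Longrightarrow> Y \<in> Obj C \<Longrightarrow> Z \<in> Obj C \<Longrightarrow> iso_mor C (Assoc C X Y Z)"
    and assoc_natural: "f \<in> hom C X X' \<Longrightarrow> g \<in> hom C Y Y' \<Longrightarrow> h \<in> hom C Z Z' \<Longrightarrow>
      Assoc C X' Y' Z' \<cdot> ((f \<boxdot> g) \<boxdot> h) = (f \<boxdot> (g \<boxdot> h)) \<cdot> Assoc C X Y Z"
    and lunit_hom: "X \<in> Obj C \<Longrightarrow> LUnit C X \<in> hom C (\<I> \<boxtimes> X) X"
    and lunit_iso: "X \<in> Obj C \<Longrightarrow> iso_mor C (LUnit C X)"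
    and lunit_natural: "f \<in> hom C X Y \<Longrightarrow> LUnit C Y \<cdot> (\<i>\<d> \<I> \<boxdot> f) = f \<cdot> LUnit C X"
    and runit_hom: "X \<in> Obj C \<Longrightarrow> RUnit C X \<in> hom C (X \<boxtimes> \<I>) X"
    and runit_iso: "X \<in> Obj C \<Longrightarrow> iso_mor C (RUnit C X)"
    and runit_natural: "f \<in> hom C X Y \<Longrightarrow> RUnit C Y \<cdot> (f \<boxdot> \<i>\<d> \<I>) = f \<cdot> RUnit C X"
    and pentagon: "W \<in> Obj C \<Longrightarrow> X \<in> Obj C \<Longrightarrow> Y \<in> Obj C \<Longrightarrow> Z \<in> Obj C \<Longrightarrow>
      (\<i>\<d> W \<boxdot> Assoc C X Y Z) \<cdot> Assoc C W (X \<boxtimes> Y) Z \<cdot> (Assoc C W X Y \<boxdot> \<i>\<d> Z) =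
      Assoc C W X (Y \<boxtimes> Z) \<cdot> Assoc C (W \<boxtimes> X) Y Z"
    and triangle: "X \<in> Obj C \<Longrightarrow> Y \<in> Obj C \<Longrightarrow>
      (\<i>\<d> X \<boxdot> LUnit C Y) \<cdot> Assoc C X \<I> Y = RUnit C X \<boxdot> \<i>\<d> Y"

text \<open>By the symmetry axiom one of the two hexagon identities implies the other.\<close>

locale tc_symmetric_monoidal = tc_monoidal +
  assumes braid_hom: "X \<in> Obj C \<Longrightarrow> Y \<in> Obj C \<Longrightarrow> Braid C X Y \<in> hom C (X \<boxtimes> Y) (Y \<boxtimes> X)"
    and braid_natural: "f \<in> hom C X X' \<Longrightarrow> g \<in> hom C Y Y' \<Longrightarrow>
      Braid C X' Y' \<cdot> (f \<boxdot> g) = (g \<boxdot> f) \<cdot> Braid C X Y"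
    and braid_symmetric: "X \<in> Obj C \<Longrightarrow> Y \<in> Obj C \<Longrightarrow> Braid C Y X \<cdot> Braid C X Y = \<i>\<d> (X \<boxtimes> Y)"
    and hexagon: "X \<in> Obj C \<Longrightarrow> Y \<in> Obj C \<Longrightarrow> Z \<in> Obj C \<Longrightarrow>
      Assoc C Y Z X \<cdot> Braid C X (Y \<boxtimes> Z) \<cdot> Assoc C X Y Z =
      (\<i>\<d> Y \<boxdot> Braid C X Z) \<cdot> Assoc C Y X Z \<cdot> (Braid C X Y \<boxdot> \<i>\<d> Z)"

locale symmetric_tensor_category = tc_locally_finite + tc_symmetric_monoidal +
  assumes tensor_add_left: "f \<in> hom C X X' \<Longrightarrow> f' \<in> hom C X X' \<Longrightarrow> g \<in> hom C Y Y' \<Longrightarrow>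
      (f \<boxplus> f') \<boxdot> g = (f \<boxdot> g) \<boxplus> (f' \<boxdot> g)"
    and tensor_add_right: "f \<in> hom C X X' \<Longrightarrow> g \<in> hom C Y Y' \<Longrightarrow> g' \<in> hom C Y Y' \<Longrightarrow>
      f \<boxdot> (g \<boxplus> g') = (f \<boxdot> g) \<boxplus> (f \<boxdot> g')"
    and tensor_scale_left: "f \<in> hom C X X' \<Longrightarrow> g \<in> hom C Y Y' \<Longrightarrow> (a \<star> f) \<boxdot> g = a \<star> (f \<boxdot> g)"
    and tensor_scale_right: "f \<in> hom C X X' \<Longrightarrow> g \<in> hom C Y Y' \<Longrightarrow> f \<boxdot> (a \<star> g) = a \<star> (f \<boxdot> g)"
    and ex_left_dual: "X \<in> Obj C \<Longrightarrow> \<exists>Xd ev coev. left_dual C X Xd ev coev"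
    and ex_right_dual: "X \<in> Obj C \<Longrightarrow> \<exists>dX ev coev. left_dual C dX X ev coev"
    and End_unit: "bij_betw (\<lambda>a. a \<star> \<i>\<d> \<I>) UNIV (hom C \<I> \<I>)"


section \<open>Dimensions, symmetric and exterior powers\<close>

text \<open>The scalar does not depend on the choice of the dual object and its structure maps.\<close>

definition cat_dim :: "('o,'m,'k) tensor_cat \<Rightarrow> 'o \<Rightarrow> 'k" where
  "cat_dim C X = (THE d. \<exists>Xd ev coev. left_dual C X Xd ev coev \<and>
     ev \<cdot>\<^bsub>C\<^esub> Braid C X Xd \<cdot>\<^bsub>C\<^esub> coev = d \<star>\<^bsub>C\<^esub> \<i>\<d>\<^bsub>C\<^esub> \<I>\<^bsub>C\<^esub>)"

primrec tensor_power :: "('o,'m,'k) tensor_cat \<Rightarrow> 'o \<Rightarrow> nat \<Rightarrow> 'o" where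
  "tensor_power C X 0 = \<I>\<^bsub>C\<^esub>"
| "tensor_power C X (Suc n) = X \<boxtimes>\<^bsub>C\<^esub> tensor_power C X n"

text \<open>
  For \<open>r : R \<rightarrow> X \<otimes> X\<close> this is \<open>id \<otimes> r \<otimes> id : X^i \<otimes> R \<otimes> X^j \<rightarrow> X^(i+j+2)\<close>, where
  the source is bracketed to the right.
\<close>

primrec ideal_gen :: "('o,'m,'k) tensor_cat \<Rightarrow> 'o \<Rightarrow> 'm \<Rightarrow> nat \<Rightarrow> nat \<Rightarrow> 'm" where
  "ideal_gen C X r 0 j =
     Assoc C X X (tensor_power C X j) \<cdot>\<^bsub>C\<^esub> (r \<boxdot>\<^bsub>C\<^esub> \<i>\<d>\<^bsub>C\<^esub> (tensor_power C X j))"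
| "ideal_gen C X r (Suc i) j = \<i>\<d>\<^bsub>C\<^esub> X \<boxdot>\<^bsub>C\<^esub> ideal_gen C X r i j"

definition kills_ideal :: "('o,'m,'k) tensor_cat \<Rightarrow> 'o \<Rightarrow> 'm \<Rightarrow> nat \<Rightarrow> 'm \<Rightarrow> bool" where
  "kills_ideal C X r n h \<longleftrightarrow> (\<forall>i j. i + j + 2 = n \<longrightarrow>
     h \<cdot>\<^bsub>C\<^esub> ideal_gen C X r i j = \<z>\<^bsub>C\<^esub> (Dom C (ideal_gen C X r i j)) (Cod C h))"

text \<open>
  \<open>q : X^n \<rightarrow> Q\<close> is the degree \<open>n\<close> part of the quotient of the tensor algebra \<open>TX\<close> by the two-sided
  ideal generated by the image of \<open>r : R \<rightarrow> X \<otimes> X\<close>. The degree \<open>n\<close> part of that ideal is the sum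
  of the images of all \<open>ideal_gen C X r i j\<close> with \<open>i + j + 2 = n\<close>, so \<open>Q\<close> is the joint
  cokernel of these morphisms.
\<close>

definition quadratic_quotient :: "('o,'m,'k) tensor_cat \<Rightarrow> 'o \<Rightarrow> 'm \<Rightarrow> nat \<Rightarrow> 'o \<Rightarrow> 'm \<Rightarrow> bool" where
  "quadratic_quotient C X r n Q q \<longleftrightarrow>
     q \<in> hom C (tensor_power C X n) Q \<and> kills_ideal C X r n q \<and>
     (\<forall>Z. \<forall>h\<in>hom C (tensor_power C X n) Z. kills_ideal C X r n h \<longrightarrow>
        (\<exists>!u. u \<in> hom C Q Z \<and> u \<cdot>\<^bsub>C\<^esub> q = h))"

definition braid_minus_id :: "('o,'m,'k::field) tensor_cat \<Rightarrow> 'o \<Rightarrow> 'm" where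
  "braid_minus_id C X = Braid C X X \<boxplus>\<^bsub>C\<^esub> ((-1) \<star>\<^bsub>C\<^esub> \<i>\<d>\<^bsub>C\<^esub> (X \<boxtimes>\<^bsub>C\<^esub> X))"

text \<open>These objects are determined up to isomorphism only.\<close>

definition sym_power :: "('o,'m,'k::field) tensor_cat \<Rightarrow> nat \<Rightarrow> 'o \<Rightarrow> 'o" where
  "sym_power C n X = (SOME Q. \<exists>q. quadratic_quotient C X (braid_minus_id C X) n Q q)"

definition ext_power :: "('o,'m,'k::field) tensor_cat \<Rightarrow> nat \<Rightarrow> 'o \<Rightarrow> 'o" where
  "ext_power C n X =
     (SOME Q. \<exists>\<kappa> q. is_kernel C \<kappa> (braid_minus_id C X) \<and> quadratic_quotient C X \<kappa> n Q q)"


section \<open>$p$-adic integers and $p$-adic dimensions\<close>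

text \<open>
  The ring of \<open>p\<close>-adic integers is the inverse limit of the rings \<open>\<int>/p\<^sup>n\<close>: the \<open>n\<close>-th entry is
  the residue modulo \<open>p\<^sup>n\<close>, represented in \<open>{0..<p\<^sup>n}\<close>.
\<close>

definition padic_ints :: "nat \<Rightarrow> (nat \<Rightarrow> int) set" where
  "padic_ints p = {t. \<forall>n. t n \<in> {0..<int p ^ n} \<and> t (Suc n) mod int p ^ n = t n}"

definition padic_mult :: "nat \<Rightarrow> (nat \<Rightarrow> int) \<Rightarrow> (nat \<Rightarrow> int) \<Rightarrow> nat \<Rightarrow> int" where
  "padic_mult p s t = (\<lambda>n. (s n * t n) mod int p ^ n)"

definition padic_uminus :: "nat \<Rightarrow> (nat \<Rightarrow> int) \<Rightarrow> nat \<Rightarrow> int" where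
  "padic_uminus p t = (\<lambda>n. (- t n) mod int p ^ n)"

text \<open>The digits of \<open>t = (\<Sum>j. t\<^sub>j * p ^ j)\<close>: the residue modulo \<open>p ^ (j + 1)\<close> is \<open>t\<^sub>0 + \<dots> + t\<^sub>j * p ^ j\<close>.\<close>

definition padic_digit :: "nat \<Rightarrow> (nat \<Rightarrow> int) \<Rightarrow> nat \<Rightarrow> nat" where
  "padic_digit p t j = nat (t (Suc j) div int p ^ j)"

text \<open>
  \<open>(1 + u)^t\<close> for a power series \<open>u\<close> without constant term; the infinite product converges in
  the \<open>z\<close>-adic topology. The coefficients lie in the prime field, viewed inside \<open>'k\<close>.
\<close>

definition padic_binomial :: "'k::field fps \<Rightarrow> (nat \<Rightarrow> int) \<Rightarrow> 'k fps" where
  "padic_binomial u t = (\<Prod>j. (1 + u ^ (CHAR('k) ^ j)) ^ padic_digit CHAR('k) t j)"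

definition Dim_plus :: "('o,'m,'k::field) tensor_cat \<Rightarrow> 'o \<Rightarrow> nat \<Rightarrow> int" where
  "Dim_plus C X = (THE d. d \<in> padic_ints CHAR('k) \<and>
     Abs_fps (\<lambda>j. cat_dim C (sym_power C j X)) = padic_binomial (- fps_X) (padic_uminus CHAR('k) d))"

definition Dim_minus :: "('o,'m,'k::field) tensor_cat \<Rightarrow> 'o \<Rightarrow> nat \<Rightarrow> int" where
  "Dim_minus C X = (THE d. d \<in> padic_ints CHAR('k) \<and>
     Abs_fps (\<lambda>j. cat_dim C (ext_power C j X)) = padic_binomial fps_X d)"


section \<open>The ambient types\<close>

text \<open>
  A statement of higher-order logic cannot quantify existentially over types, so the objects and
  morphisms of a category whose existence is claimed have to be drawn from fixed types. For an
  infinite field \<open>'k\<close> the types below have at least as many elements as \<open>'k\<close>, and this is no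
  restriction: the full subcategory generated by finitely many objects of a symmetric tensor
  category under tensor products, duals, direct sums and subquotients has at most \<open>|'k|\<close>
  isomorphism classes of objects and at most \<open>|'k|\<close> morphisms between any two of them.
\<close>

type_synonym 'k small_tensor_cat = "('k mat, 'k mat \<times> 'k mat \<times> 'k mat set, 'k) tensor_cat"

end

theory Submission
  imports Defs "Jordan_Normal_Form.Determinant"
begin

text \<open>
  The category is the semisimplification of the representations over \<open>k\<close> of the cyclic group of order
  \<open>2p\<close>, with the super braiding in which the element of order two acts as the parity. Let \<open>X\<close> be
  the even unipotent Jordan block of size two and \<open>Y\<close> the odd line. The symmetric powers \<open>S\<^sup>jX\<close> are
  Jordan blocks of size \<open>j + 1\<close>, and \<open>S\<^sup>p\<^sup>-\<^sup>1X\<close>, a block of size \<open>p\<close>, is negligible. Hence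
  \<open>\<Sum> dim (S\<^sup>jX) z\<^sup>j = \<Sum>\<^sub>j\<^sub><\<^sub>p\<^sub>-\<^sub>1 (j + 1) z\<^sup>j = (1 - z)\<^sup>p\<^sup>-\<^sup>2\<close>, so that \<open>Dim\<^sub>+ X = -(p - 2)\<close>, and \<open>Dim\<^sub>+ Y = -1\<close>. But
  \<open>S\<^sup>j(X \<otimes> Y)\<close> is \<open>\<Lambda>\<^sup>jX\<close> up to parity, so it gives the series \<open>(1 - z)\<^sup>2\<close> and
  \<open>Dim\<^sub>+ (X \<otimes> Y) = -2 \<noteq> p - 2\<close>. Exchanging the roles of \<open>X\<close> and \<open>X \<otimes> Y\<close>, in the same way
  \<open>Dim\<^sub>- (X \<otimes> Y) = p - 2\<close>, \<open>Dim\<^sub>- Y = -1\<close> and \<open>Dim\<^sub>- X = 2 \<noteq> -(p - 2)\<close>.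
\<close>

section \<open>Matrices and Kronecker products\<close>

text \<open>The coefficient of \<open>z\<close> shows that both p-adic dimensions reduce modulo
  \<open>p\<close> to the categorical dimension, which is multiplicative. A failure can thus be
  visible in the second digit at the earliest, and the discrepancies found here are exactly
  \<open>-p\<close> and \<open>p\<close>. In the quotient category morphisms are matrices up to
  negligible ones, and symmetric and exterior powers are joint cokernels there, so they cannot be
  computed on vectors. Instead a candidate power comes with a projection from the tensor power and a
  section of it, and it suffices that every (anti)symmetric map absorbs the resulting idempotent.
  The section comes from annihilation operators and divides by 1, ..., n. For binary forms it
  therefore reaches degree \<open>p - 1\<close> but no further; precisely this degree is negligible,
  and absorption then forces all higher degrees to vanish. For the exterior algebra of a plane the
  zero object in degree 3 plays this part, at the price of dividing by 3. A representation of a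
  cyclic group is a single matrix, so objects live in the prescribed type, and the Kronecker product
  is strictly associative, so all associativity and unit constraints are identities.\<close>

lemma index_mult_sum:
  assumes "i < dim_row A" "j < dim_col B" "dim_col A = dim_row B"
  shows "(A * B) $$ (i,j) = (\<Sum>k<dim_row B. A $$ (i,k) * B $$ (k,j))"
  using assms by (simp add: scalar_prod_def lessThan_atLeast0)

declare index_mult_mat(1) [simp del]

text \<open>This law and the following ones are restated with equations between dimensions instead
  of carrier sets, since the simplifier can discharge such equations by itself.\<close>

lemma mat_mult_assoc:
  fixes A :: "'a::semiring_0 mat"
  assumes "dim_col A = dim_row B" "dim_col B = dim_row C"
  shows "A * B * C = A * (B * C)"
  by (rule assoc_mult_mat) (use assms in auto)

lemma mat_add_mult:
  fixes A :: "'a::semiring_0 mat"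
  assumes "dim_row A = dim_row B" "dim_col A = dim_col B" "dim_col B = dim_row C"
  shows "(A + B) * C = A * C + B * C"
  by (rule add_mult_distrib_mat) (use assms in auto)

lemma mat_mult_add:
  fixes A :: "'a::semiring_0 mat"
  assumes "dim_row C = dim_row B" "dim_col C = dim_col B" "dim_col A = dim_row B"
  shows "A * (B + C) = A * B + A * C"
  by (rule mult_add_distrib_mat) (use assms in auto)

lemma mat_diff_mult:
  fixes A :: "'a::ring mat"
  assumes "dim_row A = dim_row B" "dim_col A = dim_col B" "dim_col B = dim_row C"
  shows "(A - B) * C = A * C - B * C"
  by (rule minus_mult_distrib_mat) (use assms in auto)

lemma mat_mult_diff:
  fixes A :: "'a::ring mat"
  assumes "dim_row C = dim_row B" "dim_col C = dim_col B" "dim_col A = dim_row B"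
  shows "A * (B - C) = A * B - A * C"
  by (rule mult_minus_distrib_mat) (use assms in auto)

lemma mat_smult_mult:
  fixes A :: "'a::comm_semiring_0 mat"
  assumes "dim_col A = dim_row B"
  shows "(c \<cdot>\<^sub>m A) * B = c \<cdot>\<^sub>m (A * B)"
  by (rule mult_smult_assoc_mat) (use assms in auto)

lemma mat_mult_smult:
  fixes A :: "'a::comm_semiring_0 mat"
  assumes "dim_col A = dim_row B"
  shows "A * (c \<cdot>\<^sub>m B) = c \<cdot>\<^sub>m (A * B)"
  by (rule mult_smult_distrib) (use assms in auto)

lemma mat_transpose_mult:
  fixes A :: "'a::comm_semiring_0 mat"
  assumes "dim_col A = dim_row B"
  shows "transpose_mat (A * B) = transpose_mat B * transpose_mat A"
  by (rule transpose_mult) (use assms in auto)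

lemmas mat_distribs = mat_mult_assoc mat_add_mult mat_mult_add mat_diff_mult mat_mult_diff
  mat_smult_mult mat_mult_smult

lemma mat_smult_smult: "a \<cdot>\<^sub>m (b \<cdot>\<^sub>m (A :: 'a::semigroup_mult mat)) = (a * b) \<cdot>\<^sub>m A"
  by (rule eq_matI) (auto simp: mult.assoc)

lemma mat_smult_add: "dim_row A = dim_row B \<Longrightarrow> dim_col A = dim_col B \<Longrightarrow>
    a \<cdot>\<^sub>m (A + (B :: 'a::semiring mat)) = a \<cdot>\<^sub>m A + a \<cdot>\<^sub>m B"
  by (rule eq_matI) (auto simp: distrib_left)

lemma mat_add_smult: "(a + b) \<cdot>\<^sub>m (A :: 'a::semiring mat) = a \<cdot>\<^sub>m A + b \<cdot>\<^sub>m A"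
  by (rule eq_matI) (auto simp: distrib_right)

lemma mat_one_smult: "(1 :: 'a::monoid_mult) \<cdot>\<^sub>m A = A"
  by (rule eq_matI) auto

lemma mat_add_zero [simp]:
  fixes A :: "'a::monoid_add mat"
  assumes "dim_row A = m" "dim_col A = n"
  shows "A + 0\<^sub>m m n = A" "0\<^sub>m m n + A = A"
  by (rule eq_matI; use assms in simp)+

section \<open>Traces and sums over encoded pairs\<close>

definition trace :: "'a::comm_monoid_add mat \<Rightarrow> 'a" where
  "trace A = (\<Sum>i<dim_row A. A $$ (i,i))"

lemma trace_mult_commute:
  fixes A B :: "'a::comm_semiring_0 mat"
  assumes "dim_col A = dim_row B" "dim_col B = dim_row A"
  shows "trace (A * B) = trace (B * A)"
proof -
  have "trace (A * B) = (\<Sum>i<dim_row A. \<Sum>k<dim_row B. A $$ (i,k) * B $$ (k,i))"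
    unfolding trace_def by (rule sum.cong) (use assms in \<open>auto simp: index_mult_sum\<close>)
  also have "\<dots> = (\<Sum>k<dim_row B. \<Sum>i<dim_row A. B $$ (k,i) * A $$ (i,k))"
    by (subst sum.swap) (simp add: mult.commute)
  also have "\<dots> = trace (B * A)"
    unfolding trace_def by (rule sum.cong) (use assms in \<open>auto simp: index_mult_sum\<close>)
  finally show ?thesis .
qed

lemma trace_add:
  "dim_row A = dim_row B \<Longrightarrow> dim_col A = dim_col B \<Longrightarrow> dim_row B = dim_col B \<Longrightarrow>
     trace (A + B) = trace A + trace (B :: 'a::comm_monoid_add mat)"
  by (simp add: trace_def sum.distrib)

lemma trace_diff:
  "dim_row A = dim_row B \<Longrightarrow> dim_col A = dim_col B \<Longrightarrow> dim_row B = dim_col B \<Longrightarrow>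
     trace (A - B) = trace A - trace (B :: 'a::ab_group_add mat)"
  by (simp add: trace_def sum_subtractf)

lemma trace_smult:
  "dim_row A = dim_col A \<Longrightarrow> trace (c \<cdot>\<^sub>m A) = c * trace (A :: 'a::semiring_0 mat)"
  by (simp add: trace_def sum_distrib_left)

lemma trace_zero [simp]: "trace (0\<^sub>m n n) = (0 :: 'a::comm_monoid_add)"
  by (simp add: trace_def)

lemma trace_one [simp]: "trace (1\<^sub>m n) = (of_nat n :: 'a::semiring_1)"
  by (simp add: trace_def)

text \<open>Indices of a Kronecker product encode the pair \<open>(i, j)\<close> as
  \<open>i * n + j\<close>; sums over them become double sums.\<close>

lemma sum_div_mod:
  fixes f :: "nat \<Rightarrow> nat \<Rightarrow> 'a::comm_monoid_add"
  shows "(\<Sum>k<m * n. f (k div n) (k mod n)) = (\<Sum>i<m. \<Sum>j<n. f i j)"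
proof -
  have "(\<Sum>k<m * n. f (k div n) (k mod n)) = (\<Sum>i<m. \<Sum>k=i*n..<i*n+n. f (k div n) (k mod n))"
    by (rule sum.nat_group [symmetric])
  also have "\<dots> = (\<Sum>i<m. \<Sum>j<n. f i j)"
  proof (rule sum.cong [OF refl])
    fix i
    have "(\<Sum>k=i*n..<i*n+n. f (k div n) (k mod n)) = (\<Sum>j=0..<n. f ((j + i*n) div n) ((j + i*n) mod n))"
      using sum.shift_bounds_nat_ivl [of "\<lambda>k. f (k div n) (k mod n)" 0 "i*n" n] by (simp add: add.commute)
    also have "\<dots> = (\<Sum>j<n. f i j)"
      by (rule sum.cong) auto
    finally show "(\<Sum>k=i*n..<i*n+n. f (k div n) (k mod n)) = (\<Sum>j<n. f i j)" .
  qed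
  finally show ?thesis .
qed

lemma mod_less_of_less_mult: "i < m * n \<Longrightarrow> i mod n < (n::nat)"
  by (cases n) auto

lemma pair_index_less: "a < m \<Longrightarrow> b < n \<Longrightarrow> a * n + b < m * (n::nat)"
proof -
  assume "a < m" "b < n"
  then have "a * n + b < Suc a * n" by simp
  also have "\<dots> \<le> m * n" using \<open>a < m\<close> by (intro mult_right_mono) auto
  finally show ?thesis .
qed

section \<open>The Kronecker product\<close>

definition kron :: "'a::times mat \<Rightarrow> 'a mat \<Rightarrow> 'a mat" where
  "kron A B = mat (dim_row A * dim_row B) (dim_col A * dim_col B)
     (\<lambda>(i,j). A $$ (i div dim_row B, j div dim_col B) * B $$ (i mod dim_row B, j mod dim_col B))"

lemma dim_kron [simp]:
  "dim_row (kron A B) = dim_row A * dim_row B" "dim_col (kron A B) = dim_col A * dim_col B"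
  by (simp_all add: kron_def)

lemma index_kron:
  "i < dim_row A * dim_row B \<Longrightarrow> j < dim_col A * dim_col B \<Longrightarrow>
   kron A B $$ (i,j) = A $$ (i div dim_row B, j div dim_col B) * B $$ (i mod dim_row B, j mod dim_col B)"
  by (simp add: kron_def)

text \<open>Lexicographic indexing makes the product strictly associative: both bracketings decode
  an index into the same three digits. With \<open>kron_one_left\<close> and
  \<open>kron_one_right\<close> this makes the monoidal structure strict.\<close>

lemma kron_assoc: "kron (kron A B) C = kron A (kron B (C :: 'a::semigroup_mult mat))"
proof (rule eq_matI)
  fix i j assume "i < dim_row (kron A (kron B C))" "j < dim_col (kron A (kron B C))"
  then have i: "i < dim_row A * dim_row B * dim_row C" and j: "j < dim_col A * dim_col B * dim_col C"
    by (simp_all add: mult.assoc)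
  have i': "i < dim_row A * (dim_row B * dim_row C)" "j < dim_col A * (dim_col B * dim_col C)"
    using i j by (simp_all add: mult.assoc)
  have *: "i div (dim_row B * dim_row C) = i div dim_row C div dim_row B" for i and B C :: "'a mat"
    by (metis div_mult2_eq mult.commute)
  have **: "j div (dim_col B * dim_col C) = j div dim_col C div dim_col B" for j and B C :: "'a mat"
    by (metis div_mult2_eq mult.commute)
  have m: "i mod (b * c) div c = i div c mod b" "i mod (b * c) mod c = i mod c" if "i mod c < c" for i b c :: nat
    using that by (simp_all add: mod_mult2_eq [of i c b] mult.commute [of b c] add.commute)
  show "kron (kron A B) C $$ (i,j) = kron A (kron B C) $$ (i,j)"
    using i j i' mod_less_of_less_mult [OF i] mod_less_of_less_mult [OF j]
      mod_less_of_less_mult [OF i'(1)] mod_less_of_less_mult [OF i'(2)]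
    by (simp add: index_kron less_mult_imp_div_less * ** m mult.assoc)
qed (simp_all add: mult.assoc)

lemma kron_mult:
  fixes A B C D :: "'a::comm_semiring_0 mat"
  assumes "dim_col A = dim_row B" "dim_col C = dim_row D"
  shows "kron (A * B) (C * D) = kron A C * kron B D"
proof (rule eq_matI)
  fix i j assume "i < dim_row (kron A C * kron B D)" "j < dim_col (kron A C * kron B D)"
  then have i: "i < dim_row A * dim_row C" and j: "j < dim_col B * dim_col D" by auto
  note b = less_mult_imp_div_less [OF i] less_mult_imp_div_less [OF j]
    mod_less_of_less_mult [OF i] mod_less_of_less_mult [OF j]
  have "(kron A C * kron B D) $$ (i,j) = (\<Sum>k<dim_row B * dim_row D. kron A C $$ (i,k) * kron B D $$ (k,j))"
    using i j assms by (subst index_mult_sum) auto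
  also have "\<dots> = (\<Sum>k<dim_row B * dim_row D.
      (A $$ (i div dim_row C, k div dim_row D) * B $$ (k div dim_row D, j div dim_col D)) *
      (C $$ (i mod dim_row C, k mod dim_row D) * D $$ (k mod dim_row D, j mod dim_col D)))"
    using i j assms by (intro sum.cong) (auto simp: index_kron mult_ac)
  also have "\<dots> = (\<Sum>a<dim_row B. \<Sum>c<dim_row D.
      (A $$ (i div dim_row C, a) * B $$ (a, j div dim_col D)) *
      (C $$ (i mod dim_row C, c) * D $$ (c, j mod dim_col D)))"
    by (rule sum_div_mod)
  also have "\<dots> = kron (A * B) (C * D) $$ (i,j)"
    using i j assms b
    by (simp add: index_kron index_mult_sum sum_product)
  finally show "kron (A * B) (C * D) $$ (i,j) = (kron A C * kron B D) $$ (i,j)" by simp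
qed simp_all

lemma kron_one: "kron (1\<^sub>m m) (1\<^sub>m n) = (1\<^sub>m (m * n) :: 'a::semiring_1 mat)"
proof (rule eq_matI)
  fix i j assume "i < dim_row (1\<^sub>m (m * n) :: 'a mat)" "j < dim_col (1\<^sub>m (m * n) :: 'a mat)"
  then have i: "i < m * n" and j: "j < m * n" by auto
  have "i = j" if "i div n = j div n" "i mod n = j mod n"
    using that by (metis div_mult_mod_eq)
  with i j mod_less_of_less_mult [OF i] mod_less_of_less_mult [OF j]
  show "kron (1\<^sub>m m) (1\<^sub>m n) $$ (i,j) = (1\<^sub>m (m * n) :: 'a mat) $$ (i,j)"
    by (auto simp: index_kron less_mult_imp_div_less)
qed simp_all

lemma kron_one_left [simp]: "kron (1\<^sub>m (Suc 0)) A = (A :: 'a::semiring_1 mat)"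
  by (rule eq_matI) (auto simp: index_kron)

lemma kron_one_right [simp]: "kron A (1\<^sub>m (Suc 0)) = (A :: 'a::semiring_1 mat)"
  by (rule eq_matI) (auto simp: index_kron)

lemma kron_add_left:
  "dim_row A = dim_row A' \<Longrightarrow> dim_col A = dim_col A' \<Longrightarrow>
     kron (A + A') B = kron A B + kron A' (B :: 'a::semiring mat)"
  by (rule eq_matI) (auto simp: index_kron less_mult_imp_div_less distrib_right)

lemma kron_add_right:
  "dim_row B = dim_row B' \<Longrightarrow> dim_col B = dim_col B' \<Longrightarrow>
     kron A (B + B') = kron A B + kron A (B' :: 'a::semiring mat)"
  by (rule eq_matI) (auto simp: index_kron less_mult_imp_div_less mod_less_of_less_mult distrib_left)

lemma kron_diff_left:
  "dim_row A = dim_row A' \<Longrightarrow> dim_col A = dim_col A' \<Longrightarrow>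
     kron (A - A') B = kron A B - kron A' (B :: 'a::ring mat)"
  by (rule eq_matI) (auto simp: index_kron less_mult_imp_div_less left_diff_distrib)

lemma kron_diff_right:
  "dim_row B = dim_row B' \<Longrightarrow> dim_col B = dim_col B' \<Longrightarrow>
     kron A (B - B') = kron A B - kron A (B' :: 'a::ring mat)"
  by (rule eq_matI) (auto simp: index_kron less_mult_imp_div_less mod_less_of_less_mult right_diff_distrib)

lemma kron_smult_left: "kron (c \<cdot>\<^sub>m A) B = c \<cdot>\<^sub>m kron A (B :: 'a::comm_semiring_1 mat)"
  by (rule eq_matI) (auto simp: index_kron less_mult_imp_div_less mult.assoc)

lemma kron_smult_right: "kron A (c \<cdot>\<^sub>m B) = c \<cdot>\<^sub>m kron A (B :: 'a::comm_semiring_1 mat)"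
  by (rule eq_matI) (auto simp: index_kron less_mult_imp_div_less mod_less_of_less_mult mult_ac)

lemma kron_zero_left: "kron (0\<^sub>m a b) B = (0\<^sub>m (a * dim_row B) (b * dim_col B) :: 'a::semiring_0 mat)"
  by (rule eq_matI) (auto simp: index_kron less_mult_imp_div_less)

lemma kron_zero_right: "kron B (0\<^sub>m a b) = (0\<^sub>m (dim_row B * a) (dim_col B * b) :: 'a::semiring_0 mat)"
  by (rule eq_matI) (auto simp: index_kron mod_less_of_less_mult)

lemma kron_transpose: "transpose_mat (kron A B) = kron (transpose_mat A) (transpose_mat B)"
  by (rule eq_matI) (auto simp: index_kron less_mult_imp_div_less mod_less_of_less_mult)

lemma kron_pow:
  fixes A B :: "'a::comm_semiring_1 mat"
  assumes "A \<in> carrier_mat m m" "B \<in> carrier_mat n n"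
  shows "kron A B ^\<^sub>m k = kron (A ^\<^sub>m k) (B ^\<^sub>m k)"
proof (induction k)
  case 0
  show ?case using assms by (simp add: kron_one)
next
  case (Suc k)
  then show ?case using assms by (simp add: kron_mult)
qed

lemma pow_mat_add:
  fixes A :: "'a::semiring_1 mat"
  assumes "A \<in> carrier_mat n n"
  shows "A ^\<^sub>m (i + j) = A ^\<^sub>m i * A ^\<^sub>m j"
proof (induction j)
  case 0
  show ?case using assms by (simp add: right_mult_one_mat [of _ n n])
next
  case (Suc j)
  then show ?case using assms by (simp add: assoc_mult_mat [of _ n n _ n _ n])
qed

lemma pow_mat_intertwine:
  fixes A B f :: "'a::semiring_1 mat"
  assumes "A \<in> carrier_mat m m" "B \<in> carrier_mat n n" "f \<in> carrier_mat n m" "f * A = B * f"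
  shows "f * A ^\<^sub>m k = B ^\<^sub>m k * f"
proof (induction k)
  case 0
  show ?case using assms by (simp add: right_mult_one_mat [of _ n m] left_mult_one_mat [of _ n m])
next
  case (Suc k)
  have "f * (A ^\<^sub>m k * A) = (f * A ^\<^sub>m k) * A"
    by (rule mat_mult_assoc [symmetric]) (use assms in auto)
  also have "\<dots> = B ^\<^sub>m k * (f * A)"
    unfolding Suc by (rule mat_mult_assoc) (use assms in auto)
  also have "\<dots> = B ^\<^sub>m k * B * f"
    unfolding assms(4) by (rule mat_mult_assoc [symmetric]) (use assms in auto)
  finally show ?case by simp
qed

lemma transpose_pow:
  fixes A :: "'a::comm_semiring_1 mat"
  assumes "A \<in> carrier_mat n n"
  shows "transpose_mat (A ^\<^sub>m k) = transpose_mat A ^\<^sub>m k"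
proof (induction k)
  case 0
  show ?case using assms by simp
next
  case (Suc k)
  have "transpose_mat (A ^\<^sub>m k * A) = transpose_mat A * transpose_mat (A ^\<^sub>m k)"
    by (rule transpose_mult) (use assms in auto)
  also have "\<dots> = transpose_mat A ^\<^sub>m (1 + k)"
    unfolding Suc using assms pow_mat_add [of "transpose_mat A" n 1 k]
    by (simp add: left_mult_one_mat [of _ n n])
  finally show ?case by simp
qed

subsection \<open>The flip, the cup and the cap\<close>

text \<open>Row \<open>b * m + a\<close> stands for the pair \<open>(b, a)\<close> and selects the
  column \<open>a * n + b\<close> of the pair \<open>(a, b)\<close>.\<close>

definition flip :: "nat \<Rightarrow> nat \<Rightarrow> 'a::zero_neq_one mat" where
  "flip m n = mat (n * m) (m * n) (\<lambda>(i,j). if j = (i mod m) * n + i div m then 1 else 0)"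

lemma dim_flip [simp]: "dim_row (flip m n) = n * m" "dim_col (flip m n) = m * n"
  by (simp_all add: flip_def)

lemma flip_mult_index:
  fixes A :: "'a::semiring_1 mat"
  assumes "dim_row A = m * n" "i < n * m" "j < dim_col A"
  shows "(flip m n * A) $$ (i,j) = A $$ ((i mod m) * n + i div m, j)"
proof -
  have *: "(i mod m) * n + i div m < m * n"
    using assms by (intro pair_index_less) (auto intro: mod_less_of_less_mult less_mult_imp_div_less)
  have "(flip m n * A) $$ (i,j) = (\<Sum>k<m*n. (if k = (i mod m) * n + i div m then 1 else 0) * A $$ (k,j))"
    using assms by (subst index_mult_sum) (auto simp: flip_def)
  also have "\<dots> = (\<Sum>k<m*n. if k = (i mod m) * n + i div m then A $$ (k,j) else 0)"
    by (rule sum.cong) auto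
  also have "\<dots> = A $$ ((i mod m) * n + i div m, j)"
    using * by (simp add: sum.delta)
  finally show ?thesis .
qed

lemma flip_flip: "flip n m * flip m n = (1\<^sub>m (m * n) :: 'a::semiring_1 mat)"
proof (rule eq_matI)
  fix i j assume "i < dim_row (1\<^sub>m (m * n) :: 'a mat)" "j < dim_col (1\<^sub>m (m * n) :: 'a mat)"
  then have i: "i < m * n" and j: "j < m * n" by auto
  define k where "k = (i mod n) * m + i div n"
  have b: "i div n < m" "i mod n < n"
    using i by (auto intro: mod_less_of_less_mult less_mult_imp_div_less)
  then have k: "k < n * m" unfolding k_def by (intro pair_index_less)
  have "k mod m = i div n" "k div m = i mod n" using b by (auto simp: k_def)
  moreover have "(flip n m * flip m n) $$ (i,j) = (flip m n :: 'a mat) $$ (k, j)"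
    unfolding k_def using i j by (subst flip_mult_index) auto
  ultimately show "(flip n m * flip m n) $$ (i,j) = (1\<^sub>m (m * n) :: 'a mat) $$ (i,j)"
    using i j k by (auto simp: flip_def)
qed simp_all

lemma mult_flip_index:
  fixes A :: "'a::semiring_1 mat"
  assumes "dim_col A = n * m" "i < dim_row A" "j < m * n"
  shows "(A * flip m n) $$ (i,j) = A $$ (i, (j mod n) * m + j div n)"
proof -
  let ?k = "(j mod n) * m + j div n"
  have b: "j div n < m" "j mod n < n"
    using assms by (auto intro: mod_less_of_less_mult less_mult_imp_div_less)
  then have *: "?k < n * m" by (intro pair_index_less)
  have eq: "j = (k mod m) * n + k div m \<longleftrightarrow> k = ?k" if "k < n * m" for k
  proof
    assume "j = (k mod m) * n + k div m"
    moreover have "k div m < n" using that by (rule less_mult_imp_div_less)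
    ultimately show "k = ?k" by simp
  next
    assume "k = ?k"
    then show "j = (k mod m) * n + k div m" using b by simp
  qed
  have "(A * flip m n) $$ (i,j) = (\<Sum>k<n*m. A $$ (i,k) * (if j = (k mod m) * n + k div m then 1 else 0))"
    using assms by (subst index_mult_sum) (auto simp: flip_def)
  also have "\<dots> = (\<Sum>k<n*m. if k = ?k then A $$ (i,k) else 0)"
    by (rule sum.cong) (use eq in auto)
  also have "\<dots> = A $$ (i, ?k)"
    using * by (simp add: sum.delta)
  finally show ?thesis .
qed

lemma flip_natural:
  fixes A B :: "'a::comm_semiring_1 mat"
  assumes "dim_row A = m'" "dim_row B = n'" "dim_col A = m" "dim_col B = n"
  shows "flip m' n' * kron A B = kron B A * flip m n"
proof (rule eq_matI)
  fix i j assume "i < dim_row (kron B A * flip m n)" "j < dim_col (kron B A * flip m n)"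
  then have i: "i < n' * m'" and j: "j < m * n" using assms by auto
  have bi: "i div m' < n'" "i mod m' < m'" and bj: "j div n < m" "j mod n < n"
    using i j by (auto intro: mod_less_of_less_mult less_mult_imp_div_less)
  have "(i mod m') * n' + i div m' < m' * n'" "(j mod n) * m + j div n < n * m"
    using bi bj by (auto intro: pair_index_less)
  then show "(flip m' n' * kron A B) $$ (i,j) = (kron B A * flip m n) $$ (i,j)"
    using i j bi bj assms
    by (simp add: flip_mult_index mult_flip_index index_kron mult.commute)
qed (use assms in simp_all)

lemma flip_one_left [simp]: "flip (Suc 0) n = (1\<^sub>m n :: 'a::{zero_neq_one} mat)"
  by (rule eq_matI) (auto simp: flip_def)

lemma flip_one_right [simp]: "flip n (Suc 0) = (1\<^sub>m n :: 'a::{zero_neq_one} mat)"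
  by (rule eq_matI) (auto simp: flip_def)

definition unit_col :: "nat \<Rightarrow> nat \<Rightarrow> 'a::zero_neq_one mat" where
  "unit_col n k = mat n 1 (\<lambda>(i,j). if i = k then 1 else 0)"

lemma dim_unit_col [simp]: "dim_row (unit_col n k) = n" "dim_col (unit_col n k) = 1"
  by (simp_all add: unit_col_def)

lemma kron_unit_col:
  assumes "k < m * n"
  shows "kron (unit_col m (k div n)) (unit_col n (k mod n)) = (unit_col (m * n) k :: 'a::semiring_1 mat)"
proof (rule eq_matI)
  fix i j assume "i < dim_row (unit_col (m * n) k :: 'a mat)" "j < dim_col (unit_col (m * n) k :: 'a mat)"
  then have i: "i < m * n" and j: "j = 0" by auto
  have "i = k" if "i div n = k div n" "i mod n = k mod n"
    using that by (metis div_mult_mod_eq)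
  then show "kron (unit_col m (k div n)) (unit_col n (k mod n)) $$ (i,j) = (unit_col (m * n) k :: 'a mat) $$ (i,j)"
    using i j mod_less_of_less_mult [OF i] by (auto simp: index_kron unit_col_def less_mult_imp_div_less)
qed simp_all

lemma mult_unit_col_index:
  fixes A :: "'a::semiring_1 mat"
  assumes "i < dim_row A" "k < dim_col A" "n = dim_col A"
  shows "(A * unit_col n k) $$ (i,0) = A $$ (i,k)"
proof -
  have "(A * unit_col n k) $$ (i,0) = (\<Sum>l<n. A $$ (i,l) * (if l = k then 1 else 0))"
    using assms by (subst index_mult_sum) (auto simp: unit_col_def)
  also have "\<dots> = (\<Sum>l<n. if l = k then A $$ (i,l) else 0)" by (rule sum.cong) auto
  finally show ?thesis using assms by simp
qed

lemma mat_eq_on_unit_cols: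
  fixes A B :: "'a::semiring_1 mat"
  assumes "dim_row A = dim_row B" "dim_col A = n" "dim_col B = n"
    and "\<And>k. k < n \<Longrightarrow> A * unit_col n k = B * unit_col n k"
  shows "A = B"
proof (rule eq_matI)
  fix i j assume ij: "i < dim_row B" "j < dim_col B"
  then have "(A * unit_col n j) $$ (i,0) = (B * unit_col n j) $$ (i,0)"
    using assms by auto
  then show "A $$ (i,j) = B $$ (i,j)"
    using mult_unit_col_index [of i A j n] mult_unit_col_index [of i B j n] ij assms(1-3) by metis
qed (use assms in auto)

text \<open>Equality may be tested on decomposable vectors, because every standard basis vector is
  decomposable.\<close>

lemma mat_eq_on_kron3:
  fixes A B :: "'a::semiring_1 mat"
  assumes "dim_row A = dim_row B" "dim_col A = m * (n * l)" "dim_col B = m * (n * l)"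
    and "\<And>u v w. dim_row u = m \<Longrightarrow> dim_row v = n \<Longrightarrow> dim_row w = l \<Longrightarrow>
      dim_col u = 1 \<Longrightarrow> dim_col v = 1 \<Longrightarrow> dim_col w = 1 \<Longrightarrow>
      A * kron u (kron v w) = B * kron u (kron v w)"
  shows "A = B"
proof (rule mat_eq_on_unit_cols [OF assms(1-3)])
  fix k assume k: "k < m * (n * l)"
  have "unit_col (m * (n * l)) k =
      kron (unit_col m (k div (n * l))) (kron (unit_col n (k mod (n * l) div l)) (unit_col l (k mod (n * l) mod l)) :: 'a mat)"
    using k by (simp add: kron_unit_col mod_less_of_less_mult)
  then show "A * unit_col (m * (n * l)) k = B * unit_col (m * (n * l)) k"
    by (metis assms(4) dim_unit_col)
qed

lemma flip_cols:
  fixes u v :: "'a::comm_semiring_1 mat"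
  assumes "dim_row u = m" "dim_row v = n" "dim_col u = 1" "dim_col v = 1"
  shows "flip m n * kron u v = kron v u"
  using flip_natural [of u m v n 1 1] assms by simp

lemma flip_hexagon:
  "flip m (n * l) = kron (1\<^sub>m n) (flip m l) * kron (flip m n) (1\<^sub>m l :: 'a::comm_semiring_1 mat)"
proof (rule mat_eq_on_kron3 [of _ _ m n l])
  fix u v w :: "'a mat"
  assume d: "dim_row u = m" "dim_row v = n" "dim_row w = l" "dim_col u = 1" "dim_col v = 1" "dim_col w = 1"
  have "kron (flip m n) (1\<^sub>m l) * kron (kron u v) w = kron (flip m n * kron u v) (1\<^sub>m l * w)"
    by (rule kron_mult [symmetric]) (use d in auto)
  then have 1: "kron (flip m n) (1\<^sub>m l) * kron u (kron v w) = kron v (kron u w)"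
    using d by (simp add: flip_cols kron_assoc)
  have "kron (1\<^sub>m n) (flip m l) * kron v (kron u w) = kron (1\<^sub>m n * v) (flip m l * kron u w)"
    by (rule kron_mult [symmetric]) (use d in auto)
  then have 2: "kron (1\<^sub>m n) (flip m l) * kron v (kron u w) = kron v (kron w u)"
    using d by (simp add: flip_cols)
  have "flip m (n * l) * kron u (kron v w) = kron (kron v w) u"
    by (rule flip_cols) (use d in auto)
  also have "\<dots> = kron (1\<^sub>m n) (flip m l) * (kron (flip m n) (1\<^sub>m l) * kron u (kron v w))"
    unfolding 1 2 by (rule kron_assoc)
  also have "\<dots> = kron (1\<^sub>m n) (flip m l) * kron (flip m n) (1\<^sub>m l) * kron u (kron v w)"
    by (rule mat_mult_assoc [symmetric]) (use d in \<open>auto simp: mult_ac\<close>)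
  finally show "flip m (n * l) * kron u (kron v w) =
      kron (1\<^sub>m n) (flip m l) * kron (flip m n) (1\<^sub>m l) * kron u (kron v w)" .
qed (simp_all add: mult_ac)

text \<open>The sum of all \<open>e_a \<otimes> e_a\<close>: the coevaluation of \<open>k^n\<close>,
  with the dual basis identified with the standard one.\<close>

definition cup :: "nat \<Rightarrow> 'a::zero_neq_one mat" where
  "cup n = mat (n * n) 1 (\<lambda>(i,j). if i div n = i mod n then 1 else 0)"

definition cap :: "nat \<Rightarrow> 'a::zero_neq_one mat" where
  "cap n = transpose_mat (cup n)"

lemma dim_cup_cap [simp]:
  "dim_row (cup n) = n * n" "dim_col (cup n) = 1" "dim_row (cap n) = 1" "dim_col (cap n) = n * n"
  by (simp_all add: cup_def cap_def)

lemma cup_cap_index: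
  "i < n * n \<Longrightarrow> cup n $$ (i,0) = (if i div n = i mod n then 1 else 0)"
  "i < n * n \<Longrightarrow> cap n $$ (0,i) = (if i div n = i mod n then 1 else 0)"
  by (simp_all add: cup_def cap_def)

lemma kron_one_mult_cup_index:
  fixes A :: "'a::comm_semiring_1 mat"
  assumes "dim_row A = n" "dim_col A = n" "i < n * n"
  shows "(kron A (1\<^sub>m n) * cup n) $$ (i,0) = A $$ (i div n, i mod n)"
proof -
  have b: "i div n < n" "i mod n < n"
    using assms by (auto intro: mod_less_of_less_mult less_mult_imp_div_less)
  have "(kron A (1\<^sub>m n) * cup n) $$ (i,0) =
      (\<Sum>k<n*n. A $$ (i div n, k div n) * (if i mod n = k mod n then 1 else 0) * (if k div n = k mod n then 1 else 0))"
    using assms b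
    by (subst index_mult_sum) (auto simp: index_kron cup_def mod_less_of_less_mult intro!: sum.cong)
  also have "\<dots> = (\<Sum>a<n. \<Sum>c<n. A $$ (i div n, a) * (if i mod n = c then 1 else 0) * (if a = c then 1 else 0))"
    by (rule sum_div_mod)
  also have "\<dots> = (\<Sum>a<n. \<Sum>c<n. if c = a then (if i mod n = a then A $$ (i div n, a) else 0) else 0)"
    by (intro sum.cong) auto
  also have "\<dots> = A $$ (i div n, i mod n)"
    using b by (simp add: sum.delta)
  finally show ?thesis .
qed

lemma one_kron_mult_cup_index:
  fixes A :: "'a::comm_semiring_1 mat"
  assumes "dim_row A = n" "dim_col A = n" "i < n * n"
  shows "(kron (1\<^sub>m n) A * cup n) $$ (i,0) = A $$ (i mod n, i div n)"
proof -
  have b: "i div n < n" "i mod n < n"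
    using assms by (auto intro: mod_less_of_less_mult less_mult_imp_div_less)
  have "(kron (1\<^sub>m n) A * cup n) $$ (i,0) =
      (\<Sum>k<n*n. (if i div n = k div n then 1 else 0) * A $$ (i mod n, k mod n) * (if k div n = k mod n then 1 else 0))"
    using assms b
    by (subst index_mult_sum) (auto simp: index_kron cup_def less_mult_imp_div_less intro!: sum.cong)
  also have "\<dots> = (\<Sum>a<n. \<Sum>c<n. (if i div n = a then 1 else 0) * A $$ (i mod n, c) * (if a = c then 1 else 0))"
    by (rule sum_div_mod)
  also have "\<dots> = (\<Sum>a<n. \<Sum>c<n. if c = a then (if i div n = a then A $$ (i mod n, a) else 0) else 0)"
    by (intro sum.cong) auto
  also have "\<dots> = A $$ (i mod n, i div n)"
    using b by (simp add: sum.delta)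
  finally show ?thesis .
qed

text \<open>Both sides are the matrix \<open>A\<close> written as one column.\<close>

lemma cup_slide:
  fixes A :: "'a::comm_semiring_1 mat"
  assumes "A \<in> carrier_mat n n"
  shows "kron A (1\<^sub>m n) * cup n = kron (1\<^sub>m n) (transpose_mat A) * cup n"
proof (rule eq_matI)
  fix i j assume "i < dim_row (kron (1\<^sub>m n) (transpose_mat A) * cup n)" "j < dim_col (kron (1\<^sub>m n) (transpose_mat A) * cup n)"
  then have i: "i < n * n" and j: "j = 0" using assms by auto
  have b: "i div n < n" "i mod n < n"
    using i by (auto intro: mod_less_of_less_mult less_mult_imp_div_less)
  have "(kron A (1\<^sub>m n) * cup n) $$ (i,0) = A $$ (i div n, i mod n)"
    by (rule kron_one_mult_cup_index) (use i assms in auto)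
  moreover have "(kron (1\<^sub>m n) (transpose_mat A) * cup n) $$ (i,0) = transpose_mat A $$ (i mod n, i div n)"
    by (rule one_kron_mult_cup_index) (use i assms in auto)
  ultimately show "(kron A (1\<^sub>m n) * cup n) $$ (i,j) = (kron (1\<^sub>m n) (transpose_mat A) * cup n) $$ (i,j)"
    using b j assms by simp
qed (use assms in simp_all)

lemma cap_slide:
  fixes A :: "'a::comm_semiring_1 mat"
  assumes "A \<in> carrier_mat n n"
  shows "cap n * kron A (1\<^sub>m n) = cap n * kron (1\<^sub>m n) (transpose_mat A)"
proof -
  have "cap n * kron B (1\<^sub>m n) = transpose_mat (kron (transpose_mat B) (1\<^sub>m n) * cup n)"
       "cap n * kron (1\<^sub>m n) B = transpose_mat (kron (1\<^sub>m n) (transpose_mat B) * cup n)"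
    if "B \<in> carrier_mat n n" for B :: "'a mat"
    using that by (simp_all add: mat_transpose_mult cap_def kron_transpose)
  then show ?thesis
    using cup_slide [of "transpose_mat A" n] assms by simp
qed

lemma flip_cup: "flip n n * cup n = (cup n :: 'a::semiring_1 mat)"
proof (rule eq_matI)
  fix i j assume "i < dim_row (cup n :: 'a mat)" "j < dim_col (cup n :: 'a mat)"
  then have i: "i < n * n" and j: "j = 0" by auto
  have b: "i div n < n" "i mod n < n"
    using i by (auto intro: mod_less_of_less_mult less_mult_imp_div_less)
  have k: "(i mod n) * n + i div n < n * n" using b by (intro pair_index_less)
  have "(flip n n * cup n) $$ (i,0) = (cup n :: 'a mat) $$ ((i mod n) * n + i div n, 0)"
    by (rule flip_mult_index) (use i in auto)
  also have "\<dots> = cup n $$ (i,0)"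
    unfolding cup_cap_index(1) [OF k] cup_cap_index(1) [OF i] using b by auto
  finally show "(flip n n * cup n) $$ (i,j) = (cup n :: 'a mat) $$ (i,j)"
    unfolding j .
qed simp_all

lemma cap_kron_cup:
  fixes A :: "'a::comm_semiring_1 mat"
  assumes "A \<in> carrier_mat n n"
  shows "cap n * (kron A (1\<^sub>m n) * cup n) = trace A \<cdot>\<^sub>m 1\<^sub>m 1"
proof (rule eq_matI)
  fix i j assume "i < dim_row (trace A \<cdot>\<^sub>m 1\<^sub>m 1)" "j < dim_col (trace A \<cdot>\<^sub>m 1\<^sub>m 1)"
  then have ij: "i = 0" "j = 0" by auto
  have "(cap n * (kron A (1\<^sub>m n) * cup n)) $$ (0,0) =
      (\<Sum>k<n*n. (if k div n = k mod n then 1 else 0) * A $$ (k div n, k mod n))"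
    using assms
    by (subst index_mult_sum; simp add: kron_one_mult_cup_index cup_cap_index)
  also have "\<dots> = (\<Sum>a<n. \<Sum>c<n. (if a = c then 1 else 0) * A $$ (a, c))"
    by (rule sum_div_mod)
  also have "\<dots> = (\<Sum>a<n. \<Sum>c<n. if c = a then A $$ (a, a) else 0)"
    by (intro sum.cong) auto
  also have "\<dots> = trace A" using assms by (simp add: trace_def)
  finally show "(cap n * (kron A (1\<^sub>m n) * cup n)) $$ (i,j) = (trace A \<cdot>\<^sub>m 1\<^sub>m 1) $$ (i,j)"
    using ij by simp
qed simp_all

lemma sum_div_mod3:
  fixes f :: "nat \<Rightarrow> nat \<Rightarrow> nat \<Rightarrow> 'a::comm_monoid_add"
  shows "(\<Sum>k<m * n * l. f (k div l div n) (k div l mod n) (k mod l)) = (\<Sum>a<m. \<Sum>b<n. \<Sum>c<l. f a b c)"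
  using sum_div_mod [of "\<lambda>i c. f (i div n) (i mod n) c" l "m * n"]
    sum_div_mod [of "\<lambda>a b. \<Sum>c<l. f a b c" n m] by simp

text \<open>The product unfolds to a triple sum of Kronecker deltas \<open>i = a\<close>,
  \<open>b = c\<close>, \<open>a = b\<close>, \<open>c = j\<close>, which together leave only
  \<open>i = j\<close>.\<close>

lemma zigzag_left:
  "kron (1\<^sub>m n) (cap n) * kron (cup n) (1\<^sub>m n) = (1\<^sub>m n :: 'a::comm_semiring_1 mat)"
proof (rule eq_matI)
  fix i j assume "i < dim_row (1\<^sub>m n :: 'a mat)" "j < dim_col (1\<^sub>m n :: 'a mat)"
  then have i: "i < n" and j: "j < n" by auto
  have d: "k mod (n * n) div n = k div n mod n" "k mod (n * n) mod n = k mod n" "k div (n * n) = k div n div n"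
    for k using i by (simp_all add: mod_mult2_eq div_mult2_eq)
  have "(kron (1\<^sub>m n) (cap n) * kron (cup n) (1\<^sub>m n)) $$ (i,j) =
     (\<Sum>k<n*n*n. kron (1\<^sub>m n) (cap n) $$ (i,k) * kron (cup n) (1\<^sub>m n) $$ (k,j) :: 'a)"
    using i j by (subst index_mult_sum) auto
  also have "\<dots> = (\<Sum>k<n*n*n. (if i = k div n div n then 1 else 0) * (if k div n mod n = k mod n then 1 else 0) *
        ((if k div n div n = k div n mod n then 1 else 0) * (if k mod n = j then 1 else 0)))"
  proof (rule sum.cong [OF refl])
    fix k assume "k \<in> {..<n*n*n}"
    then have k: "k < n * (n * n)" "k < n * n * n" by (auto simp: mult.assoc)
    have b: "k div (n * n) < n" "k mod (n * n) < n * n" "k div n < n * n" "k mod n < n"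
      using k less_mult_imp_div_less [OF k(1)] mod_less_of_less_mult [OF k(1)]
        less_mult_imp_div_less [OF k(2)] mod_less_of_less_mult [OF k(2)] by auto
    have 1: "kron (1\<^sub>m n) (cap n) $$ (i,k) =
        ((if i = k div n div n then 1 else 0) * (if k div n mod n = k mod n then 1 else 0) :: 'a)"
      using k(1) i b by (subst index_kron) (simp_all add: cup_cap_index d)
    have 2: "kron (cup n) (1\<^sub>m n) $$ (k,j) =
        ((if k div n div n = k div n mod n then 1 else 0) * (if k mod n = j then 1 else 0) :: 'a)"
      using k(2) j b by (subst index_kron) (simp_all add: cup_cap_index)
    show "kron (1\<^sub>m n) (cap n) $$ (i,k) * kron (cup n) (1\<^sub>m n) $$ (k,j) =
        ((if i = k div n div n then 1 else 0) * (if k div n mod n = k mod n then 1 else 0) *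
        ((if k div n div n = k div n mod n then 1 else 0) * (if k mod n = j then 1 else 0)) :: 'a)"
      unfolding 1 2 ..
  qed
  also have "\<dots> = (\<Sum>a<n. \<Sum>b<n. \<Sum>c<n. (if i = a then 1 else 0) * (if b = c then 1 else 0) *
        ((if a = b then 1 else 0) * (if c = j then 1 else 0)))"
    by (rule sum_div_mod3)
  also have "\<dots> = (\<Sum>a<n. \<Sum>b<n. \<Sum>c<n. if c = j then (if b = j then (if a = i then (if i = j then 1 else 0) else 0) else 0) else 0)"
    by (intro sum.cong) auto
  also have "\<dots> = (1\<^sub>m n :: 'a mat) $$ (i,j)"
    using i j by simp
  finally show "(kron (1\<^sub>m n) (cap n) * kron (cup n) (1\<^sub>m n)) $$ (i,j) = (1\<^sub>m n :: 'a mat) $$ (i,j)" .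
qed simp_all

lemma zigzag_right:
  "kron (cap n) (1\<^sub>m n) * kron (1\<^sub>m n) (cup n) = (1\<^sub>m n :: 'a::comm_semiring_1 mat)"
proof -
  have "(1\<^sub>m n :: 'a mat) = transpose_mat (kron (1\<^sub>m n) (cap n) * kron (cup n) (1\<^sub>m n))"
    by (simp add: zigzag_left)
  also have "\<dots> = transpose_mat (kron (cup n) (1\<^sub>m n)) * transpose_mat (kron (1\<^sub>m n) (cap n))"
    by (rule mat_transpose_mult) simp
  also have "\<dots> = kron (cap n) (1\<^sub>m n) * kron (1\<^sub>m n) (cup n)"
    by (simp add: kron_transpose cap_def)
  finally show ?thesis ..
qed

section \<open>Factorizations of singular matrices and Fitting idempotents\<close>

lemma mat_mult_cancel:
  fixes A :: "'a::semiring_0 mat"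
  assumes "A * B = C" "dim_col A = dim_row B" "dim_col B = dim_row w"
  shows "A * (B * w) = C * w"
  using assms mat_mult_assoc by metis

text \<open>A kernel vector with nonzero entry at \<open>k\<close> expresses column \<open>k\<close>
  through the other columns; deleting that column loses no information. This is the only form of
  rank used below.\<close>

lemma singular_factor:
  fixes A :: "'a::field mat"
  assumes A: "A \<in> carrier_mat n n" and det: "det A = 0"
  shows "n > 0 \<and> (\<exists>B \<in> carrier_mat n (n - 1). \<exists>C \<in> carrier_mat (n - 1) n. A = B * C)"
proof -
  obtain v where v: "v \<in> carrier_vec n" "v \<noteq> 0\<^sub>v n" "A *\<^sub>v v = 0\<^sub>v n"
    using det_0_iff_vec_prod_zero_field [OF A] det by blast
  have "\<exists>k<n. v $ k \<noteq> 0"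
  proof (rule ccontr)
    assume "\<not> ?thesis"
    then have "v = 0\<^sub>v n" by (intro eq_vecI) (use v(1) in auto)
    with v(2) show False by blast
  qed
  then obtain k where k: "k < n" "v $ k \<noteq> 0" by blast
  \<comment> \<open>Enumerates the indices other than \<open>k\<close>.\<close>
  define s where "s l = (if l < k then l else Suc l)" for l
  have sum_s: "(\<Sum>l<n - 1. f (s l)) = (\<Sum>l\<in>{..<n} - {k}. f l)" for f :: "nat \<Rightarrow> 'a"
    by (rule sum.reindex_bij_witness [where j = s and i = "\<lambda>l. if l < k then l else l - 1"])
      (use k(1) in \<open>auto simp: s_def split: if_splits\<close>)
  define B where "B = mat n (n - 1) (\<lambda>(i,l). A $$ (i, s l))"
  \<comment> \<open>The identity on the remaining columns, and in column \<open>k\<close> the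
    coefficients \<open>- v_l / v_k\<close> that recover the deleted column.\<close>
  define C where "C = mat (n - 1) n
    (\<lambda>(l,j). (if s l = j then 1 else 0) - (if j = k then v $ s l / v $ k else 0))"
  have Av: "(\<Sum>l<n. A $$ (i,l) * v $ l) = 0" if "i < n" for i
  proof -
    have "row A i \<bullet> v = 0" using v(3) A that by (metis carrier_matD(1) index_mult_mat_vec index_zero_vec(1))
    then show ?thesis using A v(1) that by (simp add: scalar_prod_def lessThan_atLeast0)
  qed
  have "A = B * C"
  proof (rule eq_matI)
    fix i j assume "i < dim_row (B * C)" "j < dim_col (B * C)"
    then have i: "i < n" and j: "j < n" by (auto simp: B_def C_def)
    have "(B * C) $$ (i,j) = (\<Sum>l<n - 1. A $$ (i, s l) *
        ((if s l = j then 1 else 0) - (if j = k then v $ s l / v $ k else 0)))"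
      unfolding B_def C_def using i j by (subst index_mult_sum) (auto intro!: sum.cong)
    also have "\<dots> = (\<Sum>l\<in>{..<n} - {k}. A $$ (i, l) *
        ((if l = j then 1 else 0) - (if j = k then v $ l / v $ k else 0)))"
      by (rule sum_s)
    also have "\<dots> = A $$ (i,j)"
    proof (cases "j = k")
      case True
      have "(\<Sum>l\<in>{..<n} - {k}. A $$ (i, l) * ((if l = j then 1 else 0) - (if j = k then v $ l / v $ k else 0)))
          = (\<Sum>l\<in>{..<n} - {k}. - (A $$ (i, l) * v $ l) / v $ k)"
        using True by (intro sum.cong) auto
      also have "\<dots> = - (\<Sum>l\<in>{..<n} - {k}. A $$ (i, l) * v $ l) / v $ k"
        by (simp add: sum_negf sum_divide_distrib)
      also have "(\<Sum>l\<in>{..<n} - {k}. A $$ (i, l) * v $ l) = - (A $$ (i,k) * v $ k)"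
        using Av [OF i] k(1) sum.remove [of "{..<n}" k "\<lambda>l. A $$ (i, l) * v $ l"]
        by (simp add: eq_neg_iff_add_eq_0 add.commute)
      finally show ?thesis using True k by simp
    next
      case False
      then have "(\<Sum>l\<in>{..<n} - {k}. A $$ (i, l) * ((if l = j then 1 else 0) - (if j = k then v $ l / v $ k else 0)))
          = (\<Sum>l\<in>{..<n} - {k}. if l = j then A $$ (i, l) else 0)"
        by (intro sum.cong) auto
      also have "\<dots> = A $$ (i,j)" using False j by (subst sum.delta) auto
      finally show ?thesis .
    qed
    finally show "A $$ (i,j) = (B * C) $$ (i,j)" ..
  qed (use A in \<open>auto simp: B_def C_def\<close>)
  moreover have "B \<in> carrier_mat n (n - 1)" "C \<in> carrier_mat (n - 1) n" by (auto simp: B_def C_def)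
  ultimately show ?thesis using k(1) by (intro conjI bexI [of _ B] bexI [of _ C]) auto
qed

lemma det_pow_mat: "A \<in> carrier_mat n n \<Longrightarrow> det (A ^\<^sub>m k) = det A ^ k" for A :: "'a::comm_ring_1 mat"
  by (induction k) (auto simp: det_mult [of _ n] mult.commute)

text \<open>Induction on the size, without eigenvalues: a nilpotent matrix is singular, hence
  \<open>A = B * C\<close> through a smaller dimension. Then \<open>C * B\<close> is again nilpotent
  and has the same trace.\<close>

lemma trace_nilpotent:
  fixes A :: "'a::field mat"
  assumes "A \<in> carrier_mat n n" "A ^\<^sub>m m = 0\<^sub>m n n"
  shows "trace A = 0"
  using assms
proof (induction n arbitrary: A m)
  case 0
  then show ?case by (simp add: trace_def)
next
  case (Suc n)
  have "det A ^ m = 0"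
    using Suc.prems det_pow_mat [of A "Suc n" m] by simp
  then have "det A = 0" by simp
  then obtain B C where BC: "B \<in> carrier_mat (Suc n) n" "C \<in> carrier_mat n (Suc n)" "A = B * C"
    using singular_factor [OF Suc.prems(1)] by auto
  have "C * (B * C) ^\<^sub>m m = (C * B) ^\<^sub>m m * C"
    by (rule pow_mat_intertwine [of _ "Suc n" _ n]) (use BC in \<open>auto simp: mat_mult_assoc\<close>)
  then have "(C * B) ^\<^sub>m m * C = 0\<^sub>m n (Suc n)"
    using BC Suc.prems by simp
  moreover have "(C * B) ^\<^sub>m Suc m = (C * B) ^\<^sub>m m * C * B"
    using BC by (simp add: mat_mult_assoc)
  ultimately have "(C * B) ^\<^sub>m Suc m = 0\<^sub>m n n"
    using BC by simp
  then have "trace (C * B) = 0"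
    using Suc.IH BC by (meson mult_carrier_mat)
  then show ?case using BC trace_mult_commute [of B C] by simp
qed

lemma nonsingular_inverse:
  fixes A :: "'a::field mat"
  assumes "A \<in> carrier_mat n n" "det A \<noteq> 0"
  obtains B where "B \<in> carrier_mat n n" "A * B = 1\<^sub>m n" "B * A = 1\<^sub>m n"
  using det_non_zero_imp_unit [OF assms, of "()"] unfolding Units_def by (auto simp: ring_mat_simps)

text \<open>Factor \<open>e = i * q\<close> through the least possible dimension. If
  \<open>q * i\<close> were singular, then \<open>e = i * (q * i) * q\<close> would factor through a
  smaller one. So \<open>q * i\<close> is invertible, and \<open>e * e = e\<close> makes its cube
  equal its square, whence it is the identity. The last conclusion provides the strict decrease of
  size in later inductions.\<close>

lemma idempotent_split:
  fixes e :: "'a::field mat"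
  assumes e: "e \<in> carrier_mat n n" "e * e = e"
  obtains r i q where "r \<le> n" "i \<in> carrier_mat n r" "q \<in> carrier_mat r n" "e = i * q" "q * i = 1\<^sub>m r"
    "r = n \<Longrightarrow> e = 1\<^sub>m n"
proof -
  define P where "P r \<longleftrightarrow> (\<exists>i \<in> carrier_mat n r. \<exists>q \<in> carrier_mat r n. e = i * q)" for r
  have Pn: "P n" unfolding P_def using e(1) by (intro bexI [of _ e] bexI [of _ "1\<^sub>m n"]) auto
  define r where "r = (LEAST r. P r)"
  have r: "P r" "r \<le> n" and least: "P r' \<Longrightarrow> r \<le> r'" for r'
    unfolding r_def using Pn by (auto intro: LeastI Least_le)
  obtain i q where iq: "i \<in> carrier_mat n r" "q \<in> carrier_mat r n" "e = i * q"
    using r(1) by (auto simp: P_def)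
  let ?b = "q * i"
  have b: "?b \<in> carrier_mat r r" using iq by auto
  have "det ?b \<noteq> 0"
  proof
    assume "det ?b = 0"
    then obtain s t where st: "r > 0" "s \<in> carrier_mat r (r - 1)" "t \<in> carrier_mat (r - 1) r" "?b = s * t"
      using singular_factor [OF b] by auto
    have "e = (i * q) * (i * q)" using e(2) iq(3) by simp
    also have "\<dots> = i * ?b * q" using iq(1,2) by (simp add: mat_mult_assoc)
    also have "\<dots> = (i * s) * (t * q)" unfolding st(4) using st(2,3) iq(1,2) by (simp add: mat_mult_assoc)
    finally have "P (r - 1)"
      unfolding P_def using st(2,3) iq(1,2) by (intro bexI [of _ "i * s"] bexI [of _ "t * q"]) auto
    then show False using least st(1) by fastforce
  qed
  then obtain b' where b': "b' \<in> carrier_mat r r" "?b * b' = 1\<^sub>m r" "b' * ?b = 1\<^sub>m r"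
    using nonsingular_inverse [OF b] by blast
  have "?b * ?b * ?b = q * ((i * q) * (i * q)) * i" using iq(1,2) by (simp add: mat_mult_assoc)
  also have "\<dots> = q * (i * q) * i" using e(2) unfolding iq(3) by simp
  also have "\<dots> = ?b * ?b" using iq(1,2) by (simp add: mat_mult_assoc)
  finally have "b' * (?b * ?b * ?b) = b' * (?b * ?b)" by simp
  moreover have "b' * (?b * ?b * ?b) = (b' * ?b) * (?b * ?b)" "b' * (?b * ?b) = (b' * ?b) * ?b"
    using b'(1) iq(1,2) by (simp_all add: mat_mult_assoc)
  ultimately have "(b' * ?b) * (?b * ?b) = (b' * ?b) * ?b" by simp
  then have "?b * ?b = ?b" unfolding b' using iq by simp
  then have "(b' * ?b) * ?b = b' * ?b" using b'(1) iq(1,2) by (simp add: mat_mult_assoc)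
  then have 1: "?b = 1\<^sub>m r" unfolding b' using iq by simp
  moreover have "e = 1\<^sub>m n" if "r = n"
    unfolding iq(3) by (rule mat_mult_left_right_inverse [of q]) (use 1 iq(1,2) that in auto)
  ultimately show ?thesis by (intro that [of r i q]) (use r(2) iq in auto)
qed

text \<open>Choose the power of \<open>a\<close> with the least inner dimension \<open>r\<close>.
  Since \<open>a ^ (2 * m) = i * (q * i) * q\<close> cannot factor through less,
  \<open>q * i\<close> is invertible, so \<open>a ^ m\<close> is invertible on its image. That
  \<open>y\<close> commutes with whatever commutes with \<open>a\<close> makes it a morphism of
  representations.\<close>

lemma fitting:
  fixes a :: "'a::field mat"
  assumes a: "a \<in> carrier_mat n n" and non_nil: "\<And>m. a ^\<^sub>m m \<noteq> 0\<^sub>m n n"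
  obtains m y where "m > 0" "y \<in> carrier_mat n n" "a ^\<^sub>m m * y \<noteq> 0\<^sub>m n n"
    "y * a ^\<^sub>m m = a ^\<^sub>m m * y" "y * (a ^\<^sub>m m * y) = y"
    "\<And>M. M \<in> carrier_mat n n \<Longrightarrow> M * a = a * M \<Longrightarrow> M * y = y * M"
proof -
  \<comment> \<open>The demand \<open>m > 0\<close> allows one factor \<open>a\<close> to be peeled
    off the power when the idempotent is used.\<close>
  define P where "P r \<longleftrightarrow> (\<exists>m>0. \<exists>i \<in> carrier_mat n r. \<exists>q \<in> carrier_mat r n. a ^\<^sub>m m = i * q)" for r
  have Pn: "P n" unfolding P_def using a by (intro exI [of _ 1] conjI bexI [of _ a] bexI [of _ "1\<^sub>m n"]) auto
  define r where "r = (LEAST r. P r)"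
  have r: "P r" and least: "P r' \<Longrightarrow> r \<le> r'" for r'
    unfolding r_def using Pn by (auto intro: LeastI Least_le)
  obtain m i q where m: "m > 0" and iq: "i \<in> carrier_mat n r" "q \<in> carrier_mat r n" "a ^\<^sub>m m = i * q"
    using r by (auto simp: P_def)
  let ?b = "q * i" and ?g = "a ^\<^sub>m m"
  have b: "?b \<in> carrier_mat r r" and g: "?g \<in> carrier_mat n n" using iq a by auto
  have "det ?b \<noteq> 0"
  proof
    assume "det ?b = 0"
    then obtain s t where st: "r > 0" "s \<in> carrier_mat r (r - 1)" "t \<in> carrier_mat (r - 1) r" "?b = s * t"
      using singular_factor [OF b] by auto
    have "a ^\<^sub>m (m + m) = (i * q) * (i * q)" unfolding pow_mat_add [OF a] iq(3) ..
    also have "\<dots> = i * ?b * q" using iq(1,2) by (simp add: mat_mult_assoc)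
    also have "\<dots> = (i * s) * (t * q)" unfolding st(4) using st(2,3) iq(1,2) by (simp add: mat_mult_assoc)
    finally have "P (r - 1)" unfolding P_def using st iq m by (meson mult_carrier_mat add_pos_pos)
    then show False using least st(1) by fastforce
  qed
  then obtain b' where b': "b' \<in> carrier_mat r r" "?b * b' = 1\<^sub>m r" "b' * ?b = 1\<^sub>m r"
    using nonsingular_inverse [OF b] by blast
  \<comment> \<open>\<open>y\<close> is the group inverse of \<open>a ^ m\<close>, and
    \<open>e\<close> the projection onto the image of \<open>a ^ m\<close> along its kernel.\<close>
  define y where "y = i * (b' * b') * q"
  define e where "e = i * b' * q"
  have y: "y \<in> carrier_mat n n" and e: "e \<in> carrier_mat n n" using iq b' by (auto simp: y_def e_def)
  obtain b where qi: "q * i = b" by blast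
  have bb: "b * b' = 1\<^sub>m r" "b' * b = 1\<^sub>m r" using b' qi by auto
  note S = mat_mult_assoc iq(3) qi mat_mult_cancel [OF qi] mat_mult_cancel [OF bb(1)] mat_mult_cancel [OF bb(2)] y_def e_def
  have dims: "dim_row i = n" "dim_col i = r" "dim_row q = r" "dim_col q = n"
    "dim_row b' = r" "dim_col b' = r" "dim_row b = r" "dim_col b = r"
    using iq(1,2) b'(1) qi by auto
  have gy: "?g * y = e" by (simp add: S dims)
  have yg: "y * ?g = e" by (simp add: S dims)
  have ye: "y * e = y" by (simp add: S dims)
  have eg: "e * ?g = ?g" by (simp add: S dims)
  have ge: "?g * e = ?g" by (simp add: S dims)
  have ey: "e * y = y" by (simp add: S dims)
  have "e \<noteq> 0\<^sub>m n n"
  proof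
    assume "e = 0\<^sub>m n n"
    then have "?g = 0\<^sub>m n n * ?g" using eg by simp
    also have "\<dots> = 0\<^sub>m n n" by (rule left_mult_zero_mat [OF g])
    finally show False using non_nil by blast
  qed
  moreover have "M * y = y * M" if M: "M \<in> carrier_mat n n" "M * a = a * M" for M
  proof -
    obtain g where gdef: "?g = g" by blast
    have Mg: "M * g = g * M" unfolding gdef [symmetric] by (rule pow_mat_intertwine) (use a M in auto)
    note dims = carrier_matD [OF g, unfolded gdef] carrier_matD [OF y] carrier_matD [OF e] carrier_matD [OF M(1)]
    note A = mat_mult_assoc dims and C = mat_mult_cancel [where w = M] mat_mult_cancel [where w = "M * y"]
    \<comment> \<open>As \<open>M\<close> commutes with \<open>a ^ m\<close>, it preserves both
      image and kernel of \<open>e\<close>: the compression \<open>e * M * e\<close> equals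
      \<open>M * e\<close> and also \<open>e * M\<close>.\<close>
    have 1: "M * e = g * (M * y)"
      unfolding gy [unfolded gdef, symmetric] by (simp add: A Mg flip: mat_mult_assoc)
    have 2: "e * M = y * (M * g)"
      unfolding yg [unfolded gdef, symmetric] by (simp add: A Mg)
    have 3: "e * (M * e) = M * e"
      unfolding 1 using mat_mult_cancel [OF eg [unfolded gdef], of "M * y"] by (simp add: dims)
    have "(e * M) * e = e * M"
      unfolding 2 using ge [unfolded gdef] by (simp add: A)
    then have Me: "M * e = e * M" using 3 by (simp add: A)
    have "M * y = (M * e) * y" using ey by (simp add: A)
    also have "\<dots> = e * (M * y)" unfolding Me by (simp add: A)
    also have "\<dots> = y * (g * (M * y))" unfolding yg [unfolded gdef, symmetric] by (simp add: A)
    also have "\<dots> = (y * e) * M" unfolding 1 [symmetric] Me by (simp add: A)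
    also have "\<dots> = y * M" unfolding ye ..
    finally show ?thesis .
  qed
  ultimately show ?thesis using that [of m y] m y gy yg ye by metis
qed

section \<open>Representations of the cyclic group of order $2p$ and negligible morphisms\<close>

text \<open>
  A matrix \<open>X\<close> with \<open>X\<^sup>2\<^sup>p = 1\<close> is a representation of the cyclic group of order \<open>2p\<close>. The element
  of order two acts by \<open>X\<^sup>p\<close> and defines the parity of the underlying superspace.
\<close>

definition rep_objs :: "'k::field mat set" where
  "rep_objs = {X. dim_col X = dim_row X \<and> X ^\<^sub>m (2 * CHAR('k)) = 1\<^sub>m (dim_row X)}"

definition par :: "'k::field mat \<Rightarrow> 'k mat" where
  "par X = X ^\<^sub>m CHAR('k)"

definition Hom :: "'k::field mat \<Rightarrow> 'k mat \<Rightarrow> 'k mat set" where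
  "Hom X Y = {f \<in> carrier_mat (dim_row Y) (dim_row X). f * X = Y * f}"

text \<open>The radical of the supertrace pairing between \<open>Hom X Y\<close> and
  \<open>Hom Y X\<close>. The factor \<open>par Y\<close> puts in the sign that the super braiding
  contributes to categorical traces.\<close>

definition negl :: "'k::field mat \<Rightarrow> 'k mat \<Rightarrow> 'k mat set" where
  "negl X Y = {f \<in> Hom X Y. \<forall>g \<in> Hom Y X. trace (par Y * (f * g)) = 0}"

lemma rep_obj_dims: "X \<in> rep_objs \<Longrightarrow> dim_col X = dim_row X"
  by (simp add: rep_objs_def)

lemma rep_obj_carrier: "X \<in> rep_objs \<Longrightarrow> X \<in> carrier_mat (dim_row X) (dim_row X)"
  by (auto simp: rep_objs_def)

lemma Hom_dims: "f \<in> Hom X Y \<Longrightarrow> dim_row f = dim_row Y" "f \<in> Hom X Y \<Longrightarrow> dim_col f = dim_row X"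
  by (auto simp: Hom_def)

lemma Hom_carrier: "f \<in> Hom X Y \<Longrightarrow> f \<in> carrier_mat (dim_row Y) (dim_row X)"
  by (auto simp: Hom_def)

lemma HomD: "f \<in> Hom X Y \<Longrightarrow> f * X = Y * f"
  by (simp add: Hom_def)

lemma HomI: "dim_row f = dim_row Y \<Longrightarrow> dim_col f = dim_row X \<Longrightarrow> f * X = Y * f \<Longrightarrow> f \<in> Hom X Y"
  by (auto simp: Hom_def)

lemmas rep_dims = rep_obj_dims Hom_dims

lemma par_carrier: "X \<in> rep_objs \<Longrightarrow> par X \<in> carrier_mat (dim_row X) (dim_row X)"
  unfolding par_def by (intro pow_carrier_mat rep_obj_carrier)

lemma dim_par [simp]: "X \<in> rep_objs \<Longrightarrow> dim_row (par X) = dim_row X" "X \<in> rep_objs \<Longrightarrow> dim_col (par X) = dim_row X"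
  using par_carrier by (auto dest: carrier_matD)

lemma par_par: "X \<in> rep_objs \<Longrightarrow> par X * par X = 1\<^sub>m (dim_row X)"
  unfolding par_def by (simp add: pow_mat_add [OF rep_obj_carrier, symmetric] flip: mult_2) (simp add: rep_objs_def)

lemma Hom_pow:
  assumes "X \<in> rep_objs" "Y \<in> rep_objs" "f \<in> Hom X Y"
  shows "f * X ^\<^sub>m k = Y ^\<^sub>m k * f"
  by (rule pow_mat_intertwine) (use assms in \<open>auto intro: rep_obj_carrier Hom_carrier HomD\<close>)

lemma Hom_par: "X \<in> rep_objs \<Longrightarrow> Y \<in> rep_objs \<Longrightarrow> f \<in> Hom X Y \<Longrightarrow> f * par X = par Y * f"
  unfolding par_def by (rule Hom_pow)

lemma Hom_id: "X \<in> rep_objs \<Longrightarrow> 1\<^sub>m (dim_row X) \<in> Hom X X"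
  by (auto simp: Hom_def rep_objs_def)

lemma Hom_self: "X \<in> rep_objs \<Longrightarrow> X \<in> Hom X X"
  by (auto simp: Hom_def rep_objs_def)

lemma Hom_comp:
  assumes "X \<in> rep_objs" "Y \<in> rep_objs" "Z \<in> rep_objs" "f \<in> Hom X Y" "g \<in> Hom Y Z"
  shows "g * f \<in> Hom X Z"
proof (rule HomI)
  note d = rep_dims(1) [OF assms(1)] rep_dims(1) [OF assms(2)] rep_dims(1) [OF assms(3)]
    Hom_dims [OF assms(4)] Hom_dims [OF assms(5)]
  have "g * f * X = g * (f * X)" by (rule mat_mult_assoc) (simp_all add: d)
  also have "\<dots> = g * Y * f"
    unfolding HomD [OF assms(4)] by (rule mat_mult_assoc [symmetric]) (simp_all add: d)
  also have "\<dots> = Z * (g * f)"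
    unfolding HomD [OF assms(5)] by (rule mat_mult_assoc) (simp_all add: d)
  finally show "g * f * X = Z * (g * f)" .
qed (use assms in \<open>simp_all add: rep_dims\<close>)

lemma Hom_add:
  assumes "X \<in> rep_objs" "Y \<in> rep_objs" "f \<in> Hom X Y" "g \<in> Hom X Y"
  shows "f + g \<in> Hom X Y"
  by (rule HomI) (use assms in \<open>simp_all add: rep_dims mat_distribs HomD\<close>)

lemma Hom_diff:
  assumes "X \<in> rep_objs" "Y \<in> rep_objs" "f \<in> Hom X Y" "g \<in> Hom X Y"
  shows "f - g \<in> Hom X Y"
  by (rule HomI) (use assms in \<open>simp_all add: rep_dims mat_distribs HomD\<close>)

lemma Hom_smult:
  assumes "X \<in> rep_objs" "Y \<in> rep_objs" "f \<in> Hom X Y"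
  shows "c \<cdot>\<^sub>m f \<in> Hom X Y"
  by (rule HomI) (use assms in \<open>simp_all add: rep_dims mat_distribs HomD\<close>)

lemma Hom_zero: "X \<in> rep_objs \<Longrightarrow> Y \<in> rep_objs \<Longrightarrow> 0\<^sub>m (dim_row Y) (dim_row X) \<in> Hom X Y"
  by (rule HomI) (simp_all add: rep_dims)

lemma negl_Hom: "f \<in> negl X Y \<Longrightarrow> f \<in> Hom X Y"
  by (simp add: negl_def)

lemma neglI: "f \<in> Hom X Y \<Longrightarrow> (\<And>g. g \<in> Hom Y X \<Longrightarrow> trace (par Y * (f * g)) = 0) \<Longrightarrow> f \<in> negl X Y"
  by (simp add: negl_def)

lemma neglD: "f \<in> negl X Y \<Longrightarrow> g \<in> Hom Y X \<Longrightarrow> trace (par Y * (f * g)) = 0"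
  by (simp add: negl_def)

text \<open>Morphisms commute with the parity, so cyclicity of the ordinary trace carries over
  without a sign.\<close>

lemma supertrace_commute:
  assumes "X \<in> rep_objs" "Y \<in> rep_objs" "f \<in> Hom X Y" "g \<in> Hom Y X"
  shows "trace (par Y * (f * g)) = trace (par X * (g * f))"
proof -
  note d = rep_dims(1) [OF assms(1)] rep_dims(1) [OF assms(2)] Hom_dims [OF assms(3)] Hom_dims [OF assms(4)]
    dim_par [OF assms(1)] dim_par [OF assms(2)]
  have "trace (par Y * (f * g)) = trace ((par Y * f) * g)"
    by (subst mat_mult_assoc) (simp_all add: d)
  also have "\<dots> = trace (f * par X * g)"
    using Hom_par [OF assms(1-3)] by simp
  also have "\<dots> = trace (f * (par X * g))"
    by (subst mat_mult_assoc) (simp_all add: d)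
  also have "\<dots> = trace (par X * g * f)"
    by (rule trace_mult_commute) (simp_all add: d)
  finally show ?thesis by (simp add: mat_mult_assoc d)
qed

lemma negl_comp_right:
  assumes "X \<in> rep_objs" "Y \<in> rep_objs" "Z \<in> rep_objs" "f \<in> negl X Y" "g \<in> Hom Z X"
  shows "f * g \<in> negl Z Y"
proof (rule neglI)
  note f = negl_Hom [OF assms(4)]
  show "f * g \<in> Hom Z Y" using Hom_comp [OF assms(3,1,2) assms(5) f] .
  fix h assume h: "h \<in> Hom Y Z"
  have "f * g * h = f * (g * h)"
    by (rule mat_mult_assoc) (simp_all add: Hom_dims [OF f] Hom_dims [OF assms(5)] Hom_dims [OF h])
  then show "trace (par Y * (f * g * h)) = 0"
    using neglD [OF assms(4) Hom_comp [OF assms(2,3,1) h assms(5)]] by simp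
qed

lemma negl_comp_left:
  assumes "X \<in> rep_objs" "Y \<in> rep_objs" "Z \<in> rep_objs" "f \<in> negl X Y" "g \<in> Hom Y Z"
  shows "g * f \<in> negl X Z"
proof (rule neglI)
  note f = negl_Hom [OF assms(4)]
  show "g * f \<in> Hom X Z" using Hom_comp [OF assms(1,2,3) f assms(5)] .
  fix h assume h: "h \<in> Hom Z X"
  note d = Hom_dims [OF f] Hom_dims [OF assms(5)] Hom_dims [OF h]
  have "trace (par Z * (g * f * h)) = trace (par Z * (g * (f * h)))"
    by (subst mat_mult_assoc) (simp_all add: d)
  also have "\<dots> = trace (par Y * (f * h * g))"
    by (rule supertrace_commute [OF assms(2,3,5) Hom_comp [OF assms(3,1,2) h f]])
  also have "\<dots> = trace (par Y * (f * (h * g)))"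
    by (subst mat_mult_assoc) (simp_all add: d)
  also have "\<dots> = 0"
    using neglD [OF assms(4) Hom_comp [OF assms(2,3,1) assms(5) h]] .
  finally show "trace (par Z * (g * f * h)) = 0" .
qed

lemma negl_add:
  assumes "X \<in> rep_objs" "Y \<in> rep_objs" "f \<in> negl X Y" "g \<in> negl X Y"
  shows "f + g \<in> negl X Y"
proof (rule neglI)
  note f = negl_Hom [OF assms(3)] and g = negl_Hom [OF assms(4)]
  show "f + g \<in> Hom X Y" by (rule Hom_add [OF assms(1,2) f g])
  fix h assume h: "h \<in> Hom Y X"
  show "trace (par Y * ((f + g) * h)) = 0"
    using neglD [OF assms(3) h] neglD [OF assms(4) h]
    by (simp add: mat_distribs trace_add Hom_dims [OF f] Hom_dims [OF g] Hom_dims [OF h] dim_par [OF assms(2)])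
qed

lemma negl_smult:
  assumes "X \<in> rep_objs" "Y \<in> rep_objs" "f \<in> negl X Y"
  shows "c \<cdot>\<^sub>m f \<in> negl X Y"
proof (rule neglI)
  note f = negl_Hom [OF assms(3)]
  show "c \<cdot>\<^sub>m f \<in> Hom X Y" by (rule Hom_smult [OF assms(1,2) f])
  fix h assume h: "h \<in> Hom Y X"
  show "trace (par Y * ((c \<cdot>\<^sub>m f) * h)) = 0"
    using neglD [OF assms(3) h]
    by (simp add: mat_distribs trace_smult Hom_dims [OF f] Hom_dims [OF h] dim_par [OF assms(2)])
qed

lemma negl_zero:
  assumes "X \<in> rep_objs" "Y \<in> rep_objs"
  shows "0\<^sub>m (dim_row Y) (dim_row X) \<in> negl X Y"
proof (rule neglI)
  show "0\<^sub>m (dim_row Y) (dim_row X) \<in> Hom X Y" by (rule Hom_zero [OF assms])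
  fix h assume h: "h \<in> Hom Y X"
  show "trace (par Y * (0\<^sub>m (dim_row Y) (dim_row X) * h)) = 0"
    by (simp add: Hom_dims [OF h] dim_par [OF assms(2)])
qed

lemma rep_inverse:
  fixes X :: "'k::field mat"
  assumes "X \<in> rep_objs" "CHAR('k) > 0"
  defines "X' \<equiv> X ^\<^sub>m (2 * CHAR('k) - 1)"
  shows "X' \<in> Hom X X" "X * X' = 1\<^sub>m (dim_row X)" "X' * X = 1\<^sub>m (dim_row X)"
proof -
  note c = rep_obj_carrier [OF assms(1)]
  have e: "1 + (2 * CHAR('k) - 1) = 2 * CHAR('k)" "(2 * CHAR('k) - 1) + 1 = 2 * CHAR('k)"
    using assms(2) by simp_all
  have X1: "X ^\<^sub>m 1 = X" using left_mult_one_mat [OF c] by simp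
  have X: "X ^\<^sub>m (2 * CHAR('k)) = 1\<^sub>m (dim_row X)" using assms(1) by (simp add: rep_objs_def)
  show 1: "X * X' = 1\<^sub>m (dim_row X)"
    using pow_mat_add [OF c, of 1 "2 * CHAR('k) - 1"] unfolding e X X1 X'_def by (rule sym)
  show 2: "X' * X = 1\<^sub>m (dim_row X)"
    using pow_mat_add [OF c, of "2 * CHAR('k) - 1" 1] unfolding e X X1 X'_def by (rule sym)
  have "X' \<in> carrier_mat (dim_row X) (dim_row X)" unfolding X'_def using c by (rule pow_carrier_mat)
  then show "X' \<in> Hom X X" unfolding Hom_def using 1 2 by (simp only: mem_Collect_eq)
qed

subsection \<open>Splitting idempotents\<close>

text \<open>The action on the summand is the compression \<open>q * X * i\<close>; it has the right
  order because \<open>q\<close> intertwines all powers.\<close>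

lemma rep_split:
  fixes X :: "'k::field mat"
  assumes X: "X \<in> rep_objs" and e: "e \<in> Hom X X" "e * e = e"
  obtains Z i q where "Z \<in> rep_objs" "i \<in> Hom Z X" "q \<in> Hom X Z" "e = i * q" "q * i = 1\<^sub>m (dim_row Z)"
    "dim_row Z \<le> dim_row X" "dim_row Z = dim_row X \<Longrightarrow> e = 1\<^sub>m (dim_row X)"
proof -
  let ?n = "dim_row X"
  obtain r i q where r: "r \<le> ?n" "i \<in> carrier_mat ?n r" "q \<in> carrier_mat r ?n" "e = i * q" "q * i = 1\<^sub>m r"
    "r = ?n \<Longrightarrow> e = 1\<^sub>m ?n"
    using idempotent_split [OF Hom_carrier [OF e(1)] e(2)] by metis
  define Z where "Z = q * X * i"
  note d = carrier_matD [OF r(2)] carrier_matD [OF r(3)] rep_obj_dims [OF X]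
  have Z: "dim_row Z = r" "dim_col Z = r" "Z \<in> carrier_mat r r" using d by (auto simp: Z_def)
  have eX: "i * (q * X) = X * (i * q)"
    using HomD [OF e(1)] unfolding r(4) by (simp add: mat_mult_assoc d)
  have "i * Z = i * (q * X) * i" unfolding Z_def by (simp add: mat_mult_assoc d)
  also have "\<dots> = X * i * (q * i)" unfolding eX by (simp add: mat_mult_assoc d)
  finally have iZ: "i * Z = X * i" unfolding r(5) by (simp add: d)
  have "Z * q = q * (X * (i * q))" unfolding Z_def by (simp add: mat_mult_assoc d)
  also have "\<dots> = (q * i) * (q * X)" unfolding eX [symmetric] by (simp add: mat_mult_assoc d)
  finally have Zq: "q * X = Z * q" unfolding r(5) by (simp add: d)
  have "q * X ^\<^sub>m k = Z ^\<^sub>m k * q" for k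
    by (rule pow_mat_intertwine [OF rep_obj_carrier [OF X] Z(3) r(3) Zq])
  from this [of "2 * CHAR('k)"] have "Z ^\<^sub>m (2 * CHAR('k)) * q = q"
    using X by (simp add: rep_objs_def d)
  then have "Z ^\<^sub>m (2 * CHAR('k)) * (q * i) = 1\<^sub>m r"
    using r(5) Z(3) by (metis d(2,3) mat_mult_assoc pow_carrier_mat carrier_matD(2) d(1) d(4))
  then have "Z ^\<^sub>m (2 * CHAR('k)) = 1\<^sub>m r"
    unfolding r(5) right_mult_one_mat [OF pow_carrier_mat [OF Z(3)]] .
  then have "Z \<in> rep_objs" using Z by (simp add: rep_objs_def)
  moreover have "i \<in> Hom Z X" "q \<in> Hom X Z"
    using iZ Zq d Z by (auto intro: HomI)
  ultimately show ?thesis using that [of Z i q] r Z by simp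
qed

subsection \<open>Regularity modulo negligible morphisms\<close>

text \<open>
  A non-negligible \<open>f\<close> has a non-nilpotent multiple \<open>f h\<close>, whose Fitting idempotent splits off a
  summand on which \<open>f\<close> is invertible; one continues on the complement.
\<close>

lemma regular_start:
  fixes X Y :: "'k::field mat"
  assumes X: "X \<in> rep_objs" and Y: "Y \<in> rep_objs" and f: "f \<in> Hom X Y" and non: "f \<notin> negl X Y"
  obtains g where "g \<in> Hom Y X" "g * (f * g) = g" "f * g \<noteq> 0\<^sub>m (dim_row Y) (dim_row Y)"
proof -
  let ?n = "dim_row Y"
  obtain h where h: "h \<in> Hom Y X" "trace (par Y * (f * h)) \<noteq> 0"
    using f non by (auto simp: negl_def)
  note d = rep_obj_dims [OF X] rep_obj_dims [OF Y] Hom_dims [OF f] Hom_dims [OF h(1)] dim_par [OF Y]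
  let ?a = "f * h"
  have a: "?a \<in> Hom Y Y" by (rule Hom_comp [OF Y X Y h(1) f])
  have ac: "?a \<in> carrier_mat ?n ?n" by (rule Hom_carrier [OF a])
  \<comment> \<open>The parity commutes with \<open>f * h\<close>. If \<open>f * h\<close> were
    nilpotent, so would be its product with the parity, and the supertrace would vanish.\<close>
  have "?a ^\<^sub>m m \<noteq> 0\<^sub>m ?n ?n" for m
  proof
    assume 0: "?a ^\<^sub>m m = 0\<^sub>m ?n ?n"
    have comm: "?a * par Y = par Y * ?a" by (rule Hom_par [OF Y Y a])
    have "(par Y * ?a) ^\<^sub>m k = par Y ^\<^sub>m k * ?a ^\<^sub>m k" for k
    proof (induction k)
      case 0
      show ?case using d by simp
    next
      case (Suc k)
      have 1: "?a ^\<^sub>m k * par Y = par Y * ?a ^\<^sub>m k"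
        using pow_mat_intertwine [OF ac ac par_carrier [OF Y] comm [symmetric], of k] ..
      note dd = carrier_matD [OF pow_carrier_mat [OF ac]] carrier_matD [OF pow_carrier_mat [OF par_carrier [OF Y]]]
      have "(par Y * ?a) ^\<^sub>m Suc k = par Y ^\<^sub>m k * (?a ^\<^sub>m k * par Y) * ?a"
        using Suc by (simp add: mat_mult_assoc dd d)
      also have "\<dots> = par Y ^\<^sub>m Suc k * ?a ^\<^sub>m Suc k"
        unfolding 1 by (simp add: mat_mult_assoc dd d)
      finally show ?case .
    qed
    from this [of m] have "(par Y * ?a) ^\<^sub>m m = 0\<^sub>m ?n ?n"
      unfolding 0 right_mult_zero_mat [OF pow_carrier_mat [OF par_carrier [OF Y]]] .
    then have "trace (par Y * ?a) = 0"
      using trace_nilpotent [of "par Y * ?a" ?n m] ac par_carrier [OF Y] by simp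
    then show False using h(2) by simp
  qed
  then obtain m y where m: "m > 0" and y: "y \<in> carrier_mat ?n ?n" "?a ^\<^sub>m m * y \<noteq> 0\<^sub>m ?n ?n"
    "y * ?a ^\<^sub>m m = ?a ^\<^sub>m m * y" "y * (?a ^\<^sub>m m * y) = y"
    "\<And>M. M \<in> carrier_mat ?n ?n \<Longrightarrow> M * ?a = ?a * M \<Longrightarrow> M * y = y * M"
    using fitting [OF ac] by metis
  have yH: "y \<in> Hom Y Y"
    using y(5) [OF rep_obj_carrier [OF Y]] HomD [OF a] y(1) by (intro HomI) auto
  define c where "c = ?a ^\<^sub>m (m - 1)"
  have c: "c \<in> carrier_mat ?n ?n" "c * Y = Y * c"
    using pow_mat_intertwine [OF ac ac rep_obj_carrier [OF Y], of "m - 1"] ac HomD [OF a] by (auto simp: c_def)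
  then have cH: "c \<in> Hom Y Y" by (intro HomI) auto
  have ac': "?a * c = ?a ^\<^sub>m m"
    using pow_mat_add [OF ac, of 1 "m - 1"] m ac by (simp add: c_def)
  \<comment> \<open>Writing the projection as \<open>f\<close> times something: one factor
    \<open>f * h\<close> of the power is split off, so that \<open>f * g\<close> becomes the Fitting
    idempotent.\<close>
  define g where "g = h * (c * y)"
  have g: "g \<in> Hom Y X"
    unfolding g_def by (intro Hom_comp [OF Y Y X] Hom_comp [OF Y Y Y] h yH cH)
  note dd = d carrier_matD [OF y(1)] carrier_matD [OF c(1)]
  have "f * g = (?a * c) * y" by (simp add: g_def mat_mult_assoc dd)
  then have fg: "f * g = ?a ^\<^sub>m m * y" unfolding ac' .
  have "g * w = h * (c * (y * w))" if "dim_row w = ?n" for w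
    unfolding g_def using that by (simp add: mat_mult_assoc dd)
  then have "g * (f * g) = h * (c * (y * (?a ^\<^sub>m m * y)))"
    unfolding fg by (simp only: index_mult_mat(2) carrier_matD(1) [OF pow_carrier_mat [OF ac]])
  then have "g * (f * g) = g" unfolding y(4) by (simp add: g_def)
  then show ?thesis using that [OF g] fg y(2) by simp
qed

text \<open>The conclusion is deliberately asymmetric. \<open>g * (f * g) = g\<close> holds on the
  nose, so that \<open>f * g\<close> and \<open>g * f\<close> are idempotent matrices which can be
  split; the other identity can only hold modulo negligible morphisms. The induction removes the
  image of an idempotent \<open>f * g0\<close> from \<open>Y\<close>, treats the component of
  \<open>f\<close> in the complement, and adds the two quasi-inverses.\<close>

lemma regular_mod_negl:
  fixes X Y :: "'k::field mat"
  assumes X: "X \<in> rep_objs" and Y: "Y \<in> rep_objs" and f: "f \<in> Hom X Y"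
  shows "\<exists>g \<in> Hom Y X. g * (f * g) = g \<and> f - f * (g * f) \<in> negl X Y"
  using Y f
proof (induction "dim_row Y" arbitrary: Y f rule: less_induct)
  case less
  note Y = less.prems(1) and f = less.prems(2)
  let ?n = "dim_row Y" and ?m = "dim_row X"
  show ?case
  proof (cases "f \<in> negl X Y")
    case True
    have z: "0\<^sub>m ?m ?n \<in> Hom Y X" by (rule Hom_zero [OF Y X])
    have "f - f * (0\<^sub>m ?m ?n * f) = f"
      using Hom_carrier [OF f] by (intro eq_matI) auto
    then show ?thesis using True z Hom_carrier [OF f] by (intro bexI [OF _ z]) simp
  next
    case False
    then obtain g0 where g0: "g0 \<in> Hom Y X" "g0 * (f * g0) = g0" "f * g0 \<noteq> 0\<^sub>m ?n ?n"
      using regular_start [OF X Y f] by metis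
    obtain e where e_def: "e = f * g0" by blast
    have e: "e \<in> Hom Y Y" unfolding e_def by (rule Hom_comp [OF Y X Y g0(1) f])
    note d = rep_obj_dims [OF X] rep_obj_dims [OF Y] Hom_dims [OF f] Hom_dims [OF g0(1)] Hom_dims [OF e]
    have g0e: "g0 * e = g0" using g0(2) e_def by simp
    have ee: "e * e = e"
      using g0e unfolding e_def by (simp add: mat_mult_assoc d)
    let ?c = "1\<^sub>m ?n - e"
    have c: "?c \<in> Hom Y Y" by (rule Hom_diff [OF Y Y Hom_id [OF Y] e])
    have ec: "e * ?c = 0\<^sub>m ?n ?n" and ce: "?c * e = 0\<^sub>m ?n ?n"
      using ee Hom_carrier [OF e] by (simp_all add: mat_distribs d)
    have "?c * ?c = ?c * 1\<^sub>m ?n - ?c * e" by (rule mat_mult_diff) (simp_all add: d)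
    then have cc: "?c * ?c = ?c" unfolding ce by (intro eq_matI) (simp_all add: d)
    obtain Z i q where Z: "Z \<in> rep_objs" "i \<in> Hom Z Y" "q \<in> Hom Y Z" "?c = i * q" "q * i = 1\<^sub>m (dim_row Z)"
      "dim_row Z \<le> ?n" "dim_row Z = ?n \<Longrightarrow> ?c = 1\<^sub>m ?n"
      using rep_split [OF Y c cc] by metis
    have "dim_row Z \<noteq> ?n"
    proof
      assume "dim_row Z = ?n"
      then have "e * 1\<^sub>m ?n = 0\<^sub>m ?n ?n" using ec Z(7) by simp
      then show False using g0(3) d by (simp add: e_def)
    qed
    then have lt: "dim_row Z < ?n" using Z(6) by simp
    note d = d Hom_dims [OF Z(2)] Hom_dims [OF Z(3)] rep_obj_dims [OF Z(1)]
    have qf: "q * f \<in> Hom X Z" by (rule Hom_comp [OF X Y Z(1) f Z(3)])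
    obtain g' where g': "g' \<in> Hom Z X" "g' * (q * f * g') = g'" "q * f - q * f * (g' * (q * f)) \<in> negl X Z"
      using less.hyps [OF lt Z(1) qf] by metis
    note d = d Hom_dims [OF g'(1)]
    have qe: "q * e = 0\<^sub>m (dim_row Z) ?n"
    proof -
      have "q * e = (q * i) * q * e" unfolding Z(5) by (simp add: d)
      also have "\<dots> = q * (?c * e)" unfolding Z(4) by (simp add: mat_mult_assoc d)
      finally show ?thesis unfolding ce by (simp add: d)
    qed
    have ei: "e * i = 0\<^sub>m ?n (dim_row Z)"
    proof -
      have "e * i = e * i * (q * i)" unfolding Z(5) by (simp add: d)
      also have "\<dots> = (e * ?c) * i" unfolding Z(4) by (simp add: mat_mult_assoc d)
      finally show ?thesis unfolding ec by (simp add: d)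
    qed
    have g0i: "g0 * i = 0\<^sub>m ?m (dim_row Z)"
    proof -
      have "g0 * i = g0 * e * i" unfolding g0e ..
      then have "g0 * i = g0 * (e * i)" by (simp add: mat_mult_assoc d)
      then show ?thesis unfolding ei by (simp add: d)
    qed
    \<comment> \<open>The factor \<open>1 - g0 * f\<close> makes \<open>f * k\<close> land in the
      complement, which \<open>g0\<close> annihilates, while \<open>q\<close> annihilates
      \<open>e\<close>. The mixed terms of \<open>g * (f * g)\<close> therefore vanish.\<close>
    define k where "k = (1\<^sub>m ?m - g0 * f) * (g' * q)"
    have k: "k \<in> Hom Y X"
      unfolding k_def by (intro Hom_comp [OF Y X X] Hom_comp [OF Y Z(1) X] Hom_diff [OF X X]
        Hom_id [OF X] Hom_comp [OF X Y X] f g0 g' Z)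
    note d = d Hom_dims [OF k]
    have fk: "f * k = i * (q * f * g' * q)"
    proof -
      have "f * k = (f - e * f) * (g' * q)"
        unfolding k_def e_def by (simp add: mat_distribs d)
      also have "f - e * f = ?c * f" by (simp add: mat_distribs d)
      also have "?c * f * (g' * q) = i * (q * f * g' * q)"
        unfolding Z(4) by (simp add: mat_mult_assoc d)
      finally show ?thesis .
    qed
    define g where "g = g0 + k"
    have g: "g \<in> Hom Y X" unfolding g_def by (rule Hom_add [OF Y X g0(1) k])
    have fg: "f * g = e + i * (q * f * g' * q)"
      unfolding g_def by (simp add: mat_distribs d e_def fk)
    have g0fk: "g0 * (i * (q * f * g' * q)) = 0\<^sub>m ?m ?n"
      using g0i mat_mult_assoc [of g0 i "q * f * g' * q"] by (simp add: d)
    have ke: "k * e = 0\<^sub>m ?m ?n"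
    proof -
      have "k * e = (1\<^sub>m ?m - g0 * f) * (g' * (q * e))" unfolding k_def by (simp add: mat_mult_assoc d)
      then show ?thesis unfolding qe by (simp add: d)
    qed
    have kk: "k * (i * (q * f * g' * q)) = k"
    proof -
      have "k * (i * (q * f * g' * q)) = (1\<^sub>m ?m - g0 * f) * (g' * ((q * i) * (q * f * g' * q)))"
        unfolding k_def by (simp add: mat_mult_assoc d)
      also have "\<dots> = (1\<^sub>m ?m - g0 * f) * ((g' * (q * f * g')) * q)"
        unfolding Z(5) by (simp add: mat_mult_assoc d)
      finally show ?thesis unfolding g'(2) k_def .
    qed
    have "g * (f * g) = g0 * e + k * e + (g0 * (i * (q * f * g' * q)) + k * (i * (q * f * g' * q)))"
      unfolding fg unfolding g_def by (simp add: mat_distribs(2,3) d)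
    also have "\<dots> = g"
      unfolding g0e g0fk ke kk g_def using Hom_carrier [OF g0(1)] Hom_carrier [OF k] by simp
    finally have 1: "g * (f * g) = g" .
    have "f - f * (g * f) = i * (q * f - q * f * (g' * (q * f)))"
    proof -
      have "f * (g * f) = (f * g) * f" by (simp add: g_def mat_mult_assoc d)
      also have "\<dots> = e * f + i * (q * f * g' * q) * f" unfolding fg by (simp add: mat_distribs(2) d)
      finally have "f - f * (g * f) = (f - e * f) - i * (q * f * g' * q) * f"
        by (intro eq_matI) (simp_all add: d)
      also have "f - e * f = ?c * f" by (simp add: mat_distribs d)
      also have "?c * f - i * (q * f * g' * q) * f = i * (q * f - q * f * (g' * (q * f)))"
        unfolding Z(4) by (simp add: mat_distribs d)
      finally show ?thesis .
    qed
    then have "f - f * (g * f) \<in> negl X Y"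
      using negl_comp_left [OF X Z(1) Y g'(3) Z(2)] by simp
    with 1 g show ?thesis by blast
  qed
qed

section \<open>Tensor products, braiding and duals of representations\<close>

lemma one_pow_mat: "1\<^sub>m n ^\<^sub>m k = (1\<^sub>m n :: 'a::semiring_1 mat)"
  by (induction k) auto

lemma pow_mat_pow:
  fixes A :: "'a::semiring_1 mat"
  assumes "A \<in> carrier_mat n n"
  shows "(A ^\<^sub>m i) ^\<^sub>m j = A ^\<^sub>m (i * j)"
proof (induction j)
  case 0
  show ?case using pow_carrier_mat [OF assms, of i] by (simp add: carrier_matD [OF assms])
next
  case (Suc j)
  have "A ^\<^sub>m (i * Suc j) = A ^\<^sub>m (i * j + i)" by (simp add: add.commute)
  also have "\<dots> = A ^\<^sub>m (i * j) * A ^\<^sub>m i" by (rule pow_mat_add [OF assms])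
  finally show ?case using Suc by simp
qed

lemma kron_obj:
  assumes "X \<in> rep_objs" "Y \<in> rep_objs"
  shows "kron X Y \<in> rep_objs"
  using assms kron_pow [OF rep_obj_carrier [OF assms(1)] rep_obj_carrier [OF assms(2)]]
  by (simp add: rep_objs_def kron_one)

lemma rep_unit_obj: "1\<^sub>m (Suc 0) \<in> rep_objs"
  by (simp add: rep_objs_def one_pow_mat)

lemma par_kron:
  assumes "X \<in> rep_objs" "Y \<in> rep_objs"
  shows "par (kron X Y) = kron (par X) (par Y)"
  unfolding par_def by (rule kron_pow [OF rep_obj_carrier [OF assms(1)] rep_obj_carrier [OF assms(2)]])

lemma Hom_kron:
  assumes "X \<in> rep_objs" "X' \<in> rep_objs" "Y \<in> rep_objs" "Y' \<in> rep_objs" "f \<in> Hom X X'" "g \<in> Hom Y Y'"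
  shows "kron f g \<in> Hom (kron X Y) (kron X' Y')"
proof (rule HomI)
  note d = Hom_dims [OF assms(5)] Hom_dims [OF assms(6)] assms(1-4) [THEN rep_obj_dims]
  show "kron f g * kron X Y = kron X' Y' * kron f g"
    by (simp add: d HomD [OF assms(5)] HomD [OF assms(6)] flip: kron_mult)
qed (use assms in \<open>simp_all add: Hom_dims\<close>)

subsection \<open>The partial trace\<close>

text \<open>The trace is taken over the second tensor factor, of dimension \<open>w\<close>.\<close>

definition ptr :: "nat \<Rightarrow> nat \<Rightarrow> nat \<Rightarrow> 'a::comm_monoid_add mat \<Rightarrow> 'a mat" where
  "ptr a b w A = mat a b (\<lambda>(i,j). \<Sum>c<w. A $$ (i * w + c, j * w + c))"

lemma dim_ptr [simp]: "dim_row (ptr a b w A) = a" "dim_col (ptr a b w A) = b"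
  by (simp_all add: ptr_def)

lemma index_ptr: "i < a \<Longrightarrow> j < b \<Longrightarrow> ptr a b w A $$ (i,j) = (\<Sum>c<w. A $$ (i * w + c, j * w + c))"
  by (simp add: ptr_def)

lemma trace_ptr:
  assumes "dim_row A = a * w"
  shows "trace A = trace (ptr a a w A)"
proof -
  have "trace A = (\<Sum>k<a*w. A $$ (k div w * w + k mod w, k div w * w + k mod w))"
    unfolding trace_def assms by simp
  also have "\<dots> = (\<Sum>i<a. \<Sum>c<w. A $$ (i * w + c, i * w + c))"
    by (rule sum_div_mod)
  also have "\<dots> = trace (ptr a a w A)"
    unfolding trace_def by (simp add: index_ptr)
  finally show ?thesis .
qed

lemma kron_mult_index:
  fixes A :: "'a::comm_semiring_1 mat"
  assumes "i < dim_row B" "c < dim_row E" "j < dim_col A" "dim_row A = dim_col B * dim_col E"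
  shows "(kron B E * A) $$ (i * dim_row E + c, j) =
    (\<Sum>l<dim_col B. \<Sum>d<dim_col E. B $$ (i,l) * E $$ (c,d) * A $$ (l * dim_col E + d, j))"
proof -
  have b: "i * dim_row E + c < dim_row B * dim_row E" using assms by (intro pair_index_less)
  have "(kron B E * A) $$ (i * dim_row E + c, j) =
      (\<Sum>k<dim_col B * dim_col E. kron B E $$ (i * dim_row E + c, k) * A $$ (k, j))"
    using b assms by (subst index_mult_sum) auto
  also have "\<dots> = (\<Sum>k<dim_col B * dim_col E.
      B $$ (i, k div dim_col E) * E $$ (c, k mod dim_col E) * A $$ (k div dim_col E * dim_col E + k mod dim_col E, j))"
    using b assms(1,2) by (intro sum.cong) (auto simp: index_kron)
  also have "\<dots> = (\<Sum>l<dim_col B. \<Sum>d<dim_col E. B $$ (i,l) * E $$ (c,d) * A $$ (l * dim_col E + d, j))"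
    by (rule sum_div_mod)
  finally show ?thesis .
qed

lemma mult_kron_index:
  fixes A :: "'a::comm_semiring_1 mat"
  assumes "i < dim_row A" "j < dim_col B" "c < dim_col E" "dim_col A = dim_row B * dim_row E"
  shows "(A * kron B E) $$ (i, j * dim_col E + c) =
    (\<Sum>l<dim_row B. \<Sum>d<dim_row E. A $$ (i, l * dim_row E + d) * (B $$ (l,j) * E $$ (d,c)))"
proof -
  have b: "j * dim_col E + c < dim_col B * dim_col E" using assms by (intro pair_index_less)
  have "(A * kron B E) $$ (i, j * dim_col E + c) =
      (\<Sum>k<dim_row B * dim_row E. A $$ (i, k) * kron B E $$ (k, j * dim_col E + c))"
    using b assms by (subst index_mult_sum) auto
  also have "\<dots> = (\<Sum>k<dim_row B * dim_row E.
      A $$ (i, k div dim_row E * dim_row E + k mod dim_row E) * (B $$ (k div dim_row E, j) * E $$ (k mod dim_row E, c)))"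
    using b assms(2,3) by (intro sum.cong) (auto simp: index_kron)
  also have "\<dots> = (\<Sum>l<dim_row B. \<Sum>d<dim_row E. A $$ (i, l * dim_row E + d) * (B $$ (l,j) * E $$ (d,c)))"
    by (rule sum_div_mod)
  finally show ?thesis .
qed

lemma ptr_mult_left:
  fixes A :: "'a::comm_semiring_1 mat"
  assumes "B \<in> carrier_mat x a" "A \<in> carrier_mat (a * w) (b * w)"
  shows "ptr x b w (kron B (1\<^sub>m w) * A) = B * ptr a b w A"
proof (rule eq_matI)
  fix i j assume "i < dim_row (B * ptr a b w A)" "j < dim_col (B * ptr a b w A)"
  then have i: "i < x" and j: "j < b" using assms by auto
  have "ptr x b w (kron B (1\<^sub>m w) * A) $$ (i,j) =
      (\<Sum>c<w. \<Sum>l<a. \<Sum>d<w. B $$ (i,l) * (1\<^sub>m w) $$ (c,d) * A $$ (l * w + d, j * w + c))"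
    using i j assms kron_mult_index [of i B _ "1\<^sub>m w" _ A] by (simp add: index_ptr pair_index_less)
  also have "\<dots> = (\<Sum>c<w. \<Sum>l<a. \<Sum>d<w. if d = c then B $$ (i,l) * A $$ (l * w + c, j * w + c) else 0)"
    by (intro sum.cong) auto
  also have "\<dots> = (\<Sum>l<a. \<Sum>c<w. B $$ (i,l) * A $$ (l * w + c, j * w + c))"
    by (subst sum.swap) simp
  also have "\<dots> = (B * ptr a b w A) $$ (i,j)"
    using i j assms by (subst index_mult_sum) (auto simp: index_ptr sum_distrib_left)
  finally show "ptr x b w (kron B (1\<^sub>m w) * A) $$ (i,j) = (B * ptr a b w A) $$ (i,j)" .
qed (use assms in auto)

lemma ptr_mult_right:
  fixes A :: "'a::comm_semiring_1 mat"
  assumes "C \<in> carrier_mat b y" "A \<in> carrier_mat (a * w) (b * w)"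
  shows "ptr a y w (A * kron C (1\<^sub>m w)) = ptr a b w A * C"
proof (rule eq_matI)
  fix i j assume "i < dim_row (ptr a b w A * C)" "j < dim_col (ptr a b w A * C)"
  then have i: "i < a" and j: "j < y" using assms by auto
  have "ptr a y w (A * kron C (1\<^sub>m w)) $$ (i,j) =
      (\<Sum>c<w. \<Sum>l<b. \<Sum>d<w. A $$ (i * w + c, l * w + d) * (C $$ (l,j) * (1\<^sub>m w) $$ (d,c)))"
    using i j assms mult_kron_index [of _ A j C _ "1\<^sub>m w"] by (simp add: index_ptr pair_index_less)
  also have "\<dots> = (\<Sum>c<w. \<Sum>l<b. \<Sum>d<w. if d = c then A $$ (i * w + c, l * w + c) * C $$ (l,j) else 0)"
    by (intro sum.cong) auto
  also have "\<dots> = (\<Sum>l<b. \<Sum>c<w. A $$ (i * w + c, l * w + c) * C $$ (l,j))"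
    by (subst sum.swap) simp
  also have "\<dots> = (ptr a b w A * C) $$ (i,j)"
    using i j assms by (subst index_mult_sum) (auto simp: index_ptr sum_distrib_right)
  finally show "ptr a y w (A * kron C (1\<^sub>m w)) $$ (i,j) = (ptr a b w A * C) $$ (i,j)" .
qed (use assms in auto)

lemma ptr_cyclic:
  fixes A :: "'a::comm_semiring_1 mat"
  assumes "E \<in> carrier_mat w w" "A \<in> carrier_mat (a * w) (b * w)"
  shows "ptr a b w (kron (1\<^sub>m a) E * A) = ptr a b w (A * kron (1\<^sub>m b) E)"
proof (rule eq_matI)
  fix i j assume "i < dim_row (ptr a b w (A * kron (1\<^sub>m b) E))" "j < dim_col (ptr a b w (A * kron (1\<^sub>m b) E))"
  then have i: "i < a" and j: "j < b" by auto
  have "ptr a b w (kron (1\<^sub>m a) E * A) $$ (i,j) =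
      (\<Sum>c<w. \<Sum>l<a. \<Sum>d<w. (1\<^sub>m a) $$ (i,l) * E $$ (c,d) * A $$ (l * w + d, j * w + c))"
    using i j assms kron_mult_index [of i "1\<^sub>m a" _ E _ A] by (simp add: index_ptr pair_index_less)
  also have "\<dots> = (\<Sum>c<w. \<Sum>l<a. if l = i then \<Sum>d<w. E $$ (c,d) * A $$ (i * w + d, j * w + c) else 0)"
    using i by (intro sum.cong) auto
  also have "\<dots> = (\<Sum>d<w. \<Sum>c<w. A $$ (i * w + d, j * w + c) * E $$ (c,d))"
    using i by (subst sum.swap) (simp add: mult.commute)
  also have "\<dots> = (\<Sum>d<w. \<Sum>l<b. if l = j then \<Sum>c<w. A $$ (i * w + d, j * w + c) * E $$ (c,d) else 0)"
    using j by simp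
  also have "\<dots> = (\<Sum>d<w. \<Sum>l<b. \<Sum>c<w. A $$ (i * w + d, l * w + c) * ((1\<^sub>m b) $$ (l,j) * E $$ (c,d)))"
    using j by (intro sum.cong) auto
  also have "\<dots> = ptr a b w (A * kron (1\<^sub>m b) E) $$ (i,j)"
    using i j assms mult_kron_index [of _ A j "1\<^sub>m b" _ E] by (simp add: index_ptr pair_index_less)
  finally show "ptr a b w (kron (1\<^sub>m a) E * A) $$ (i,j) = ptr a b w (A * kron (1\<^sub>m b) E) $$ (i,j)" .
qed simp_all

text \<open>Negligible morphisms form a tensor ideal, because the partial supertrace over \<open>W\<close> of a morphism is a morphism.\<close>

lemma negl_kron_one:
  fixes W :: "'k::field mat"
  assumes X: "X \<in> rep_objs" and Y: "Y \<in> rep_objs" and W: "W \<in> rep_objs" and f: "f \<in> negl X Y"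
    and char: "CHAR('k) > 0"
  shows "kron f (1\<^sub>m (dim_row W)) \<in> negl (kron X W) (kron Y W)"
proof (rule neglI)
  let ?w = "dim_row W" and ?x = "dim_row X" and ?y = "dim_row Y"
  note fH = negl_Hom [OF f]
  show "kron f (1\<^sub>m ?w) \<in> Hom (kron X W) (kron Y W)"
    by (rule Hom_kron [OF X Y W W fH Hom_id [OF W]])
  fix h assume h: "h \<in> Hom (kron Y W) (kron X W)"
  define D where "D = par W"
  obtain W' where W': "W' \<in> Hom W W" "W * W' = 1\<^sub>m ?w" "W' * W = 1\<^sub>m ?w"
    using rep_inverse [OF W char] by blast
  note d = rep_obj_dims [OF X] rep_obj_dims [OF Y] rep_obj_dims [OF W] Hom_dims [OF fH] Hom_dims [OF h, simplified]
    dim_par [OF W, folded D_def] Hom_dims [OF W'(1)] dim_par [OF Y]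
  have WD: "W * D = D * W"
    unfolding D_def by (rule Hom_par [OF W W Hom_self [OF W]])
  \<comment> \<open>Inserting the parity of \<open>W\<close> turns the partial trace of
    \<open>h\<close> into a partial supertrace.\<close>
  define B where "B = kron (1\<^sub>m ?x) D * h"
  have B: "B \<in> carrier_mat (?x * ?w) (?y * ?w)" by (auto simp: B_def d)
  have hc: "h \<in> carrier_mat (?x * ?w) (?y * ?w)" by (auto simp: d)
  have DW'c: "D * W' \<in> carrier_mat ?w ?w" by (auto simp: d)
  define t where "t = ptr ?x ?y ?w B"
  \<comment> \<open>To commute \<open>t\<close> with the action, \<open>W' * W = 1\<close> is
    inserted on the traced factor; \<open>W\<close> passes through \<open>h\<close> together with
    \<open>X\<close>, and \<open>W'\<close> is carried around the loop by \<open>ptr_cyclic\<close>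
    and cancels it on the other side.\<close>
  have "t \<in> Hom Y X"
  proof (rule HomI)
    have DW'W: "D * W' * W = D" using W'(3) by (simp add: mat_mult_assoc d)
    have WDW': "W * (D * W') = D"
    proof -
      have "W * (D * W') = (W * D) * W'" by (simp add: mat_mult_assoc d)
      also have "\<dots> = D * (W * W')" unfolding WD by (simp add: mat_mult_assoc d)
      finally show ?thesis unfolding W'(2) by (simp add: d)
    qed
    have 1: "kron X (1\<^sub>m ?w) * kron (1\<^sub>m ?x) D = kron (1\<^sub>m ?x) (D * W') * kron X W"
      using DW'W by (simp add: d flip: kron_mult)
    have 2: "kron Y W * kron (1\<^sub>m ?y) (D * W') = kron (1\<^sub>m ?y) D * kron Y (1\<^sub>m ?w)"
      using WDW' by (simp add: d flip: kron_mult)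
    have "X * t = ptr ?x ?y ?w (kron X (1\<^sub>m ?w) * B)"
      unfolding t_def by (rule ptr_mult_left [symmetric]) (use B in \<open>auto simp: d\<close>)
    also have "kron X (1\<^sub>m ?w) * B = (kron X (1\<^sub>m ?w) * kron (1\<^sub>m ?x) D) * h"
      unfolding B_def by (rule mat_mult_assoc [symmetric]) (simp_all add: d)
    also have "\<dots> = kron (1\<^sub>m ?x) (D * W') * (kron X W * h)"
      unfolding 1 by (rule mat_mult_assoc) (simp_all add: d)
    also have "kron X W * h = h * kron Y W" using HomD [OF h] ..
    also have "ptr ?x ?y ?w (kron (1\<^sub>m ?x) (D * W') * (h * kron Y W)) =
        ptr ?x ?y ?w (h * kron Y W * kron (1\<^sub>m ?y) (D * W'))"
      by (rule ptr_cyclic [OF DW'c]) (auto simp: d)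
    also have "h * kron Y W * kron (1\<^sub>m ?y) (D * W') = h * (kron Y W * kron (1\<^sub>m ?y) (D * W'))"
      by (rule mat_mult_assoc) (simp_all add: d)
    also have "\<dots> = h * kron (1\<^sub>m ?y) D * kron Y (1\<^sub>m ?w)"
      unfolding 2 by (rule mat_mult_assoc [symmetric]) (simp_all add: d)
    also have "ptr ?x ?y ?w \<dots> = ptr ?x ?y ?w (h * kron (1\<^sub>m ?y) D) * Y"
      by (rule ptr_mult_right) (auto simp: d)
    also have "ptr ?x ?y ?w (h * kron (1\<^sub>m ?y) D) = t"
      unfolding t_def B_def by (rule ptr_cyclic [symmetric]) (auto simp: d)
    finally show "t * Y = X * t" ..
  qed (simp_all add: t_def)
  have "par (kron Y W) * (kron f (1\<^sub>m ?w) * h) = kron (par Y) D * kron f (1\<^sub>m ?w) * h"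
    unfolding par_kron [OF Y W] D_def by (rule mat_mult_assoc [symmetric]) (simp_all add: d dim_par [OF W])
  also have "kron (par Y) D * kron f (1\<^sub>m ?w) = kron (par Y * f) (1\<^sub>m ?w) * kron (1\<^sub>m ?x) D"
    by (simp add: d flip: kron_mult)
  also have "kron (par Y * f) (1\<^sub>m ?w) * kron (1\<^sub>m ?x) D * h = kron (par Y * f) (1\<^sub>m ?w) * B"
    unfolding B_def by (rule mat_mult_assoc) (simp_all add: d)
  finally have "trace (par (kron Y W) * (kron f (1\<^sub>m ?w) * h)) = trace (ptr ?y ?y ?w (kron (par Y * f) (1\<^sub>m ?w) * B))"
    using trace_ptr [of "kron (par Y * f) (1\<^sub>m ?w) * B" ?y ?w] by (simp add: d)
  also have "ptr ?y ?y ?w (kron (par Y * f) (1\<^sub>m ?w) * B) = par Y * f * t"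
    unfolding t_def by (rule ptr_mult_left) (use B in \<open>auto simp: d\<close>)
  also have "trace (par Y * f * t) = trace (par Y * (f * t))"
    by (subst mat_mult_assoc) (simp_all add: d t_def)
  also have "\<dots> = 0" using neglD [OF f \<open>t \<in> Hom Y X\<close>] .
  finally show "trace (par (kron Y W) * (kron f (1\<^sub>m ?w) * h)) = 0" .
qed

subsection \<open>The super braiding\<close>

text \<open>With the projections \<open>P\<close> and \<open>Q\<close> onto the even and odd part of \<open>X\<close>, the sign \<open>(-1)\<^bsup>|x||y|\<^esup>\<close> on \<open>X \<otimes> Y\<close> is \<open>P \<otimes> 1 + Q \<otimes> par Y\<close>.\<close>

definition even_proj :: "'k::field mat \<Rightarrow> 'k mat" where
  "even_proj D = (1 / 2) \<cdot>\<^sub>m (1\<^sub>m (dim_row D) + D)"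

definition odd_proj :: "'k::field mat \<Rightarrow> 'k mat" where
  "odd_proj D = (1 / 2) \<cdot>\<^sub>m (1\<^sub>m (dim_row D) - D)"

definition sign_mat :: "'k::field mat \<Rightarrow> 'k mat \<Rightarrow> 'k mat" where
  "sign_mat D E = kron (even_proj D) (1\<^sub>m (dim_row E)) + kron (odd_proj D) E"

definition braid :: "'k::field mat \<Rightarrow> 'k mat \<Rightarrow> 'k mat" where
  "braid X Y = flip (dim_row X) (dim_row Y) * sign_mat (par X) (par Y)"

lemma dim_proj [simp]:
  "dim_row (even_proj D) = dim_row D" "dim_col (even_proj D) = dim_col D"
  "dim_row (odd_proj D) = dim_row D" "dim_col (odd_proj D) = dim_col D"
  by (simp_all add: even_proj_def odd_proj_def)

lemma dim_sign_mat [simp]: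
  "dim_row (sign_mat D E) = dim_row D * dim_row E" "dim_col (sign_mat D E) = dim_col D * dim_col E"
  by (simp_all add: sign_mat_def)

context
  fixes D :: "'k::field mat"
  assumes D: "dim_col D = dim_row D" "D * D = 1\<^sub>m (dim_row D)" and two: "(2::'k) \<noteq> 0"
begin

private lemma half: "x / 2 + x / 2 = (x :: 'k)"
  using two by (simp add: field_simps)

lemma proj_sum: "even_proj D + odd_proj D = 1\<^sub>m (dim_row D)" "even_proj D - odd_proj D = D"
  using two
  by - (rule eq_matI; auto simp: even_proj_def odd_proj_def D add_divide_distrib diff_divide_distrib half)+

lemma proj_mult:
  "even_proj D * even_proj D = even_proj D" "odd_proj D * odd_proj D = odd_proj D"
  "even_proj D * odd_proj D = 0\<^sub>m (dim_row D) (dim_row D)" "odd_proj D * even_proj D = 0\<^sub>m (dim_row D) (dim_row D)"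
  "odd_proj D * D = - odd_proj D"
  by (rule eq_matI;
      simp add: even_proj_def odd_proj_def D mat_distribs mat_smult_smult add_divide_distrib diff_divide_distrib half algebra_simps)+

end

lemma sign_mat_natural:
  fixes D :: "'k::field mat"
  assumes "f * D = D' * f" "g * E = E' * g"
    and d: "dim_col D = dim_row D" "dim_col D' = dim_row D'" "dim_col E = dim_row E" "dim_col E' = dim_row E'"
      "dim_row f = dim_row D'" "dim_col f = dim_row D" "dim_row g = dim_row E'" "dim_col g = dim_row E"
  shows "kron f g * sign_mat D E = sign_mat D' E' * kron f g"
proof -
  have "f * even_proj D = even_proj D' * f" "f * odd_proj D = odd_proj D' * f"
    using assms(1) by (simp_all add: even_proj_def odd_proj_def mat_distribs d)
  then show ?thesis
    using assms(2) by (simp add: sign_mat_def mat_distribs(2,3) d flip: kron_mult)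
qed

lemma sign_mat_square:
  fixes D :: "'k::field mat"
  assumes D: "dim_col D = dim_row D" "D * D = 1\<^sub>m (dim_row D)" and E: "dim_col E = dim_row E" "E * E = 1\<^sub>m (dim_row E)"
    and two: "(2::'k) \<noteq> 0"
  shows "sign_mat D E * sign_mat D E = 1\<^sub>m (dim_row D * dim_row E)"
proof -
  have "sign_mat D E * sign_mat D E = kron (even_proj D) (1\<^sub>m (dim_row E)) + kron (odd_proj D) (1\<^sub>m (dim_row E))"
    by (simp add: sign_mat_def mat_distribs(2,3) D(1) E kron_zero_left proj_mult [OF D two] flip: kron_mult)
  also have "\<dots> = 1\<^sub>m (dim_row D * dim_row E)"
    by (simp add: proj_sum [OF D two] kron_one flip: kron_add_left)
  finally show ?thesis .
qed

text \<open>The sign is symmetric in the two parities: writing \<open>1 = P' + Q'\<close> and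
  \<open>E = P' - Q'\<close> for the second factor and regrouping exchanges the roles of the
  factors.\<close>

lemma flip_sign_mat:
  fixes D :: "'k::field mat"
  assumes D: "dim_col D = dim_row D" "D * D = 1\<^sub>m (dim_row D)" and E: "dim_col E = dim_row E" "E * E = 1\<^sub>m (dim_row E)"
    and two: "(2::'k) \<noteq> 0"
  shows "flip (dim_row D) (dim_row E) * sign_mat D E = sign_mat E D * flip (dim_row D) (dim_row E)"
proof -
  let ?P = "even_proj D" and ?Q = "odd_proj D" and ?P' = "even_proj E" and ?Q' = "odd_proj E"
  have "flip (dim_row D) (dim_row E) * sign_mat D E =
      (kron (1\<^sub>m (dim_row E)) ?P + kron E ?Q) * flip (dim_row D) (dim_row E)"
    by (simp add: sign_mat_def mat_distribs(2,3) D E flip_natural)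
  also have "kron (1\<^sub>m (dim_row E)) ?P + kron E ?Q = kron (?P' + ?Q') ?P + kron (?P' - ?Q') ?Q"
    by (simp add: proj_sum [OF E two])
  also have "\<dots> = kron ?P' (?P + ?Q) + kron ?Q' (?P - ?Q)"
    by (rule eq_matI)
      (simp_all add: D E kron_add_left kron_add_right kron_diff_left kron_diff_right)
  also have "\<dots> = sign_mat E D"
    by (simp add: sign_mat_def proj_sum [OF D two])
  finally show ?thesis .
qed

text \<open>The sign for passing \<open>E \<otimes> F\<close> is the product of the signs for
  \<open>E\<close> and \<open>F\<close>, because \<open>P\<close> and \<open>Q\<close> are
  orthogonal idempotents. This is the sign part of the hexagon; \<open>flip_hexagon\<close> is the
  other part.\<close>

lemma sign_mat_kron:
  fixes D :: "'k::field mat"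
  assumes D: "dim_col D = dim_row D" "D * D = 1\<^sub>m (dim_row D)" and d: "dim_col E = dim_row E" "dim_col F = dim_row F"
    and two: "(2::'k) \<noteq> 0"
  shows "kron (1\<^sub>m (dim_row E)) (sign_mat D F) * kron (flip (dim_row D) (dim_row E)) (1\<^sub>m (dim_row F))
      * kron (sign_mat D E) (1\<^sub>m (dim_row F))
    = kron (flip (dim_row D) (dim_row E)) (1\<^sub>m (dim_row F)) * sign_mat D (kron E F)"
proof -
  let ?P = "even_proj D" and ?Q = "odd_proj D" and ?e = "1\<^sub>m (dim_row E)" and ?f = "1\<^sub>m (dim_row F)"
  let ?s = "flip (dim_row D) (dim_row E)"
  have "kron ?e (sign_mat D F) * kron ?s ?f = kron (kron ?e ?P * ?s) ?f + kron (kron ?e ?Q * ?s) F"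
    by (simp add: sign_mat_def kron_add_right mat_distribs(2,3) D d kron_assoc mult.assoc flip: kron_mult kron_assoc)
  also have "\<dots> = kron ?s ?f * (kron (kron ?P ?e) ?f + kron (kron ?Q ?e) F)"
    by (simp add: mat_distribs(2,3) D d flip: kron_mult flip_natural)
  finally have "kron ?e (sign_mat D F) * kron ?s ?f * kron (sign_mat D E) ?f =
      kron ?s ?f * ((kron (kron ?P ?e) ?f + kron (kron ?Q ?e) F) * kron (sign_mat D E) ?f)"
    by (simp add: mat_mult_assoc D d)
  also have "(kron (kron ?P ?e) ?f + kron (kron ?Q ?e) F) * kron (sign_mat D E) ?f =
      kron (kron ?P ?e) ?f + kron (kron ?Q E) F"
    by (simp add: sign_mat_def kron_add_left mat_distribs(2,3) D d kron_zero_left proj_mult [OF D two] flip: kron_mult)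
  also have "\<dots> = sign_mat D (kron E F)"
    by (simp add: sign_mat_def kron_assoc kron_one)
  finally show ?thesis .
qed

lemma par_props:
  assumes "X \<in> rep_objs"
  shows "dim_col (par X) = dim_row (par X)" "par X * par X = 1\<^sub>m (dim_row (par X))"
  using assms by (simp_all add: par_par)

lemma dim_braid [simp]:
  assumes "X \<in> rep_objs" "Y \<in> rep_objs"
  shows "dim_row (braid X Y) = dim_row Y * dim_row X" "dim_col (braid X Y) = dim_row X * dim_row Y"
  using assms by (simp_all add: braid_def)

lemma braid_natural:
  fixes X Y :: "'k::field mat"
  assumes "X \<in> rep_objs" "Y \<in> rep_objs" "X' \<in> rep_objs" "Y' \<in> rep_objs" "f \<in> Hom X X'" "g \<in> Hom Y Y'"
  shows "braid X' Y' * kron f g = kron g f * braid X Y"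
proof -
  note d = Hom_dims [OF assms(5)] Hom_dims [OF assms(6)] assms(1-4)
  have "kron f g * sign_mat (par X) (par Y) = sign_mat (par X') (par Y') * kron f g"
    by (rule sign_mat_natural) (use assms in \<open>simp_all add: Hom_par d\<close>)
  then have "braid X' Y' * kron f g = flip (dim_row X') (dim_row Y') * kron f g * sign_mat (par X) (par Y)"
    by (simp add: braid_def mat_mult_assoc d)
  also have "flip (dim_row X') (dim_row Y') * kron f g = kron g f * flip (dim_row X) (dim_row Y)"
    by (rule flip_natural) (simp_all add: d)
  also have "kron g f * flip (dim_row X) (dim_row Y) * sign_mat (par X) (par Y) = kron g f * braid X Y"
    unfolding braid_def by (rule mat_mult_assoc) (simp_all add: d)
  finally show ?thesis .
qed

lemma braid_Hom:
  assumes "X \<in> rep_objs" "Y \<in> rep_objs"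
  shows "braid X Y \<in> Hom (kron X Y) (kron Y X)"
  by (rule HomI) (use assms in \<open>simp_all add: braid_natural Hom_self\<close>)

lemma braid_symmetric:
  fixes X Y :: "'k::field mat"
  assumes "X \<in> rep_objs" "Y \<in> rep_objs" and two: "(2::'k) \<noteq> 0"
  shows "braid Y X * braid X Y = 1\<^sub>m (dim_row X * dim_row Y)"
proof -
  have "braid Y X * braid X Y =
      flip (dim_row Y) (dim_row X) * (sign_mat (par Y) (par X) * flip (dim_row X) (dim_row Y)) * sign_mat (par X) (par Y)"
    using assms by (simp add: braid_def mat_mult_assoc)
  also have "sign_mat (par Y) (par X) * flip (dim_row X) (dim_row Y) = flip (dim_row X) (dim_row Y) * sign_mat (par X) (par Y)"
    using flip_sign_mat [OF par_props [OF assms(1)] par_props [OF assms(2)] two] assms by simp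
  also have "flip (dim_row Y) (dim_row X) * (flip (dim_row X) (dim_row Y) * sign_mat (par X) (par Y)) * sign_mat (par X) (par Y) =
     (flip (dim_row Y) (dim_row X) * flip (dim_row X) (dim_row Y)) * (sign_mat (par X) (par Y) * sign_mat (par X) (par Y))"
    using assms by (simp add: mat_mult_assoc)
  also have "\<dots> = 1\<^sub>m (dim_row X * dim_row Y)"
    using sign_mat_square [OF par_props [OF assms(1)] par_props [OF assms(2)] two] assms by (simp add: flip_flip)
  finally show ?thesis .
qed

lemma braid_hexagon:
  fixes X Y Z :: "'k::field mat"
  assumes "X \<in> rep_objs" "Y \<in> rep_objs" "Z \<in> rep_objs" and two: "(2::'k) \<noteq> 0"
  shows "braid X (kron Y Z) = kron (1\<^sub>m (dim_row Y)) (braid X Z) * kron (braid X Y) (1\<^sub>m (dim_row Z))"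
proof -
  let ?x = "dim_row X" and ?y = "dim_row Y" and ?z = "dim_row Z"
  let ?D = "par X" and ?E = "par Y" and ?F = "par Z"
  note d = assms(1-3)
  have "kron (1\<^sub>m ?y) (braid X Z) * kron (braid X Y) (1\<^sub>m ?z) =
      kron (1\<^sub>m ?y) (flip ?x ?z) * (kron (1\<^sub>m ?y) (sign_mat ?D ?F) * kron (flip ?x ?y) (1\<^sub>m ?z) * kron (sign_mat ?D ?E) (1\<^sub>m ?z))"
  proof -
    have 1: "kron (1\<^sub>m ?y) (braid X Z) = kron (1\<^sub>m ?y) (flip ?x ?z) * kron (1\<^sub>m ?y) (sign_mat ?D ?F)"
      by (simp add: braid_def d flip: kron_mult)
    have 2: "kron (braid X Y) (1\<^sub>m ?z) = kron (flip ?x ?y) (1\<^sub>m ?z) * kron (sign_mat ?D ?E) (1\<^sub>m ?z)"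
      by (simp add: braid_def d flip: kron_mult)
    show ?thesis unfolding 1 2 by (simp add: mat_mult_assoc d mult_ac)
  qed
  also have "kron (1\<^sub>m ?y) (sign_mat ?D ?F) * kron (flip ?x ?y) (1\<^sub>m ?z) * kron (sign_mat ?D ?E) (1\<^sub>m ?z) =
      kron (flip ?x ?y) (1\<^sub>m ?z) * sign_mat ?D (kron ?E ?F)"
    using sign_mat_kron [OF par_props [OF d(1)] par_props(1) [OF d(2)] par_props(1) [OF d(3)] two] d by simp
  also have "kron (1\<^sub>m ?y) (flip ?x ?z) * (kron (flip ?x ?y) (1\<^sub>m ?z) * sign_mat ?D (kron ?E ?F)) =
      flip ?x (?y * ?z) * sign_mat ?D (kron ?E ?F)"
    unfolding flip_hexagon by (rule mat_mult_assoc [symmetric]) (simp_all add: d mult_ac)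
  also have "\<dots> = braid X (kron Y Z)"
    by (simp add: braid_def par_kron d)
  finally show ?thesis ..
qed

text \<open>The partial trace argument treats a negligible left factor; conjugation with the
  braiding moves a negligible right factor to the left.\<close>

lemma negl_kron:
  fixes X Y :: "'k::field mat"
  assumes "X \<in> rep_objs" "X' \<in> rep_objs" "Y \<in> rep_objs" "Y' \<in> rep_objs"
    and char: "CHAR('k) > 0" and two: "(2::'k) \<noteq> 0"
  shows "f \<in> negl X X' \<Longrightarrow> g \<in> Hom Y Y' \<Longrightarrow> kron f g \<in> negl (kron X Y) (kron X' Y')"
    and "f \<in> Hom X X' \<Longrightarrow> g \<in> negl Y Y' \<Longrightarrow> kron f g \<in> negl (kron X Y) (kron X' Y')"
proof -
  note o = assms(1-4)
  have *: "kron f g \<in> negl (kron X Y) (kron X' Y')"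
    if f: "f \<in> negl X X'" and g: "g \<in> Hom Y Y'" and o: "X \<in> rep_objs" "X' \<in> rep_objs" "Y \<in> rep_objs" "Y' \<in> rep_objs"
    for X X' Y Y' f g :: "'k mat"
  proof -
    note d = Hom_dims [OF negl_Hom [OF f]] Hom_dims [OF g]
    have "kron (1\<^sub>m (dim_row X')) g * kron f (1\<^sub>m (dim_row Y)) \<in> negl (kron X Y) (kron X' Y')"
      by (intro negl_comp_left [of _ "kron X' Y"] kron_obj negl_kron_one Hom_kron Hom_id o f g char)
    then show ?thesis by (simp add: d flip: kron_mult)
  qed
  show "f \<in> negl X X' \<Longrightarrow> g \<in> Hom Y Y' \<Longrightarrow> kron f g \<in> negl (kron X Y) (kron X' Y')"
    using * o by blast
  assume f: "f \<in> Hom X X'" and g: "g \<in> negl Y Y'"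
  note gH = negl_Hom [OF g]
  note d = Hom_dims [OF f] Hom_dims [OF gH]
  have "braid Y' X' * (kron g f * braid X Y) \<in> negl (kron X Y) (kron X' Y')"
    by (intro negl_comp_left [of _ "kron Y' X'"] negl_comp_right [of "kron Y X"] kron_obj braid_Hom o * f g)
  moreover have "braid Y' X' * (kron g f * braid X Y) = braid Y' X' * braid X' Y' * kron f g"
    unfolding braid_natural [OF o(1,3,2,4) f gH, symmetric]
    by (rule mat_mult_assoc [symmetric]) (simp_all add: o d)
  ultimately show "kron f g \<in> negl (kron X Y) (kron X' Y')"
    using braid_symmetric [OF o(2,4) two] by (simp add: d)
qed

subsection \<open>Duals\<close>

text \<open>Since \<open>X\<close> has order dividing \<open>2 * p\<close>, the power is the
  inverse, so this is the contragredient representation.\<close>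

definition dual :: "'k::field mat \<Rightarrow> 'k mat" where
  "dual X = transpose_mat (X ^\<^sub>m (2 * CHAR('k) - 1))"

context
  fixes X :: "'k::field mat"
  assumes X: "X \<in> rep_objs" and char: "CHAR('k) > 0"
begin

private definition "n = dim_row X"
private definition "X' = X ^\<^sub>m (2 * CHAR('k) - 1)"

private lemma Xc: "X \<in> carrier_mat n n" and X'c: "X' \<in> carrier_mat n n"
  unfolding n_def X'_def by (rule rep_obj_carrier [OF X], rule pow_carrier_mat [OF rep_obj_carrier [OF X]])

private lemma inv: "X * X' = 1\<^sub>m n" "X' * X = 1\<^sub>m n"
  using rep_inverse [OF X char] by (simp_all add: n_def X'_def)

private lemma X'_obj: "X' \<in> rep_objs"
proof -
  have "X' ^\<^sub>m (2 * CHAR('k)) = (X ^\<^sub>m (2 * CHAR('k))) ^\<^sub>m (2 * CHAR('k) - 1)"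
    unfolding X'_def pow_mat_pow [OF Xc] by (simp add: mult.commute)
  then show ?thesis
    using X carrier_matD [OF X'c] by (simp add: rep_objs_def one_pow_mat n_def)
qed

private lemma dual_eq: "dual X = transpose_mat X'"
  unfolding dual_def X'_def ..

lemma dim_dual: "dim_row (dual X) = dim_row X" "dim_col (dual X) = dim_row X"
  using carrier_matD [OF X'c] unfolding dual_eq n_def by simp_all

lemma dual_obj: "dual X \<in> rep_objs"
  using X'_obj transpose_pow [OF X'c, of "2 * CHAR('k)"] carrier_matD [OF X'c]
  by (simp add: rep_objs_def dual_eq)

text \<open>The parity is an involution and \<open>2 * p - 1\<close> is odd, so inverting
  \<open>X\<close> does not change it.\<close>

lemma par_dual: "par (dual X) = transpose_mat (par X)"
proof -
  have D: "par X ^\<^sub>m (2 * k + 1) = par X" for k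
  proof -
    have "par X ^\<^sub>m 2 = 1\<^sub>m n"
      using par_par [OF X] pow_mat_add [OF par_carrier [OF X], of 1 1] left_mult_one_mat [OF par_carrier [OF X]]
      by (simp add: n_def numeral_2_eq_2)
    then have "par X ^\<^sub>m (2 * k) = 1\<^sub>m n"
      using pow_mat_pow [OF par_carrier [OF X], of 2 k] by (simp add: one_pow_mat)
    then show ?thesis
      using pow_mat_add [OF par_carrier [OF X], of "2 * k" 1] left_mult_one_mat [OF par_carrier [OF X]]
      by (simp add: n_def)
  qed
  have "X' ^\<^sub>m CHAR('k) = par X ^\<^sub>m (2 * CHAR('k) - 1)"
    unfolding X'_def par_def pow_mat_pow [OF Xc] by (simp add: mult.commute)
  also have "2 * CHAR('k) - 1 = 2 * (CHAR('k) - 1) + 1" using char by simp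
  finally have "X' ^\<^sub>m CHAR('k) = par X" unfolding D .
  then show ?thesis
    using transpose_pow [OF X'c, of "CHAR('k)"] by (simp add: par_def dual_eq)
qed

lemma dual_dual: "dual (dual X) = X"
proof -
  let ?Y = "X' ^\<^sub>m (2 * CHAR('k) - 1)"
  have Y: "?Y * X' = 1\<^sub>m n" "?Y \<in> carrier_mat n n"
    using rep_inverse(3) [OF X'_obj char] X'c by (auto intro: pow_carrier_mat)
  have "?Y = ?Y * (X' * X)" unfolding inv using right_mult_one_mat [OF Y(2)] ..
  also have "\<dots> = ?Y * X' * X"
    by (rule assoc_mult_mat [symmetric, OF Y(2) X'c Xc])
  also have "\<dots> = X" unfolding Y using left_mult_one_mat [OF Xc] .
  finally have "?Y = X" .
  moreover have "dual (dual X) = transpose_mat (dual X ^\<^sub>m (2 * CHAR('k) - 1))"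
    by (rule dual_def)
  ultimately show ?thesis
    unfolding dual_eq transpose_pow [OF X'c, symmetric] transpose_transpose by (simp only:)
qed

text \<open>The transposed inverse slides across the cup and cancels \<open>X\<close>.\<close>

lemma cup_Hom: "cup (dim_row X) \<in> Hom (1\<^sub>m (Suc 0)) (kron X (dual X))"
proof (rule HomI)
  note d = carrier_matD [OF Xc] carrier_matD [OF X'c]
  have "kron X (dual X) * cup n = kron X (1\<^sub>m n) * (kron (1\<^sub>m n) (transpose_mat X') * cup n)"
    by (simp add: dual_eq d flip: kron_mult mat_mult_assoc)
  also have "kron (1\<^sub>m n) (transpose_mat X') * cup n = kron X' (1\<^sub>m n) * cup n"
    by (rule cup_slide [OF X'c, symmetric])
  also have "kron X (1\<^sub>m n) * (kron X' (1\<^sub>m n) * cup n) = cup n"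
    by (simp add: d inv kron_one flip: kron_mult mat_mult_assoc)
  finally show "cup (dim_row X) * 1\<^sub>m (Suc 0) = kron X (dual X) * cup (dim_row X)"
    unfolding n_def [symmetric] by simp
qed (simp_all add: dim_dual)

lemma cap_Hom: "cap (dim_row X) \<in> Hom (kron (dual X) X) (1\<^sub>m (Suc 0))"
proof (rule HomI)
  note d = carrier_matD [OF Xc] carrier_matD [OF X'c]
  have "cap n * kron (dual X) X = cap n * kron (transpose_mat X') (1\<^sub>m n) * kron (1\<^sub>m n) X"
    by (simp add: dual_eq d mat_mult_assoc flip: kron_mult)
  also have "cap n * kron (transpose_mat X') (1\<^sub>m n) = cap n * kron (1\<^sub>m n) X'"
    using cap_slide [of "transpose_mat X'" n] X'c by simp
  also have "cap n * kron (1\<^sub>m n) X' * kron (1\<^sub>m n) X = cap n"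
    by (simp add: d inv kron_one mat_mult_assoc flip: kron_mult)
  finally show "cap (dim_row X) * kron (dual X) X = 1\<^sub>m (Suc 0) * cap (dim_row X)"
    unfolding n_def [symmetric] by simp
qed (simp_all add: dim_dual)

text \<open>On the cup the sign \<open>P \<otimes> 1 + Q \<otimes> par\<close> slides to
  \<open>(P + Q * par) \<otimes> 1\<close>, and \<open>P + Q * par = P - Q\<close> is the parity
  itself. The flip fixes the cup, so closing the loop leaves the supertrace of the identity.\<close>

lemma cap_braid_cup:
  assumes two: "(2::'k) \<noteq> 0"
  shows "cap (dim_row X) * (braid X (dual X) * cup (dim_row X)) = trace (par X) \<cdot>\<^sub>m 1\<^sub>m 1"
proof -
  let ?D = "par X" and ?P = "even_proj (par X)" and ?Q = "odd_proj (par X)"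
  have D: "?D \<in> carrier_mat n n" using par_carrier [OF X] by (simp add: n_def)
  have Q: "?Q \<in> carrier_mat n n" "?P \<in> carrier_mat n n" using D by auto
  note d = carrier_matD [OF D] carrier_matD [OF Q(1)] carrier_matD [OF Q(2)]
  note DP = proj_mult [OF par_props [OF X] two] proj_sum [OF par_props [OF X] two]
  have "kron ?Q (transpose_mat ?D) * cup n = kron ?Q (1\<^sub>m n) * (kron (1\<^sub>m n) (transpose_mat ?D) * cup n)"
    by (simp add: d flip: kron_mult mat_mult_assoc)
  also have "\<dots> = kron ?Q (1\<^sub>m n) * (kron ?D (1\<^sub>m n) * cup n)"
    unfolding cup_slide [OF D] ..
  also have "\<dots> = kron (?Q * ?D) (1\<^sub>m n) * cup n"
    by (simp add: d flip: kron_mult mat_mult_assoc)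
  finally have "sign_mat ?D (par (dual X)) * cup n = kron ?P (1\<^sub>m n) * cup n + kron (?Q * ?D) (1\<^sub>m n) * cup n"
    unfolding par_dual sign_mat_def by (simp add: d mat_distribs(2,3))
  also have "\<dots> = kron (?P + ?Q * ?D) (1\<^sub>m n) * cup n"
    by (simp add: d kron_add_left mat_distribs(2,3))
  also have "?P + ?Q * ?D = ?P - ?Q"
    unfolding DP(5) by (rule eq_matI) (simp_all add: d)
  also have "\<dots> = ?D" by (rule DP)
  finally have S: "sign_mat ?D (par (dual X)) * cup n = kron ?D (1\<^sub>m n) * cup n" .
  have "braid X (dual X) * cup n = flip n n * (sign_mat ?D (par (dual X)) * cup n)"
    unfolding braid_def using X dual_obj by (simp add: mat_mult_assoc dim_dual n_def)
  also have "\<dots> = flip n n * kron ?D (1\<^sub>m n) * cup n"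
    unfolding S by (rule mat_mult_assoc [symmetric]) (simp_all add: d)
  also have "flip n n * kron ?D (1\<^sub>m n) = kron (1\<^sub>m n) ?D * flip n n"
    by (rule flip_natural) (simp_all add: d)
  also have "kron (1\<^sub>m n) ?D * flip n n * cup n = kron (1\<^sub>m n) ?D * cup n"
    by (simp add: mat_mult_assoc d flip_cup)
  also have "\<dots> = kron (transpose_mat ?D) (1\<^sub>m n) * cup n"
    using cup_slide [of "transpose_mat ?D" n] D by simp
  finally have "cap n * (braid X (dual X) * cup n) = trace (transpose_mat ?D) \<cdot>\<^sub>m 1\<^sub>m 1"
    using cap_kron_cup [of "transpose_mat ?D" n] D by simp
  also have "trace (transpose_mat ?D) = trace ?D" using D by (simp add: trace_def)
  finally show ?thesis by (simp add: n_def)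
qed

end

section \<open>Regular categories with split idempotents are abelian\<close>

context tc_category
begin

lemma hom_obj: "f \<in> hom C X Y \<Longrightarrow> X \<in> Obj C" "f \<in> hom C X Y \<Longrightarrow> Y \<in> Obj C"
  using dom_obj cod_obj by (auto simp: hom_def)

lemma hom_dom: "f \<in> hom C X Y \<Longrightarrow> Dom C f = X" "f \<in> hom C X Y \<Longrightarrow> Cod C f = Y" "f \<in> hom C X Y \<Longrightarrow> f \<in> Mor C"
  by (auto simp: hom_def)

end

context tc_linear
begin

lemma add_eq_self:
  assumes "f \<in> hom C X Y" "x \<in> hom C X Y" "f \<boxplus> x = f"
  shows "x = \<z> X Y"
proof -
  obtain g where g: "g \<in> hom C X Y" "f \<boxplus> g = \<z> X Y" using add_inverse [OF assms(1)] by blast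
  have "x = x \<boxplus> (f \<boxplus> g)" using add_zero [OF assms(2)] g(2) by simp
  also have "\<dots> = (f \<boxplus> x) \<boxplus> g"
    using add_assoc [OF assms(2,1) g(1)] add_commute [OF assms(2,1)] by simp
  also have "\<dots> = \<z> X Y" using assms(3) g(2) by simp
  finally show ?thesis .
qed

lemma zero_add: "f \<in> hom C X Y \<Longrightarrow> \<z> X Y \<boxplus> f = f"
  using add_zero add_commute zero_hom hom_obj by metis

lemma zero_comp:
  assumes "f \<in> hom C X Y" "Z \<in> Obj C"
  shows "\<z> Y Z \<cdot> f = \<z> X Z"
proof -
  have z: "\<z> Y Z \<in> hom C Y Z" using assms zero_hom hom_obj by blast
  have "\<z> Y Z \<cdot> f = (\<z> Y Z \<cdot> f) \<boxplus> (\<z> Y Z \<cdot> f)"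
    using comp_add_left [OF assms(1) z z] add_zero [OF z] by simp
  then show ?thesis using add_eq_self comp_hom [OF assms(1) z] by metis
qed

lemma comp_zero:
  assumes "f \<in> hom C X Y" "W \<in> Obj C"
  shows "f \<cdot> \<z> W X = \<z> W Y"
proof -
  have z: "\<z> W X \<in> hom C W X" using assms zero_hom hom_obj by blast
  have "f \<cdot> \<z> W X = (f \<cdot> \<z> W X) \<boxplus> (f \<cdot> \<z> W X)"
    using comp_add_right [OF z z assms(1)] add_zero [OF z] by simp
  then show ?thesis using add_eq_self comp_hom [OF z assms(1)] by metis
qed

text \<open>\<open>f\<close> kills the complement of the idempotent \<open>g \<cdot> f\<close>, and
  a map killed by \<open>f\<close> lies entirely in that complement. \<open>split_cokernel\<close>
  is the dual statement.\<close>

lemma split_kernel: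
  assumes f: "f \<in> hom C X Y" and g: "g \<in> hom C Y X" and i: "i \<in> hom C Z X" and q: "q \<in> hom C X Z"
    and fgf: "f \<cdot> (g \<cdot> f) = f" and qi: "q \<cdot> i = \<i>\<d> Z" and sum: "(g \<cdot> f) \<boxplus> (i \<cdot> q) = \<i>\<d> X"
  shows "is_kernel C i f"
proof -
  note o = hom_obj [OF f] hom_obj [OF i]
  have gf: "g \<cdot> f \<in> hom C X X" and iq: "i \<cdot> q \<in> hom C X X" and fi: "f \<cdot> i \<in> hom C Z Y"
    using comp_hom f g i q by blast+
  have fiq: "f \<cdot> (i \<cdot> q) \<in> hom C X Y" using comp_hom [OF iq f] .
  have "f = f \<cdot> ((g \<cdot> f) \<boxplus> (i \<cdot> q))" using id_right [OF f] sum by simp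
  also have "\<dots> = f \<boxplus> (f \<cdot> (i \<cdot> q))" using comp_add_right [OF gf iq f] fgf by simp
  finally have "f \<cdot> (i \<cdot> q) = \<z> X Y" using add_eq_self [OF f fiq] by simp
  then have "(f \<cdot> i) \<cdot> q = \<z> X Y" using comp_assoc [OF q i f] by simp
  then have "(f \<cdot> i) \<cdot> (q \<cdot> i) = \<z> Z Y"
    using comp_assoc [OF i q fi] zero_comp [OF i o(2)] by simp
  then have fi0: "f \<cdot> i = \<z> Z Y" using qi id_right [OF fi] by simp
  have "\<exists>!u. u \<in> hom C W Z \<and> i \<cdot> u = h" if h: "h \<in> hom C W X" and 0: "f \<cdot> h = \<z> W Y" for W h
  proof (rule ex1I [of _ "q \<cdot> h"])
    have "h = ((g \<cdot> f) \<boxplus> (i \<cdot> q)) \<cdot> h" using sum id_left [OF h] by simp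
    also have "\<dots> = ((g \<cdot> f) \<cdot> h) \<boxplus> ((i \<cdot> q) \<cdot> h)" by (rule comp_add_left [OF h gf iq])
    also have "\<dots> = \<z> W X \<boxplus> (i \<cdot> (q \<cdot> h))"
      using comp_assoc [OF h f g] comp_assoc [OF h q i] 0 comp_zero [OF g] hom_obj [OF h] by simp
    also have "\<dots> = i \<cdot> (q \<cdot> h)" using zero_add comp_hom h q i by blast
    finally show "q \<cdot> h \<in> hom C W Z \<and> i \<cdot> (q \<cdot> h) = h" using comp_hom [OF h q] by simp
    fix u assume "u \<in> hom C W Z \<and> i \<cdot> u = h"
    then show "u = q \<cdot> h" using comp_assoc [OF _ i q] qi id_left by metis
  qed
  then show ?thesis
    unfolding is_kernel_def using hom_dom [OF f] hom_dom [OF i] i fi0 by simp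
qed

lemma split_cokernel:
  assumes f: "f \<in> hom C X Y" and g: "g \<in> hom C Y X" and j: "j \<in> hom C W Y" and r: "r \<in> hom C Y W"
    and fgf: "f \<cdot> (g \<cdot> f) = f" and rj: "r \<cdot> j = \<i>\<d> W" and sum: "(f \<cdot> g) \<boxplus> (j \<cdot> r) = \<i>\<d> Y"
  shows "is_cokernel C r f"
proof -
  note o = hom_obj [OF f] hom_obj [OF j]
  have fg: "f \<cdot> g \<in> hom C Y Y" and jr: "j \<cdot> r \<in> hom C Y Y" and rf: "r \<cdot> f \<in> hom C X W"
    using comp_hom f g j r by blast+
  have jrf: "(j \<cdot> r) \<cdot> f \<in> hom C X Y" using comp_hom [OF f jr] .
  have "f = ((f \<cdot> g) \<boxplus> (j \<cdot> r)) \<cdot> f" using id_left [OF f] sum by simp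
  also have "\<dots> = f \<boxplus> ((j \<cdot> r) \<cdot> f)" using comp_add_left [OF f fg jr] fgf comp_assoc [OF f g f] by simp
  finally have "(j \<cdot> r) \<cdot> f = \<z> X Y" using add_eq_self [OF f jrf] by simp
  then have "j \<cdot> (r \<cdot> f) = \<z> X Y" using comp_assoc [OF f r j] by simp
  then have "(r \<cdot> j) \<cdot> (r \<cdot> f) = \<z> X W"
    using comp_assoc [OF rf j r] comp_zero [OF r o(1)] by simp
  then have rf0: "r \<cdot> f = \<z> X W" using rj id_left [OF rf] by simp
  have "\<exists>!u. u \<in> hom C W V \<and> u \<cdot> r = h" if h: "h \<in> hom C Y V" and 0: "h \<cdot> f = \<z> X V" for V h
  proof (rule ex1I [of _ "h \<cdot> j"])
    have "h = h \<cdot> ((f \<cdot> g) \<boxplus> (j \<cdot> r))" using sum id_right [OF h] by simp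
    also have "\<dots> = (h \<cdot> (f \<cdot> g)) \<boxplus> (h \<cdot> (j \<cdot> r))" by (rule comp_add_right [OF fg jr h])
    also have "\<dots> = \<z> Y V \<boxplus> ((h \<cdot> j) \<cdot> r)"
      using comp_assoc [OF g f h] comp_assoc [OF r j h] 0 zero_comp [OF g] hom_obj [OF h] by simp
    also have "\<dots> = (h \<cdot> j) \<cdot> r" using zero_add comp_hom h r j by blast
    finally show "h \<cdot> j \<in> hom C W V \<and> (h \<cdot> j) \<cdot> r = h" using comp_hom [OF j h] by simp
    fix u assume "u \<in> hom C W V \<and> u \<cdot> r = h"
    then show "u = h \<cdot> j" using comp_assoc [OF j r] rj id_right by metis
  qed
  then show ?thesis
    unfolding is_cokernel_def using hom_dom [OF f] hom_dom [OF r] r rf0 by simp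
qed

end

text \<open>Von Neumann regularity: each \<open>f\<close> has a quasi-inverse \<open>g\<close>, and
  the idempotents \<open>g \<cdot> f\<close> and \<open>f \<cdot> g\<close> have split complements.
  Every exact sequence then splits, which makes the axioms of an abelian category accessible by
  equations.\<close>

locale tc_split_regular = tc_linear +
  assumes split_regular: "f \<in> hom C X Y \<Longrightarrow> \<exists>g Z i q W j r.
      g \<in> hom C Y X \<and> i \<in> hom C Z X \<and> q \<in> hom C X Z \<and> j \<in> hom C W Y \<and> r \<in> hom C Y W \<and>
      f \<cdot> (g \<cdot> f) = f \<and> q \<cdot> i = \<i>\<d> Z \<and> (g \<cdot> f) \<boxplus> (i \<cdot> q) = \<i>\<d> X \<and>
      r \<cdot> j = \<i>\<d> W \<and> (f \<cdot> g) \<boxplus> (j \<cdot> r) = \<i>\<d> Y"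
    and ex_zero: "\<exists>Z. zero_obj C Z"
    and ex_biprod: "X \<in> Obj C \<Longrightarrow> Y \<in> Obj C \<Longrightarrow> \<exists>P i1 i2 p1 p2. biproduct C X Y P i1 i2 p1 p2"
begin

lemma mor_hom: "f \<in> Mor C \<Longrightarrow> f \<in> hom C (Dom C f) (Cod C f)"
  by (simp add: hom_def)

lemma mono_split:
  assumes m: "mono_mor C f" and f: "f \<in> hom C X Y" and g: "g \<in> hom C Y X" and fgf: "f \<cdot> (g \<cdot> f) = f"
  shows "g \<cdot> f = \<i>\<d> X"
proof -
  have "f \<cdot> (g \<cdot> f) = f \<cdot> \<i>\<d> X" using fgf id_right [OF f] by simp
  moreover have "g \<cdot> f \<in> hom C X X" "\<i>\<d> X \<in> hom C X X"
    using comp_hom [OF f g] id_hom hom_obj [OF f] by auto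
  ultimately show ?thesis using m hom_dom [OF f] unfolding mono_mor_def by blast
qed

lemma epi_split:
  assumes m: "epi_mor C f" and f: "f \<in> hom C X Y" and g: "g \<in> hom C Y X" and fgf: "f \<cdot> (g \<cdot> f) = f"
  shows "f \<cdot> g = \<i>\<d> Y"
proof -
  have "(f \<cdot> g) \<cdot> f = \<i>\<d> Y \<cdot> f" using fgf id_left [OF f] comp_assoc [OF f g f] by simp
  moreover have "f \<cdot> g \<in> hom C Y Y" "\<i>\<d> Y \<in> hom C Y Y"
    using comp_hom [OF g f] id_hom hom_obj [OF f] by auto
  ultimately show ?thesis using m hom_dom [OF f] unfolding epi_mor_def by blast
qed

text \<open>Kernels and cokernels are the complementary summands. A monomorphism cancels in
  \<open>f \<cdot> g \<cdot> f = f\<close>, so it is split; interchanging the roles of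
  \<open>f\<close> and of the complementary projection \<open>r\<close> exhibits it as the kernel of
  \<open>r\<close>. Epimorphisms are dual.\<close>

sublocale tc_abelian
proof
  show "\<exists>Z. zero_obj C Z" by (rule ex_zero)
  show "\<exists>P i1 i2 p1 p2. biproduct C X Y P i1 i2 p1 p2" if "X \<in> Obj C" "Y \<in> Obj C" for X Y
    using ex_biprod that .
  show "\<exists>k. is_kernel C k f" if "f \<in> Mor C" for f
    using split_regular [OF mor_hom [OF that]] split_kernel [OF mor_hom [OF that]] by meson
  show "\<exists>q. is_cokernel C q f" if "f \<in> Mor C" for f
    using split_regular [OF mor_hom [OF that]] split_cokernel [OF mor_hom [OF that]] by meson
next
  fix f assume m: "mono_mor C f"
  define X Y where "X = Dom C f" and "Y = Cod C f"
  have f: "f \<in> hom C X Y" using m mor_hom by (simp add: X_def Y_def mono_mor_def)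
  obtain g W j r where g: "g \<in> hom C Y X" and j: "j \<in> hom C W Y" and r: "r \<in> hom C Y W"
    and fgf: "f \<cdot> (g \<cdot> f) = f" and rj: "r \<cdot> j = \<i>\<d> W" and sum: "(f \<cdot> g) \<boxplus> (j \<cdot> r) = \<i>\<d> Y"
    using split_regular [OF f] by blast
  have gf: "g \<cdot> f = \<i>\<d> X" by (rule mono_split [OF m f g fgf])
  have "r \<cdot> (j \<cdot> r) = r" using comp_assoc [OF r j r] rj id_left [OF r] by simp
  moreover have "(j \<cdot> r) \<boxplus> (f \<cdot> g) = \<i>\<d> Y"
    using sum add_commute comp_hom [OF r j] comp_hom [OF g f] by metis
  ultimately have "is_kernel C f r" using split_kernel [OF r j f g] gf by simp
  then show "\<exists>g. is_kernel C f g" ..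
next
  fix f assume m: "epi_mor C f"
  define X Y where "X = Dom C f" and "Y = Cod C f"
  have f: "f \<in> hom C X Y" using m mor_hom by (simp add: X_def Y_def epi_mor_def)
  obtain g Z i q where g: "g \<in> hom C Y X" and i: "i \<in> hom C Z X" and q: "q \<in> hom C X Z"
    and fgf: "f \<cdot> (g \<cdot> f) = f" and qi: "q \<cdot> i = \<i>\<d> Z" and sum: "(g \<cdot> f) \<boxplus> (i \<cdot> q) = \<i>\<d> X"
    using split_regular [OF f] by blast
  have fg: "f \<cdot> g = \<i>\<d> Y" by (rule epi_split [OF m f g fgf])
  have "i \<cdot> (q \<cdot> i) = i" using qi id_right [OF i] by simp
  moreover have "(i \<cdot> q) \<boxplus> (g \<cdot> f) = \<i>\<d> X"
    using sum add_commute comp_hom [OF q i] comp_hom [OF f g] by metis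
  ultimately have "is_cokernel C f i" using split_cokernel [OF i q g f] fg by simp
  then show "\<exists>g. is_cokernel C f g" ..
qed

end

section \<open>The semisimplification\<close>

definition rhom :: "'k::field mat \<Rightarrow> 'k mat \<Rightarrow> 'k mat set" where
  "rhom X Y = {f \<in> Hom X Y. X \<in> rep_objs \<and> Y \<in> rep_objs}"

text \<open>Residue class modulo negligible morphisms. In \<open>mor\<close> it is tagged with
  source and target, so that \<open>Dom\<close> and \<open>Cod\<close> are well defined on the set
  of morphisms.\<close>

definition coset :: "'k::field mat \<Rightarrow> 'k mat \<Rightarrow> 'k mat \<Rightarrow> 'k mat set" where
  "coset X Y f = {f' \<in> Hom X Y. f' - f \<in> negl X Y}"

definition mor :: "'k::field mat \<Rightarrow> 'k mat \<Rightarrow> 'k mat \<Rightarrow> 'k mat \<times> 'k mat \<times> 'k mat set" where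
  "mor X Y f = (X, Y, coset X Y f)"

definition repr :: "'k mat \<times> 'k mat \<times> 'k mat set \<Rightarrow> 'k mat" where
  "repr m = (SOME f. f \<in> snd (snd m))"

text \<open>The operations act on chosen representatives; \<open>ver_comp\<close>,
  \<open>ver_add\<close>, \<open>ver_scale\<close> and \<open>ver_tensor\<close> show that the
  choice does not matter. Because \<open>kron\<close> is strict, the associativity and unit
  constraints are classes of identity matrices.\<close>

definition ver :: "'k::field small_tensor_cat" where
  "ver = \<lparr> Obj = rep_objs,
     Mor = {mor X Y f |X Y f. f \<in> rhom X Y},
     Dom = fst,
     Cod = (\<lambda>m. fst (snd m)),
     Id = (\<lambda>X. mor X X (1\<^sub>m (dim_row X))),
     Comp = (\<lambda>m n. mor (fst n) (fst (snd m)) (repr m * repr n)),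
     ZeroM = (\<lambda>X Y. mor X Y (0\<^sub>m (dim_row Y) (dim_row X))),
     Add = (\<lambda>m n. mor (fst m) (fst (snd m)) (repr m + repr n)),
     Scale = (\<lambda>a m. mor (fst m) (fst (snd m)) (a \<cdot>\<^sub>m repr m)),
     Unit = 1\<^sub>m 1,
     TensorO = kron,
     TensorM = (\<lambda>m n. mor (kron (fst m) (fst n)) (kron (fst (snd m)) (fst (snd n))) (kron (repr m) (repr n))),
     Assoc = (\<lambda>X Y Z. mor (kron X (kron Y Z)) (kron X (kron Y Z)) (1\<^sub>m (dim_row X * (dim_row Y * dim_row Z)))),
     LUnit = (\<lambda>X. mor X X (1\<^sub>m (dim_row X))),
     RUnit = (\<lambda>X. mor X X (1\<^sub>m (dim_row X))),
     Braid = (\<lambda>X Y. mor (kron X Y) (kron Y X) (braid X Y)) \<rparr>"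

lemma ver_sel [simp]:
  "Obj ver = rep_objs" "Mor ver = {mor X Y f |X Y f. f \<in> rhom X Y}"
  "Dom ver (mor X Y f) = X" "Cod ver (mor X Y f) = Y"
  "Id ver X = mor X X (1\<^sub>m (dim_row X))"
  "ZeroM ver X Y = mor X Y (0\<^sub>m (dim_row Y) (dim_row X))"
  "Unit ver = 1\<^sub>m (Suc 0)" "TensorO ver = kron"
  "Assoc ver X Y Z = mor (kron X (kron Y Z)) (kron X (kron Y Z)) (1\<^sub>m (dim_row X * (dim_row Y * dim_row Z)))"
  "LUnit ver X = mor X X (1\<^sub>m (dim_row X))" "RUnit ver X = mor X X (1\<^sub>m (dim_row X))"
  "Braid ver X Y = mor (kron X Y) (kron Y X) (braid X Y)"
  by (simp_all add: ver_def mor_def)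

lemma rhomD: "f \<in> rhom X Y \<Longrightarrow> f \<in> Hom X Y" "f \<in> rhom X Y \<Longrightarrow> X \<in> rep_objs" "f \<in> rhom X Y \<Longrightarrow> Y \<in> rep_objs"
  by (auto simp: rhom_def)

lemma rhomI: "f \<in> Hom X Y \<Longrightarrow> X \<in> rep_objs \<Longrightarrow> Y \<in> rep_objs \<Longrightarrow> f \<in> rhom X Y"
  by (auto simp: rhom_def)

lemma rhom_dims: "f \<in> rhom X Y \<Longrightarrow> dim_row f = dim_row Y" "f \<in> rhom X Y \<Longrightarrow> dim_col f = dim_row X"
  by (auto simp: rhom_def Hom_dims)

lemma rhom_id: "X \<in> rep_objs \<Longrightarrow> 1\<^sub>m (dim_row X) \<in> rhom X X"
  by (simp add: rhom_def Hom_id)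

lemma rhom_comp: "g \<in> rhom Y Z \<Longrightarrow> f \<in> rhom X Y \<Longrightarrow> g * f \<in> rhom X Z"
  by (auto simp: rhom_def intro: Hom_comp)

lemma rhom_add: "f \<in> rhom X Y \<Longrightarrow> g \<in> rhom X Y \<Longrightarrow> f + g \<in> rhom X Y"
  by (auto simp: rhom_def intro: Hom_add)

lemma rhom_diff: "f \<in> rhom X Y \<Longrightarrow> g \<in> rhom X Y \<Longrightarrow> f - g \<in> rhom X Y"
  by (auto simp: rhom_def intro: Hom_diff)

lemma rhom_smult: "f \<in> rhom X Y \<Longrightarrow> a \<cdot>\<^sub>m f \<in> rhom X Y"
  by (auto simp: rhom_def intro: Hom_smult)

lemma rhom_zero: "X \<in> rep_objs \<Longrightarrow> Y \<in> rep_objs \<Longrightarrow> 0\<^sub>m (dim_row Y) (dim_row X) \<in> rhom X Y"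
  by (simp add: rhom_def Hom_zero)

lemma rhom_kron: "f \<in> rhom X X' \<Longrightarrow> g \<in> rhom Y Y' \<Longrightarrow> kron f g \<in> rhom (kron X Y) (kron X' Y')"
  by (auto simp: rhom_def intro: Hom_kron kron_obj)

lemma rhom_braid: "X \<in> rep_objs \<Longrightarrow> Y \<in> rep_objs \<Longrightarrow> braid X Y \<in> rhom (kron X Y) (kron Y X)"
  by (auto simp: rhom_def intro: braid_Hom kron_obj)

section \<open>Computing with classes through representatives\<close>

lemma negl_uminus:
  assumes "X \<in> rep_objs" "Y \<in> rep_objs" "f - g \<in> negl X Y" "f \<in> Hom X Y" "g \<in> Hom X Y"
  shows "g - f \<in> negl X Y"
proof -
  have "(-1) \<cdot>\<^sub>m (f - g) = g - f"
    by (rule eq_matI) (use assms(4,5) in \<open>auto simp: Hom_dims\<close>)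
  then show ?thesis using negl_smult [OF assms(1-3), of "-1"] by simp
qed

lemma negl_trans:
  assumes "X \<in> rep_objs" "Y \<in> rep_objs" "f - g \<in> negl X Y" "g - h \<in> negl X Y"
    "f \<in> Hom X Y" "g \<in> Hom X Y" "h \<in> Hom X Y"
  shows "f - h \<in> negl X Y"
proof -
  have "(f - g) + (g - h) = f - h"
    by (rule eq_matI) (use assms(5-7) in \<open>auto simp: Hom_dims\<close>)
  then show ?thesis using negl_add [OF assms(1-4)] by simp
qed

lemma mor_eq:
  assumes "f \<in> rhom X Y" "g \<in> rhom X Y"
  shows "mor X Y f = mor X Y g \<longleftrightarrow> f - g \<in> negl X Y"
proof -
  note o = rhomD(2,3) [OF assms(1)] and H = rhomD(1) [OF assms(1)] rhomD(1) [OF assms(2)]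
  have ff: "f - f \<in> negl X Y"
  proof -
    have "f - f = 0\<^sub>m (dim_row Y) (dim_row X)" using H by (intro eq_matI) (auto simp: Hom_dims)
    then show ?thesis using negl_zero [OF o] by simp
  qed
  show ?thesis
  proof
    assume "mor X Y f = mor X Y g"
    then have "f \<in> coset X Y g" using H ff by (auto simp: mor_def coset_def)
    then show "f - g \<in> negl X Y" by (simp add: coset_def)
  next
    assume "f - g \<in> negl X Y"
    moreover from this have "g - f \<in> negl X Y" by (rule negl_uminus [OF o _ H])
    ultimately show "mor X Y f = mor X Y g"
      using negl_trans [OF o] H by (auto simp: mor_def coset_def)
  qed
qed

lemma mor_eq_zero:
  assumes "f \<in> rhom X Y"
  shows "mor X Y f = mor X Y (0\<^sub>m (dim_row Y) (dim_row X)) \<longleftrightarrow> f \<in> negl X Y"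
proof -
  have "f - 0\<^sub>m (dim_row Y) (dim_row X) = f"
    by (rule eq_matI) (use assms in \<open>auto simp: rhom_dims\<close>)
  then show ?thesis using mor_eq [OF assms rhom_zero] rhomD [OF assms] by simp
qed

lemma repr_mor:
  assumes "f \<in> rhom X Y"
  shows "repr (mor X Y f) \<in> rhom X Y" "repr (mor X Y f) - f \<in> negl X Y"
proof -
  have "f \<in> coset X Y f" using mor_eq [OF assms assms] rhomD [OF assms] by (simp add: coset_def)
  then have "repr (mor X Y f) \<in> coset X Y f"
    using someI [of "\<lambda>f'. f' \<in> coset X Y f" f] by (simp add: repr_def mor_def)
  then show "repr (mor X Y f) \<in> rhom X Y" "repr (mor X Y f) - f \<in> negl X Y"
    using rhomD [OF assms] by (auto simp: coset_def rhom_def)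
qed

lemma ver_hom_iff: "m \<in> hom ver X Y \<longleftrightarrow> (\<exists>f \<in> rhom X Y. m = mor X Y f)"
  unfolding hom_def by (auto simp: mor_def ver_def)

lemma ver_homE:
  assumes "m \<in> hom ver X Y"
  obtains f where "f \<in> rhom X Y" "m = mor X Y f"
  using assms ver_hom_iff by blast

lemma ver_homI: "f \<in> rhom X Y \<Longrightarrow> mor X Y f \<in> hom ver X Y"
  using ver_hom_iff by blast

text \<open>\<open>g * f - g' * f' = g * (f - f') + (g - g') * f'\<close>, and negligible morphisms
  form an ideal. The tensor product is treated in the same way with
  \<open>negl_kron\<close>.\<close>

lemma mor_comp_cong:
  assumes "f \<in> rhom X Y" "f' \<in> rhom X Y" "g \<in> rhom Y Z" "g' \<in> rhom Y Z"
    and "mor X Y f = mor X Y f'" "mor Y Z g = mor Y Z g'"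
  shows "mor X Z (g * f) = mor X Z (g' * f')"
proof -
  note o = rhomD(2,3) [OF assms(1)] rhomD(3) [OF assms(3)] and H = assms(1-4) [THEN rhomD(1)]
  note d = assms(1-4) [THEN rhom_dims(1)] assms(1-4) [THEN rhom_dims(2)]
  have "g * (f - f') + (g - g') * f' \<in> negl X Z"
    by (intro negl_add [OF o(1,3)] negl_comp_left [OF o] negl_comp_right [OF o(2,3,1)] H)
      (use mor_eq assms in blast)+
  also have "g * (f - f') + (g - g') * f' = g * f - g' * f'"
    by (rule eq_matI) (simp_all add: mat_distribs d)
  finally show ?thesis using mor_eq rhom_comp assms by blast
qed

lemma ver_comp:
  assumes "g \<in> rhom Y Z" "f \<in> rhom X Y"
  shows "mor Y Z g \<cdot>\<^bsub>ver\<^esub> mor X Y f = mor X Z (g * f)"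
proof -
  have "mor Y Z g \<cdot>\<^bsub>ver\<^esub> mor X Y f = mor X Z (repr (mor Y Z g) * repr (mor X Y f))"
    by (simp add: ver_def) (simp add: mor_def)
  also have "\<dots> = mor X Z (g * f)"
    by (rule mor_comp_cong) (use assms repr_mor mor_eq in blast)+
  finally show ?thesis .
qed

lemma ver_add:
  assumes "f \<in> rhom X Y" "g \<in> rhom X Y"
  shows "mor X Y f \<boxplus>\<^bsub>ver\<^esub> mor X Y g = mor X Y (f + g)"
proof -
  let ?f = "repr (mor X Y f)" and ?g = "repr (mor X Y g)"
  note r = repr_mor [OF assms(1)] repr_mor [OF assms(2)]
  note d = rhom_dims [OF assms(1)] rhom_dims [OF assms(2)] rhom_dims [OF r(1)] rhom_dims [OF r(3)]
  have "(?f - f) + (?g - g) \<in> negl X Y" by (intro negl_add r rhomD [OF assms(1)])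
  also have "(?f - f) + (?g - g) = (?f + ?g) - (f + g)"
    by (rule eq_matI) (simp_all add: d)
  finally have "mor X Y (?f + ?g) = mor X Y (f + g)"
    using mor_eq rhom_add assms r by blast
  then show ?thesis by (simp add: ver_def) (simp add: mor_def)
qed

lemma ver_scale:
  assumes "f \<in> rhom X Y"
  shows "a \<star>\<^bsub>ver\<^esub> mor X Y f = mor X Y (a \<cdot>\<^sub>m f)"
proof -
  let ?f = "repr (mor X Y f)"
  note r = repr_mor [OF assms]
  note d = rhom_dims [OF assms(1)] rhom_dims [OF r(1)]
  have "a \<cdot>\<^sub>m (?f - f) \<in> negl X Y" by (intro negl_smult r rhomD [OF assms(1)])
  also have "a \<cdot>\<^sub>m (?f - f) = a \<cdot>\<^sub>m ?f - a \<cdot>\<^sub>m f"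
    by (rule eq_matI) (simp_all add: d algebra_simps)
  finally have "mor X Y (a \<cdot>\<^sub>m ?f) = mor X Y (a \<cdot>\<^sub>m f)"
    using mor_eq rhom_smult assms r by blast
  then show ?thesis by (simp add: ver_def) (simp add: mor_def)
qed

context
  fixes K :: "'k::field itself"
  assumes char: "CHAR('k) > 2"
begin

lemma two_nz: "(2::'k) \<noteq> 0"
proof
  assume "(2::'k) = 0"
  then have "of_nat 2 = (0::'k)" by simp
  then have "CHAR('k) dvd 2" using of_nat_eq_0_iff_char_dvd by blast
  then show False using char by (auto dest: dvd_imp_le)
qed

lemma char_pos: "CHAR('k) > 0" using char by simp

lemma ver_tensor:
  fixes X Y :: "'k mat"
  assumes "f \<in> rhom X X'" "g \<in> rhom Y Y'"
  shows "mor X X' f \<boxdot>\<^bsub>ver\<^esub> mor Y Y' g = mor (kron X Y) (kron X' Y') (kron f g)"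
proof -
  let ?f = "repr (mor X X' f)" and ?g = "repr (mor Y Y' g)"
  note r = repr_mor [OF assms(1)] repr_mor [OF assms(2)]
  note d = rhom_dims [OF assms(1)] rhom_dims [OF assms(2)] rhom_dims [OF r(1)] rhom_dims [OF r(3)]
  note o = rhomD(2,3) [OF assms(1)] rhomD(2,3) [OF assms(2)]
  have "kron (?f - f) ?g + kron f (?g - g) \<in> negl (kron X Y) (kron X' Y')"
    by (intro negl_add kron_obj negl_kron [OF o char_pos two_nz] o r rhomD(1) [OF assms(1)] rhomD(1) [OF r(3)])
  also have "kron (?f - f) ?g + kron f (?g - g) = kron ?f ?g - kron f g"
    by (rule eq_matI) (simp_all add: d kron_diff_left kron_diff_right)
  finally have "mor (kron X Y) (kron X' Y') (kron ?f ?g) = mor (kron X Y) (kron X' Y') (kron f g)"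
    using mor_eq rhom_kron assms r by blast
  then show ?thesis by (simp add: ver_def) (simp add: mor_def)
qed

section \<open>Linear and symmetric monoidal axioms\<close>

lemma ver_category: "tc_category (ver :: 'k small_tensor_cat)"
proof
  fix f :: "'k mat \<times> 'k mat \<times> 'k mat set" assume "f \<in> Mor ver"
  then show "Dom ver f \<in> Obj ver" "Cod ver f \<in> Obj ver" by (auto dest: rhomD)
next
  fix X :: "'k mat" assume "X \<in> Obj ver"
  then show "\<i>\<d>\<^bsub>ver\<^esub> X \<in> hom ver X X" by (auto intro: ver_homI rhom_id)
next
  fix f g and X Y Z :: "'k mat" assume "f \<in> hom ver X Y" "g \<in> hom ver Y Z"
  then show "g \<cdot>\<^bsub>ver\<^esub> f \<in> hom ver X Z"
    by (elim ver_homE) (auto simp: ver_comp intro: ver_homI rhom_comp)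
next
  fix f and X Y :: "'k mat" assume "f \<in> hom ver X Y"
  then show "\<i>\<d>\<^bsub>ver\<^esub> Y \<cdot>\<^bsub>ver\<^esub> f = f" "f \<cdot>\<^bsub>ver\<^esub> \<i>\<d>\<^bsub>ver\<^esub> X = f"
    by (elim ver_homE; simp add: ver_comp rhom_id rhomD rhom_dims)+
next
  fix f g h and W X Y Z :: "'k mat" assume "f \<in> hom ver W X" "g \<in> hom ver X Y" "h \<in> hom ver Y Z"
  then obtain f' g' h' where 1: "f' \<in> rhom W X" "g' \<in> rhom X Y" "h' \<in> rhom Y Z"
    and 2: "f = mor W X f'" "g = mor X Y g'" "h = mor Y Z h'" by (meson ver_homE)
  show "(h \<cdot>\<^bsub>ver\<^esub> g) \<cdot>\<^bsub>ver\<^esub> f = h \<cdot>\<^bsub>ver\<^esub> (g \<cdot>\<^bsub>ver\<^esub> f)"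
    unfolding 2 ver_comp [OF 1(2,1)] ver_comp [OF 1(3,2)] ver_comp [OF 1(3) rhom_comp [OF 1(2,1)]]
      ver_comp [OF rhom_comp [OF 1(3,2)] 1(1)]
    using 1 by (simp add: mat_mult_assoc rhom_dims)
qed

lemma ver_linear: "tc_linear (ver :: 'k small_tensor_cat)"
proof -
  interpret tc_category "ver :: 'k small_tensor_cat" by (rule ver_category)
  show ?thesis
  proof
    fix X Y :: "'k mat"
    show "\<z>\<^bsub>ver\<^esub> X Y \<in> hom ver X Y" if "X \<in> Obj ver" "Y \<in> Obj ver"
      using that by (auto intro!: ver_homI rhom_zero)
    fix f assume "f \<in> hom ver X Y"
    then obtain f' where f': "f' \<in> rhom X Y" and f: "f = mor X Y f'" by (rule ver_homE)
    note df = rhom_dims [OF f']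
    show "a \<star>\<^bsub>ver\<^esub> f \<in> hom ver X Y" for a
      unfolding f ver_scale [OF f'] by (intro ver_homI rhom_smult f')
    show "f \<boxplus>\<^bsub>ver\<^esub> \<z>\<^bsub>ver\<^esub> X Y = f"
      unfolding f ver_sel ver_add [OF f' rhom_zero [OF rhomD(2,3) [OF f']]] by (simp add: df)
    show "\<exists>g\<in>hom ver X Y. f \<boxplus>\<^bsub>ver\<^esub> g = \<z>\<^bsub>ver\<^esub> X Y"
    proof
      have n: "(-1) \<cdot>\<^sub>m f' \<in> rhom X Y" by (rule rhom_smult [OF f'])
      show "mor X Y ((-1) \<cdot>\<^sub>m f') \<in> hom ver X Y" by (rule ver_homI [OF n])
      have "f' + (-1) \<cdot>\<^sub>m f' = 0\<^sub>m (dim_row Y) (dim_row X)" by (rule eq_matI) (simp_all add: df)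
      then show "f \<boxplus>\<^bsub>ver\<^esub> mor X Y ((-1) \<cdot>\<^sub>m f') = \<z>\<^bsub>ver\<^esub> X Y"
        unfolding f ver_add [OF f' n] by simp
    qed
    show "1 \<star>\<^bsub>ver\<^esub> f = f"
      unfolding f ver_scale [OF f'] by (simp add: mat_one_smult)
    show "a \<star>\<^bsub>ver\<^esub> (b \<star>\<^bsub>ver\<^esub> f) = (a * b) \<star>\<^bsub>ver\<^esub> f" for a b
      unfolding f ver_scale [OF f'] ver_scale [OF rhom_smult [OF f']] by (simp add: mat_smult_smult)
    show "(a + b) \<star>\<^bsub>ver\<^esub> f = (a \<star>\<^bsub>ver\<^esub> f) \<boxplus>\<^bsub>ver\<^esub> (b \<star>\<^bsub>ver\<^esub> f)" for a b
      unfolding f ver_scale [OF f'] ver_add [OF rhom_smult [OF f'] rhom_smult [OF f']] by (simp add: mat_add_smult)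
    fix g assume "g \<in> hom ver X Y"
    then obtain g' where g': "g' \<in> rhom X Y" and g: "g = mor X Y g'" by (rule ver_homE)
    note dg = rhom_dims [OF g']
    show "f \<boxplus>\<^bsub>ver\<^esub> g \<in> hom ver X Y"
      unfolding f g ver_add [OF f' g'] by (intro ver_homI rhom_add f' g')
    show "f \<boxplus>\<^bsub>ver\<^esub> g = g \<boxplus>\<^bsub>ver\<^esub> f"
      unfolding f g ver_add [OF f' g'] ver_add [OF g' f']
      by (rule arg_cong [of _ _ "mor X Y"], rule eq_matI) (simp_all add: df dg)
    show "a \<star>\<^bsub>ver\<^esub> (f \<boxplus>\<^bsub>ver\<^esub> g) = (a \<star>\<^bsub>ver\<^esub> f) \<boxplus>\<^bsub>ver\<^esub> (a \<star>\<^bsub>ver\<^esub> g)" for a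
      unfolding f g ver_add [OF f' g'] ver_scale [OF f'] ver_scale [OF g'] ver_scale [OF rhom_add [OF f' g']]
        ver_add [OF rhom_smult [OF f'] rhom_smult [OF g']]
      by (simp add: mat_smult_add df dg)
    show "(f \<boxplus>\<^bsub>ver\<^esub> g) \<boxplus>\<^bsub>ver\<^esub> h = f \<boxplus>\<^bsub>ver\<^esub> (g \<boxplus>\<^bsub>ver\<^esub> h)" if "h \<in> hom ver X Y" for h
    proof -
      obtain h' where h': "h' \<in> rhom X Y" and h: "h = mor X Y h'" using \<open>h \<in> hom ver X Y\<close> by (rule ver_homE)
      show ?thesis
        unfolding f g h ver_add [OF f' g'] ver_add [OF g' h'] ver_add [OF rhom_add [OF f' g'] h'] ver_add [OF f' rhom_add [OF g' h']]
        by (rule arg_cong [of _ _ "mor X Y"], rule eq_matI) (simp_all add: df dg rhom_dims [OF h'])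
    qed
  next
    fix X Y Z :: "'k mat" and f g h a
    assume "f \<in> hom ver X Y" "g \<in> hom ver Y Z" "h \<in> hom ver Y Z"
    then obtain f' g' h' where 1: "f' \<in> rhom X Y" "g' \<in> rhom Y Z" "h' \<in> rhom Y Z"
      and 2: "f = mor X Y f'" "g = mor Y Z g'" "h = mor Y Z h'" by (meson ver_homE)
    show "(g \<boxplus>\<^bsub>ver\<^esub> h) \<cdot>\<^bsub>ver\<^esub> f = (g \<cdot>\<^bsub>ver\<^esub> f) \<boxplus>\<^bsub>ver\<^esub> (h \<cdot>\<^bsub>ver\<^esub> f)"
      unfolding 2 ver_add [OF 1(2,3)] ver_comp [OF 1(2,1)] ver_comp [OF 1(3,1)] ver_comp [OF rhom_add [OF 1(2,3)] 1(1)]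
        ver_add [OF rhom_comp [OF 1(2,1)] rhom_comp [OF 1(3,1)]]
      using 1 by (simp add: mat_distribs rhom_dims)
  next
    fix X Y Z :: "'k mat" and f g h a
    assume "f \<in> hom ver X Y" "g \<in> hom ver X Y" "h \<in> hom ver Y Z"
    then obtain f' g' h' where 1: "f' \<in> rhom X Y" "g' \<in> rhom X Y" "h' \<in> rhom Y Z"
      and 2: "f = mor X Y f'" "g = mor X Y g'" "h = mor Y Z h'" by (meson ver_homE)
    show "h \<cdot>\<^bsub>ver\<^esub> (f \<boxplus>\<^bsub>ver\<^esub> g) = (h \<cdot>\<^bsub>ver\<^esub> f) \<boxplus>\<^bsub>ver\<^esub> (h \<cdot>\<^bsub>ver\<^esub> g)"
      unfolding 2 ver_add [OF 1(1,2)] ver_comp [OF 1(3,1)] ver_comp [OF 1(3,2)] ver_comp [OF 1(3) rhom_add [OF 1(1,2)]]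
        ver_add [OF rhom_comp [OF 1(3,1)] rhom_comp [OF 1(3,2)]]
      using 1 by (simp add: mat_distribs rhom_dims)
  next
    fix X Y Z :: "'k mat" and f g a
    assume "f \<in> hom ver X Y" "g \<in> hom ver Y Z"
    then obtain f' g' where 1: "f' \<in> rhom X Y" "g' \<in> rhom Y Z"
      and 2: "f = mor X Y f'" "g = mor Y Z g'" by (meson ver_homE)
    show "(a \<star>\<^bsub>ver\<^esub> g) \<cdot>\<^bsub>ver\<^esub> f = a \<star>\<^bsub>ver\<^esub> (g \<cdot>\<^bsub>ver\<^esub> f)" "g \<cdot>\<^bsub>ver\<^esub> (a \<star>\<^bsub>ver\<^esub> f) = a \<star>\<^bsub>ver\<^esub> (g \<cdot>\<^bsub>ver\<^esub> f)"
      unfolding 2 ver_scale [OF 1(1)] ver_scale [OF 1(2)] ver_comp [OF 1(2,1)] ver_scale [OF rhom_comp [OF 1(2,1)]]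
        ver_comp [OF rhom_smult [OF 1(2)] 1(1)] ver_comp [OF 1(2) rhom_smult [OF 1(1)]]
      using 1 by (simp_all add: mat_distribs rhom_dims)
  qed
qed

lemma ver_monoidal: "tc_monoidal (ver :: 'k small_tensor_cat)"
proof -
  interpret tc_category "ver :: 'k small_tensor_cat" by (rule ver_category)
  have iso_id: "iso_mor ver (mor X X (1\<^sub>m (dim_row X)))" if "X \<in> rep_objs" for X :: "'k mat"
    unfolding iso_mor_def inverse_pair_def
    by (rule exI [of _ "mor X X (1\<^sub>m (dim_row X))"])
      (use that hom_dom(3) [OF ver_homI [OF rhom_id [OF that]]] in \<open>auto simp: ver_comp rhom_id intro!: ver_homI\<close>)
  have dk: "dim_row X * (dim_row Y * dim_row Z) = dim_row (kron X (kron Y Z))" for X Y Z :: "'k mat" by simp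
  show ?thesis
  proof
    show "\<I>\<^bsub>ver\<^esub> \<in> Obj (ver :: 'k small_tensor_cat)" by (simp add: rep_unit_obj)
    fix X Y :: "'k mat" assume XY: "X \<in> Obj ver" "Y \<in> Obj ver"
    then show "X \<boxtimes>\<^bsub>ver\<^esub> Y \<in> Obj ver" by (simp add: kron_obj)
    show "\<i>\<d>\<^bsub>ver\<^esub> X \<boxdot>\<^bsub>ver\<^esub> \<i>\<d>\<^bsub>ver\<^esub> Y = \<i>\<d>\<^bsub>ver\<^esub> (X \<boxtimes>\<^bsub>ver\<^esub> Y)"
      using XY by (simp add: ver_tensor rhom_id kron_one)
    show "(\<i>\<d>\<^bsub>ver\<^esub> X \<boxdot>\<^bsub>ver\<^esub> LUnit ver Y) \<cdot>\<^bsub>ver\<^esub> Assoc ver X \<I>\<^bsub>ver\<^esub> Y = RUnit ver X \<boxdot>\<^bsub>ver\<^esub> \<i>\<d>\<^bsub>ver\<^esub> Y"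
      using XY ver_comp [OF rhom_id rhom_id, of "kron X Y"] by (simp add: ver_tensor rhom_id kron_one kron_obj)
    show "LUnit ver X \<in> hom ver (\<I>\<^bsub>ver\<^esub> \<boxtimes>\<^bsub>ver\<^esub> X) X" "RUnit ver X \<in> hom ver (X \<boxtimes>\<^bsub>ver\<^esub> \<I>\<^bsub>ver\<^esub>) X"
      using XY by (auto intro!: ver_homI rhom_id)
    show "iso_mor ver (LUnit ver X)" "iso_mor ver (RUnit ver X)"
      using XY iso_id by simp_all
    fix Z :: "'k mat" assume Z: "Z \<in> Obj ver"
    have o: "kron X (kron Y Z) \<in> rep_objs" using XY Z by (simp add: kron_obj)
    show "Assoc ver X Y Z \<in> hom ver ((X \<boxtimes>\<^bsub>ver\<^esub> Y) \<boxtimes>\<^bsub>ver\<^esub> Z) (X \<boxtimes>\<^bsub>ver\<^esub> (Y \<boxtimes>\<^bsub>ver\<^esub> Z))"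
      using rhom_id [OF o] by (auto simp: kron_assoc intro!: ver_homI)
    show "iso_mor ver (Assoc ver X Y Z)"
      using iso_id [OF o] by simp
    fix W :: "'k mat" assume W: "W \<in> Obj ver"
    have o4: "kron W (kron X (kron Y Z)) \<in> rep_objs" using XY Z W by (simp add: kron_obj)
    show "(\<i>\<d>\<^bsub>ver\<^esub> W \<boxdot>\<^bsub>ver\<^esub> Assoc ver X Y Z) \<cdot>\<^bsub>ver\<^esub> Assoc ver W (X \<boxtimes>\<^bsub>ver\<^esub> Y) Z \<cdot>\<^bsub>ver\<^esub> (Assoc ver W X Y \<boxdot>\<^bsub>ver\<^esub> \<i>\<d>\<^bsub>ver\<^esub> Z) =
      Assoc ver W X (Y \<boxtimes>\<^bsub>ver\<^esub> Z) \<cdot>\<^bsub>ver\<^esub> Assoc ver (W \<boxtimes>\<^bsub>ver\<^esub> X) Y Z"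
    proof -
      have oW: "kron W (kron X Y) \<in> rep_objs" using XY W by (simp add: kron_obj)
      let ?O = "kron W (kron X (kron Y Z))"
      let ?I = "mor ?O ?O (1\<^sub>m (dim_row ?O))"
      have 1: "\<i>\<d>\<^bsub>ver\<^esub> W \<boxdot>\<^bsub>ver\<^esub> Assoc ver X Y Z = ?I"
        using ver_tensor [OF rhom_id rhom_id [OF o], of W] W by (simp add: kron_one)
      have 2: "Assoc ver W X Y \<boxdot>\<^bsub>ver\<^esub> \<i>\<d>\<^bsub>ver\<^esub> Z = ?I"
        using ver_tensor [OF rhom_id [OF oW] rhom_id, of Z] Z by (simp add: kron_one kron_assoc mult.assoc)
      have 3: "Assoc ver W (X \<boxtimes>\<^bsub>ver\<^esub> Y) Z = ?I" "Assoc ver W X (Y \<boxtimes>\<^bsub>ver\<^esub> Z) = ?I" "Assoc ver (W \<boxtimes>\<^bsub>ver\<^esub> X) Y Z = ?I"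
        by (simp_all add: kron_assoc mult.assoc)
      have 4: "?I \<cdot>\<^bsub>ver\<^esub> ?I = ?I" using ver_comp [OF rhom_id [OF o4] rhom_id [OF o4]] by simp
      show ?thesis unfolding 1 2 3 4 ..
    qed
  next
    fix f g and X X' Y Y' :: "'k mat"
    assume "f \<in> hom ver X X'" "g \<in> hom ver Y Y'"
    then show "f \<boxdot>\<^bsub>ver\<^esub> g \<in> hom ver (X \<boxtimes>\<^bsub>ver\<^esub> Y) (X' \<boxtimes>\<^bsub>ver\<^esub> Y')"
      by (elim ver_homE) (auto simp: ver_tensor intro!: ver_homI rhom_kron)
  next
    fix f f' g g' and X X' X'' Y Y' Y'' :: "'k mat"
    assume "f \<in> hom ver X X'" "f' \<in> hom ver X' X''" "g \<in> hom ver Y Y'" "g' \<in> hom ver Y' Y''"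
    then obtain a a' b b' where 1: "a \<in> rhom X X'" "a' \<in> rhom X' X''" "b \<in> rhom Y Y'" "b' \<in> rhom Y' Y''"
      and 2: "f = mor X X' a" "f' = mor X' X'' a'" "g = mor Y Y' b" "g' = mor Y' Y'' b'" by (meson ver_homE)
    show "(f' \<cdot>\<^bsub>ver\<^esub> f) \<boxdot>\<^bsub>ver\<^esub> (g' \<cdot>\<^bsub>ver\<^esub> g) = (f' \<boxdot>\<^bsub>ver\<^esub> g') \<cdot>\<^bsub>ver\<^esub> (f \<boxdot>\<^bsub>ver\<^esub> g)"
      unfolding 2 ver_comp [OF 1(2,1)] ver_comp [OF 1(4,3)] ver_tensor [OF 1(1,3)] ver_tensor [OF 1(2,4)]
        ver_tensor [OF rhom_comp [OF 1(2,1)] rhom_comp [OF 1(4,3)]] ver_comp [OF rhom_kron [OF 1(2,4)] rhom_kron [OF 1(1,3)]]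
      using 1 by (simp add: kron_mult rhom_dims)
  next
    fix f g h and X X' Y Y' Z Z' :: "'k mat"
    assume "f \<in> hom ver X X'" "g \<in> hom ver Y Y'" "h \<in> hom ver Z Z'"
    then obtain a b c where 1: "a \<in> rhom X X'" "b \<in> rhom Y Y'" "c \<in> rhom Z Z'"
      and 2: "f = mor X X' a" "g = mor Y Y' b" "h = mor Z Z' c" by (meson ver_homE)
    note k = rhom_kron [OF 1(1) rhom_kron [OF 1(2,3)]]
    have i: "1\<^sub>m (dim_row V * (dim_row V' * dim_row V'')) \<in> rhom (kron V (kron V' V'')) (kron V (kron V' V''))"
      if "V \<in> rep_objs" "V' \<in> rep_objs" "V'' \<in> rep_objs" for V V' V'' :: "'k mat"
      using rhom_id [of "kron V (kron V' V'')"] that by (simp add: kron_obj)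
    note i1 = i [OF rhomD(2) [OF 1(1)] rhomD(2) [OF 1(2)] rhomD(2) [OF 1(3)]]
    note i2 = i [OF rhomD(3) [OF 1(1)] rhomD(3) [OF 1(2)] rhomD(3) [OF 1(3)]]
    show "Assoc ver X' Y' Z' \<cdot>\<^bsub>ver\<^esub> ((f \<boxdot>\<^bsub>ver\<^esub> g) \<boxdot>\<^bsub>ver\<^esub> h) = (f \<boxdot>\<^bsub>ver\<^esub> (g \<boxdot>\<^bsub>ver\<^esub> h)) \<cdot>\<^bsub>ver\<^esub> Assoc ver X Y Z"
      unfolding 2 ver_tensor [OF 1(1,2)] ver_tensor [OF 1(2,3)] ver_tensor [OF 1(1) rhom_kron [OF 1(2,3)]]
        ver_tensor [OF rhom_kron [OF 1(1,2)] 1(3)] ver_sel kron_assoc ver_comp [OF k i1] ver_comp [OF i2 k]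
      using 1 by (simp add: rhom_dims)
  next
    fix f and X Y :: "'k mat"
    assume "f \<in> hom ver X Y"
    then obtain a where 1: "a \<in> rhom X Y" and 2: "f = mor X Y a" by (meson ver_homE)
    note i = rhom_id [OF rhomD(2) [OF 1]] rhom_id [OF rhomD(3) [OF 1]]
    have i1: "1\<^sub>m (Suc 0) \<in> rhom (1\<^sub>m (Suc 0)) (1\<^sub>m (Suc 0) :: 'k mat)"
      using rhom_id [OF rep_unit_obj] by simp
    show "LUnit ver Y \<cdot>\<^bsub>ver\<^esub> (\<i>\<d>\<^bsub>ver\<^esub> \<I>\<^bsub>ver\<^esub> \<boxdot>\<^bsub>ver\<^esub> f) = f \<cdot>\<^bsub>ver\<^esub> LUnit ver X"
      "RUnit ver Y \<cdot>\<^bsub>ver\<^esub> (f \<boxdot>\<^bsub>ver\<^esub> \<i>\<d>\<^bsub>ver\<^esub> \<I>\<^bsub>ver\<^esub>) = f \<cdot>\<^bsub>ver\<^esub> RUnit ver X"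
      using 1 i i1 unfolding 2 by (simp_all add: ver_tensor ver_comp rhom_dims)
  qed
qed

lemma ver_symmetric_monoidal: "tc_symmetric_monoidal (ver :: 'k small_tensor_cat)"
proof -
  interpret tc_monoidal "ver :: 'k small_tensor_cat" by (rule ver_monoidal)
  show ?thesis
  proof
    fix X Y :: "'k mat" assume XY: "X \<in> Obj ver" "Y \<in> Obj ver"
    then have o: "X \<in> rep_objs" "Y \<in> rep_objs" by simp_all
    show "Braid ver X Y \<in> hom ver (X \<boxtimes>\<^bsub>ver\<^esub> Y) (Y \<boxtimes>\<^bsub>ver\<^esub> X)"
      using o by (auto intro!: ver_homI rhom_braid)
    show "Braid ver Y X \<cdot>\<^bsub>ver\<^esub> Braid ver X Y = \<i>\<d>\<^bsub>ver\<^esub> (X \<boxtimes>\<^bsub>ver\<^esub> Y)"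
      using o braid_symmetric [OF o two_nz] by (simp add: ver_comp rhom_braid)
    fix Z :: "'k mat" assume Z: "Z \<in> Obj ver"
    then have oZ: "Z \<in> rep_objs" by simp
    show "Assoc ver Y Z X \<cdot>\<^bsub>ver\<^esub> Braid ver X (Y \<boxtimes>\<^bsub>ver\<^esub> Z) \<cdot>\<^bsub>ver\<^esub> Assoc ver X Y Z =
      (\<i>\<d>\<^bsub>ver\<^esub> Y \<boxdot>\<^bsub>ver\<^esub> Braid ver X Z) \<cdot>\<^bsub>ver\<^esub> Assoc ver Y X Z \<cdot>\<^bsub>ver\<^esub> (Braid ver X Y \<boxdot>\<^bsub>ver\<^esub> \<i>\<d>\<^bsub>ver\<^esub> Z)"
    proof -
      let ?O = "\<lambda>U V W. kron U (kron V W)"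
      have oo: "?O X Y Z \<in> rep_objs" "?O Y Z X \<in> rep_objs" "?O Y X Z \<in> rep_objs"
        using o oZ by (simp_all add: kron_obj)
      have i: "1\<^sub>m (dim_row X * (dim_row Y * dim_row Z)) \<in> rhom (?O X Y Z) (?O X Y Z)"
        "1\<^sub>m (dim_row Y * (dim_row Z * dim_row X)) \<in> rhom (?O Y Z X) (?O Y Z X)"
        "1\<^sub>m (dim_row Y * (dim_row X * dim_row Z)) \<in> rhom (?O Y X Z) (?O Y X Z)"
        using rhom_id [OF oo(1)] rhom_id [OF oo(2)] rhom_id [OF oo(3)] by simp_all
      have b: "braid X (kron Y Z) \<in> rhom (?O X Y Z) (?O Y Z X)"
        using rhom_braid [of X "kron Y Z"] o oZ by (simp add: kron_obj kron_assoc)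
      have b1: "kron (1\<^sub>m (dim_row Y)) (braid X Z) \<in> rhom (?O Y X Z) (?O Y Z X)"
        using rhom_kron [OF rhom_id rhom_braid] o oZ by blast
      have b2: "kron (braid X Y) (1\<^sub>m (dim_row Z)) \<in> rhom (?O X Y Z) (?O Y X Z)"
        using rhom_kron [OF rhom_braid rhom_id, of X Y Z] o oZ by (simp add: kron_assoc)
      have t1: "\<i>\<d>\<^bsub>ver\<^esub> Y \<boxdot>\<^bsub>ver\<^esub> Braid ver X Z = mor (?O Y X Z) (?O Y Z X) (kron (1\<^sub>m (dim_row Y)) (braid X Z))"
        using o oZ by (simp add: ver_tensor rhom_id rhom_braid)
      have t2: "Braid ver X Y \<boxdot>\<^bsub>ver\<^esub> \<i>\<d>\<^bsub>ver\<^esub> Z = mor (?O X Y Z) (?O Y X Z) (kron (braid X Y) (1\<^sub>m (dim_row Z)))"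
        using o oZ by (simp add: ver_tensor rhom_id rhom_braid kron_assoc)
      show ?thesis
        unfolding t1 t2 unfolding ver_sel kron_assoc ver_comp [OF b i(1)] ver_comp [OF i(2) rhom_comp [OF b i(1)]]
          ver_comp [OF i(3) b2] ver_comp [OF b1 rhom_comp [OF i(3) b2]]
        using o oZ by (simp add: braid_hexagon two_nz mult_ac)
    qed
  next
    fix f g and X X' Y Y' :: "'k mat"
    assume "f \<in> hom ver X X'" "g \<in> hom ver Y Y'"
    then obtain a b where 1: "a \<in> rhom X X'" "b \<in> rhom Y Y'" and 2: "f = mor X X' a" "g = mor Y Y' b"
      by (meson ver_homE)
    note o = rhomD(2,3) [OF 1(1)] rhomD(2,3) [OF 1(2)]
    show "Braid ver X' Y' \<cdot>\<^bsub>ver\<^esub> (f \<boxdot>\<^bsub>ver\<^esub> g) = (g \<boxdot>\<^bsub>ver\<^esub> f) \<cdot>\<^bsub>ver\<^esub> Braid ver X Y"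
      unfolding 2 ver_sel ver_tensor [OF 1] ver_tensor [OF 1(2,1)]
        ver_comp [OF rhom_braid [OF o(2,4)] rhom_kron [OF 1]] ver_comp [OF rhom_kron [OF 1(2,1)] rhom_braid [OF o(1,3)]]
      using braid_natural [OF o(1,3,2,4) rhomD(1) [OF 1(1)] rhomD(1) [OF 1(2)]] by simp
  qed
qed

end

subsection \<open>Direct sums, kernels and cokernels\<close>

definition incl1 :: "nat \<Rightarrow> nat \<Rightarrow> 'a::zero_neq_one mat" where
  "incl1 m n = mat (m + n) m (\<lambda>(i,j). if i = j then 1 else 0)"

definition incl2 :: "nat \<Rightarrow> nat \<Rightarrow> 'a::zero_neq_one mat" where
  "incl2 m n = mat (m + n) n (\<lambda>(i,j). if i = m + j then 1 else 0)"

lemma dim_incl [simp]: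
  "dim_row (incl1 m n) = m + n" "dim_col (incl1 m n) = m" "dim_row (incl2 m n) = m + n" "dim_col (incl2 m n) = n"
  by (simp_all add: incl1_def incl2_def)

lemma incl_rules:
  fixes m n :: nat
  defines "i1 \<equiv> (incl1 m n :: 'a::semiring_1 mat)" and "i2 \<equiv> (incl2 m n :: 'a mat)"
  shows "transpose_mat i1 * i1 = 1\<^sub>m m" "transpose_mat i2 * i2 = 1\<^sub>m n"
    "transpose_mat i1 * i2 = 0\<^sub>m m n" "transpose_mat i2 * i1 = 0\<^sub>m n m"
    "i1 * transpose_mat i1 + i2 * transpose_mat i2 = 1\<^sub>m (m + n)"
proof -
  have s: "(\<Sum>k<m+n. (if k = a then 1 else 0) * (if k = b then 1 else 0)) = (if a = b then 1 else (0::'a))"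
    if "a < m + n" for a b
  proof -
    have "(\<Sum>k<m+n. (if k = a then 1 else 0) * (if k = b then 1 else (0::'a))) = (\<Sum>k<m+n. if k = a then (if a = b then 1 else 0) else 0)"
      by (rule sum.cong) auto
    then show ?thesis using that by simp
  qed
  show "transpose_mat i1 * i1 = 1\<^sub>m m" "transpose_mat i2 * i2 = 1\<^sub>m n"
    "transpose_mat i1 * i2 = 0\<^sub>m m n" "transpose_mat i2 * i1 = 0\<^sub>m n m"
    by (rule eq_matI; simp add: i1_def i2_def index_mult_sum; simp add: incl1_def incl2_def s)+
  have t: "(\<Sum>k<l. (if i = f k then 1 else 0) * (if j = f k then 1 else 0)) = (if i = j \<and> i \<in> f ` {..<l} then 1 else (0::'a))"
    if "inj f" for i j l :: nat and f :: "nat \<Rightarrow> nat"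
  proof -
    have "(\<Sum>k<l. (if i = f k then 1 else 0) * (if j = f k then 1 else (0::'a))) = (\<Sum>k<l. if i = f k \<and> i = j then 1 else 0)"
      by (rule sum.cong) auto
    also have "\<dots> = of_nat (card ({..<l} \<inter> {k. i = f k \<and> i = j}))"
      by (simp add: sum.If_cases)
    also have "\<dots> = (if i = j \<and> i \<in> f ` {..<l} then 1 else 0)"
    proof (cases "i = j \<and> i \<in> f ` {..<l}")
      case True
      then obtain k where "k < l" "i = f k" "i = j" by auto
      then have "{..<l} \<inter> {k. i = f k \<and> i = j} = {k}" using that by (auto dest: injD)
      then show ?thesis using True by auto
    next
      case False
      then have "{..<l} \<inter> {k. i = f k \<and> i = j} = {}" by auto
      then show ?thesis using False by simp
    qed
    finally show ?thesis .
  qed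
  show "i1 * transpose_mat i1 + i2 * transpose_mat i2 = 1\<^sub>m (m + n)"
  proof (rule eq_matI)
    fix i j assume "i < dim_row (1\<^sub>m (m + n) :: 'a mat)" "j < dim_col (1\<^sub>m (m + n) :: 'a mat)"
    then have i: "i < m + n" and j: "j < m + n" by auto
    have "(i1 * transpose_mat i1) $$ (i,j) = (\<Sum>k<m. (if i = k then 1 else 0) * (if j = k then 1 else 0))"
      using i j by (subst index_mult_sum) (simp_all add: i1_def incl1_def)
    also have "\<dots> = (if i = j \<and> i < m then 1 else 0)" using t [where f = id and i = i and j = j and l = m] by (simp add: image_iff)
    finally have 1: "(i1 * transpose_mat i1) $$ (i,j) = (if i = j \<and> i < m then 1 else 0)" .
    have "(i2 * transpose_mat i2) $$ (i,j) = (\<Sum>k<n. (if i = m + k then 1 else 0) * (if j = m + k then 1 else 0))"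
      using i j by (subst index_mult_sum) (simp_all add: i2_def incl2_def)
    also have "\<dots> = (if i = j \<and> i \<in> (\<lambda>k. m + k) ` {..<n} then 1 else 0)" by (rule t) (simp add: inj_def)
    also have "i \<in> (\<lambda>k. m + k) ` {..<n} \<longleftrightarrow> m \<le> i"
      using i by (auto simp: image_iff intro: bexI [of _ "i - m"])
    finally have 2: "(i2 * transpose_mat i2) $$ (i,j) = (if i = j \<and> m \<le> i then 1 else 0)" .
    show "(i1 * transpose_mat i1 + i2 * transpose_mat i2) $$ (i,j) = 1\<^sub>m (m + n) $$ (i,j)"
      using i j 1 2 by (simp add: i1_def i2_def)
  qed (simp_all add: i1_def i2_def)
qed

lemma rep_direct_sum:
  fixes X Y :: "'k::field mat"
  assumes X: "X \<in> rep_objs" and Y: "Y \<in> rep_objs"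
  obtains P i1 i2 p1 p2 where "i1 \<in> rhom X P" "i2 \<in> rhom Y P" "p1 \<in> rhom P X" "p2 \<in> rhom P Y"
    "p1 * i1 = 1\<^sub>m (dim_row X)" "p2 * i2 = 1\<^sub>m (dim_row Y)"
    "p1 * i2 = 0\<^sub>m (dim_row X) (dim_row Y)" "p2 * i1 = 0\<^sub>m (dim_row Y) (dim_row X)"
    "i1 * p1 + i2 * p2 = 1\<^sub>m (dim_row P)"
proof -
  let ?m = "dim_row X" and ?n = "dim_row Y"
  obtain i1 i2 p1 p2 :: "'k mat" where ip: "i1 = incl1 ?m ?n" "i2 = incl2 ?m ?n"
    "p1 = transpose_mat (incl1 ?m ?n)" "p2 = transpose_mat (incl2 ?m ?n)" by blast
  have r: "p1 * i1 = 1\<^sub>m ?m" "p2 * i2 = 1\<^sub>m ?n" "p1 * i2 = 0\<^sub>m ?m ?n" "p2 * i1 = 0\<^sub>m ?n ?m"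
    "i1 * p1 + i2 * p2 = 1\<^sub>m (?m + ?n)"
    unfolding ip by (rule incl_rules)+
  have d: "dim_row i1 = ?m + ?n" "dim_col i1 = ?m" "dim_row i2 = ?m + ?n" "dim_col i2 = ?n"
    "dim_row p1 = ?m" "dim_col p1 = ?m + ?n" "dim_row p2 = ?n" "dim_col p2 = ?m + ?n"
    "dim_col X = ?m" "dim_col Y = ?n"
    unfolding ip using X Y by (simp_all add: rep_obj_dims)
  note r' = mat_mult_cancel [OF r(1)] mat_mult_cancel [OF r(2)] mat_mult_cancel [OF r(3)] mat_mult_cancel [OF r(4)]
  define P where "P = i1 * (X * p1) + i2 * (Y * p2)"
  have dP: "dim_row P = ?m + ?n" "dim_col P = ?m + ?n" by (simp_all add: P_def d)
  have 1: "i1 * X = P * i1" "i2 * Y = P * i2" "p1 * P = X * p1" "p2 * P = Y * p2"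
    unfolding P_def by (simp_all add: mat_distribs d r r')
  have Pc: "P \<in> carrier_mat (?m + ?n) (?m + ?n)" using dP by auto
  have ic: "i1 \<in> carrier_mat (?m + ?n) ?m" "i2 \<in> carrier_mat (?m + ?n) ?n" using d by auto
  \<comment> \<open>The order of the block sum is tested on the two inclusions, which together
    recover the identity.\<close>
  have Pk: "P ^\<^sub>m (2 * CHAR('k)) * i1 = i1" "P ^\<^sub>m (2 * CHAR('k)) * i2 = i2"
    using pow_mat_intertwine [OF rep_obj_carrier [OF X] Pc ic(1) 1(1), of "2 * CHAR('k)"]
      pow_mat_intertwine [OF rep_obj_carrier [OF Y] Pc ic(2) 1(2), of "2 * CHAR('k)"] X Y
    by (simp_all add: rep_objs_def d)
  have "P ^\<^sub>m (2 * CHAR('k)) = P ^\<^sub>m (2 * CHAR('k)) * (i1 * p1 + i2 * p2)"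
    unfolding r(5) using right_mult_one_mat [OF pow_carrier_mat [OF Pc]] by simp
  also have "\<dots> = P ^\<^sub>m (2 * CHAR('k)) * i1 * p1 + P ^\<^sub>m (2 * CHAR('k)) * i2 * p2"
    by (simp add: mat_distribs d dP)
  finally have "P ^\<^sub>m (2 * CHAR('k)) = 1\<^sub>m (?m + ?n)" unfolding Pk r(5) .
  then have P: "P \<in> rep_objs" by (simp add: rep_objs_def dP)
  have "i1 \<in> rhom X P" "i2 \<in> rhom Y P" "p1 \<in> rhom P X" "p2 \<in> rhom P Y"
    using 1 by (auto intro!: rhomI HomI X Y P simp: d dP)
  then show ?thesis using that r dP by metis
qed

context
  fixes K :: "'k::field itself"
  assumes char: "CHAR('k) > 2"
begin

text \<open>Through this criterion a representation of positive dimension can become a zero object;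
  the unipotent block of size \<open>p\<close> will be the decisive case.\<close>

lemma ver_zero_iff: "X \<in> rep_objs \<Longrightarrow> zero_obj ver X \<longleftrightarrow> 1\<^sub>m (dim_row X) \<in> negl X X"
  for X :: "'k mat"
proof
  assume X: "X \<in> rep_objs" and z: "zero_obj ver X"
  then have "mor X X (1\<^sub>m (dim_row X)) = mor X X (0\<^sub>m (dim_row X) (dim_row X))"
    using ver_homI rhom_id rhom_zero unfolding zero_obj_def by (metis ver_sel(1))
  then show "1\<^sub>m (dim_row X) \<in> negl X X" using mor_eq_zero rhom_id X by blast
next
  assume X: "X \<in> rep_objs" and n: "1\<^sub>m (dim_row X) \<in> negl X X"
  have 1: "mor X Y f = mor X Y (0\<^sub>m (dim_row Y) (dim_row X))" if f: "f \<in> rhom X Y" for Y f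
    using negl_comp_left [OF X X rhomD(3) [OF f] n rhomD(1) [OF f]] mor_eq_zero [OF f] by (simp add: rhom_dims [OF f])
  have 2: "mor Y X f = mor Y X (0\<^sub>m (dim_row X) (dim_row Y))" if f: "f \<in> rhom Y X" for Y f
    using negl_comp_right [OF X X rhomD(2) [OF f] n rhomD(1) [OF f]] mor_eq_zero [OF f] by (simp add: rhom_dims [OF f])
  show "zero_obj ver X"
    unfolding zero_obj_def
  proof (intro conjI ballI)
    show "X \<in> Obj ver" using X by simp
    fix Y :: "'k mat" assume "Y \<in> Obj ver"
    then have Y: "Y \<in> rep_objs" by simp
    show "\<exists>!f. f \<in> hom ver X Y"
      by (rule ex1I [of _ "mor X Y (0\<^sub>m (dim_row Y) (dim_row X))"])
        (auto elim!: ver_homE intro!: ver_homI rhom_zero X Y 1)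
    show "\<exists>!f. f \<in> hom ver Y X"
      by (rule ex1I [of _ "mor Y X (0\<^sub>m (dim_row X) (dim_row Y))"])
        (auto elim!: ver_homE intro!: ver_homI rhom_zero X Y 2)
  qed
qed

lemma rep_complement:
  fixes X :: "'k mat"
  assumes "e \<in> rhom X X" "e * e = e"
  obtains Z i q where "i \<in> rhom Z X" "q \<in> rhom X Z" "q * i = 1\<^sub>m (dim_row Z)" "e + i * q = 1\<^sub>m (dim_row X)"
    "dim_row Z \<le> dim_row X" "dim_row Z = dim_row X \<Longrightarrow> e = 0\<^sub>m (dim_row X) (dim_row X)"
proof -
  let ?n = "dim_row X"
  note X = rhomD(2) [OF assms(1)] and d = rhom_dims [OF assms(1)]
  let ?c = "1\<^sub>m ?n - e"
  have c: "?c \<in> Hom X X" using rhom_diff [OF rhom_id [OF X] assms(1)] rhomD by blast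
  have "?c * ?c = ?c * 1\<^sub>m ?n - ?c * e" by (rule mat_mult_diff) (simp_all add: d)
  also have "?c * e = 1\<^sub>m ?n * e - e * e" by (rule mat_diff_mult) (simp_all add: d)
  finally have cc: "?c * ?c = ?c" unfolding assms(2) by (intro eq_matI) (simp_all add: d)
  obtain Z i q where Z: "Z \<in> rep_objs" "i \<in> Hom Z X" "q \<in> Hom X Z" "?c = i * q" "q * i = 1\<^sub>m (dim_row Z)"
    "dim_row Z \<le> ?n" "dim_row Z = ?n \<Longrightarrow> ?c = 1\<^sub>m ?n"
    using rep_split [OF X c cc] by metis
  have "e = 1\<^sub>m ?n - ?c" by (rule eq_matI) (simp_all add: d)
  also have "dim_row Z = ?n \<Longrightarrow> \<dots> = 0\<^sub>m ?n ?n" using Z(7) by (simp only:) (rule eq_matI; simp)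
  finally have "dim_row Z = ?n \<Longrightarrow> e = 0\<^sub>m ?n ?n" by blast
  moreover have "e + i * q = 1\<^sub>m ?n" unfolding Z(4) [symmetric] by (rule eq_matI) (simp_all add: d)
  ultimately show ?thesis using that [of i Z q] Z X by (auto intro: rhomI)
qed

text \<open>The exact relation \<open>b * (a * b) = b\<close> makes \<open>b * a\<close> and
  \<open>a * b\<close> idempotent as matrices, so they are split before passing to the quotient. The
  relation \<open>a * (b * a) = a\<close> is needed only for classes.\<close>

lemma ver_split_regular: "tc_split_regular (ver :: 'k small_tensor_cat)"
proof -
  interpret tc_linear "ver :: 'k small_tensor_cat" by (rule ver_linear [OF char])
  show ?thesis
  proof
    show "\<exists>Z. zero_obj (ver :: 'k small_tensor_cat) Z"
    proof
      have "(0\<^sub>m 0 0 :: 'k mat) ^\<^sub>m k = 1\<^sub>m 0" for k by (rule eq_matI) simp_all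
      then have o: "0\<^sub>m 0 0 \<in> (rep_objs :: 'k mat set)" by (simp add: rep_objs_def)
      have "1\<^sub>m 0 \<in> negl (0\<^sub>m 0 0) (0\<^sub>m 0 0 :: 'k mat)"
        using Hom_id [OF o] dim_par [OF o] by (intro neglI) (simp_all add: trace_def)
      then show "zero_obj ver (0\<^sub>m 0 0 :: 'k mat)"
        using ver_zero_iff [OF o] by simp
    qed
  next
    fix X Y :: "'k mat" assume "X \<in> Obj ver" "Y \<in> Obj ver"
    then have o: "X \<in> rep_objs" "Y \<in> rep_objs" by simp_all
    obtain P i1 i2 p1 p2 where r: "i1 \<in> rhom X P" "i2 \<in> rhom Y P" "p1 \<in> rhom P X" "p2 \<in> rhom P Y"
      "p1 * i1 = 1\<^sub>m (dim_row X)" "p2 * i2 = 1\<^sub>m (dim_row Y)"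
      "p1 * i2 = 0\<^sub>m (dim_row X) (dim_row Y)" "p2 * i1 = 0\<^sub>m (dim_row Y) (dim_row X)"
      "i1 * p1 + i2 * p2 = 1\<^sub>m (dim_row P)" by (rule rep_direct_sum [OF o])
    have "biproduct ver X Y P (mor X P i1) (mor Y P i2) (mor P X p1) (mor P Y p2)"
      unfolding biproduct_def ver_sel
        ver_comp [OF r(3,1)] ver_comp [OF r(4,2)] ver_comp [OF r(3,2)] ver_comp [OF r(4,1)]
        ver_comp [OF r(1,3)] ver_comp [OF r(2,4)] ver_add [OF rhom_comp [OF r(1,3)] rhom_comp [OF r(2,4)]] r(5-9)
      by (intro conjI ver_homI r(1-4) refl)
    then show "\<exists>P i1 i2 p1 p2. biproduct ver X Y P i1 i2 p1 p2" by blast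
  next
    fix f and X Y :: "'k mat" assume "f \<in> hom ver X Y"
    then obtain a where a: "a \<in> rhom X Y" and f: "f = mor X Y a" by (rule ver_homE)
    note o = rhomD(2,3) [OF a]
    obtain b where b: "b \<in> Hom Y X" "b * (a * b) = b" "a - a * (b * a) \<in> negl X Y"
      using regular_mod_negl [OF o rhomD(1) [OF a]] by blast
    have b': "b \<in> rhom Y X" using b o by (auto intro: rhomI)
    note d = rhom_dims [OF a] rhom_dims [OF b']
    have ba: "b * a \<in> rhom X X" "(b * a) * (b * a) = b * a"
      using rhom_comp [OF b' a] b(2) mat_mult_assoc [of b "a * b" a] by (simp_all add: mat_mult_assoc d)
    have ab: "a * b \<in> rhom Y Y" "(a * b) * (a * b) = a * b"
      using rhom_comp [OF a b'] b(2) by (simp_all add: mat_mult_assoc d)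
    obtain Z i q where Z: "i \<in> rhom Z X" "q \<in> rhom X Z" "q * i = 1\<^sub>m (dim_row Z)" "b * a + i * q = 1\<^sub>m (dim_row X)"
      using rep_complement [OF ba] by metis
    obtain W j r where W: "j \<in> rhom W Y" "r \<in> rhom Y W" "r * j = 1\<^sub>m (dim_row W)" "a * b + j * r = 1\<^sub>m (dim_row Y)"
      using rep_complement [OF ab] by metis
    have aba: "mor X Y (a * (b * a)) = mor X Y a"
      using mor_eq [OF a rhom_comp [OF a ba(1)]] b(3) by simp
    show "\<exists>g Z i q W j r. g \<in> hom ver Y X \<and> i \<in> hom ver Z X \<and> q \<in> hom ver X Z \<and> j \<in> hom ver W Y \<and> r \<in> hom ver Y W \<and>
      f \<cdot>\<^bsub>ver\<^esub> (g \<cdot>\<^bsub>ver\<^esub> f) = f \<and> q \<cdot>\<^bsub>ver\<^esub> i = \<i>\<d>\<^bsub>ver\<^esub> Z \<and> (g \<cdot>\<^bsub>ver\<^esub> f) \<boxplus>\<^bsub>ver\<^esub> (i \<cdot>\<^bsub>ver\<^esub> q) = \<i>\<d>\<^bsub>ver\<^esub> X \<and>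
      r \<cdot>\<^bsub>ver\<^esub> j = \<i>\<d>\<^bsub>ver\<^esub> W \<and> (f \<cdot>\<^bsub>ver\<^esub> g) \<boxplus>\<^bsub>ver\<^esub> (j \<cdot>\<^bsub>ver\<^esub> r) = \<i>\<d>\<^bsub>ver\<^esub> Y"
      unfolding f
      by (rule exI [of _ "mor Y X b"], rule exI [of _ Z], rule exI [of _ "mor Z X i"], rule exI [of _ "mor X Z q"],
          rule exI [of _ W], rule exI [of _ "mor W Y j"], rule exI [of _ "mor Y W r"])
        (simp add: ver_homI a b' Z W ver_comp [OF b' a] ver_comp [OF a b'] ver_comp [OF Z(2,1)] ver_comp [OF Z(1,2)]
          ver_comp [OF W(2,1)] ver_comp [OF W(1,2)] ver_comp [OF a ba(1)] aba
          ver_add [OF ba(1) rhom_comp [OF Z(1,2)]] ver_add [OF ab(1) rhom_comp [OF W(1,2)]])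
  qed
qed

subsection \<open>Finiteness\<close>

text \<open>A monomorphism into \<open>S\<close> is split, and its idempotent cuts out a retract
  \<open>T\<close> of \<open>S\<close>. If the identity of \<open>T\<close> is negligible, the
  source of the monomorphism is zero. Otherwise minimality gives \<open>T\<close> the full size of
  \<open>S\<close>, and the monomorphism is invertible.\<close>

lemma ver_simple:
  fixes S :: "'k mat"
  assumes S: "S \<in> rep_objs" and nz: "1\<^sub>m (dim_row S) \<notin> negl S S"
    and min: "\<And>T i q. i \<in> rhom T S \<Longrightarrow> q \<in> rhom S T \<Longrightarrow> q * i = 1\<^sub>m (dim_row T) \<Longrightarrow>
      1\<^sub>m (dim_row T) \<notin> negl T T \<Longrightarrow> dim_row S \<le> dim_row T"
  shows "simple_obj ver S"
proof -
  interpret tc_split_regular "ver :: 'k small_tensor_cat" by (rule ver_split_regular)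
  have "zero_obj ver (Dom ver m) \<or> iso_mor ver m" if m: "mono_mor ver m" "Cod ver m = S" for m
  proof -
    have "m \<in> hom ver (Dom ver m) S" using m mor_hom unfolding mono_mor_def by blast
    then obtain Z a where a: "a \<in> rhom Z S" and ma: "m = mor Z S a"
      by (elim ver_homE) blast
    note Z = rhomD(2) [OF a]
    obtain b where b: "b \<in> Hom S Z" "b * (a * b) = b" "a - a * (b * a) \<in> negl Z S"
      using regular_mod_negl [OF Z S rhomD(1) [OF a]] by blast
    have b': "b \<in> rhom S Z" using b Z S by (auto intro: rhomI)
    note d = rhom_dims [OF a] rhom_dims [OF b']
    have ba: "b * a \<in> rhom Z Z" and ab: "a * b \<in> rhom S S" using rhom_comp a b' by blast+
    have aba: "mor Z S (a * (b * a)) = mor Z S a"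
      using mor_eq [OF a rhom_comp [OF a ba]] b(3) by simp
    have inv: "mor Z Z (b * a) = mor Z Z (1\<^sub>m (dim_row Z))"
      using mono_split [OF m(1), of Z S "mor S Z b"] aba
      unfolding ma by (simp add: ver_homI a b' ver_comp [OF b' a] ver_comp [OF a ba])
    have ee: "(a * b) * (a * b) = a * b" using b(2) by (simp add: mat_mult_assoc d)
    obtain T i q where T: "T \<in> rep_objs" "i \<in> Hom T S" "q \<in> Hom S T" "a * b = i * q" "q * i = 1\<^sub>m (dim_row T)"
      "dim_row T \<le> dim_row S" "dim_row T = dim_row S \<Longrightarrow> a * b = 1\<^sub>m (dim_row S)"
      using rep_split [OF S rhomD(1) [OF ab] ee] by metis
    show ?thesis
    proof (cases "1\<^sub>m (dim_row T) \<in> negl T T")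
      case True
      have "i * 1\<^sub>m (dim_row T) \<in> negl T S" by (rule negl_comp_left [OF T(1,1) S True T(2)])
      then have "i * q \<in> negl S S" using negl_comp_right [OF T(1) S S _ T(3)] T(2) by (simp add: Hom_dims)
      then have "b * (i * q) \<in> negl S Z" by (rule negl_comp_left [OF S S Z _ b(1)])
      then have "b \<in> negl S Z" using b(2) T(4) by simp
      then have "b * a \<in> negl Z Z" by (rule negl_comp_right [OF S Z Z _ rhomD(1) [OF a]])
      then have "mor Z Z (b * a) = mor Z Z (0\<^sub>m (dim_row Z) (dim_row Z))" using mor_eq_zero [OF ba] by simp
      then have "1\<^sub>m (dim_row Z) \<in> negl Z Z" using inv mor_eq_zero [OF rhom_id [OF Z]] by simp
      then show ?thesis using ver_zero_iff [OF Z] by (simp add: ma)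
    next
      case False
      then have "dim_row S \<le> dim_row T"
        using min [OF rhomI [OF T(2,1) S] rhomI [OF T(3) S T(1)] T(5)] by blast
      then have ab1: "a * b = 1\<^sub>m (dim_row S)" using T(6,7) by simp
      have "inverse_pair ver m (mor S Z b)"
        unfolding inverse_pair_def ma
        using hom_dom(3) [OF ver_homI [OF a]]
        by (auto simp: ver_comp [OF b' a] ver_comp [OF a b'] inv ab1 intro!: ver_homI b')
      then show ?thesis unfolding iso_mor_def by blast
    qed
  qed
  then show ?thesis
    unfolding simple_obj_def using S nz ver_zero_iff [OF S] by auto
qed

text \<open>Induction on the size of the matrix: a retract of least size with non-negligible
  identity is simple by \<open>ver_simple\<close>, and its complement is strictly smaller.\<close>

lemma ver_finite_length:
  fixes X :: "'k mat"
  assumes "X \<in> rep_objs"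
  shows "finite_length ver X"
  using assms
proof (induction "dim_row X" arbitrary: X rule: less_induct)
  case less
  note X = less.prems
  interpret tc_split_regular "ver :: 'k small_tensor_cat" by (rule ver_split_regular)
  show ?case
  proof (cases "1\<^sub>m (dim_row X) \<in> negl X X")
    case True
    then show ?thesis using ver_zero_iff [OF X] by (intro finite_length.zero) simp
  next
    case False
    define P where "P n \<longleftrightarrow> (\<exists>S i q. i \<in> rhom S X \<and> q \<in> rhom X S \<and> q * i = 1\<^sub>m (dim_row S) \<and>
      1\<^sub>m (dim_row S) \<notin> negl S S \<and> dim_row S = n)" for n
    have "P (dim_row X)"
      unfolding P_def using False rhom_id [OF X]
      by (intro exI [of _ X] exI [of _ "1\<^sub>m (dim_row X)"]) simp
    then have "P (LEAST n. P n)" by (rule LeastI)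
    then obtain S i q where S: "i \<in> rhom S X" "q \<in> rhom X S" "q * i = 1\<^sub>m (dim_row S)"
      "1\<^sub>m (dim_row S) \<notin> negl S S" "dim_row S = (LEAST n. P n)"
      unfolding P_def by blast
    note So = rhomD(2) [OF S(1)]
    note d = rhom_dims [OF S(1)] rhom_dims [OF S(2)]
    have simple: "simple_obj ver S"
    proof (rule ver_simple [OF So S(4)])
      fix T j r assume T: "j \<in> rhom T S" "r \<in> rhom S T" "r * j = 1\<^sub>m (dim_row T)" "1\<^sub>m (dim_row T) \<notin> negl T T"
      note dT = rhom_dims [OF T(1)] rhom_dims [OF T(2)]
      have "(r * q) * (i * j) = r * ((q * i) * j)" by (simp add: mat_mult_assoc d dT)
      also have "\<dots> = 1\<^sub>m (dim_row T)" unfolding S(3) using T(3) by (simp add: dT)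
      finally have "P (dim_row T)"
        unfolding P_def using rhom_comp [OF S(1) T(1)] rhom_comp [OF T(2) S(2)] T(4) by blast
      then show "dim_row S \<le> dim_row T" unfolding S(5) by (rule Least_le)
    qed
    have iq: "i * q \<in> rhom X X" "(i * q) * (i * q) = i * q"
      using rhom_comp [OF S(1,2)] mat_mult_cancel [OF S(3), of q] by (simp_all add: mat_mult_assoc d)
    obtain Y j r where Y: "j \<in> rhom Y X" "r \<in> rhom X Y" "r * j = 1\<^sub>m (dim_row Y)" "i * q + j * r = 1\<^sub>m (dim_row X)"
      "dim_row Y \<le> dim_row X" "dim_row Y = dim_row X \<Longrightarrow> i * q = 0\<^sub>m (dim_row X) (dim_row X)"
      using rep_complement [OF iq] by metis
    \<comment> \<open>A complement of full size would force \<open>i * q = 0\<close>, and then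
      \<open>1 = (q * i) * (q * i)\<close> would vanish on \<open>S\<close>.\<close>
    have "dim_row Y \<noteq> dim_row X"
    proof
      assume "dim_row Y = dim_row X"
      then have 0: "i * q = 0\<^sub>m (dim_row X) (dim_row X)" by (rule Y(6))
      have "1\<^sub>m (dim_row S) = (q * i) * (q * i)" unfolding S(3) by simp
      also have "\<dots> = q * ((i * q) * i)" by (simp add: mat_mult_assoc d)
      also have "\<dots> = 0\<^sub>m (dim_row S) (dim_row S)" unfolding 0 by (simp add: d)
      finally show False using S(4) negl_zero [OF So So] by simp
    qed
    then have Yf: "finite_length ver Y" using Y less.hyps rhomD(2) [OF Y(1)] by simp
    have "j * r + i * q = i * q + j * r"
      by (rule comm_add_mat [of _ "dim_row X" "dim_row X"])
        (simp_all only: Hom_carrier [OF rhomD(1)] iq(1) rhom_comp [OF Y(1,2)])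
    then have iq': "mor X X (j * r) \<boxplus>\<^bsub>ver\<^esub> mor X X (i * q) = mor X X (1\<^sub>m (dim_row X))"
      unfolding ver_add [OF rhom_comp [OF Y(1,2)] iq(1)] Y(4) by simp
    have "is_kernel ver (mor Y X j) (mor X S q)"
      by (rule split_kernel [of _ X S "mor S X i" _ Y "mor X Y r"])
        (use S(1-3) Y(1-4) mat_mult_cancel [OF S(3), of q] in
          \<open>simp_all add: ver_homI ver_comp [OF S(1,2)] ver_comp [OF Y(2,1)] ver_comp [OF Y(1,2)]
            ver_comp [OF S(2) iq(1)] ver_add [OF iq(1) rhom_comp [OF Y(1,2)]] d\<close>)
    moreover have "is_cokernel ver (mor X S q) (mor Y X j)"
      by (rule split_cokernel [of _ Y X "mor X Y r" "mor S X i" S])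
        (use S(1-3) Y(1-4) iq' in
          \<open>simp_all add: ver_homI ver_comp [OF S(1,2)] ver_comp [OF S(2,1)] ver_comp [OF Y(2,1)] ver_comp [OF Y(1,2)]
            ver_comp [OF Y(1) rhom_id] rhomD rhom_dims [OF Y(1)]\<close>)
    ultimately show ?thesis
      using finite_length.extend [OF Yf simple ver_homI [OF Y(1)] ver_homI [OF S(2)]] by blast
  qed
qed

end

section \<open>Finite spanning sets for spaces of matrices\<close>

inductive_set mat_span :: "nat \<Rightarrow> nat \<Rightarrow> 'a::field mat set \<Rightarrow> 'a mat set" for m n B where
  zero: "0\<^sub>m m n \<in> mat_span m n B"
| step: "b \<in> B \<Longrightarrow> f \<in> mat_span m n B \<Longrightarrow> a \<cdot>\<^sub>m b + f \<in> mat_span m n B"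

lemma mat_span_mono: "f \<in> mat_span m n B \<Longrightarrow> B \<subseteq> B' \<Longrightarrow> f \<in> mat_span m n B'"
  by (induction rule: mat_span.induct) (auto intro: mat_span.intros)

text \<open>Gaussian elimination over the set \<open>S\<close> of positions where entries may be
  nonzero: a member \<open>b\<close> with nonzero entry at \<open>s\<close> clears that entry in all
  others and joins the spanning set of the rest.\<close>

lemma mat_subspace_span:
  fixes V :: "'a::field mat set"
  assumes "finite S" "V \<subseteq> carrier_mat m n" "0\<^sub>m m n \<in> V" "\<And>u v a. u \<in> V \<Longrightarrow> v \<in> V \<Longrightarrow> a \<cdot>\<^sub>m u + v \<in> V"
    "\<And>v i j. v \<in> V \<Longrightarrow> i < m \<Longrightarrow> j < n \<Longrightarrow> (i,j) \<notin> S \<Longrightarrow> v $$ (i,j) = 0"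
  shows "\<exists>B. finite B \<and> B \<subseteq> V \<and> V \<subseteq> mat_span m n B"
  using assms
proof (induction S arbitrary: V rule: finite_induct)
  case empty
  have "v = 0\<^sub>m m n" if "v \<in> V" for v
    by (rule eq_matI) (use empty.prems(1,4) that in auto)
  then show ?case by (intro exI [of _ "{}"]) (auto intro: mat_span.zero)
next
  case (insert s S)
  show ?case
  proof (cases "\<exists>b \<in> V. fst s < m \<and> snd s < n \<and> b $$ s \<noteq> 0")
    case False
    show ?thesis
      by (rule insert.IH [OF insert.prems(1-3)]) (use False insert.prems(4) in force)+
  next
    case True
    then obtain b where b: "b \<in> V" "fst s < m" "snd s < n" "b $$ s \<noteq> 0" by blast
    obtain i0 j0 where s: "s = (i0, j0)" by (cases s)
    define V' where "V' = {v \<in> V. v $$ s = 0}"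
    have "\<exists>B. finite B \<and> B \<subseteq> V' \<and> V' \<subseteq> mat_span m n B"
    proof (rule insert.IH)
      show "V' \<subseteq> carrier_mat m n" using insert.prems(1) by (auto simp: V'_def)
      show "0\<^sub>m m n \<in> V'" using insert.prems(2) b(2,3) s by (auto simp: V'_def)
      show "a \<cdot>\<^sub>m u + v \<in> V'" if "u \<in> V'" "v \<in> V'" for u v a
      proof -
        have "u \<in> carrier_mat m n" "v \<in> carrier_mat m n" using that insert.prems(1) by (auto simp: V'_def)
        then have "(a \<cdot>\<^sub>m u + v) $$ s = a * u $$ s + v $$ s" using b(2,3) s by auto
        then show ?thesis using that insert.prems(3) by (auto simp: V'_def)
      qed
      show "v $$ (i,j) = 0" if "v \<in> V'" "i < m" "j < n" "(i,j) \<notin> S" for v i j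
        using that insert.prems(4) by (cases "(i,j) = s") (auto simp: V'_def)
    qed
    then obtain B where B: "finite B" "B \<subseteq> V'" "V' \<subseteq> mat_span m n B" by blast
    have "v \<in> mat_span m n (insert b B)" if v: "v \<in> V" for v
    proof -
      define c where "c = v $$ s / b $$ s"
      have car: "v \<in> carrier_mat m n" "b \<in> carrier_mat m n" using v b(1) insert.prems(1) by auto
      have w: "(- c) \<cdot>\<^sub>m b + v \<in> V" using insert.prems(3) b(1) v by blast
      moreover have "((- c) \<cdot>\<^sub>m b + v) $$ s = 0" using car b(2-4) s by (auto simp: c_def)
      ultimately have "(- c) \<cdot>\<^sub>m b + v \<in> mat_span m n (insert b B)"
        using B(3) mat_span_mono [of _ m n B "insert b B"] by (auto simp: V'_def)
      then have "c \<cdot>\<^sub>m b + ((- c) \<cdot>\<^sub>m b + v) \<in> mat_span m n (insert b B)"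
        by (rule mat_span.step [OF insertI1])
      also have "c \<cdot>\<^sub>m b + ((- c) \<cdot>\<^sub>m b + v) = v"
        by (rule eq_matI) (use car in auto)
      finally show ?thesis .
    qed
    then show ?thesis using B b(1) by (intro exI [of _ "insert b B"]) (auto simp: V'_def)
  qed
qed

context
  fixes K :: "'k::field itself"
  assumes char: "CHAR('k) > 2"
begin

lemma ver_locally_finite: "tc_locally_finite (ver :: 'k small_tensor_cat)"
proof -
  interpret tc_split_regular "ver :: 'k small_tensor_cat" by (rule ver_split_regular [OF char])
  show ?thesis
  proof
    fix X :: "'k mat" assume "X \<in> Obj ver"
    then show "finite_length ver X" using ver_finite_length [OF char] by simp
    fix Y :: "'k mat" assume "Y \<in> Obj ver"
    then have X: "X \<in> rep_objs" and Y: "Y \<in> rep_objs" using \<open>X \<in> Obj ver\<close> by simp_all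
    let ?m = "dim_row Y" and ?n = "dim_row X"
    have "\<exists>B. finite B \<and> B \<subseteq> Hom X Y \<and> Hom X Y \<subseteq> mat_span ?m ?n B"
    proof (rule mat_subspace_span [of "{..<?m} \<times> {..<?n}"])
      show "Hom X Y \<subseteq> carrier_mat ?m ?n" using Hom_carrier by blast
      show "0\<^sub>m ?m ?n \<in> Hom X Y" by (rule Hom_zero [OF X Y])
      show "a \<cdot>\<^sub>m u + v \<in> Hom X Y" if "u \<in> Hom X Y" "v \<in> Hom X Y" for u v a
        by (intro Hom_add Hom_smult X Y that)
    qed auto
    then obtain B where B: "finite B" "B \<subseteq> Hom X Y" "Hom X Y \<subseteq> mat_span ?m ?n B" by blast
    have Br: "b \<in> rhom X Y" if "b \<in> B" for b using B(2) X Y that by (auto intro: rhomI)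
    have *: "f \<in> rhom X Y \<and> mor X Y f \<in> mor_span ver X Y (mor X Y ` B)" if "f \<in> mat_span ?m ?n B" for f
      using that
    proof induction
      case zero
      show ?case using mor_span.zero [of ver X Y "mor X Y ` B"] rhom_zero [OF X Y] by simp
    next
      case (step b f a)
      have "(a \<star>\<^bsub>ver\<^esub> mor X Y b) \<boxplus>\<^bsub>ver\<^esub> mor X Y f \<in> mor_span ver X Y (mor X Y ` B)"
        using step by (intro mor_span.step) auto
      then show ?case
        using step Br [OF step.hyps(1)] by (simp add: ver_scale ver_add rhom_smult rhom_add)
    qed
    have "hom ver X Y \<subseteq> mor_span ver X Y (mor X Y ` B)"
    proof (intro subsetI)
      fix m assume "m \<in> hom ver X Y"
      then obtain f where "f \<in> rhom X Y" "m = mor X Y f" by (rule ver_homE)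
      with * show "m \<in> mor_span ver X Y (mor X Y ` B)" using B(3) rhomD(1) by blast
    qed
    moreover have "mor X Y ` B \<subseteq> hom ver X Y" using Br ver_homI by blast
    ultimately show "\<exists>B. finite B \<and> B \<subseteq> hom ver X Y \<and> hom ver X Y \<subseteq> mor_span ver X Y B"
      using B(1) by (intro exI [of _ "mor X Y ` B"]) auto
  qed
qed

subsection \<open>Rigidity\<close>

lemma ver_inv_id:
  fixes X :: "'k mat"
  assumes "X \<in> rep_objs"
  shows "inv_mor ver (mor X X (1\<^sub>m (dim_row X))) = mor X X (1\<^sub>m (dim_row X))"
  unfolding inv_mor_def
proof (rule the_equality)
  interpret tc_category "ver :: 'k small_tensor_cat" by (rule ver_category [OF char])
  show "inverse_pair ver (mor X X (1\<^sub>m (dim_row X))) (mor X X (1\<^sub>m (dim_row X)))"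
    unfolding inverse_pair_def using hom_dom(3) [OF ver_homI [OF rhom_id [OF assms]]]
    by (auto simp: ver_comp rhom_id assms intro!: ver_homI)
  fix g assume g: "inverse_pair ver (mor X X (1\<^sub>m (dim_row X))) g"
  then have "g \<in> hom ver X X" "g \<cdot>\<^bsub>ver\<^esub> \<i>\<d>\<^bsub>ver\<^esub> X = \<i>\<d>\<^bsub>ver\<^esub> X"
    unfolding inverse_pair_def by simp_all
  then show "g = mor X X (1\<^sub>m (dim_row X))"
    using id_right [of g X X] by simp
qed

lemma rhom_cup: "X \<in> rep_objs \<Longrightarrow> cup (dim_row X) \<in> rhom (1\<^sub>m (Suc 0)) (kron X (dual X))"
  and rhom_cap: "X \<in> rep_objs \<Longrightarrow> cap (dim_row X) \<in> rhom (kron (dual X) X) (1\<^sub>m (Suc 0))"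
  for X :: "'k mat"
  using cup_Hom cap_Hom char_pos [OF char] by (auto intro!: rhomI rep_unit_obj kron_obj dual_obj)

lemma ver_left_dual_iff:
  fixes X Xd :: "'k mat"
  assumes X: "X \<in> rep_objs" and Xd: "Xd \<in> rep_objs"
    and ev: "ev \<in> rhom (kron Xd X) (1\<^sub>m (Suc 0))" and coev: "coev \<in> rhom (1\<^sub>m (Suc 0)) (kron X Xd)"
  shows "left_dual ver X Xd (mor (kron Xd X) (1\<^sub>m (Suc 0)) ev) (mor (1\<^sub>m (Suc 0)) (kron X Xd) coev) \<longleftrightarrow>
    mor X X (kron (1\<^sub>m (dim_row X)) ev * kron coev (1\<^sub>m (dim_row X))) = mor X X (1\<^sub>m (dim_row X)) \<and>
    mor Xd Xd (kron ev (1\<^sub>m (dim_row Xd)) * kron (1\<^sub>m (dim_row Xd)) coev) = mor Xd Xd (1\<^sub>m (dim_row Xd))"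
proof -
  let ?I = "1\<^sub>m (Suc 0) :: 'k mat" and ?x = "dim_row X" and ?d = "dim_row Xd"
  let ?ev = "mor (kron Xd X) ?I ev" and ?coev = "mor ?I (kron X Xd) coev"
  let ?A = "kron X (kron Xd X)" and ?B = "kron Xd (kron X Xd)"
  have o: "?A \<in> rep_objs" "?B \<in> rep_objs" using X Xd by (simp_all add: kron_obj)
  note i = rhom_id [OF X] rhom_id [OF Xd]
  have iA: "1\<^sub>m (?x * (?d * ?x)) \<in> rhom ?A ?A" and iB: "1\<^sub>m (?d * (?x * ?d)) \<in> rhom ?B ?B"
    using rhom_id [OF o(1)] rhom_id [OF o(2)] by simp_all
  have r: "kron (1\<^sub>m ?x) ev \<in> rhom ?A X" "kron coev (1\<^sub>m ?x) \<in> rhom X ?A"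
    "kron ev (1\<^sub>m ?d) \<in> rhom ?B Xd" "kron (1\<^sub>m ?d) coev \<in> rhom Xd ?B"
    using rhom_kron [OF i(1) ev] rhom_kron [OF coev i(1)] rhom_kron [OF ev i(2)] rhom_kron [OF i(2) coev]
    by (simp_all add: kron_assoc)
  have t: "mor X X (1\<^sub>m ?x) \<boxdot>\<^bsub>ver\<^esub> ?ev = mor ?A X (kron (1\<^sub>m ?x) ev)"
    "?coev \<boxdot>\<^bsub>ver\<^esub> mor X X (1\<^sub>m ?x) = mor X ?A (kron coev (1\<^sub>m ?x))"
    "?ev \<boxdot>\<^bsub>ver\<^esub> mor Xd Xd (1\<^sub>m ?d) = mor ?B Xd (kron ev (1\<^sub>m ?d))"
    "mor Xd Xd (1\<^sub>m ?d) \<boxdot>\<^bsub>ver\<^esub> ?coev = mor Xd ?B (kron (1\<^sub>m ?d) coev)"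
    using ver_tensor [OF char i(1) ev] ver_tensor [OF char coev i(1)] ver_tensor [OF char ev i(2)] ver_tensor [OF char i(2) coev]
    by (simp_all add: kron_assoc)
  have inv: "inv_mor ver (mor ?B ?B (1\<^sub>m (?d * (?x * ?d)))) = mor ?B ?B (1\<^sub>m (?d * (?x * ?d)))"
    using ver_inv_id [OF o(2)] by simp
  have 1: "RUnit ver X \<cdot>\<^bsub>ver\<^esub> (\<i>\<d>\<^bsub>ver\<^esub> X \<boxdot>\<^bsub>ver\<^esub> ?ev) \<cdot>\<^bsub>ver\<^esub> Assoc ver X Xd X \<cdot>\<^bsub>ver\<^esub> (?coev \<boxdot>\<^bsub>ver\<^esub> \<i>\<d>\<^bsub>ver\<^esub> X)
      = mor X X (kron (1\<^sub>m ?x) ev * kron coev (1\<^sub>m ?x))"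
    unfolding ver_sel t ver_comp [OF iA r(2)] ver_comp [OF r(1) rhom_comp [OF iA r(2)]]
      ver_comp [OF i(1) rhom_comp [OF r(1) rhom_comp [OF iA r(2)]]]
    by (simp add: rhom_dims [OF ev] rhom_dims [OF coev])
  have 2: "LUnit ver Xd \<cdot>\<^bsub>ver\<^esub> (?ev \<boxdot>\<^bsub>ver\<^esub> \<i>\<d>\<^bsub>ver\<^esub> Xd) \<cdot>\<^bsub>ver\<^esub> inv_mor ver (Assoc ver Xd X Xd) \<cdot>\<^bsub>ver\<^esub> (\<i>\<d>\<^bsub>ver\<^esub> Xd \<boxdot>\<^bsub>ver\<^esub> ?coev)
      = mor Xd Xd (kron ev (1\<^sub>m ?d) * kron (1\<^sub>m ?d) coev)"
    unfolding ver_sel inv t ver_comp [OF iB r(4)] ver_comp [OF r(3) rhom_comp [OF iB r(4)]]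
      ver_comp [OF i(2) rhom_comp [OF r(3) rhom_comp [OF iB r(4)]]]
    by (simp add: rhom_dims [OF ev] rhom_dims [OF coev])
  show ?thesis
    unfolding left_dual_def 1 2 using X Xd ev coev by (auto intro: ver_homI)
qed

lemma ver_dual:
  fixes X :: "'k mat"
  assumes X: "X \<in> rep_objs"
  shows "left_dual ver X (dual X) (mor (kron (dual X) X) (1\<^sub>m (Suc 0)) (cap (dim_row X)))
    (mor (1\<^sub>m (Suc 0)) (kron X (dual X)) (cup (dim_row X)))"
  using ver_left_dual_iff [OF X dual_obj [OF X char_pos [OF char]] rhom_cap [OF X] rhom_cup [OF X]]
  by (simp add: zigzag_left zigzag_right dim_dual [OF X char_pos [OF char]])

theorem ver_symmetric_tensor_category: "symmetric_tensor_category (ver :: 'k small_tensor_cat)"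
proof -
  interpret tc_symmetric_monoidal "ver :: 'k small_tensor_cat" by (rule ver_symmetric_monoidal [OF char])
  interpret tc_locally_finite "ver :: 'k small_tensor_cat" by (rule ver_locally_finite)
  show ?thesis
  proof
    fix f f' g and X X' Y Y' :: "'k mat"
    assume "f \<in> hom ver X X'" "f' \<in> hom ver X X'" "g \<in> hom ver Y Y'"
    then obtain a a' b where 1: "a \<in> rhom X X'" "a' \<in> rhom X X'" "b \<in> rhom Y Y'"
      and 2: "f = mor X X' a" "f' = mor X X' a'" "g = mor Y Y' b" by (meson ver_homE)
    show "(f \<boxplus>\<^bsub>ver\<^esub> f') \<boxdot>\<^bsub>ver\<^esub> g = (f \<boxdot>\<^bsub>ver\<^esub> g) \<boxplus>\<^bsub>ver\<^esub> (f' \<boxdot>\<^bsub>ver\<^esub> g)"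
      unfolding 2 ver_add [OF 1(1,2)] ver_tensor [OF char 1(1,3)] ver_tensor [OF char 1(2,3)]
        ver_tensor [OF char rhom_add [OF 1(1,2)] 1(3)] ver_add [OF rhom_kron [OF 1(1,3)] rhom_kron [OF 1(2,3)]]
      using 1 by (simp add: kron_add_left rhom_dims)
  next
    fix f g g' and X X' Y Y' :: "'k mat"
    assume "f \<in> hom ver X X'" "g \<in> hom ver Y Y'" "g' \<in> hom ver Y Y'"
    then obtain a b b' where 1: "a \<in> rhom X X'" "b \<in> rhom Y Y'" "b' \<in> rhom Y Y'"
      and 2: "f = mor X X' a" "g = mor Y Y' b" "g' = mor Y Y' b'" by (meson ver_homE)
    show "f \<boxdot>\<^bsub>ver\<^esub> (g \<boxplus>\<^bsub>ver\<^esub> g') = (f \<boxdot>\<^bsub>ver\<^esub> g) \<boxplus>\<^bsub>ver\<^esub> (f \<boxdot>\<^bsub>ver\<^esub> g')"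
      unfolding 2 ver_add [OF 1(2,3)] ver_tensor [OF char 1(1,2)] ver_tensor [OF char 1(1,3)]
        ver_tensor [OF char 1(1) rhom_add [OF 1(2,3)]] ver_add [OF rhom_kron [OF 1(1,2)] rhom_kron [OF 1(1,3)]]
      using 1 by (simp add: kron_add_right rhom_dims)
  next
    fix f g a and X X' Y Y' :: "'k mat"
    assume "f \<in> hom ver X X'" "g \<in> hom ver Y Y'"
    then obtain u v where 1: "u \<in> rhom X X'" "v \<in> rhom Y Y'"
      and 2: "f = mor X X' u" "g = mor Y Y' v" by (meson ver_homE)
    show "(a \<star>\<^bsub>ver\<^esub> f) \<boxdot>\<^bsub>ver\<^esub> g = a \<star>\<^bsub>ver\<^esub> (f \<boxdot>\<^bsub>ver\<^esub> g)" "f \<boxdot>\<^bsub>ver\<^esub> (a \<star>\<^bsub>ver\<^esub> g) = a \<star>\<^bsub>ver\<^esub> (f \<boxdot>\<^bsub>ver\<^esub> g)"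
      unfolding 2 ver_scale [OF 1(1)] ver_scale [OF 1(2)] ver_tensor [OF char 1]
        ver_tensor [OF char rhom_smult [OF 1(1)] 1(2)] ver_tensor [OF char 1(1) rhom_smult [OF 1(2)]] ver_scale [OF rhom_kron [OF 1]]
      by (simp_all add: kron_smult_left kron_smult_right)
  next
    fix X :: "'k mat" assume "X \<in> Obj ver"
    then have X: "X \<in> rep_objs" by simp
    show "\<exists>Xd ev coev. left_dual ver X Xd ev coev" using ver_dual [OF X] by blast
    show "\<exists>dX ev coev. left_dual ver dX X ev coev"
      using ver_dual [OF dual_obj [OF X char_pos [OF char]]] unfolding dual_dual [OF X char_pos [OF char]] by blast
  next
    let ?I = "1\<^sub>m (Suc 0) :: 'k mat"
    have i: "1\<^sub>m (Suc 0) \<in> rhom ?I ?I" using rhom_id [OF rep_unit_obj] by simp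
    have s: "a \<star>\<^bsub>ver\<^esub> \<i>\<d>\<^bsub>ver\<^esub> \<I>\<^bsub>ver\<^esub> = mor ?I ?I (a \<cdot>\<^sub>m ?I)" for a using ver_scale [OF i] by simp
    \<comment> \<open>On the unit object the supertrace pairing is multiplication of scalars, so no
      nonzero scalar is negligible.\<close>
    have "a = b" if "mor ?I ?I (a \<cdot>\<^sub>m ?I) = mor ?I ?I (b \<cdot>\<^sub>m ?I)" for a b
    proof -
      have "a \<cdot>\<^sub>m ?I - b \<cdot>\<^sub>m ?I \<in> negl ?I ?I"
        using mor_eq [OF rhom_smult [OF i] rhom_smult [OF i]] that by blast
      then have "trace (par ?I * ((a \<cdot>\<^sub>m ?I - b \<cdot>\<^sub>m ?I) * ?I)) = 0"
        using neglD rhomD(1) [OF i] by blast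
      then show ?thesis by (simp add: par_def one_pow_mat trace_def)
    qed
    note inj = this
    have ex: "\<exists>a. m = mor ?I ?I (a \<cdot>\<^sub>m ?I)" if m: "m \<in> hom ver ?I ?I" for m
    proof -
      obtain f where f: "f \<in> rhom ?I ?I" "m = mor ?I ?I f" using m by (rule ver_homE)
      have "f = (f $$ (0,0)) \<cdot>\<^sub>m ?I" by (rule eq_matI) (use rhom_dims [OF f(1)] in auto)
      then show ?thesis using f(2) by metis
    qed
    show "bij_betw (\<lambda>a. a \<star>\<^bsub>ver\<^esub> \<i>\<d>\<^bsub>ver\<^esub> \<I>\<^bsub>ver\<^esub>) UNIV (hom (ver :: 'k small_tensor_cat) \<I>\<^bsub>ver\<^esub> \<I>\<^bsub>ver\<^esub>)"
      unfolding s unfolding ver_sel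
    proof (rule bij_betw_imageI)
      show "inj (\<lambda>a. mor ?I ?I (a \<cdot>\<^sub>m ?I))" by (rule injI) (rule inj)
      show "range (\<lambda>a. mor ?I ?I (a \<cdot>\<^sub>m ?I)) = hom ver ?I ?I"
        using ver_homI [OF rhom_smult [OF i]] ex by (intro equalityI subsetI) (erule imageE, simp, metis rangeI)
    qed
  qed
qed

end

section \<open>Dimensions and powers in the semisimplification\<close>

context tc_category
begin

lemma universal_quotient_unique:
  assumes Q: "q \<in> hom C T Q" "P q" "\<And>Z h. h \<in> hom C T Z \<Longrightarrow> P h \<Longrightarrow> \<exists>!u. u \<in> hom C Q Z \<and> u \<cdot> q = h"
    and Q': "q' \<in> hom C T Q'" "P q'" "\<And>Z h. h \<in> hom C T Z \<Longrightarrow> P h \<Longrightarrow> \<exists>!u. u \<in> hom C Q' Z \<and> u \<cdot> q' = h"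
  shows "\<exists>u \<in> hom C Q Q'. \<exists>v \<in> hom C Q' Q. v \<cdot> u = \<i>\<d> Q \<and> u \<cdot> v = \<i>\<d> Q'"
proof -
  obtain u where u: "u \<in> hom C Q Q'" "u \<cdot> q = q'" using Q(3) [OF Q'(1,2)] by blast
  obtain v where v: "v \<in> hom C Q' Q" "v \<cdot> q' = q" using Q'(3) [OF Q(1,2)] by blast
  have "v \<cdot> u \<in> hom C Q Q" "(v \<cdot> u) \<cdot> q = q"
    using comp_hom [OF u(1) v(1)] comp_assoc [OF Q(1) u(1) v(1)] u v by simp_all
  moreover have "\<i>\<d> Q \<in> hom C Q Q" "\<i>\<d> Q \<cdot> q = q" using id_hom id_left [OF Q(1)] hom_obj [OF Q(1)] by auto
  ultimately have 1: "v \<cdot> u = \<i>\<d> Q" using Q(3) [OF Q(1,2)] by blast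
  have "u \<cdot> v \<in> hom C Q' Q'" "(u \<cdot> v) \<cdot> q' = q'"
    using comp_hom [OF v(1) u(1)] comp_assoc [OF Q'(1) v(1) u(1)] u v by simp_all
  moreover have "\<i>\<d> Q' \<in> hom C Q' Q'" "\<i>\<d> Q' \<cdot> q' = q'" using id_hom id_left [OF Q'(1)] hom_obj [OF Q'(1)] by auto
  ultimately have "u \<cdot> v = \<i>\<d> Q'" using Q'(3) [OF Q'(1,2)] by blast
  with 1 u v show ?thesis by blast
qed

end

context
  fixes K :: "'k::field itself"
  assumes char: "CHAR('k) > 2"
begin

lemma ver_compositeD:
  fixes X Y Z :: "'k mat"
  assumes "mor X Y f = mor X Y f'" "f \<in> rhom X Y" "f' \<in> rhom X Y"
  shows "g \<in> rhom Y Z \<Longrightarrow> mor X Z (g * f) = mor X Z (g * f')"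
    and "h \<in> rhom W X \<Longrightarrow> mor W Y (f * h) = mor W Y (f' * h)"
  using mor_comp_cong assms by blast+

lemma ver_kronD:
  fixes X Y W V :: "'k mat"
  assumes "mor X Y f = mor X Y f'" "f \<in> rhom X Y" "f' \<in> rhom X Y" "g \<in> rhom W V"
  shows "mor (kron X W) (kron Y V) (kron f g) = mor (kron X W) (kron Y V) (kron f' g)"
    and "mor (kron W X) (kron V Y) (kron g f) = mor (kron W X) (kron V Y) (kron g f')"
  using ver_tensor [OF char assms(2,4)] ver_tensor [OF char assms(3,4)] ver_tensor [OF char assms(4,2)]
    ver_tensor [OF char assms(4,3)] assms(1) by simp_all

subsection \<open>The dimension of an object\<close>

text \<open>The dimension does not depend on the dual. An arbitrary dual \<open>Xd\<close> is
  compared with the standard one through a map \<open>\<phi>\<close>, and naturality of the braiding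
  carries \<open>\<phi>\<close> from the evaluation to the coevaluation.\<close>

lemma dual_dim_scalar:
  fixes X :: "'k mat"
  assumes X: "X \<in> rep_objs" and Xd: "Xd \<in> rep_objs"
    and e: "e \<in> rhom (kron Xd X) (1\<^sub>m (Suc 0))" and c: "c \<in> rhom (1\<^sub>m (Suc 0)) (kron X Xd)"
    and zz: "mor X X (kron (1\<^sub>m (dim_row X)) e * kron c (1\<^sub>m (dim_row X))) = mor X X (1\<^sub>m (dim_row X))"
  shows "mor (1\<^sub>m (Suc 0)) (1\<^sub>m (Suc 0)) (e * (braid X Xd * c)) =
    mor (1\<^sub>m (Suc 0)) (1\<^sub>m (Suc 0)) (trace (par X) \<cdot>\<^sub>m 1\<^sub>m (Suc 0))"
proof -
  let ?I = "1\<^sub>m (Suc 0) :: 'k mat" and ?x = "dim_row X" and ?d = "dim_row Xd" and ?Y = "dual X"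
  let ?ux = "1\<^sub>m (dim_row X) :: 'k mat" and ?ud = "1\<^sub>m (dim_row Xd) :: 'k mat"
  note pos = char_pos [OF char]
  have Y: "?Y \<in> rep_objs" "dim_row ?Y = ?x" using dual_obj [OF X pos] dim_dual [OF X pos] by auto
  note cup = rhom_cup [OF char X] and cap = rhom_cap [OF char X]
  note i = rhom_id [OF X] rhom_id [OF Xd]
  have iY: "1\<^sub>m ?x \<in> rhom ?Y ?Y" using rhom_id [OF Y(1)] Y(2) by simp
  have ed: "dim_row e = 1" "dim_col e = ?d * ?x" "dim_row c = ?x * ?d" "dim_col c = 1"
    using rhom_dims [OF e] rhom_dims [OF c] by simp_all
  \<comment> \<open>The canonical comparison of duals: create a standard pair with the cup, then
    evaluate \<open>Xd\<close> against its first member.\<close>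
  define \<phi> where "\<phi> = kron e ?ux * kron ?ud (cup ?x)"
  have k1: "kron e ?ux \<in> rhom (kron Xd (kron X ?Y)) ?Y"
    using rhom_kron [OF e iY] by (simp add: kron_assoc)
  have k2: "kron ?ud (cup ?x) \<in> rhom Xd (kron Xd (kron X ?Y))"
    using rhom_kron [OF i(2) cup] by simp
  have \<phi>: "\<phi> \<in> rhom Xd ?Y" unfolding \<phi>_def by (rule rhom_comp [OF k1 k2])
  have d\<phi>: "dim_row \<phi> = ?x" "dim_col \<phi> = ?d" using rhom_dims [OF \<phi>] Y by simp_all
  have "kron \<phi> ?ux = kron (kron e ?ux) ?ux * kron (kron ?ud (cup ?x)) ?ux"
    unfolding \<phi>_def by (simp add: ed mult_ac flip: kron_mult)
  then have 1: "kron \<phi> ?ux = kron e (1\<^sub>m (?x * ?x)) * kron ?ud (kron (cup ?x) ?ux)"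
    by (simp add: kron_assoc kron_one)
  have "cap ?x * kron e (1\<^sub>m (?x * ?x)) = kron (1\<^sub>m 1) (cap ?x) * kron e (1\<^sub>m (?x * ?x))" by simp
  also have "\<dots> = kron (1\<^sub>m 1 * e) (cap ?x * 1\<^sub>m (?x * ?x))" by (rule kron_mult [symmetric]) (simp_all add: ed)
  also have "\<dots> = kron (e * 1\<^sub>m (?d * ?x)) (1\<^sub>m 1 * cap ?x)" using ed by simp
  also have "\<dots> = kron e (1\<^sub>m 1) * kron (1\<^sub>m (?d * ?x)) (cap ?x)" by (rule kron_mult) (simp_all add: ed)
  also have "\<dots> = e * kron ?ud (kron ?ux (cap ?x))" by (simp add: kron_assoc flip: kron_one)
  finally have 2: "cap ?x * kron e (1\<^sub>m (?x * ?x)) = e * kron ?ud (kron ?ux (cap ?x))" .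
  \<comment> \<open>On the evaluation side the comparison is exact, by the zigzag identity for
    matrices.\<close>
  have "cap ?x * kron \<phi> ?ux = cap ?x * kron e (1\<^sub>m (?x * ?x)) * kron ?ud (kron (cup ?x) ?ux)"
    unfolding 1 by (simp add: mat_mult_assoc ed mult_ac)
  also have "\<dots> = e * (kron ?ud (kron ?ux (cap ?x)) * kron ?ud (kron (cup ?x) ?ux))"
    unfolding 2 by (simp add: mat_mult_assoc ed mult_ac)
  also have "kron ?ud (kron ?ux (cap ?x)) * kron ?ud (kron (cup ?x) ?ux) = 1\<^sub>m (?d * ?x)"
    by (simp add: zigzag_left kron_one flip: kron_mult)
  finally have ev: "cap ?x * kron \<phi> ?ux = e" by (simp add: ed)
  have "kron ?ux \<phi> = kron ?ux (kron e ?ux) * kron ?ux (kron ?ud (cup ?x))"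
    unfolding \<phi>_def by (simp add: ed mult_ac flip: kron_mult)
  then have "kron ?ux \<phi> * c = kron (kron ?ux e) ?ux * (kron (1\<^sub>m (?x * ?d)) (cup ?x) * c)"
    by (simp add: mat_mult_assoc ed mult_ac kron_assoc flip: kron_one)
  also have "kron (1\<^sub>m (?x * ?d)) (cup ?x) * c = kron (1\<^sub>m (?x * ?d)) (cup ?x) * kron c (1\<^sub>m 1)" by simp
  also have "\<dots> = kron (1\<^sub>m (?x * ?d) * c) (cup ?x * 1\<^sub>m 1)" by (rule kron_mult [symmetric]) (simp_all add: ed)
  also have "\<dots> = kron (c * 1\<^sub>m 1) (1\<^sub>m (?x * ?x) * cup ?x)" by (simp add: ed)
  also have "\<dots> = kron c (1\<^sub>m (?x * ?x)) * kron (1\<^sub>m 1) (cup ?x)" by (rule kron_mult) (simp_all add: ed)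
  also have "\<dots> = kron (kron c ?ux) ?ux * cup ?x" by (simp add: kron_assoc flip: kron_one)
  also have "kron (kron ?ux e) ?ux * (kron (kron c ?ux) ?ux * cup ?x) =
      (kron (kron ?ux e) ?ux * kron (kron c ?ux) ?ux) * cup ?x"
    by (rule mat_mult_assoc [symmetric]) (simp_all add: ed mult_ac)
  also have "kron (kron ?ux e) ?ux * kron (kron c ?ux) ?ux = kron (kron ?ux e * kron c ?ux) ?ux"
    by (simp add: ed mult_ac flip: kron_mult)
  finally have coev: "kron ?ux \<phi> * c = kron (kron ?ux e * kron c ?ux) ?ux * cup ?x" .
  have zr: "kron ?ux e * kron c ?ux \<in> rhom X X"
  proof (rule rhom_comp)
    show "kron ?ux e \<in> rhom (kron X (kron Xd X)) X" using rhom_kron [OF i(1) e] by simp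
    show "kron c ?ux \<in> rhom X (kron X (kron Xd X))" using rhom_kron [OF c i(1)] by (simp add: kron_assoc)
  qed
  have k\<phi>: "kron ?ux \<phi> \<in> rhom (kron X Xd) (kron X ?Y)" by (rule rhom_kron [OF i(1) \<phi>])
  note kz = rhom_kron [OF zr iY]
  have ku: "kron ?ux ?ux \<in> rhom (kron X ?Y) (kron X ?Y)" by (rule rhom_kron [OF i(1) iY])
  \<comment> \<open>On the coevaluation side it holds only for classes, since the zigzag identity
    for \<open>e\<close> and \<open>c\<close> is known only modulo negligible morphisms.\<close>
  have cc: "mor ?I (kron X ?Y) (kron ?ux \<phi> * c) = mor ?I (kron X ?Y) (cup ?x)"
  proof -
    have "mor ?I (kron X ?Y) (kron ?ux \<phi> * c) = mor ?I (kron X ?Y) (kron ?ux ?ux * cup ?x)"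
      unfolding coev by (rule ver_compositeD(2) [OF ver_kronD(1) [OF zz zr i(1) iY] kz ku cup])
    then show ?thesis by (simp add: kron_one)
  qed
  note b = rhom_braid [OF X Y(1)]
  have "e * (braid X Xd * c) = cap ?x * kron \<phi> ?ux * (braid X Xd * c)" unfolding ev ..
  also have "\<dots> = cap ?x * (kron \<phi> ?ux * braid X Xd) * c"
    by (simp add: mat_mult_assoc ed d\<phi> X Xd mult_ac)
  also have "kron \<phi> ?ux * braid X Xd = braid X ?Y * kron ?ux \<phi>"
    by (rule braid_natural [symmetric, OF X Xd X Y(1) Hom_id [OF X] rhomD(1) [OF \<phi>]])
  also have "cap ?x * (braid X ?Y * kron ?ux \<phi>) * c = (cap ?x * braid X ?Y) * (kron ?ux \<phi> * c)"
    by (simp add: mat_mult_assoc ed d\<phi> X Y mult_ac)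
  finally have "mor ?I ?I (e * (braid X Xd * c)) = mor ?I ?I ((cap ?x * braid X ?Y) * cup ?x)"
    using ver_compositeD(1) [OF cc rhom_comp [OF k\<phi> c] cup rhom_comp [OF cap b]] by simp
  also have "(cap ?x * braid X ?Y) * cup ?x = trace (par X) \<cdot>\<^sub>m 1\<^sub>m (Suc 0)"
    using cap_braid_cup [OF X pos two_nz [OF char]] X Y by (simp add: mat_mult_assoc)
  finally show ?thesis .
qed

lemma ver_scalar_inj:
  assumes "mor (1\<^sub>m (Suc 0)) (1\<^sub>m (Suc 0)) (a \<cdot>\<^sub>m 1\<^sub>m (Suc 0)) = mor (1\<^sub>m (Suc 0)) (1\<^sub>m (Suc 0)) (b \<cdot>\<^sub>m 1\<^sub>m (Suc 0) :: 'k mat)"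
  shows "a = b"
proof -
  let ?I = "1\<^sub>m (Suc 0) :: 'k mat"
  interpret symmetric_tensor_category "ver :: 'k small_tensor_cat" by (rule ver_symmetric_tensor_category [OF char])
  have i: "1\<^sub>m (Suc 0) \<in> rhom ?I ?I" using rhom_id [OF rep_unit_obj] by simp
  have "a \<star>\<^bsub>ver\<^esub> \<i>\<d>\<^bsub>ver\<^esub> \<I>\<^bsub>ver\<^esub> = b \<star>\<^bsub>ver\<^esub> \<i>\<d>\<^bsub>ver\<^esub> \<I>\<^bsub>ver\<^esub>"
    using assms ver_scale [OF i] by simp
  then show ?thesis using End_unit unfolding bij_betw_def inj_on_def by blast
qed

theorem ver_cat_dim:
  fixes X :: "'k mat"
  assumes X: "X \<in> rep_objs"
  shows "cat_dim ver X = trace (par X)"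
proof -
  let ?I = "1\<^sub>m (Suc 0) :: 'k mat"
  have i: "1\<^sub>m (Suc 0) \<in> rhom ?I ?I" using rhom_id [OF rep_unit_obj] by simp
  have s: "d \<star>\<^bsub>ver\<^esub> \<i>\<d>\<^bsub>ver\<^esub> \<I>\<^bsub>ver\<^esub> = mor ?I ?I (d \<cdot>\<^sub>m ?I)" for d
    using ver_scale [OF i] by simp
  have val: "ev \<cdot>\<^bsub>ver\<^esub> Braid ver X Xd \<cdot>\<^bsub>ver\<^esub> coev = mor ?I ?I (trace (par X) \<cdot>\<^sub>m ?I)"
    if ld: "left_dual ver X Xd ev coev" for Xd ev coev
  proof -
    have h: "Xd \<in> rep_objs" "ev \<in> hom ver (kron Xd X) ?I" "coev \<in> hom ver ?I (kron X Xd)"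
      using ld unfolding left_dual_def by simp_all
    obtain e where e: "e \<in> rhom (kron Xd X) ?I" "ev = mor (kron Xd X) ?I e" using h(2) by (rule ver_homE)
    obtain c where c: "c \<in> rhom ?I (kron X Xd)" "coev = mor ?I (kron X Xd) c" using h(3) by (rule ver_homE)
    note b = rhom_braid [OF X h(1)]
    have "ev \<cdot>\<^bsub>ver\<^esub> Braid ver X Xd \<cdot>\<^bsub>ver\<^esub> coev = mor ?I ?I (e * (braid X Xd * c))"
      unfolding e(2) c(2) ver_sel ver_comp [OF b c(1)] ver_comp [OF e(1) rhom_comp [OF b c(1)]] ..
    also have "\<dots> = mor ?I ?I (trace (par X) \<cdot>\<^sub>m ?I)"
      using ld dual_dim_scalar [OF X h(1) e(1) c(1)] ver_left_dual_iff [OF char X h(1) e(1) c(1)]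
      unfolding e(2) c(2) by blast
    finally show ?thesis .
  qed
  show ?thesis
    unfolding cat_dim_def s
  proof (rule the_equality)
    show "\<exists>Xd ev coev. left_dual ver X Xd ev coev \<and>
        ev \<cdot>\<^bsub>ver\<^esub> Braid ver X Xd \<cdot>\<^bsub>ver\<^esub> coev = mor ?I ?I (trace (par X) \<cdot>\<^sub>m ?I)"
      using ver_dual [OF char X] val by blast
    show "d = trace (par X)" if "\<exists>Xd ev coev. left_dual ver X Xd ev coev \<and>
        ev \<cdot>\<^bsub>ver\<^esub> Braid ver X Xd \<cdot>\<^bsub>ver\<^esub> coev = mor ?I ?I (d \<cdot>\<^sub>m ?I)" for d
      using that val ver_scalar_inj by metis
  qed
qed

text \<open>The supertrace of an endomorphism depends only on its class, so isomorphic objects of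
  the quotient have equal supertraces even when their matrices have different sizes.\<close>

lemma trace_par_iso:
  fixes X Y :: "'k mat"
  assumes f: "f \<in> rhom X Y" and g: "g \<in> rhom Y X"
    and gf: "mor X X (g * f) = mor X X (1\<^sub>m (dim_row X))" and fg: "mor Y Y (f * g) = mor Y Y (1\<^sub>m (dim_row Y))"
  shows "trace (par X) = trace (par Y)"
proof -
  have *: "trace (par X * h) = trace (par X)"
    if h: "h \<in> rhom X X" and eq: "mor X X h = mor X X (1\<^sub>m (dim_row X))" for X h :: "'k mat"
  proof -
    note X = rhomD(2) [OF h]
    have "h - 1\<^sub>m (dim_row X) \<in> negl X X" using mor_eq [OF h rhom_id [OF X]] eq by simp
    then have "trace (par X * ((h - 1\<^sub>m (dim_row X)) * 1\<^sub>m (dim_row X))) = 0"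
      using neglD Hom_id [OF X] by blast
    then show ?thesis
      using X by (simp add: rhom_dims [OF h] mat_mult_diff trace_diff)
  qed
  have "trace (par X) = trace (par X * (g * f))" using *[OF rhom_comp [OF g f] gf] ..
  also have "\<dots> = trace (par Y * (f * g))"
    using supertrace_commute [OF rhomD(2,3) [OF g] rhomD(1) [OF g] rhomD(1) [OF f]] .
  also have "\<dots> = trace (par Y)" using *[OF rhom_comp [OF f g] fg] .
  finally show ?thesis .
qed

end

subsection \<open>Symmetric and exterior powers\<close>

primrec tpow :: "'k::semiring_1 mat \<Rightarrow> nat \<Rightarrow> 'k mat" where
  "tpow X 0 = 1\<^sub>m (Suc 0)"
| "tpow X (Suc n) = kron X (tpow X n)"

lemma dim_tpow [simp]: "dim_row (tpow X n) = dim_row X ^ n"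
  by (induction n) auto

lemma tpow_obj: "X \<in> rep_objs \<Longrightarrow> tpow X n \<in> rep_objs"
  by (induction n) (auto simp: kron_obj rep_unit_obj)

lemma kron_tpow: "kron (tpow X i) (tpow X j) = tpow X (i + j)"
  for X :: "'k::comm_ring_1 mat"
  by (induction i) (auto simp: kron_assoc)

lemma tensor_power_ver: "tensor_power ver X n = tpow X n"
  by (induction n) auto

definition place :: "'k::semiring_1 mat \<Rightarrow> nat \<Rightarrow> nat \<Rightarrow> 'k mat \<Rightarrow> 'k mat" where
  "place X i j r = kron (1\<^sub>m (dim_row X ^ i)) (kron r (1\<^sub>m (dim_row X ^ j)))"

lemma dim_place [simp]:
  "dim_row (place X i j r) = dim_row X ^ i * (dim_row r * dim_row X ^ j)"
  "dim_col (place X i j r) = dim_row X ^ i * (dim_col r * dim_row X ^ j)"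
  by (simp_all add: place_def)

lemma place_mult: "dim_col r = dim_row r' \<Longrightarrow> place X i j (r * r') = place X i j r * place X i j r'"
  for X :: "'k::comm_semiring_1 mat"
  by (simp add: place_def flip: kron_mult)

lemma place_add: "dim_row r = dim_row r' \<Longrightarrow> dim_col r = dim_col r' \<Longrightarrow> place X i j (r + r') = place X i j r + place X i j r'"
  for X :: "'k::comm_semiring_1 mat"
  by (simp add: place_def kron_add_left kron_add_right)

lemma place_one: "place X i j (1\<^sub>m (dim_row X * dim_row X)) = 1\<^sub>m (dim_row X ^ (i + j + 2))"
  for X :: "'k::comm_semiring_1 mat"
  by (simp add: place_def kron_one power_add power2_eq_square mult_ac)

lemma place_Suc: "place X (Suc i) j r = kron (1\<^sub>m (dim_row X)) (place X i j r)"
  for X :: "'k::comm_semiring_1 mat"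
  by (simp add: place_def kron_assoc flip: kron_one)

lemma place_0: "place X 0 j r = kron r (1\<^sub>m (dim_row X ^ j))"
  by (simp add: place_def)

lemma rhom_place:
  fixes X :: "'k::field mat"
  assumes X: "X \<in> rep_objs" and r: "r \<in> rhom A B"
  shows "place X i j r \<in> rhom (kron (tpow X i) (kron A (tpow X j))) (kron (tpow X i) (kron B (tpow X j)))"
  unfolding place_def
  using rhom_kron [OF rhom_id [OF tpow_obj [OF X]] rhom_kron [OF r rhom_id [OF tpow_obj [OF X]]], of i j] by simp

lemma kron_tpow3: "kron (tpow X i) (kron (kron X X) (tpow X j)) = tpow X (i + j + 2)"
  for X :: "'k::comm_ring_1 mat"
proof -
  have "kron (tpow X i) (kron (kron X X) (tpow X j)) = kron (tpow X i) (tpow X (Suc (Suc j)))"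
    by (simp add: kron_assoc)
  then show ?thesis unfolding kron_tpow by simp
qed

text \<open>Invariance (\<open>\<epsilon> = 1\<close>) or anti-invariance
  (\<open>\<epsilon> = -1\<close>) under all adjacent transpositions, as an identity of
  classes.\<close>

definition twisted :: "'k::field \<Rightarrow> 'k mat \<Rightarrow> nat \<Rightarrow> 'k mat \<Rightarrow> 'k mat \<Rightarrow> bool" where
  "twisted \<epsilon> X n Z a \<longleftrightarrow> (\<forall>i j. i + j + 2 = n \<longrightarrow>
     mor (tpow X n) Z (a * place X i j (braid X X)) = mor (tpow X n) Z (\<epsilon> \<cdot>\<^sub>m a))"

text \<open>An equational form of the universal property: \<open>q\<close> has a section
  \<open>s\<close>, and every twisted map absorbs the idempotent \<open>s * q\<close>, hence factors
  through \<open>q\<close>.\<close>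

definition power_split :: "'k::field \<Rightarrow> 'k mat \<Rightarrow> nat \<Rightarrow> 'k mat \<Rightarrow> bool" where
  "power_split \<epsilon> X n Q \<longleftrightarrow> (\<exists>q \<in> rhom (tpow X n) Q. \<exists>s \<in> rhom Q (tpow X n).
     mor Q Q (q * s) = mor Q Q (1\<^sub>m (dim_row Q)) \<and> twisted \<epsilon> X n Q q \<and>
     (\<forall>Z. \<forall>a \<in> rhom (tpow X n) Z. twisted \<epsilon> X n Z a \<longrightarrow> mor (tpow X n) Z (a * (s * q)) = mor (tpow X n) Z a))"

section \<open>Quadratic quotients of the tensor algebra in the semisimplification\<close>

context
  fixes K :: "'k::field itself"
  assumes char: "CHAR('k) > 2"
begin

lemma ideal_gen_ver:
  fixes X :: "'k mat"
  assumes X: "X \<in> rep_objs" and r: "r \<in> rhom A (kron X X)"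
  shows "ideal_gen ver X (mor A (kron X X) r) i j =
    mor (kron (tpow X i) (kron A (tpow X j))) (tpow X (i + j + 2)) (place X i j r)"
proof (induction i)
  case 0
  let ?T = "tpow X j"
  have T: "?T \<in> rep_objs" by (rule tpow_obj [OF X])
  have o: "kron X (kron X ?T) \<in> rep_objs" by (intro kron_obj X T)
  have i: "1\<^sub>m (dim_row X * (dim_row X * dim_row ?T)) \<in> rhom (kron X (kron X ?T)) (kron X (kron X ?T))"
    using rhom_id [OF o] by simp
  have k: "kron r (1\<^sub>m (dim_row ?T)) \<in> rhom (kron A ?T) (kron X (kron X ?T))"
    using rhom_kron [OF r rhom_id [OF T]] by (simp add: kron_assoc)
  have "ideal_gen ver X (mor A (kron X X) r) 0 j =
      Assoc ver X X ?T \<cdot>\<^bsub>ver\<^esub> (mor A (kron X X) r \<boxdot>\<^bsub>ver\<^esub> \<i>\<d>\<^bsub>ver\<^esub> ?T)"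
    by (simp add: tensor_power_ver)
  also have "mor A (kron X X) r \<boxdot>\<^bsub>ver\<^esub> \<i>\<d>\<^bsub>ver\<^esub> ?T = mor (kron A ?T) (kron X (kron X ?T)) (kron r (1\<^sub>m (dim_row ?T)))"
    using ver_tensor [OF char r rhom_id [OF T]] by (simp add: kron_assoc)
  also have "Assoc ver X X ?T \<cdot>\<^bsub>ver\<^esub> \<dots> = mor (kron A ?T) (kron X (kron X ?T)) (kron r (1\<^sub>m (dim_row ?T)))"
    unfolding ver_sel ver_comp [OF i k] using rhom_dims [OF k] by simp
  finally show ?case by (simp add: place_0)
next
  case (Suc i)
  have "ideal_gen ver X (mor A (kron X X) r) (Suc i) j =
      mor X X (1\<^sub>m (dim_row X)) \<boxdot>\<^bsub>ver\<^esub> mor (kron (tpow X i) (kron A (tpow X j))) (tpow X (i + j + 2)) (place X i j r)"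
    using Suc by simp
  also have "\<dots> = mor (kron X (kron (tpow X i) (kron A (tpow X j)))) (kron X (tpow X (i + j + 2))) (kron (1\<^sub>m (dim_row X)) (place X i j r))"
    by (rule ver_tensor [OF char rhom_id [OF X]]) (use rhom_place [OF X r, of i j] in \<open>simp only: kron_tpow3\<close>)
  finally show ?case by (simp add: place_Suc kron_assoc)
qed

lemma braid_minus_id_ver:
  fixes X :: "'k mat"
  assumes X: "X \<in> rep_objs"
  shows "braid_minus_id ver X = mor (kron X X) (kron X X) (braid X X - 1\<^sub>m (dim_row X * dim_row X))"
    and "braid X X - 1\<^sub>m (dim_row X * dim_row X) \<in> rhom (kron X X) (kron X X)"
proof -
  have i: "1\<^sub>m (dim_row X * dim_row X) \<in> rhom (kron X X) (kron X X)"
    using rhom_id [OF kron_obj [OF X X]] by simp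
  note b = rhom_braid [OF X X]
  have "braid X X + (-1) \<cdot>\<^sub>m 1\<^sub>m (dim_row X * dim_row X) = braid X X - 1\<^sub>m (dim_row X * dim_row X)"
    by (rule eq_matI) (simp_all add: X)
  then show "braid_minus_id ver X = mor (kron X X) (kron X X) (braid X X - 1\<^sub>m (dim_row X * dim_row X))"
    unfolding braid_minus_id_def using ver_scale [OF i] ver_add [OF b rhom_smult [OF i]] by simp
  show "braid X X - 1\<^sub>m (dim_row X * dim_row X) \<in> rhom (kron X X) (kron X X)"
    by (rule rhom_diff [OF b i])
qed

lemma kills_ideal_ver:
  fixes X :: "'k mat"
  assumes X: "X \<in> rep_objs" and r: "r \<in> rhom A (kron X X)" and a: "a \<in> rhom (tpow X n) Z"
  shows "kills_ideal ver X (mor A (kron X X) r) n (mor (tpow X n) Z a) \<longleftrightarrow>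
    (\<forall>i j. i + j + 2 = n \<longrightarrow> a * place X i j r \<in> negl (kron (tpow X i) (kron A (tpow X j))) Z)"
proof -
  have "mor (tpow X n) Z a \<cdot>\<^bsub>ver\<^esub> ideal_gen ver X (mor A (kron X X) r) i j =
      \<z>\<^bsub>ver\<^esub> (Dom ver (ideal_gen ver X (mor A (kron X X) r) i j)) (Cod ver (mor (tpow X n) Z a)) \<longleftrightarrow>
      a * place X i j r \<in> negl (kron (tpow X i) (kron A (tpow X j))) Z"
    if n: "i + j + 2 = n" for i j
  proof -
    have p: "place X i j r \<in> rhom (kron (tpow X i) (kron A (tpow X j))) (tpow X n)"
      using rhom_place [OF X r, of i j] unfolding kron_tpow3 n .
    show ?thesis
      unfolding ideal_gen_ver [OF X r] n ver_comp [OF a p] ver_sel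
      by (rule mor_eq_zero [OF rhom_comp [OF a p]])
  qed
  then show ?thesis unfolding kills_ideal_def by blast
qed

lemma place_braid_rhom:
  fixes X :: "'k mat"
  assumes X: "X \<in> rep_objs" and n: "i + j + 2 = n"
  shows "place X i j (braid X X) \<in> rhom (tpow X n) (tpow X n)"
  using rhom_place [OF X rhom_braid [OF X X], of i j] unfolding kron_tpow3 n .

lemma kills_sym:
  fixes X :: "'k mat"
  assumes X: "X \<in> rep_objs" and a: "a \<in> rhom (tpow X n) Z"
  shows "kills_ideal ver X (braid_minus_id ver X) n (mor (tpow X n) Z a) \<longleftrightarrow> twisted 1 X n Z a"
proof -
  have "a * place X i j (braid X X - 1\<^sub>m (dim_row X * dim_row X)) \<in> negl (kron (tpow X i) (kron (kron X X) (tpow X j))) Z \<longleftrightarrow>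
      mor (tpow X n) Z (a * place X i j (braid X X)) = mor (tpow X n) Z (1 \<cdot>\<^sub>m a)" if n: "i + j + 2 = n" for i j
  proof -
    note p = place_braid_rhom [OF X n]
    have "place X i j (braid X X - 1\<^sub>m (dim_row X * dim_row X)) = place X i j (braid X X) - 1\<^sub>m (dim_row X ^ n)"
      using X unfolding place_one [of X i j, unfolded n, symmetric] place_def by (simp add: kron_diff_left kron_diff_right)
    then have "a * place X i j (braid X X - 1\<^sub>m (dim_row X * dim_row X)) = a * place X i j (braid X X) - 1 \<cdot>\<^sub>m a"
      using rhom_dims [OF a] rhom_dims [OF p] by (simp add: mat_mult_diff mat_one_smult)
    then show ?thesis
      unfolding kron_tpow3 n using mor_eq [OF rhom_comp [OF a p] rhom_smult [OF a, of 1]] by simp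
  qed
  then show ?thesis
    unfolding twisted_def braid_minus_id_ver(1) [OF X] kills_ideal_ver [OF X braid_minus_id_ver(2) [OF X] a] by blast
qed

text \<open>As the braiding \<open>c\<close> is an involution and 2 is invertible, the kernel of
  \<open>c - 1\<close> is the image of \<open>c + 1\<close>. Killing the kernel therefore means
  \<open>a * (c + 1) = 0\<close>, whichever kernel was chosen.\<close>

lemma kills_ext:
  fixes X :: "'k mat"
  assumes X: "X \<in> rep_objs" and a: "a \<in> rhom (tpow X n) Z" and \<kappa>: "is_kernel ver \<kappa> (braid_minus_id ver X)"
  shows "kills_ideal ver X \<kappa> n (mor (tpow X n) Z a) \<longleftrightarrow> twisted (-1) X n Z a"
proof -
  let ?XX = "kron X X" and ?u = "1\<^sub>m (dim_row X * dim_row X) :: 'k mat" and ?c = "braid X X"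
  note Z = rhomD(3) [OF a]
  note b = rhom_braid [OF X X] and c1 = braid_minus_id_ver(2) [OF X]
  have i: "?u \<in> rhom ?XX ?XX" using rhom_id [OF kron_obj [OF X X]] by simp
  have dc: "dim_row ?c = dim_row X * dim_row X" "dim_col ?c = dim_row X * dim_row X" using X by simp_all
  have cc: "?c * ?c = ?u" by (rule braid_symmetric [OF X X two_nz [OF char]])
  define A where "A = Dom ver \<kappa>"
  have "\<kappa> \<in> hom ver A ?XX"
    using \<kappa> unfolding is_kernel_def A_def braid_minus_id_ver(1) [OF X] by simp
  then obtain k where k: "k \<in> rhom A ?XX" "\<kappa> = mor A ?XX k" by (rule ver_homE)
  note A = rhomD(2) [OF k(1)] and dk = rhom_dims [OF k(1)]
  have ck: "(?c - ?u) * k \<in> negl A ?XX"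
    using \<kappa> unfolding is_kernel_def k(2) braid_minus_id_ver(1) [OF X]
    using ver_comp [OF c1 k(1)] mor_eq_zero [OF rhom_comp [OF c1 k(1)]] by simp
  have pr: "?c + ?u \<in> rhom ?XX ?XX" by (rule rhom_add [OF b i])
  \<comment> \<open>Hence \<open>c + 1\<close> factors through the kernel, say as
    \<open>k * v\<close> modulo negligible morphisms.\<close>
  have "(?c - ?u) * (?c + ?u) = 0\<^sub>m (dim_row X * dim_row X) (dim_row X * dim_row X)"
    by (rule eq_matI) (simp_all add: mat_distribs dc cc)
  then have "mor ?XX ?XX (?c - ?u) \<cdot>\<^bsub>ver\<^esub> mor ?XX ?XX (?c + ?u) = \<z>\<^bsub>ver\<^esub> ?XX ?XX"
    using ver_comp [OF c1 pr] by simp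
  then obtain u where u: "u \<in> hom ver ?XX A" "\<kappa> \<cdot>\<^bsub>ver\<^esub> u = mor ?XX ?XX (?c + ?u)"
    using \<kappa> ver_homI [OF pr] unfolding is_kernel_def braid_minus_id_ver(1) [OF X] k(2) ver_sel by blast
  obtain v where v: "v \<in> rhom ?XX A" "u = mor ?XX A v" using u(1) by (rule ver_homE)
  have kv: "mor ?XX ?XX (k * v) = mor ?XX ?XX (?c + ?u)" using u(2) ver_comp [OF k(1) v(1)] unfolding k(2) v(2) by simp
  have "a * place X i j k \<in> negl (kron (tpow X i) (kron A (tpow X j))) Z \<longleftrightarrow>
      mor (tpow X n) Z (a * place X i j ?c) = mor (tpow X n) Z (-1 \<cdot>\<^sub>m a)" if n: "i + j + 2 = n" for i j
  proof -
    let ?P = "place X i j" and ?T = "tpow X n" and ?B = "kron (tpow X i) (kron A (tpow X j))"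
    have T: "?T \<in> rep_objs" by (rule tpow_obj [OF X])
    have B: "?B \<in> rep_objs" by (intro kron_obj tpow_obj X A)
    note da = rhom_dims [OF a]
    have p: "?P r \<in> rhom ?T ?T" if "r \<in> rhom ?XX ?XX" for r
      using rhom_place [OF X that, of i j] unfolding kron_tpow3 n .
    have pk: "?P k \<in> rhom ?B ?T" using rhom_place [OF X k(1), of i j] unfolding kron_tpow3 n .
    have pv: "?P v \<in> rhom ?T ?B" using rhom_place [OF X v(1), of i j] unfolding kron_tpow3 n .
    have neg: "mor ?T Z (a * ?P ?c) = mor ?T Z (-1 \<cdot>\<^sub>m a) \<longleftrightarrow> a * ?P (?c + ?u) \<in> negl ?T Z"
    proof -
      have "?P (?c + ?u) = ?P ?c + ?P ?u" by (rule place_add) (simp_all add: dc)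
      also have "?P ?u = 1\<^sub>m (dim_row X ^ n)" using place_one [of X i j] unfolding n .
      finally have "?P (?c + ?u) = ?P ?c + 1\<^sub>m (dim_row X ^ n)" .
      then have "a * ?P (?c + ?u) = a * ?P ?c - (-1 \<cdot>\<^sub>m a)"
        using da rhom_dims [OF p [OF b]] by (simp add: mat_mult_add) (rule eq_matI; simp)
      then show ?thesis using mor_eq [OF rhom_comp [OF a p [OF b]] rhom_smult [OF a, of "-1"]] by simp
    qed
    have d1: "k * v - (?c + ?u) \<in> negl ?XX ?XX"
      using mor_eq [OF rhom_comp [OF k(1) v(1)] pr] kv by simp
    have place_negl: "?P r \<in> negl (kron (tpow X i) (kron U (tpow X j))) (kron (tpow X i) (kron V (tpow X j)))"
      if "r \<in> negl U V" "U \<in> rep_objs" "V \<in> rep_objs" for r U V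
    proof -
      have ids: "1\<^sub>m (dim_row X ^ l) \<in> Hom (tpow X l) (tpow X l)" for l
        using Hom_id [OF tpow_obj [OF X, of l]] by simp
      show ?thesis
        unfolding place_def
        by (intro negl_kron(2) [OF _ _ _ _ char_pos [OF char] two_nz [OF char]]
            negl_kron(1) [OF _ _ _ _ char_pos [OF char] two_nz [OF char]] kron_obj tpow_obj X that ids)
    qed
    show ?thesis
      unfolding neg
    proof
      assume "a * ?P k \<in> negl ?B Z"
      then have "a * ?P k * ?P v \<in> negl ?T Z" by (rule negl_comp_right [OF B Z T _ rhomD(1) [OF pv]])
      moreover have "?P (k * v - (?c + ?u)) \<in> negl ?T ?T"
        using place_negl [OF d1 kron_obj [OF X X] kron_obj [OF X X]] unfolding kron_tpow3 n .
      then have "(-1) \<cdot>\<^sub>m (a * ?P (k * v - (?c + ?u))) \<in> negl ?T Z"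
        by (intro negl_smult T Z negl_comp_left [OF T T Z _ rhomD(1) [OF a]])
      ultimately have "a * ?P k * ?P v + (-1) \<cdot>\<^sub>m (a * ?P (k * v - (?c + ?u))) \<in> negl ?T Z"
        by (rule negl_add [OF T Z])
      also have "a * ?P k * ?P v = a * ?P (k * v)"
        using dk rhom_dims [OF v(1)] da rhom_dims [OF pk] rhom_dims [OF pv] by (simp add: place_mult mat_mult_assoc)
      also have "a * ?P (k * v) + (-1) \<cdot>\<^sub>m (a * ?P (k * v - (?c + ?u))) = a * ?P (?c + ?u)"
      proof -
        note pp = rhom_dims [OF p [OF rhom_comp [OF k(1) v(1)]]] rhom_dims [OF p [OF pr]]
        have "?P (k * v - (?c + ?u)) = ?P (k * v) - ?P (?c + ?u)"
          using dk rhom_dims [OF v(1)] dc by (simp add: place_def kron_diff_left kron_diff_right)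
        then have "a * ?P (k * v - (?c + ?u)) = a * ?P (k * v) - a * ?P (?c + ?u)"
          using pp da by (simp add: mat_mult_diff)
        then show ?thesis
          using pp da by (intro eq_matI) simp_all
      qed
      finally show "a * ?P (?c + ?u) \<in> negl ?T Z" .
    next
      assume "a * ?P (?c + ?u) \<in> negl ?T Z"
      then have "a * ?P (?c + ?u) * ?P k \<in> negl ?B Z" by (rule negl_comp_right [OF T Z B _ rhomD(1) [OF pk]])
      moreover have "?P ((?c - ?u) * k) \<in> negl ?B ?T"
        using place_negl [OF ck A kron_obj [OF X X]] unfolding kron_tpow3 n .
      then have "(-1) \<cdot>\<^sub>m (a * ?P ((?c - ?u) * k)) \<in> negl ?B Z"
        by (intro negl_smult B Z negl_comp_left [OF B T Z _ rhomD(1) [OF a]])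
      ultimately have "(1/2) \<cdot>\<^sub>m (a * ?P (?c + ?u) * ?P k + (-1) \<cdot>\<^sub>m (a * ?P ((?c - ?u) * k))) \<in> negl ?B Z"
        by (rule negl_smult [OF B Z negl_add [OF B Z]])
      also have "a * ?P (?c + ?u) * ?P k = a * ?P ((?c + ?u) * k)"
        using dk dc da rhom_dims [OF pk] rhom_dims [OF p [OF pr]] by (simp add: place_mult mat_mult_assoc)
      \<comment> \<open>From \<open>2 * k = (c + 1) * k - (c - 1) * k\<close>, whose second term is
        negligible.\<close>
      also have "(1/2) \<cdot>\<^sub>m (a * ?P ((?c + ?u) * k) + (-1) \<cdot>\<^sub>m (a * ?P ((?c - ?u) * k))) = a * ?P k"
      proof -
        have ckr: "?c * k \<in> rhom A ?XX" by (rule rhom_comp [OF b k(1)])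
        note pp = rhom_dims [OF pk] rhom_dims [OF rhom_place [OF X ckr, of i j, unfolded kron_tpow3 n]]
        have 1: "(?c + ?u) * k = ?c * k + k" "(?c - ?u) * k = ?c * k - k" using dk dc by (simp_all add: mat_distribs)
        have 2: "?P (?c * k + k) = ?P (?c * k) + ?P k" "?P (?c * k - k) = ?P (?c * k) - ?P k"
          using dk dc by (simp_all add: place_def kron_diff_left kron_diff_right kron_add_left kron_add_right)
        have h: "x / 2 + x / 2 = x" for x :: 'k using two_nz [OF char] by (simp add: field_simps)
        have "(y + x) / 2 - (y - x) / 2 = x" for x y :: 'k
          using h by (simp add: add_divide_distrib diff_divide_distrib)
        then show ?thesis
          unfolding 1 2 using pp da by (intro eq_matI) (simp_all add: mat_mult_add mat_mult_diff two_nz [OF char])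
      qed
      finally show "a * ?P k \<in> negl ?B Z" .
    qed
  qed
  then show ?thesis
    unfolding twisted_def k(2) kills_ideal_ver [OF X k(1) a] by blast
qed

lemma power_split_quotient:
  fixes X :: "'k mat"
  assumes split: "power_split \<epsilon> X n Q"
    and P: "\<And>Z a. a \<in> rhom (tpow X n) Z \<Longrightarrow> kills_ideal ver X r n (mor (tpow X n) Z a) \<longleftrightarrow> twisted \<epsilon> X n Z a"
  shows "\<exists>q. quadratic_quotient ver X r n Q q"
proof -
  interpret tc_category "ver :: 'k small_tensor_cat" by (rule ver_category [OF char])
  obtain q s where q: "q \<in> rhom (tpow X n) Q" and s: "s \<in> rhom Q (tpow X n)"
    and qs: "mor Q Q (q * s) = mor Q Q (1\<^sub>m (dim_row Q))" and tq: "twisted \<epsilon> X n Q q"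
    and abs: "\<And>Z a. a \<in> rhom (tpow X n) Z \<Longrightarrow> twisted \<epsilon> X n Z a \<Longrightarrow> mor (tpow X n) Z (a * (s * q)) = mor (tpow X n) Z a"
    using split unfolding power_split_def by blast
  let ?T = "tpow X n"
  note Q = rhomD(3) [OF q]
  have "\<exists>!u. u \<in> hom ver Q Z \<and> u \<cdot>\<^bsub>ver\<^esub> mor ?T Q q = h"
    if h: "h \<in> hom ver ?T Z" and kills: "kills_ideal ver X r n h" for Z h
  proof -
    obtain a where a: "a \<in> rhom ?T Z" "h = mor ?T Z a" using h by (rule ver_homE)
    have as: "a * s \<in> rhom Q Z" by (rule rhom_comp [OF a(1) s])
    show ?thesis
    proof (rule ex1I [of _ "mor Q Z (a * s)"])
      have "a * s * q = a * (s * q)"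
        using rhom_dims [OF a(1)] rhom_dims [OF s] rhom_dims [OF q] by (simp add: mat_mult_assoc)
      then show "mor Q Z (a * s) \<in> hom ver Q Z \<and> mor Q Z (a * s) \<cdot>\<^bsub>ver\<^esub> mor ?T Q q = h"
        using ver_homI [OF as] ver_comp [OF as q] abs [OF a(1)] P [OF a(1)] kills a(2) by simp
      fix u assume u: "u \<in> hom ver Q Z \<and> u \<cdot>\<^bsub>ver\<^esub> mor ?T Q q = h"
      have "u = u \<cdot>\<^bsub>ver\<^esub> mor Q Q (q * s)" unfolding qs using id_right [of u Q Z] u by simp
      also have "\<dots> = (u \<cdot>\<^bsub>ver\<^esub> mor ?T Q q) \<cdot>\<^bsub>ver\<^esub> mor Q ?T s"
        using comp_assoc [OF ver_homI [OF s] ver_homI [OF q], where h = u and Z = Z] u ver_comp [OF q s] by simp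
      also have "\<dots> = mor Q Z (a * s)" using u a(2) ver_comp [OF a(1) s] by simp
      finally show "u = mor Q Z (a * s)" .
    qed
  qed
  then have "quadratic_quotient ver X r n Q (mor ?T Q q)"
    unfolding quadratic_quotient_def tensor_power_ver using ver_homI [OF q] P [OF q] tq by blast
  then show ?thesis by blast
qed

text \<open>The powers are picked by \<open>SOME\<close>, and \<open>ext_power\<close> picks the
  kernel as well. So quotients by two relations \<open>r\<close> and \<open>r'\<close> must be
  compared, which is possible as soon as they kill the same maps.\<close>

lemma cat_dim_quotient:
  fixes X :: "'k mat"
  assumes Q: "quadratic_quotient ver X r n Q q" and Q': "quadratic_quotient ver X r' n Q' q'"
    and P: "\<And>Z a. a \<in> rhom (tpow X n) Z \<Longrightarrow> kills_ideal ver X r n (mor (tpow X n) Z a) \<longleftrightarrow> kills_ideal ver X r' n (mor (tpow X n) Z a)"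
  shows "cat_dim ver Q = cat_dim ver Q'"
proof -
  interpret tc_category "ver :: 'k small_tensor_cat" by (rule ver_category [OF char])
  let ?T = "tpow X n"
  have P': "kills_ideal ver X r n h \<longleftrightarrow> kills_ideal ver X r' n h" if "h \<in> hom ver ?T Z" for Z h
    using that P by (metis ver_homE)
  note q = Q [unfolded quadratic_quotient_def tensor_power_ver] and q' = Q' [unfolded quadratic_quotient_def tensor_power_ver]
  have "\<exists>u \<in> hom ver Q Q'. \<exists>v \<in> hom ver Q' Q. v \<cdot>\<^bsub>ver\<^esub> u = \<i>\<d>\<^bsub>ver\<^esub> Q \<and> u \<cdot>\<^bsub>ver\<^esub> v = \<i>\<d>\<^bsub>ver\<^esub> Q'"
    by (rule universal_quotient_unique [of q ?T Q "kills_ideal ver X r n" q' Q']) (use q q' P' in blast)+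
  then obtain u v where uv: "u \<in> hom ver Q Q'" "v \<in> hom ver Q' Q" "v \<cdot>\<^bsub>ver\<^esub> u = \<i>\<d>\<^bsub>ver\<^esub> Q" "u \<cdot>\<^bsub>ver\<^esub> v = \<i>\<d>\<^bsub>ver\<^esub> Q'"
    by blast
  obtain f where f: "f \<in> rhom Q Q'" "u = mor Q Q' f" using uv(1) by (rule ver_homE)
  obtain g where g: "g \<in> rhom Q' Q" "v = mor Q' Q g" using uv(2) by (rule ver_homE)
  have "trace (par Q) = trace (par Q')"
    by (rule trace_par_iso [OF char f(1) g(1)])
      (use uv(3,4) in \<open>simp_all add: f(2) g(2) ver_comp [OF f(1) g(1)] ver_comp [OF g(1) f(1)]\<close>)
  then show ?thesis using ver_cat_dim [OF char] rhomD(2,3) [OF f(1)] by simp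
qed

lemma cat_dim_sym_power:
  fixes X :: "'k mat"
  assumes X: "X \<in> rep_objs" and split: "power_split 1 X n Q"
  shows "cat_dim ver (sym_power ver n X) = trace (par Q)"
proof -
  have ex: "\<exists>q. quadratic_quotient ver X (braid_minus_id ver X) n Q q"
    by (rule power_split_quotient [OF split kills_sym [OF X]])
  then have "\<exists>q. quadratic_quotient ver X (braid_minus_id ver X) n (sym_power ver n X) q"
    unfolding sym_power_def by (rule someI)
  then have "cat_dim ver (sym_power ver n X) = cat_dim ver Q"
    using ex cat_dim_quotient by blast
  also have "Q \<in> rep_objs" using split unfolding power_split_def by (auto dest: rhomD)
  then have "cat_dim ver Q = trace (par Q)" by (rule ver_cat_dim [OF char])
  finally show ?thesis .
qed

lemma cat_dim_ext_power:
  fixes X :: "'k mat"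
  assumes X: "X \<in> rep_objs" and split: "power_split (-1) X n Q"
  shows "cat_dim ver (ext_power ver n X) = trace (par Q)"
proof -
  interpret symmetric_tensor_category "ver :: 'k small_tensor_cat" by (rule ver_symmetric_tensor_category [OF char])
  have "braid_minus_id ver X \<in> Mor ver"
    using hom_dom(3) [OF ver_homI [OF braid_minus_id_ver(2) [OF X]]] unfolding braid_minus_id_ver(1) [OF X] .
  then obtain \<kappa> where \<kappa>: "is_kernel ver \<kappa> (braid_minus_id ver X)" using ex_kernel by blast
  have ex: "\<exists>q. quadratic_quotient ver X \<kappa> n Q q"
    by (rule power_split_quotient [OF split kills_ext [OF X _ \<kappa>]])
  with \<kappa> have "\<exists>\<kappa> q. is_kernel ver \<kappa> (braid_minus_id ver X) \<and> quadratic_quotient ver X \<kappa> n Q q" by blast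
  then have "\<exists>\<kappa> q. is_kernel ver \<kappa> (braid_minus_id ver X) \<and> quadratic_quotient ver X \<kappa> n (ext_power ver n X) q"
    unfolding ext_power_def by (rule someI)
  then obtain \<kappa>' q' where \<kappa>': "is_kernel ver \<kappa>' (braid_minus_id ver X)" "quadratic_quotient ver X \<kappa>' n (ext_power ver n X) q'"
    by blast
  obtain q where q: "quadratic_quotient ver X \<kappa> n Q q" using ex by blast
  have "cat_dim ver (ext_power ver n X) = cat_dim ver Q"
    by (rule cat_dim_quotient [OF \<kappa>'(2) q]) (simp add: kills_ext [OF X _ \<kappa>'(1)] kills_ext [OF X _ \<kappa>])
  also have "Q \<in> rep_objs" using split unfolding power_split_def by (auto dest: rhomD)
  then have "cat_dim ver Q = trace (par Q)" by (rule ver_cat_dim [OF char])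
  finally show ?thesis .
qed

end

subsection \<open>Powers from creation and annihilation operators\<close>

text \<open>
  The objects \<open>S j\<close> are candidates for the symmetric (\<open>\<epsilon> = 1\<close>) or exterior (\<open>\<epsilon> = -1\<close>) powers of \<open>X\<close>,
  with multiplication \<open>m j : X \<otimes> S j \<rightarrow> S (j + 1)\<close> and comultiplication \<open>\<Delta> j\<close> in the other direction.
  The relation \<open>comm\<close> is the (anti)commutation relation of creation and annihilation operators.
\<close>

locale fock =
  fixes X :: "'k::field mat" and S m \<Delta> :: "nat \<Rightarrow> 'k mat" and \<epsilon> :: 'k and N :: nat
  assumes char: "CHAR('k) > 2" and X: "X \<in> rep_objs" and S0: "S 0 = 1\<^sub>m (Suc 0)"
    and m: "\<And>j. j < N \<Longrightarrow> m j \<in> rhom (kron X (S j)) (S (Suc j))"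
    and \<Delta>: "\<And>j. j < N \<Longrightarrow> \<Delta> j \<in> rhom (S (Suc j)) (kron X (S j))"
    and \<epsilon>: "\<epsilon> * \<epsilon> = 1"
    and inv: "\<And>j. j < N \<Longrightarrow> of_nat (Suc j) \<noteq> (0::'k)"
    and m\<Delta>: "\<And>j. j < N \<Longrightarrow> m j * \<Delta> j = of_nat (Suc j) \<cdot>\<^sub>m 1\<^sub>m (dim_row (S (Suc j)))"
    and \<Delta>m0: "0 < N \<Longrightarrow> \<Delta> 0 * m 0 = 1\<^sub>m (dim_row X)"
    and comm: "\<And>j. Suc j < N \<Longrightarrow> \<Delta> (Suc j) * m (Suc j) = 1\<^sub>m (dim_row X * dim_row (S (Suc j))) +
      \<epsilon> \<cdot>\<^sub>m (kron (1\<^sub>m (dim_row X)) (m j) * (kron (braid X X) (1\<^sub>m (dim_row (S j))) * kron (1\<^sub>m (dim_row X)) (\<Delta> j)))"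
    and mm: "\<And>j. Suc j < N \<Longrightarrow> m (Suc j) * (kron (1\<^sub>m (dim_row X)) (m j) * kron (braid X X) (1\<^sub>m (dim_row (S j)))) =
      \<epsilon> \<cdot>\<^sub>m (m (Suc j) * kron (1\<^sub>m (dim_row X)) (m j))"
begin

lemma S_obj: "j \<le> N \<Longrightarrow> S j \<in> rep_objs"
proof (cases j)
  case 0
  then show ?thesis using S0 rep_unit_obj by simp
next
  case (Suc i)
  assume "j \<le> N"
  then show ?thesis using m [of i] Suc rhomD(3) by simp
qed

primrec q :: "nat \<Rightarrow> 'k mat" where
  "q 0 = 1\<^sub>m (Suc 0)"
| "q (Suc n) = m n * kron (1\<^sub>m (dim_row X)) (q n)"

text \<open>Iterated comultiplication divided by \<open>n!\<close>, with the factorial accumulated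
  step by step.\<close>

primrec s :: "nat \<Rightarrow> 'k mat" where
  "s 0 = 1\<^sub>m (Suc 0)"
| "s (Suc n) = (1 / of_nat (Suc n)) \<cdot>\<^sub>m (kron (1\<^sub>m (dim_row X)) (s n) * \<Delta> n)"

lemma q_rhom: "n \<le> N \<Longrightarrow> q n \<in> rhom (tpow X n) (S n)"
proof (induction n)
  case 0
  then show ?case using rhom_id [OF rep_unit_obj] by (simp add: S0)
next
  case (Suc n)
  then show ?case using rhom_comp [OF m rhom_kron [OF rhom_id [OF X] Suc.IH]] by simp
qed

lemma s_rhom: "n \<le> N \<Longrightarrow> s n \<in> rhom (S n) (tpow X n)"
proof (induction n)
  case 0
  then show ?case using rhom_id [OF rep_unit_obj] by (simp add: S0)
next
  case (Suc n)
  then show ?case using rhom_smult [OF rhom_comp [OF rhom_kron [OF rhom_id [OF X] Suc.IH] \<Delta>]] by simp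
qed

lemma dims:
  "n \<le> N \<Longrightarrow> dim_row (q n) = dim_row (S n)" "n \<le> N \<Longrightarrow> dim_col (q n) = dim_row X ^ n"
  "n \<le> N \<Longrightarrow> dim_row (s n) = dim_row X ^ n" "n \<le> N \<Longrightarrow> dim_col (s n) = dim_row (S n)"
  "n < N \<Longrightarrow> dim_row (m n) = dim_row (S (Suc n))" "n < N \<Longrightarrow> dim_col (m n) = dim_row X * dim_row (S n)"
  "n < N \<Longrightarrow> dim_row (\<Delta> n) = dim_row X * dim_row (S n)" "n < N \<Longrightarrow> dim_col (\<Delta> n) = dim_row (S (Suc n))"
  using rhom_dims [OF q_rhom] rhom_dims [OF s_rhom] rhom_dims [OF m] rhom_dims [OF \<Delta>] by simp_all

lemma dims_braid: "dim_row (braid X X) = dim_row X * dim_row X" "dim_col (braid X X) = dim_row X * dim_row X"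
  using X by simp_all

lemma q_s: "n \<le> N \<Longrightarrow> q n * s n = 1\<^sub>m (dim_row (S n))"
proof (induction n)
  case 0
  then show ?case by (simp add: S0)
next
  case (Suc n)
  have n: "n \<le> N" "n < N" using Suc.prems by auto
  note d = dims(1-4) [OF n(1)] dims(5-8) [OF n(2)]
  let ?E = "kron (1\<^sub>m (dim_row X))"
  have "q (Suc n) * s (Suc n) = (1 / of_nat (Suc n)) \<cdot>\<^sub>m (m n * ?E (q n) * (?E (s n) * \<Delta> n))"
    by (simp add: mat_mult_smult d del: of_nat_Suc)
  also have "m n * ?E (q n) * (?E (s n) * \<Delta> n) = m n * ((?E (q n) * ?E (s n)) * \<Delta> n)"
    by (simp add: mat_mult_assoc d)
  also have "?E (q n) * ?E (s n) = 1\<^sub>m (dim_row X * dim_row (S n))"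
    using Suc.IH n by (simp add: d kron_one flip: kron_mult)
  also have "m n * (1\<^sub>m (dim_row X * dim_row (S n)) * \<Delta> n) = m n * \<Delta> n" by (simp add: d)
  also have "(1 / of_nat (Suc n)) \<cdot>\<^sub>m (m n * \<Delta> n) = 1\<^sub>m (dim_row (S (Suc n)))"
    unfolding m\<Delta> [OF n(2)] using inv [OF n(2)] by (simp add: mat_smult_smult mat_one_smult del: of_nat_Suc)
  finally show ?case .
qed

lemma q_place: "n \<le> N \<Longrightarrow> i + j + 2 = n \<Longrightarrow> q n * place X i j (braid X X) = \<epsilon> \<cdot>\<^sub>m q n"
proof (induction n arbitrary: i)
  case 0
  then show ?case by simp
next
  case (Suc n)
  have n: "n \<le> N" "n < N" using Suc.prems by auto
  note d = dims(1-4) [OF n(1)] dims(5-8) [OF n(2)]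
  let ?E = "kron (1\<^sub>m (dim_row X))" and ?c = "braid X X"
  show ?case
  proof (cases i)
    case 0
    then have j: "n = Suc j" using Suc.prems by simp
    then have jN: "j \<le> N" "j < N" "Suc j < N" using n by auto
    note dj = dims(1-4) [OF jN(1)] dims(5-8) [OF jN(2)] dims(5-8) [OF jN(3)] dims_braid
    let ?u = "1\<^sub>m (dim_row X) :: 'k mat"
    have "kron (1\<^sub>m (dim_row X * dim_row X)) (q j) * kron ?c (1\<^sub>m (dim_row X ^ j)) = kron ?c (q j)"
      using kron_mult [of "1\<^sub>m (dim_row X * dim_row X)" ?c "q j" "1\<^sub>m (dim_row X ^ j)"] by (simp add: dj)
    also have "\<dots> = kron ?c (1\<^sub>m (dim_row (S j))) * kron (1\<^sub>m (dim_row X * dim_row X)) (q j)"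
      using kron_mult [of ?c "1\<^sub>m (dim_row X * dim_row X)" "1\<^sub>m (dim_row (S j))" "q j"] by (simp add: dj)
    finally have 1: "?E (?E (q j)) * kron ?c (1\<^sub>m (dim_row X ^ j)) = kron ?c (1\<^sub>m (dim_row (S j))) * ?E (?E (q j))"
      by (simp add: kron_assoc flip: kron_one)
    have 2: "q (Suc n) = m (Suc j) * (?E (m j) * ?E (?E (q j)))"
      unfolding j by (simp add: dj flip: kron_mult)
    have "q (Suc n) * place X i j ?c = m (Suc j) * (?E (m j) * (?E (?E (q j)) * kron ?c (1\<^sub>m (dim_row X ^ j))))"
      unfolding 2 0 place_0 by (simp add: mat_mult_assoc dj mult_ac)
    also have "\<dots> = m (Suc j) * (?E (m j) * kron ?c (1\<^sub>m (dim_row (S j)))) * ?E (?E (q j))"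
      unfolding 1 by (simp add: mat_mult_assoc dj mult_ac)
    also have "\<dots> = \<epsilon> \<cdot>\<^sub>m q (Suc n)"
      unfolding mm [OF jN(3)] 2 by (simp add: mat_distribs dj mult_ac)
    finally show ?thesis .
  next
    case (Suc i')
    have "q n * place X i' j ?c = \<epsilon> \<cdot>\<^sub>m q n" using Suc.prems Suc.IH n Suc by simp
    moreover have "q (Suc n) * place X i j ?c = m n * ?E (q n * place X i' j ?c)"
    proof -
      have l: "dim_row (place X i' j ?c) = dim_row X ^ n"
        using Suc.prems Suc by (auto simp: dims_braid power_add mult_ac)
      show ?thesis unfolding Suc place_Suc using l by (simp add: mat_mult_assoc d flip: kron_mult)
    qed
    ultimately show ?thesis by (simp add: kron_smult_right mat_mult_smult d)
  qed
qed

text \<open>The core of the computation. The object \<open>W\<close> collects the tensor factors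
  already set aside, so that the induction can peel off the leftmost factor of the power. With the
  tail already projected to \<open>S n\<close>, what remains is that \<open>\<Delta> n * m n\<close>
  acts on a twisted map as the scalar \<open>n + 1\<close>.\<close>

lemma absorb:
  assumes "n \<le> N" "W \<in> rep_objs" "h \<in> rhom (kron W (tpow X n)) Z"
    and "\<And>i j. i + j + 2 = n \<Longrightarrow> mor (kron W (tpow X n)) Z (h * kron (1\<^sub>m (dim_row W)) (place X i j (braid X X))) =
      mor (kron W (tpow X n)) Z (\<epsilon> \<cdot>\<^sub>m h)"
  shows "mor (kron W (tpow X n)) Z (h * kron (1\<^sub>m (dim_row W)) (s n * q n)) = mor (kron W (tpow X n)) Z h"
  using assms
proof (induction n arbitrary: W h)
  case 0
  then show ?case using rhom_dims [OF 0(3)] by (simp add: kron_one)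
next
  case (Suc n)
  note W = Suc.prems(2) and h = Suc.prems(3)
  have n: "n \<le> N" "n < N" using Suc.prems by auto
  note d = dims(1-4) [OF n(1)] dims(5-8) [OF n(2)] dims_braid rhom_dims [OF h, simplified]
  let ?x = "dim_row X" and ?w = "dim_row W"
  let ?E = "kron (1\<^sub>m ?x)" and ?B = "kron (1\<^sub>m ?w)" and ?c = "braid X X" and ?U = "kron W (tpow X (Suc n))"
  note B1 = rhom_kron [OF rhom_id [OF W]] and E1 = rhom_kron [OF rhom_id [OF X]]
  have BE: "kron (1\<^sub>m (dim_row (kron W X))) u = ?B (?E u)" for u :: "'k mat"
    by (simp add: kron_assoc flip: kron_one)
  have Bmult: "?B (u * v) = ?B u * ?B v" if "dim_col u = dim_row v" for u v :: "'k mat"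
    using that by (simp flip: kron_mult)
  have Emult: "?E (u * v) = ?E u * ?E v" if "dim_col u = dim_row v" for u v :: "'k mat"
    using that by (simp flip: kron_mult)
  \<comment> \<open>The induction hypothesis for \<open>W \<otimes> X\<close>: the last
    \<open>n\<close> factors may be replaced by their projection.\<close>
  have IH: "mor ?U Z (h * ?B (?E (s n * q n))) = mor ?U Z h"
  proof -
    have "mor (kron (kron W X) (tpow X n)) Z (h * kron (1\<^sub>m (dim_row (kron W X))) (s n * q n)) =
        mor (kron (kron W X) (tpow X n)) Z h"
    proof (rule Suc.IH [OF n(1)])
      show "kron W X \<in> rep_objs" by (intro kron_obj W X)
      show "h \<in> rhom (kron (kron W X) (tpow X n)) Z" using h by (simp add: kron_assoc)
      fix i j assume "i + j + 2 = n"
      then show "mor (kron (kron W X) (tpow X n)) Z (h * kron (1\<^sub>m (dim_row (kron W X))) (place X i j ?c)) =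
          mor (kron (kron W X) (tpow X n)) Z (\<epsilon> \<cdot>\<^sub>m h)"
        using Suc.prems(4) [of "Suc i" j] unfolding BE place_Suc by (simp add: kron_assoc)
    qed
    then show ?thesis unfolding BE by (simp add: kron_assoc)
  qed
  define h1 where "h1 = h * ?B (?E (s n))"
  let ?V = "kron W (kron X (S n))"
  have Bs: "?B (?E (s n)) \<in> rhom ?V ?U" using B1 [OF E1 [OF s_rhom [OF n(1)]]] by simp
  have Bq: "?B (?E (q n)) \<in> rhom ?U ?V" using B1 [OF E1 [OF q_rhom [OF n(1)]]] by simp
  have h1: "h1 \<in> rhom ?V Z" unfolding h1_def by (rule rhom_comp [OF h Bs])
  note d1 = rhom_dims [OF h1, simplified]
  have h1q: "mor ?U Z (h1 * ?B (?E (q n))) = mor ?U Z h"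
    using IH unfolding h1_def by (simp add: Emult Bmult mat_mult_assoc d)
  have \<Delta>m: "\<Delta> n * m n \<in> rhom (kron X (S n)) (kron X (S n))" by (rule rhom_comp [OF \<Delta> [OF n(2)] m [OF n(2)]])
  \<comment> \<open>By the commutation relation, \<open>\<Delta> n * m n\<close> is the identity
    plus \<open>\<epsilon>\<close> times a term that multiplies, braids and comultiplies one degree
    lower. Twistedness turns that braiding into another \<open>\<epsilon>\<close>, and the rest
    contributes \<open>k + 1\<close> with \<open>n = k + 1\<close>; altogether
    \<open>1 + \<epsilon> * \<epsilon> * (k + 1) = n + 1\<close>.\<close>
  have key: "mor ?V Z (h1 * ?B (\<Delta> n * m n)) = mor ?V Z (of_nat (Suc n) \<cdot>\<^sub>m h1)"
  proof (cases n)
    case 0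
    then have "\<Delta> n * m n = 1\<^sub>m ?x" "dim_row (S n) = 1" using \<Delta>m0 n S0 by auto
    then show ?thesis unfolding 0 using d1 0 by (simp add: kron_one mat_one_smult)
  next
    case (Suc k)
    have k: "k \<le> N" "k < N" "Suc k < N" using n Suc by auto
    note dk = dims(1-4) [OF k(1)] dims(5-8) [OF k(2)] dims(5-8) [OF k(3)] dims(1-4) [OF n(1), unfolded Suc]
    let ?Vk = "kron W (kron X (kron X (S k)))" and ?C = "kron ?c (1\<^sub>m (dim_row (S k)))"
    have Bss: "?B (?E (?E (s k))) \<in> rhom ?Vk ?U" using B1 [OF E1 [OF E1 [OF s_rhom [OF k(1)]]]] Suc by simp
    have Bm: "?B (?E (m k)) \<in> rhom ?Vk ?V" using B1 [OF E1 [OF m [OF k(2)]]] Suc by simp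
    have B\<Delta>: "?B (?E (\<Delta> k)) \<in> rhom ?V ?Vk" using B1 [OF E1 [OF \<Delta> [OF k(2)]]] Suc by simp
    have C: "?C \<in> rhom (kron X (kron X (S k))) (kron X (kron X (S k)))"
      using rhom_kron [OF rhom_braid [OF X X] rhom_id [OF S_obj [OF k(1)]]] by (simp add: kron_assoc)
    note BC = B1 [OF C]
    have BT: "?B (kron ?c (1\<^sub>m (?x ^ k))) \<in> rhom ?U ?U"
      using B1 [OF rhom_kron [OF rhom_braid [OF X X] rhom_id [OF tpow_obj [OF X, of k]]]] Suc by (simp add: kron_assoc)
    have qs: "q n * ?E (s k) = m k"
    proof -
      have "q n * ?E (s k) = m k * ?E (q k * s k)"
        unfolding Suc by (simp add: Emult mat_mult_assoc dk)
      then show ?thesis unfolding q_s [OF k(1)] by (simp add: kron_one dk)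
    qed
    have 1: "mor ?Vk Z (h1 * ?B (?E (m k))) = mor ?Vk Z (h * ?B (?E (?E (s k))))"
    proof -
      have "?B (?E (q n)) * ?B (?E (?E (s k))) = ?B (?E (m k))"
        unfolding qs [symmetric] using Suc by (simp add: Emult Bmult dk)
      then have "h1 * ?B (?E (m k)) = h1 * ?B (?E (q n)) * ?B (?E (?E (s k)))"
        using Suc by (simp add: mat_mult_assoc d1 dk)
      then show ?thesis
        using ver_compositeD(2) [OF char h1q rhom_comp [OF h1 Bq] h Bss] by simp
    qed
    have sc: "?E (?E (s k)) * ?C = kron ?c (1\<^sub>m (?x ^ k)) * ?E (?E (s k))"
    proof -
      have "kron (1\<^sub>m (?x * ?x)) (s k) * ?C = kron ?c (s k)"
        using kron_mult [of "1\<^sub>m (?x * ?x)" ?c "s k" "1\<^sub>m (dim_row (S k))"] by (simp add: dk dims_braid)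
      also have "\<dots> = kron ?c (1\<^sub>m (?x ^ k)) * kron (1\<^sub>m (?x * ?x)) (s k)"
        using kron_mult [of ?c "1\<^sub>m (?x * ?x)" "1\<^sub>m (?x ^ k)" "s k"] by (simp add: dk dims_braid)
      finally show ?thesis by (simp add: kron_assoc flip: kron_one)
    qed
    have 2: "mor ?Vk Z (h * ?B (?E (?E (s k))) * ?B ?C) = mor ?Vk Z (\<epsilon> \<cdot>\<^sub>m h * ?B (?E (?E (s k))))"
    proof -
      have "h * ?B (?E (?E (s k))) * ?B ?C = h * ?B (?E (?E (s k)) * ?C)"
        using Suc by (simp add: Bmult mat_mult_assoc d dk dims_braid)
      also have "\<dots> = h * ?B (kron ?c (1\<^sub>m (?x ^ k))) * ?B (?E (?E (s k)))"
        unfolding sc using Suc by (simp add: Bmult mat_mult_assoc d dk dims_braid)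
      finally have e: "h * ?B (?E (?E (s k))) * ?B ?C = h * ?B (kron ?c (1\<^sub>m (?x ^ k))) * ?B (?E (?E (s k)))" .
      have "mor ?U Z (h * ?B (kron ?c (1\<^sub>m (?x ^ k)))) = mor ?U Z (\<epsilon> \<cdot>\<^sub>m h)"
        using Suc.prems(4) [of 0 k] Suc unfolding place_0 by simp
      then show ?thesis
        unfolding e by (rule ver_compositeD(2) [OF char _ rhom_comp [OF h BT] rhom_smult [OF h] Bss])
    qed
    have 3: "mor ?V Z (h1 * ?B (?E (m k)) * (?B ?C * ?B (?E (\<Delta> k)))) =
        mor ?V Z (\<epsilon> \<cdot>\<^sub>m h * ?B (?E (?E (s k))) * ?B (?E (\<Delta> k)))"
    proof -
      have "mor ?V Z (h1 * ?B (?E (m k)) * (?B ?C * ?B (?E (\<Delta> k)))) =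
          mor ?V Z (h * ?B (?E (?E (s k))) * (?B ?C * ?B (?E (\<Delta> k))))"
        by (rule ver_compositeD(2) [OF char 1 rhom_comp [OF h1 Bm] rhom_comp [OF h Bss] rhom_comp [OF BC B\<Delta>]])
      also have "h * ?B (?E (?E (s k))) * (?B ?C * ?B (?E (\<Delta> k))) = h * ?B (?E (?E (s k))) * ?B ?C * ?B (?E (\<Delta> k))"
        using Suc by (simp add: mat_mult_assoc d dk dims_braid)
      also have "mor ?V Z (h * ?B (?E (?E (s k))) * ?B ?C * ?B (?E (\<Delta> k))) =
          mor ?V Z (\<epsilon> \<cdot>\<^sub>m h * ?B (?E (?E (s k))) * ?B (?E (\<Delta> k)))"
        by (rule ver_compositeD(2) [OF char 2 rhom_comp [OF rhom_comp [OF h Bss] BC] rhom_comp [OF rhom_smult [OF h] Bss] B\<Delta>])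
      finally show ?thesis .
    qed
    \<comment> \<open>The recursion for \<open>s\<close> read backwards; the denominator reappears
      as the factor \<open>k + 1\<close>.\<close>
    have es: "?E (s k) * \<Delta> k = of_nat (Suc k) \<cdot>\<^sub>m s n"
      unfolding Suc using inv [OF k(2)] by (simp add: mat_smult_smult mat_one_smult del: of_nat_Suc)
    have "?B (?E (?E (s k))) * ?B (?E (\<Delta> k)) = ?B (?E (?E (s k) * \<Delta> k))"
      by (simp add: Bmult Emult dk)
    then have "?B (?E (?E (s k))) * ?B (?E (\<Delta> k)) = of_nat (Suc k) \<cdot>\<^sub>m ?B (?E (s n))"
      unfolding es kron_smult_right .
    then have "\<epsilon> \<cdot>\<^sub>m h * ?B (?E (?E (s k))) * ?B (?E (\<Delta> k)) = (\<epsilon> * of_nat (Suc k)) \<cdot>\<^sub>m h1"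
      unfolding h1_def using Suc by (simp add: mat_mult_assoc mat_smult_mult mat_mult_smult mat_smult_smult d dk del: of_nat_Suc)
    with 3 have 4: "mor ?V Z (h1 * ?B (?E (m k)) * (?B ?C * ?B (?E (\<Delta> k)))) = mor ?V Z ((\<epsilon> * of_nat (Suc k)) \<cdot>\<^sub>m h1)"
      by simp
    let ?t = "h1 * ?B (?E (m k)) * (?B ?C * ?B (?E (\<Delta> k)))"
    have t: "?t \<in> rhom ?V Z" by (rule rhom_comp [OF rhom_comp [OF h1 Bm] rhom_comp [OF BC B\<Delta>]])
    have "h1 * ?B (\<Delta> n * m n) = h1 + \<epsilon> \<cdot>\<^sub>m ?t"
    proof -
      let ?r = "?E (m k) * (?C * ?E (\<Delta> k))"
      have "?B (\<Delta> n * m n) = ?B (1\<^sub>m (?x * dim_row (S n)) + \<epsilon> \<cdot>\<^sub>m ?r)"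
        unfolding Suc comm [OF k(3)] ..
      also have "\<dots> = 1\<^sub>m (?w * (?x * dim_row (S n))) + \<epsilon> \<cdot>\<^sub>m ?B ?r"
        using Suc by (simp add: kron_add_right kron_smult_right kron_one dk)
      also have "?B ?r = ?B (?E (m k)) * (?B ?C * ?B (?E (\<Delta> k)))"
        by (simp add: Bmult dk dims_braid)
      finally show ?thesis using Suc by (simp add: mat_mult_add mat_mult_smult mat_mult_assoc d1 dk dims_braid)
    qed
    then have "mor ?V Z (h1 * ?B (\<Delta> n * m n)) = mor ?V Z h1 \<boxplus>\<^bsub>ver\<^esub> (\<epsilon> \<star>\<^bsub>ver\<^esub> mor ?V Z ?t)"
      using ver_add [OF h1 rhom_smult [OF t]] ver_scale [OF t] by simp
    also have "\<dots> = mor ?V Z (h1 + (\<epsilon> * (\<epsilon> * of_nat (Suc k))) \<cdot>\<^sub>m h1)"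
      unfolding 4 ver_scale [OF rhom_smult [OF h1]] mat_smult_smult ver_add [OF h1 rhom_smult [OF h1]] ..
    also have "h1 + (\<epsilon> * (\<epsilon> * of_nat (Suc k))) \<cdot>\<^sub>m h1 = of_nat (Suc n) \<cdot>\<^sub>m h1"
      unfolding Suc mult.assoc [symmetric] \<epsilon> by (rule eq_matI) (simp_all add: algebra_simps)
    finally show ?thesis .
  qed
  let ?a = "1 / of_nat (Suc n) :: 'k"
  have "h * ?B (s (Suc n) * q (Suc n)) = ?a \<cdot>\<^sub>m (h1 * ?B (\<Delta> n * m n) * ?B (?E (q n)))"
    unfolding h1_def by (simp add: Bmult mat_mult_assoc mat_smult_mult mat_mult_smult kron_smult_right d mult_ac del: of_nat_Suc)
  then have "mor ?U Z (h * ?B (s (Suc n) * q (Suc n))) = ?a \<star>\<^bsub>ver\<^esub> mor ?U Z (h1 * ?B (\<Delta> n * m n) * ?B (?E (q n)))"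
    using ver_scale [OF rhom_comp [OF rhom_comp [OF h1 B1 [OF \<Delta>m]] Bq]] by simp
  also have "mor ?U Z (h1 * ?B (\<Delta> n * m n) * ?B (?E (q n))) = mor ?U Z (of_nat (Suc n) \<cdot>\<^sub>m h1 * ?B (?E (q n)))"
    by (rule ver_compositeD(2) [OF char key rhom_comp [OF h1 B1 [OF \<Delta>m]] rhom_smult [OF h1] Bq])
  also have "?a \<star>\<^bsub>ver\<^esub> mor ?U Z (of_nat (Suc n) \<cdot>\<^sub>m h1 * ?B (?E (q n))) = mor ?U Z (h1 * ?B (?E (q n)))"
    unfolding ver_scale [OF rhom_comp [OF rhom_smult [OF h1] Bq]]
    using inv [OF n(2)] by (simp add: mat_smult_mult mat_smult_smult mat_one_smult d1 d del: of_nat_Suc)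
  finally show ?case using h1q by simp
qed

lemma split:
  assumes n: "n \<le> N"
  shows "power_split \<epsilon> X n (S n)"
  unfolding power_split_def
proof (intro bexI conjI allI ballI impI)
  note qr = q_rhom [OF n] and sr = s_rhom [OF n]
  show "q n \<in> rhom (tpow X n) (S n)" "s n \<in> rhom (S n) (tpow X n)" by (rule qr sr)+
  show "mor (S n) (S n) (q n * s n) = mor (S n) (S n) (1\<^sub>m (dim_row (S n)))" unfolding q_s [OF n] ..
  show "twisted \<epsilon> X n (S n) (q n)" unfolding twisted_def using q_place [OF n] by simp
  fix Z a assume a: "a \<in> rhom (tpow X n) Z" and t: "twisted \<epsilon> X n Z a"
  show "mor (tpow X n) Z (a * (s n * q n)) = mor (tpow X n) Z a"
    using absorb [OF n rep_unit_obj, of a Z] a t unfolding twisted_def by simp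
qed

text \<open>If the identity of \<open>S N\<close> is negligible, so is \<open>s N * q N\<close>. A
  twisted map in degree \<open>n\<close> at least \<open>N\<close> absorbs this idempotent in its
  last \<open>N\<close> factors and is therefore zero, so the zero object \<open>S N\<close>
  represents the power in all these degrees.\<close>

lemma split_zero:
  assumes zero: "1\<^sub>m (dim_row (S N)) \<in> negl (S N) (S N)" and n: "N \<le> n"
  shows "power_split \<epsilon> X n (S N)"
  unfolding power_split_def
proof (intro bexI conjI allI ballI impI)
  let ?T = "tpow X n" and ?S = "S N"
  have T: "?T \<in> rep_objs" by (rule tpow_obj [OF X])
  have SN: "?S \<in> rep_objs" by (rule S_obj) simp
  let ?q = "0\<^sub>m (dim_row ?S) (dim_row ?T)" and ?s = "0\<^sub>m (dim_row ?T) (dim_row ?S)"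
  show q: "?q \<in> rhom ?T ?S" and s: "?s \<in> rhom ?S ?T" using rhom_zero T SN by blast+
  show "mor ?S ?S (?q * ?s) = mor ?S ?S (1\<^sub>m (dim_row ?S))"
    using mor_eq_zero [OF rhom_id [OF SN]] zero by simp
  have p: "dim_row (place X i j (braid X X)) = dim_row ?T \<and> dim_col (place X i j (braid X X)) = dim_row ?T"
    if "i + j + 2 = n" for i j using that by (auto simp: dims_braid power_add mult_ac)
  show "twisted \<epsilon> X n ?S ?q"
  proof -
    have "\<epsilon> \<cdot>\<^sub>m ?q = ?q" by (rule eq_matI) auto
    then show ?thesis unfolding twisted_def using p by simp
  qed
  fix Z a assume a: "a \<in> rhom ?T Z" and t: "twisted \<epsilon> X n Z a"
  note Z = rhomD(3) [OF a]
  define W where "W = tpow X (n - N)"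
  have W: "W \<in> rep_objs" unfolding W_def by (rule tpow_obj [OF X])
  have WT: "kron W (tpow X N) = ?T" unfolding W_def kron_tpow using n by simp
  have "mor (kron W (tpow X N)) Z (a * kron (1\<^sub>m (dim_row W)) (s N * q N)) = mor (kron W (tpow X N)) Z a"
  proof (rule absorb [OF order_refl W])
    show "a \<in> rhom (kron W (tpow X N)) Z" unfolding WT by (rule a)
    fix i j assume ij: "i + j + 2 = N"
    have "kron (1\<^sub>m (dim_row W)) (place X i j (braid X X)) = place X (n - N + i) j (braid X X)"
      unfolding place_def W_def by (simp add: power_add flip: kron_assoc kron_one)
    moreover have "(n - N + i) + j + 2 = n" using ij n by simp
    ultimately show "mor (kron W (tpow X N)) Z (a * kron (1\<^sub>m (dim_row W)) (place X i j (braid X X))) =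
        mor (kron W (tpow X N)) Z (\<epsilon> \<cdot>\<^sub>m a)"
      unfolding WT using t unfolding twisted_def by auto
  qed
  moreover have "a * kron (1\<^sub>m (dim_row W)) (s N * q N) \<in> negl ?T Z"
  proof -
    note qr = q_rhom [OF order_refl] and sr = s_rhom [OF order_refl]
    note TN = tpow_obj [OF X, of N]
    have "s N * 1\<^sub>m (dim_row ?S) \<in> negl ?S (tpow X N)"
      by (rule negl_comp_left [OF SN SN TN zero rhomD(1) [OF sr]])
    then have "s N \<in> negl ?S (tpow X N)" using rhom_dims [OF sr] by simp
    then have "s N * q N \<in> negl (tpow X N) (tpow X N)"
      by (rule negl_comp_right [OF SN TN TN _ rhomD(1) [OF qr]])
    then have "kron (1\<^sub>m (dim_row W)) (s N * q N) \<in> negl ?T ?T"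
      using negl_kron(2) [OF W W TN TN char_pos [OF char] two_nz [OF char] Hom_id [OF W]] unfolding WT by blast
    then show ?thesis by (rule negl_comp_left [OF T T Z _ rhomD(1) [OF a]])
  qed
  ultimately have "mor ?T Z a = mor ?T Z (0\<^sub>m (dim_row Z) (dim_row ?T))"
    using mor_eq_zero [OF rhom_comp [OF a rhom_kron [OF rhom_id [OF W] rhom_comp [OF s_rhom [OF order_refl] q_rhom [OF order_refl]], unfolded WT]]]
    unfolding WT by simp
  then show "mor ?T Z (a * (?s * ?q)) = mor ?T Z a"
    using rhom_dims [OF a] by simp
qed

end

section \<open>The two-dimensional representation and its powers\<close>

definition brow :: "nat \<Rightarrow> 'a::zero_neq_one mat" where
  "brow i = mat 1 2 (\<lambda>(a,b). if b = i then 1 else 0)"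

definition bcol :: "nat \<Rightarrow> 'a::zero_neq_one mat" where
  "bcol i = mat 2 1 (\<lambda>(a,b). if a = i then 1 else 0)"

lemma dim_brow_bcol [simp]:
  "dim_row (brow i) = Suc 0" "dim_col (brow i) = 2" "dim_row (bcol i) = 2" "dim_col (bcol i) = Suc 0"
  by (simp_all add: brow_def bcol_def)

lemma less2: "(i::nat) < 2 \<longleftrightarrow> i = 0 \<or> i = 1" by auto

lemma brow_bcol:
  fixes i k :: nat
  assumes "i < 2" "k < 2"
  shows "brow i * bcol k = (if i = k then 1\<^sub>m 1 else 0\<^sub>m 1 1 :: 'a::comm_semiring_1 mat)"
  by (rule eq_matI) (use assms in \<open>auto simp: index_mult_sum brow_def bcol_def numeral_2_eq_2 less_Suc_eq\<close>)

lemma bcol_brow_sum: "bcol 0 * brow 0 + bcol 1 * brow 1 = (1\<^sub>m 2 :: 'a::comm_semiring_1 mat)"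
  by (rule eq_matI) (auto simp: index_mult_sum brow_def bcol_def)

lemma bcol_brow_kron: "kron (bcol k) (brow i) = (bcol k * brow i :: 'a::comm_semiring_1 mat)"
proof -
  have "kron (bcol k * 1\<^sub>m 1) (1\<^sub>m 1 * brow i) = kron (bcol k) (1\<^sub>m 1) * (kron (1\<^sub>m 1) (brow i) :: 'a mat)"
    by (rule kron_mult) simp_all
  then show ?thesis by simp
qed

lemma brow_flip_bcol:
  "kron (1\<^sub>m 2) (brow i) * (flip 2 2 * kron (1\<^sub>m 2) (bcol k)) = (bcol k * brow i :: 'a::comm_semiring_1 mat)"
proof -
  have "flip 2 2 * kron (1\<^sub>m 2) (bcol k) = kron (bcol k) (1\<^sub>m 2) * (flip 2 1 :: 'a mat)"
    by (rule flip_natural) simp_all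
  moreover have "kron (1\<^sub>m 2) (brow i) * kron (bcol k) (1\<^sub>m 2) = (kron (bcol k) (brow i) :: 'a mat)"
    using kron_mult [of "1\<^sub>m 2 :: 'a mat" "bcol k" "brow i" "1\<^sub>m 2"] by simp
  ultimately show ?thesis by (simp add: bcol_brow_kron)
qed

lemma brow_brow_flip: "kron (brow k) (brow i) * flip 2 2 = (kron (brow i) (brow k) :: 'a::comm_semiring_1 mat)"
  using flip_natural [of "brow i :: 'a mat" 1 "brow k" 1 2 2] by simp

lemma smult_pow_mat: "A \<in> carrier_mat n n \<Longrightarrow> (c \<cdot>\<^sub>m A) ^\<^sub>m k = c ^ k \<cdot>\<^sub>m (A ^\<^sub>m k)"
  for A :: "'a::comm_semiring_1 mat"
proof (induction k)
  case 0
  then show ?case by (simp add: mat_one_smult)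
next
  case (Suc k)
  have "dim_col (A ^\<^sub>m k) = n" using pow_carrier_mat [OF Suc.prems] by (rule carrier_matD)
  then show ?case using Suc by (simp add: mat_smult_mult mat_mult_smult mat_smult_smult mult.commute)
qed

text \<open>Column \<open>b\<close> lists the coefficients of \<open>(x + 1)^b\<close>: this is the
  substitution of \<open>x + 1\<close> for \<open>x\<close> on polynomials of degree at most
  \<open>j\<close>, the \<open>j\<close>-th symmetric power of the block \<open>shift 1\<close>. Its
  \<open>n\<close>-th power substitutes \<open>x + n\<close>, so it is the identity for
  \<open>n = p\<close>.\<close>

definition shift :: "nat \<Rightarrow> 'a::semiring_1 mat" where
  "shift j = mat (Suc j) (Suc j) (\<lambda>(a,b). of_nat (b choose a))"

lemma dim_shift [simp]: "dim_row (shift j) = Suc j" "dim_col (shift j) = Suc j"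
  by (simp_all add: shift_def)

lemma shift_pow:
  "shift j ^\<^sub>m n = mat (Suc j) (Suc j) (\<lambda>(a,b). of_nat ((b choose a) * n ^ (b - a)) :: 'a::comm_semiring_1)"
proof (induction n)
  case 0
  show ?case by (rule eq_matI) (auto simp: not_less binomial_eq_0 power_0_left)
next
  case (Suc n)
  show ?case
  proof (rule eq_matI)
    fix a b
    assume "a < dim_row (mat (Suc j) (Suc j) (\<lambda>(a,b). of_nat ((b choose a) * Suc n ^ (b - a)) :: 'a))"
      "b < dim_col (mat (Suc j) (Suc j) (\<lambda>(a,b). of_nat ((b choose a) * Suc n ^ (b - a)) :: 'a))"
    then have ab: "a \<le> j" "b \<le> j" by auto
    have "(\<Sum>c\<le>j. (c choose a) * n ^ (c - a) * (b choose c)) = (b choose a) * Suc n ^ (b - a)"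
    proof (cases "a \<le> b")
      case True
      have "(\<Sum>c\<le>j. (c choose a) * n ^ (c - a) * (b choose c)) = (\<Sum>c\<in>{a..b}. (c choose a) * n ^ (c - a) * (b choose c))"
        using ab by (intro sum.mono_neutral_right) (auto simp: not_le binomial_eq_0)
      also have "\<dots> = (\<Sum>d\<in>{0..b - a}. (d + a choose a) * n ^ d * (b choose (d + a)))"
        using sum.shift_bounds_cl_nat_ivl [of "\<lambda>c. (c choose a) * n ^ (c - a) * (b choose c)" 0 a "b - a"] True by simp
      also have "\<dots> = (\<Sum>d\<le>b - a. (b choose a) * ((b - a choose d) * n ^ d))"
        unfolding atMost_atLeast0
      proof (rule sum.cong [OF refl])
        fix d assume "d \<in> {0..b - a}"
        then show "(d + a choose a) * n ^ d * (b choose (d + a)) = (b choose a) * ((b - a choose d) * n ^ d)"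
          using choose_mult [of a "d + a" b] True by (simp add: mult_ac)
      qed
      also have "\<dots> = (b choose a) * (\<Sum>d\<le>b - a. (b - a choose d) * n ^ d)"
        by (simp add: sum_distrib_left)
      also have "(\<Sum>d\<le>b - a. (b - a choose d) * n ^ d) = (n + 1) ^ (b - a)"
        using binomial [of n 1 "b - a"] by simp
      finally show ?thesis by simp
    next
      case False
      have "(\<Sum>c\<le>j. (c choose a) * n ^ (c - a) * (b choose c)) = 0"
      proof (rule sum.neutral, rule ballI)
        fix c show "(c choose a) * n ^ (c - a) * (b choose c) = 0"
          using False by (cases "c < a") (auto simp: binomial_eq_0)
      qed
      then show ?thesis using False by (simp add: binomial_eq_0)
    qed
    then have "(\<Sum>c<Suc j. of_nat ((c choose a) * n ^ (c - a)) * of_nat (b choose c)) = (of_nat ((b choose a) * Suc n ^ (b - a)) :: 'a)"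
      by (simp only: lessThan_Suc_atMost flip: of_nat_mult of_nat_sum)
    then show "(shift j ^\<^sub>m Suc n) $$ (a,b) = mat (Suc j) (Suc j) (\<lambda>(a,b). of_nat ((b choose a) * Suc n ^ (b - a)) :: 'a) $$ (a,b)"
      using ab unfolding pow_mat.simps Suc by (subst index_mult_sum) (simp_all add: shift_def del: sum.lessThan_Suc)
  qed simp_all
qed

lemma shift_pow_CHAR: "CHAR('a) > 0 \<Longrightarrow> shift j ^\<^sub>m CHAR('a) = (1\<^sub>m (Suc j) :: 'a::comm_semiring_1 mat)"
  unfolding shift_pow by (rule eq_matI) (auto simp: not_less binomial_eq_0 power_0_left nat_neq_iff)

context
  fixes V :: "'k::field mat" and c :: 'k
  assumes V: "dim_col V = dim_row V" "V ^\<^sub>m CHAR('k) = 1\<^sub>m (dim_row V)" and c: "c * c = 1" and odd: "odd CHAR('k)"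
begin

private lemma c_pow: "c ^ CHAR('k) = c" "c ^ (2 * CHAR('k)) = 1"
proof -
  have 1: "c ^ (2 * n) = 1" for n using c by (simp add: power_mult power2_eq_square)
  from odd obtain n where n: "CHAR('k) = 2 * n + 1" by (auto elim: oddE)
  have "c ^ (2 * n + 1) = c ^ (2 * n) * c" by simp
  then show "c ^ CHAR('k) = c" unfolding n 1 by simp
  show "c ^ (2 * CHAR('k)) = 1" by (rule 1)
qed

text \<open>\<open>V\<close> has order dividing \<open>p\<close> and \<open>c ^ p = c\<close> for
  odd \<open>p\<close>, so the scalar \<open>c\<close> is precisely the parity.\<close>

lemma par_smult: "par (c \<cdot>\<^sub>m V) = c \<cdot>\<^sub>m 1\<^sub>m (dim_row V)"
proof -
  have "V \<in> carrier_mat (dim_row V) (dim_row V)" using V(1) by (intro carrier_matI) simp_all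
  from smult_pow_mat [OF this, of c "CHAR('k)"] show ?thesis unfolding par_def V(2) c_pow .
qed

lemma smult_obj: "c \<cdot>\<^sub>m V \<in> rep_objs"
proof -
  have Vc: "V \<in> carrier_mat (dim_row V) (dim_row V)" using V(1) by (intro carrier_matI) simp_all
  have "V ^\<^sub>m (2 * CHAR('k)) = 1\<^sub>m (dim_row V)"
    using pow_mat_pow [OF Vc, of "CHAR('k)" 2] unfolding V(2) one_pow_mat by (simp add: mult.commute)
  then have "(c \<cdot>\<^sub>m V) ^\<^sub>m (2 * CHAR('k)) = 1\<^sub>m (dim_row V)"
    using smult_pow_mat [OF Vc, of c "2 * CHAR('k)"] unfolding c_pow by (simp add: mat_one_smult)
  then show ?thesis using V(1) by (simp add: rep_objs_def)
qed

lemma braid_smult: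
  assumes two: "(2::'k) \<noteq> 0"
  shows "braid (c \<cdot>\<^sub>m V) (c \<cdot>\<^sub>m V) = c \<cdot>\<^sub>m flip (dim_row V) (dim_row V)"
proof -
  let ?n = "dim_row V"
  have "sign_mat (c \<cdot>\<^sub>m 1\<^sub>m ?n) (c \<cdot>\<^sub>m 1\<^sub>m ?n) = c \<cdot>\<^sub>m 1\<^sub>m (?n * ?n)"
  proof -
    have e: "even_proj (c \<cdot>\<^sub>m 1\<^sub>m ?n) = ((1 + c) / 2) \<cdot>\<^sub>m 1\<^sub>m ?n" "odd_proj (c \<cdot>\<^sub>m 1\<^sub>m ?n) = ((1 - c) / 2) \<cdot>\<^sub>m 1\<^sub>m ?n"
      by (rule eq_matI; simp add: even_proj_def odd_proj_def)+
    have "(1 + c) + (1 - c) * c = 2 * c" using c by (simp add: algebra_simps)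
    then have 1: "(1 + c) / 2 + (1 - c) / 2 * c = c" using two by (simp flip: add_divide_distrib)
    have "sign_mat (c \<cdot>\<^sub>m 1\<^sub>m ?n) (c \<cdot>\<^sub>m 1\<^sub>m ?n) = ((1 + c) / 2) \<cdot>\<^sub>m 1\<^sub>m (?n * ?n) + ((1 - c) / 2 * c) \<cdot>\<^sub>m 1\<^sub>m (?n * ?n)"
      unfolding sign_mat_def e by (simp add: kron_smult_left kron_smult_right kron_one mat_smult_smult mult.commute)
    then show ?thesis unfolding mat_add_smult [symmetric] 1 .
  qed
  then show ?thesis unfolding braid_def par_smult by (simp add: mat_mult_smult)
qed

end

text \<open>
  The representation \<open>X = c \<cdot> shift 1\<close> has basis \<open>e\<^sub>0, e\<^sub>1\<close> of parity \<open>c\<close>. Its powers are described by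
  operators \<open>x0, x1\<close> (multiplication by the basis) and \<open>d0, d1\<close> (partial derivatives).
\<close>

locale fock_ops =
  fixes c \<epsilon> :: "'k::field" and V x0 x1 d0 d1 :: "nat \<Rightarrow> 'k mat" and N :: nat
  assumes char: "CHAR('k) > 2" and odd: "odd CHAR('k)" and c: "c * c = 1" and \<epsilon>: "\<epsilon> * \<epsilon> = 1"
    and V0: "V 0 = 1\<^sub>m (Suc 0)" and V: "\<And>j. dim_col (V j) = dim_row (V j)" "\<And>j. V j ^\<^sub>m CHAR('k) = 1\<^sub>m (dim_row (V j))"
    and inv: "\<And>j. j < N \<Longrightarrow> of_nat (Suc j) \<noteq> (0::'k)"
    and x0: "\<And>j. x0 j \<in> carrier_mat (dim_row (V (Suc j))) (dim_row (V j))"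
    and x1: "\<And>j. x1 j \<in> carrier_mat (dim_row (V (Suc j))) (dim_row (V j))"
    and d0: "\<And>j. d0 j \<in> carrier_mat (dim_row (V j)) (dim_row (V (Suc j)))"
    and d1: "\<And>j. d1 j \<in> carrier_mat (dim_row (V j)) (dim_row (V (Suc j)))"
    and x_hom: "\<And>j. j < N \<Longrightarrow> x0 j * V j = V (Suc j) * x0 j" "\<And>j. j < N \<Longrightarrow> (x0 j + x1 j) * V j = V (Suc j) * x1 j"
    and d_hom: "\<And>j. j < N \<Longrightarrow> V j * (d0 j + d1 j) = d0 j * V (Suc j)" "\<And>j. j < N \<Longrightarrow> V j * d1 j = d1 j * V (Suc j)"
    and xd: "\<And>j. j < N \<Longrightarrow> x0 j * d0 j + x1 j * d1 j = of_nat (Suc j) \<cdot>\<^sub>m 1\<^sub>m (dim_row (V (Suc j)))"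
    and dx0: "0 < N \<Longrightarrow> d0 0 * x0 0 = 1\<^sub>m 1 \<and> d0 0 * x1 0 = 0\<^sub>m 1 1 \<and> d1 0 * x0 0 = 0\<^sub>m 1 1 \<and> d1 0 * x1 0 = 1\<^sub>m 1"
    and dx: "\<And>j. Suc j < N \<Longrightarrow> d0 (Suc j) * x0 (Suc j) = 1\<^sub>m (dim_row (V (Suc j))) + (c * \<epsilon>) \<cdot>\<^sub>m (x0 j * d0 j)"
      "\<And>j. Suc j < N \<Longrightarrow> d0 (Suc j) * x1 (Suc j) = (c * \<epsilon>) \<cdot>\<^sub>m (x1 j * d0 j)"
      "\<And>j. Suc j < N \<Longrightarrow> d1 (Suc j) * x0 (Suc j) = (c * \<epsilon>) \<cdot>\<^sub>m (x0 j * d1 j)"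
      "\<And>j. Suc j < N \<Longrightarrow> d1 (Suc j) * x1 (Suc j) = 1\<^sub>m (dim_row (V (Suc j))) + (c * \<epsilon>) \<cdot>\<^sub>m (x1 j * d1 j)"
    and xx: "\<And>j. Suc j < N \<Longrightarrow> x0 (Suc j) * x0 j = (c * \<epsilon>) \<cdot>\<^sub>m (x0 (Suc j) * x0 j)"
      "\<And>j. Suc j < N \<Longrightarrow> x0 (Suc j) * x1 j = (c * \<epsilon>) \<cdot>\<^sub>m (x1 (Suc j) * x0 j)"
      "\<And>j. Suc j < N \<Longrightarrow> x1 (Suc j) * x0 j = (c * \<epsilon>) \<cdot>\<^sub>m (x0 (Suc j) * x1 j)"
      "\<And>j. Suc j < N \<Longrightarrow> x1 (Suc j) * x1 j = (c * \<epsilon>) \<cdot>\<^sub>m (x1 (Suc j) * x1 j)"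
begin

definition "X = c \<cdot>\<^sub>m shift 1"
text \<open>A product of \<open>j\<close> vectors of parity \<open>c\<close> has parity
  \<open>c ^ j\<close>.\<close>

definition "S j = c ^ j \<cdot>\<^sub>m V j"
definition "mul j = kron (brow 0) (x0 j) + kron (brow 1) (x1 j)"
definition "comult j = kron (bcol 0) (d0 j) + kron (bcol 1) (d1 j)"

lemma shift1: "dim_col (shift 1 :: 'k mat) = dim_row (shift 1 :: 'k mat)"
  "shift 1 ^\<^sub>m CHAR('k) = (1\<^sub>m (dim_row (shift 1 :: 'k mat)) :: 'k mat)"
  using shift_pow_CHAR [where 'a = 'k] char by simp_all

lemma X_obj: "X \<in> rep_objs"
  unfolding X_def by (rule smult_obj [OF shift1 c odd])

lemma dim_X [simp]: "dim_row X = 2" "dim_col X = 2"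
  by (simp_all add: X_def)

lemma braid_X: "braid X X = c \<cdot>\<^sub>m flip 2 2"
  using braid_smult [OF shift1 c odd two_nz [OF char]] by (simp add: X_def numeral_2_eq_2)

lemma cj: "c ^ j * c ^ j = 1"
  using c by (simp flip: power_mult_distrib)

lemma S_objs: "S j \<in> rep_objs"
  unfolding S_def by (rule smult_obj [OF V cj odd])

lemma trace_par_S: "trace (par (S j)) = c ^ j * of_nat (dim_row (V j))"
  unfolding S_def par_smult [OF V cj odd] by (simp add: trace_smult)

lemma dim_S [simp]: "dim_row (S j) = dim_row (V j)" "dim_col (S j) = dim_row (V j)"
  by (simp_all add: S_def V)

lemma dim_ops [simp]:
  "dim_row (x0 j) = dim_row (V (Suc j))" "dim_col (x0 j) = dim_row (V j)"
  "dim_row (x1 j) = dim_row (V (Suc j))" "dim_col (x1 j) = dim_row (V j)"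
  "dim_row (d0 j) = dim_row (V j)" "dim_col (d0 j) = dim_row (V (Suc j))"
  "dim_row (d1 j) = dim_row (V j)" "dim_col (d1 j) = dim_row (V (Suc j))"
  using carrier_matD [OF x0] carrier_matD [OF x1] carrier_matD [OF d0] carrier_matD [OF d1] by simp_all

lemma dim_mult [simp]:
  "dim_row (mul j) = dim_row (V (Suc j))" "dim_col (mul j) = 2 * dim_row (V j)"
  "dim_row (comult j) = 2 * dim_row (V j)" "dim_col (comult j) = dim_row (V (Suc j))"
  by (simp_all add: mul_def comult_def)

lemma brow_shift: "brow 0 * shift 1 = (brow 0 + brow 1 :: 'k mat)" "brow 1 * shift 1 = (brow 1 :: 'k mat)"
  "shift 1 * bcol 0 = (bcol 0 :: 'k mat)" "shift 1 * bcol 1 = (bcol 0 + bcol 1 :: 'k mat)"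
  by (rule eq_matI; auto simp: index_mult_sum brow_def bcol_def shift_def less2 numeral_2_eq_2 less_Suc_eq)+

lemma kron_X_S: "kron X (S j) = c ^ Suc j \<cdot>\<^sub>m kron (shift 1) (V j)"
  by (simp add: X_def S_def kron_smult_left kron_smult_right mat_smult_smult mult.commute)

lemma mul_rhom:
  assumes j: "j < N"
  shows "mul j \<in> rhom (kron X (S j)) (S (Suc j))"
proof (intro rhomI HomI kron_obj X_obj S_objs)
  have "mul j * kron (shift 1) (V j) = kron (brow 0 * shift 1) (x0 j * V j) + kron (brow 1 * shift 1) (x1 j * V j)"
    by (simp add: mul_def mat_add_mult numeral_2_eq_2 flip: kron_mult)
  also have "\<dots> = kron (brow 0) (x0 j * V j) + kron (brow 1) (x0 j * V j + x1 j * V j)"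
    unfolding brow_shift by (simp add: kron_add_left kron_add_right V) (rule eq_matI; simp add: V)
  also have "x0 j * V j + x1 j * V j = (x0 j + x1 j) * V j"
    by (rule mat_add_mult [symmetric]) simp_all
  also have "kron (brow 0) (x0 j * V j) + kron (brow 1) ((x0 j + x1 j) * V j) = V (Suc j) * mul j"
    unfolding x_hom [OF j]
    using kron_mult [of "1\<^sub>m 1" "brow 0" "V (Suc j)" "x0 j"] kron_mult [of "1\<^sub>m 1" "brow 1" "V (Suc j)" "x1 j"]
    by (simp add: mul_def mat_mult_add V)
  finally show "mul j * kron X (S j) = S (Suc j) * mul j"
    unfolding kron_X_S S_def [of "Suc j"] by (simp add: mat_mult_smult mat_smult_mult V numeral_2_eq_2)
qed simp_all

lemma comult_rhom:
  assumes j: "j < N"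
  shows "comult j \<in> rhom (S (Suc j)) (kron X (S j))"
proof (intro rhomI HomI kron_obj X_obj S_objs)
  have "kron (shift 1) (V j) * comult j = kron (shift 1 * bcol 0) (V j * d0 j) + kron (shift 1 * bcol 1) (V j * d1 j)"
    by (simp add: comult_def mat_mult_add numeral_2_eq_2 V flip: kron_mult)
  also have "\<dots> = kron (bcol 0) (V j * d0 j + V j * d1 j) + kron (bcol 1) (V j * d1 j)"
    unfolding brow_shift by (simp add: kron_add_left kron_add_right V) (rule eq_matI; simp add: V)
  also have "V j * d0 j + V j * d1 j = V j * (d0 j + d1 j)"
    by (rule mat_mult_add [symmetric]) (simp_all add: V)
  also have "kron (bcol 0) (V j * (d0 j + d1 j)) + kron (bcol 1) (V j * d1 j) = comult j * V (Suc j)"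
    unfolding d_hom [OF j]
    using kron_mult [of "bcol 0" "1\<^sub>m 1" "d0 j" "V (Suc j)"] kron_mult [of "bcol 1" "1\<^sub>m 1" "d1 j" "V (Suc j)"]
    by (simp add: comult_def mat_add_mult V)
  finally show "comult j * S (Suc j) = kron X (S j) * comult j"
    unfolding kron_X_S S_def [of "Suc j"] by (simp add: mat_mult_smult mat_smult_mult V numeral_2_eq_2)
qed simp_all

text \<open>Over the basis of \<open>X\<close> this is a two by two block matrix whose block
  \<open>(k, i)\<close> is \<open>d_k * x_i\<close>; in \<open>wick\<close> the block is
  \<open>x_i * d_k\<close>. The relation \<open>comm\<close> thus becomes
  \<open>d_k * x_i = \<delta> + c * \<epsilon> * x_i * d_k\<close>, where \<open>c\<close> comes
  from the braiding of \<open>X\<close> and \<open>\<delta>\<close> is the Kronecker delta.\<close>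

lemma comult_mult: "comult j * mul j =
   kron (bcol 0 * brow 0) (d0 j * x0 j) + kron (bcol 0 * brow 1) (d0 j * x1 j) +
   (kron (bcol 1 * brow 0) (d1 j * x0 j) + kron (bcol 1 * brow 1) (d1 j * x1 j))"
  by (simp add: comult_def mul_def mat_mult_add mat_add_mult kron_mult) (rule eq_matI; simp add: add_ac)

lemma wick: "kron (1\<^sub>m 2) (mul j) * (kron (flip 2 2) (1\<^sub>m (dim_row (V j))) * kron (1\<^sub>m 2) (comult j)) =
   kron (bcol 0 * brow 0) (x0 j * d0 j) + kron (bcol 0 * brow 1) (x1 j * d0 j) +
   (kron (bcol 1 * brow 0) (x0 j * d1 j) + kron (bcol 1 * brow 1) (x1 j * d1 j))"
proof -
  have *: "kron (kron (1\<^sub>m 2) (brow i)) x * (kron (flip 2 2) (1\<^sub>m (dim_row (V j))) * kron (kron (1\<^sub>m 2) (bcol k)) y) =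
      kron (bcol k * brow i) (x * y)"
    if "dim_col x = dim_row (V j)" "dim_row y = dim_row (V j)" for x y :: "'k mat" and i k
  proof -
    have "kron (flip 2 2) (1\<^sub>m (dim_row (V j))) * kron (kron (1\<^sub>m 2) (bcol k)) y = kron (flip 2 2 * kron (1\<^sub>m 2) (bcol k)) y"
      using kron_mult [of "flip 2 2" "kron (1\<^sub>m 2) (bcol k)" "1\<^sub>m (dim_row (V j))" y] that by simp
    also have "kron (kron (1\<^sub>m 2) (brow i)) x * \<dots> = kron (kron (1\<^sub>m 2) (brow i) * (flip 2 2 * kron (1\<^sub>m 2) (bcol k))) (x * y)"
      by (rule kron_mult [symmetric]) (use that in simp_all)
    finally show ?thesis unfolding brow_flip_bcol .
  qed
  have m: "kron (1\<^sub>m 2) (mul j) = kron (kron (1\<^sub>m 2) (brow 0)) (x0 j) + kron (kron (1\<^sub>m 2) (brow 1)) (x1 j)"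
    by (simp add: mul_def kron_add_right kron_assoc)
  have d: "kron (1\<^sub>m 2) (comult j) = kron (kron (1\<^sub>m 2) (bcol 0)) (d0 j) + kron (kron (1\<^sub>m 2) (bcol 1)) (d1 j)"
    by (simp add: comult_def kron_add_right kron_assoc)
  show ?thesis
    unfolding m d by (simp add: mat_mult_add mat_add_mult *)
qed

text \<open>The flip interchanges the two coordinate functionals, so comparing blocks reduces
  \<open>mm\<close> to the relations \<open>xx\<close> between products of two variables.\<close>

lemma mult_mult_flip: "mul (Suc j) * (kron (1\<^sub>m 2) (mul j) * kron (flip 2 2) (1\<^sub>m (dim_row (V j)))) =
   kron (kron (brow 0) (brow 0)) (x0 (Suc j) * x0 j) + kron (kron (brow 1) (brow 0)) (x0 (Suc j) * x1 j) +
   (kron (kron (brow 0) (brow 1)) (x1 (Suc j) * x0 j) + kron (kron (brow 1) (brow 1)) (x1 (Suc j) * x1 j))"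
  and mult_mult: "mul (Suc j) * kron (1\<^sub>m 2) (mul j) =
   kron (kron (brow 0) (brow 0)) (x0 (Suc j) * x0 j) + kron (kron (brow 0) (brow 1)) (x0 (Suc j) * x1 j) +
   (kron (kron (brow 1) (brow 0)) (x1 (Suc j) * x0 j) + kron (kron (brow 1) (brow 1)) (x1 (Suc j) * x1 j))"
proof -
  have m: "kron (1\<^sub>m 2) (mul j) = kron (kron (1\<^sub>m 2) (brow 0)) (x0 j) + kron (kron (1\<^sub>m 2) (brow 1)) (x1 j)"
    by (simp add: mul_def kron_add_right kron_assoc)
  have *: "kron (brow i) x * kron (kron (1\<^sub>m 2) (brow k)) y = kron (kron (brow i) (brow k)) (x * y)"
    if "dim_col x = dim_row y" for x y :: "'k mat" and i k
  proof -
    have "brow i * kron (1\<^sub>m 2) (brow k) = (kron (brow i) (brow k) :: 'k mat)"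
      using kron_mult [of "brow i" "1\<^sub>m 2 :: 'k mat" "1\<^sub>m 1" "brow k"] by simp
    then show ?thesis using kron_mult [of "brow i" "kron (1\<^sub>m 2) (brow k)" x y] that by simp
  qed
  show mm: "mul (Suc j) * kron (1\<^sub>m 2) (mul j) =
   kron (kron (brow 0) (brow 0)) (x0 (Suc j) * x0 j) + kron (kron (brow 0) (brow 1)) (x0 (Suc j) * x1 j) +
   (kron (kron (brow 1) (brow 0)) (x1 (Suc j) * x0 j) + kron (kron (brow 1) (brow 1)) (x1 (Suc j) * x1 j))"
    unfolding m mul_def [of "Suc j"] by (simp add: mat_mult_add mat_add_mult *) (rule eq_matI; simp add: add_ac)
  have **: "kron (kron (brow i) (brow k)) x * kron (flip 2 2) (1\<^sub>m (dim_row (V j))) = kron (kron (brow k) (brow i)) x"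
    if "dim_col x = dim_row (V j)" for x :: "'k mat" and i k
    using kron_mult [of "kron (brow i) (brow k)" "flip 2 2" x "1\<^sub>m (dim_row (V j))"] that by (simp add: brow_brow_flip)
  have "mul (Suc j) * (kron (1\<^sub>m 2) (mul j) * kron (flip 2 2) (1\<^sub>m (dim_row (V j)))) =
      mul (Suc j) * kron (1\<^sub>m 2) (mul j) * kron (flip 2 2) (1\<^sub>m (dim_row (V j)))"
    by (rule mat_mult_assoc [symmetric]) simp_all
  then show "mul (Suc j) * (kron (1\<^sub>m 2) (mul j) * kron (flip 2 2) (1\<^sub>m (dim_row (V j)))) =
   kron (kron (brow 0) (brow 0)) (x0 (Suc j) * x0 j) + kron (kron (brow 1) (brow 0)) (x0 (Suc j) * x1 j) +
   (kron (kron (brow 0) (brow 1)) (x1 (Suc j) * x0 j) + kron (kron (brow 1) (brow 1)) (x1 (Suc j) * x1 j))"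
    unfolding mm by (simp add: mat_add_mult **)
qed

sublocale fock X S mul comult \<epsilon> N
proof
  show "CHAR('k) > 2" by (rule char)
  show "X \<in> rep_objs" by (rule X_obj)
  show "S 0 = 1\<^sub>m (Suc 0)" by (simp add: S_def V0 mat_one_smult)
  show "\<epsilon> * \<epsilon> = 1" by (rule \<epsilon>)
  show "0 < N \<Longrightarrow> comult 0 * mul 0 = 1\<^sub>m (dim_row X)"
    unfolding comult_mult using dx0 bcol_brow_sum [where 'a = 'k]
    by (simp add: kron_zero_right)
  fix j
  show "j < N \<Longrightarrow> of_nat (Suc j) \<noteq> (0::'k)" by (rule inv)
  show "j < N \<Longrightarrow> mul j \<in> rhom (kron X (S j)) (S (Suc j))" by (rule mul_rhom)
  show "j < N \<Longrightarrow> comult j \<in> rhom (S (Suc j)) (kron X (S j))" by (rule comult_rhom)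
  show "mul j * comult j = of_nat (Suc j) \<cdot>\<^sub>m 1\<^sub>m (dim_row (S (Suc j)))" if "j < N"
  proof -
    have "mul j * comult j = x0 j * d0 j + x1 j * d1 j"
      by (simp add: comult_def mul_def mat_distribs(2,3) brow_bcol kron_zero_left flip: kron_mult)
    then show ?thesis using xd [OF that] by simp
  qed
next
  fix j assume j: "Suc j < N"
  have c\<epsilon>: "\<epsilon> \<cdot>\<^sub>m (kron (1\<^sub>m (dim_row X)) (mul j) * (kron (braid X X) (1\<^sub>m (dim_row (S j))) * kron (1\<^sub>m (dim_row X)) (comult j))) =
      (c * \<epsilon>) \<cdot>\<^sub>m (kron (1\<^sub>m 2) (mul j) * (kron (flip 2 2) (1\<^sub>m (dim_row (V j))) * kron (1\<^sub>m 2) (comult j)))"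
    unfolding braid_X by (simp add: kron_smult_left mat_smult_mult mat_mult_smult mat_smult_smult mult.commute)
  have one: "1\<^sub>m (2 * dim_row (V (Suc j))) = kron (bcol 0 * brow 0) (1\<^sub>m (dim_row (V (Suc j)))) + kron (bcol 1 * brow 1) (1\<^sub>m (dim_row (V (Suc j))) :: 'k mat)"
    using bcol_brow_sum [where 'a = 'k] by (simp add: kron_one flip: kron_add_left)
  show "comult (Suc j) * mul (Suc j) = 1\<^sub>m (dim_row X * dim_row (S (Suc j))) +
      \<epsilon> \<cdot>\<^sub>m (kron (1\<^sub>m (dim_row X)) (mul j) * (kron (braid X X) (1\<^sub>m (dim_row (S j))) * kron (1\<^sub>m (dim_row X)) (comult j)))"
    unfolding c\<epsilon> wick comult_mult dx [OF j] using one
    by (simp add: kron_add_right kron_smult_right mat_smult_add) (rule eq_matI; simp add: add_ac)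
  have c\<epsilon>2: "mul (Suc j) * (kron (1\<^sub>m (dim_row X)) (mul j) * kron (braid X X) (1\<^sub>m (dim_row (S j)))) =
      c \<cdot>\<^sub>m (mul (Suc j) * (kron (1\<^sub>m 2) (mul j) * kron (flip 2 2) (1\<^sub>m (dim_row (V j)))))"
    unfolding braid_X by (simp add: kron_smult_left mat_smult_mult mat_mult_smult)
  have "\<epsilon> \<cdot>\<^sub>m (mul (Suc j) * kron (1\<^sub>m 2) (mul j)) =
      \<epsilon> \<cdot>\<^sub>m (kron (kron (brow 0) (brow 0)) ((c * \<epsilon>) \<cdot>\<^sub>m (x0 (Suc j) * x0 j)) + kron (kron (brow 0) (brow 1)) ((c * \<epsilon>) \<cdot>\<^sub>m (x1 (Suc j) * x0 j)) +
        (kron (kron (brow 1) (brow 0)) ((c * \<epsilon>) \<cdot>\<^sub>m (x0 (Suc j) * x1 j)) + kron (kron (brow 1) (brow 1)) ((c * \<epsilon>) \<cdot>\<^sub>m (x1 (Suc j) * x1 j))))"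
    unfolding mult_mult by (simp only: xx [OF j, symmetric])
  also have "\<dots> = c \<cdot>\<^sub>m (mul (Suc j) * (kron (1\<^sub>m 2) (mul j) * kron (flip 2 2) (1\<^sub>m (dim_row (V j)))))"
  proof -
    have "\<epsilon> * (c * \<epsilon>) = c" using \<epsilon> by (metis mult.left_commute mult_1_right)
    then have "\<epsilon> \<cdot>\<^sub>m ((c * \<epsilon>) \<cdot>\<^sub>m A) = c \<cdot>\<^sub>m A" for A by (simp only: mat_smult_smult)
    then show ?thesis
      unfolding mult_mult_flip kron_smult_right by (simp add: mat_smult_add) (rule eq_matI; simp add: add_ac)
  qed
  finally show "mul (Suc j) * (kron (1\<^sub>m (dim_row X)) (mul j) * kron (braid X X) (1\<^sub>m (dim_row (S j)))) =
      \<epsilon> \<cdot>\<^sub>m (mul (Suc j) * kron (1\<^sub>m (dim_row X)) (mul j))"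
    unfolding c\<epsilon>2 by simp
qed

end

subsection \<open>Symmetric powers of a two-dimensional representation\<close>

lemma mult_column_monomial:
  assumes "dim_col A = r"
  shows "A * mat r c (\<lambda>(a,b). if a = g b then f b else 0) =
    mat (dim_row A) c (\<lambda>(i,b). if g b < r then A $$ (i, g b) * f b else (0 :: 'a::comm_semiring_1))"
  by (rule eq_matI) (use assms in \<open>auto simp: index_mult_sum if_distrib [of "(*) _"] cong: if_cong\<close>)

lemma row_monomial_mult:
  assumes "dim_row B = c"
  shows "mat r c (\<lambda>(a,b). if b = h a then f a else 0) * B =
    mat r (dim_col B) (\<lambda>(a,j). if h a < c then f a * B $$ (h a, j) else (0 :: 'a::comm_semiring_1))"
  by (rule eq_matI) (use assms in \<open>auto simp: index_mult_sum if_distrib [of "\<lambda>x. x * _"] cong: if_cong\<close>)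

text \<open>Multiplication by the variables and partial derivatives on binary forms, in the basis of monomials.\<close>

definition "sx0 j = mat (Suc (Suc j)) (Suc j) (\<lambda>(a,b). if a = b then 1 else 0 :: 'a::comm_semiring_1)"
definition "sx1 j = mat (Suc (Suc j)) (Suc j) (\<lambda>(a,b). if a = Suc b then 1 else 0 :: 'a::comm_semiring_1)"
definition "sd0 j = mat (Suc j) (Suc (Suc j)) (\<lambda>(a,b). if a = b then of_nat (Suc j - b) else 0 :: 'a::comm_semiring_1)"
definition "sd1 j = mat (Suc j) (Suc (Suc j)) (\<lambda>(a,b). if a = b - 1 then of_nat b else 0 :: 'a::comm_semiring_1)"

text \<open>Each operator has at most one nonzero entry per row as well as per column; the
  description by rows serves multiplication from the left. Where a predecessor of 0 is formed, the
  coefficient is 0.\<close>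

lemma ops_rows:
  "sx0 j = mat (Suc (Suc j)) (Suc j) (\<lambda>(a,b). if b = a then 1 else 0 :: 'a::comm_semiring_1)"
  "sx1 j = mat (Suc (Suc j)) (Suc j) (\<lambda>(a,b). if b = a - 1 then if a = 0 then 0 else 1 else 0 :: 'a::comm_semiring_1)"
  "sd0 j = mat (Suc j) (Suc (Suc j)) (\<lambda>(a,b). if b = a then of_nat (Suc j - a) else 0 :: 'a::comm_semiring_1)"
  "sd1 j = mat (Suc j) (Suc (Suc j)) (\<lambda>(a,b). if b = Suc a then of_nat (Suc a) else 0 :: 'a::comm_semiring_1)"
     apply (rule eq_matI; auto simp: sx0_def)
    apply (rule eq_matI; auto simp: sx1_def)
   apply (rule eq_matI; auto simp: sd0_def)
  apply (rule eq_matI; simp add: sd1_def split: nat_diff_split)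
  done

lemma ops_mult:
  "dim_col A = Suc (Suc j) \<Longrightarrow> A * sx0 j = mat (dim_row A) (Suc j) (\<lambda>(i,b). A $$ (i,b) :: 'a::comm_semiring_1)"
  "dim_col A = Suc (Suc j) \<Longrightarrow> A * sx1 j = mat (dim_row A) (Suc j) (\<lambda>(i,b). A $$ (i, Suc b))"
  "dim_col A = Suc j \<Longrightarrow> A * sd0 j = mat (dim_row A) (Suc (Suc j)) (\<lambda>(i,b). if b < Suc j then A $$ (i,b) * of_nat (Suc j - b) else 0)"
  "dim_col A = Suc j \<Longrightarrow> A * sd1 j = mat (dim_row A) (Suc (Suc j)) (\<lambda>(i,b). A $$ (i, b - 1) * of_nat b)"
  "dim_row B = Suc j \<Longrightarrow> sx0 j * B = mat (Suc (Suc j)) (dim_col B) (\<lambda>(a,i). if a < Suc j then B $$ (a,i) else 0)"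
  "dim_row B = Suc j \<Longrightarrow> sx1 j * B = mat (Suc (Suc j)) (dim_col B) (\<lambda>(a,i). if a = 0 then 0 else B $$ (a - 1,i))"
  "dim_row B = Suc (Suc j) \<Longrightarrow> sd0 j * B = mat (Suc j) (dim_col B) (\<lambda>(a,i). of_nat (Suc j - a) * B $$ (a,i))"
  "dim_row B = Suc (Suc j) \<Longrightarrow> sd1 j * B = mat (Suc j) (dim_col B) (\<lambda>(a,i). of_nat (Suc a) * B $$ (Suc a,i))"
         apply (subst sx0_def, subst mult_column_monomial, assumption, rule eq_matI; simp)
        apply (subst sx1_def, subst mult_column_monomial, assumption, rule eq_matI; simp)
       apply (subst sd0_def, subst mult_column_monomial, assumption, rule eq_matI; simp)
      apply (subst sd1_def, subst mult_column_monomial, assumption, rule eq_matI; auto)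
     apply (subst ops_rows, subst row_monomial_mult, assumption, rule eq_matI; simp)
    apply (subst ops_rows, subst row_monomial_mult, assumption, rule eq_matI; auto)
   apply (subst ops_rows, subst row_monomial_mult, assumption, rule eq_matI; simp)
  apply (subst ops_rows, subst row_monomial_mult, assumption, rule eq_matI; simp)
  done

lemma dim_ops_sym [simp]:
  "dim_row (sx0 j) = Suc (Suc j)" "dim_col (sx0 j) = Suc j" "dim_row (sx1 j) = Suc (Suc j)" "dim_col (sx1 j) = Suc j"
  "dim_row (sd0 j) = Suc j" "dim_col (sd0 j) = Suc (Suc j)" "dim_row (sd1 j) = Suc j" "dim_col (sd1 j) = Suc (Suc j)"
  by (simp_all add: sx0_def sx1_def sd0_def sd1_def)

lemma shift_index: "a \<le> j \<Longrightarrow> b \<le> j \<Longrightarrow> shift j $$ (a,b) = (of_nat (b choose a) :: 'a::semiring_1)"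
  by (simp add: shift_def)

lemma ops_index:
  "a < Suc (Suc j) \<Longrightarrow> b < Suc j \<Longrightarrow> sx0 j $$ (a,b) = (if a = b then 1 else 0 :: 'a::comm_semiring_1)"
  "a < Suc (Suc j) \<Longrightarrow> b < Suc j \<Longrightarrow> sx1 j $$ (a,b) = (if a = Suc b then 1 else 0 :: 'a)"
  "a < Suc j \<Longrightarrow> b < Suc (Suc j) \<Longrightarrow> sd0 j $$ (a,b) = (if a = b then of_nat (Suc j - b) else 0 :: 'a)"
  "a < Suc j \<Longrightarrow> b < Suc (Suc j) \<Longrightarrow> sd1 j $$ (a,b) = (if a = b - 1 then of_nat b else 0 :: 'a)"
  by (simp_all add: sx0_def sx1_def sd0_def sd1_def)

text \<open>With \<open>\<epsilon> = c\<close> the effective sign \<open>c * \<epsilon>\<close> is 1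
  and the variables commute. Binary forms thus give the symmetric powers of the even block
  (\<open>c = 1\<close>) and the exterior powers of the odd one (\<open>c = -1\<close>). The bound
  \<open>p - 1\<close> is the largest for which all divisors are invertible.\<close>

lemma fock_ops_sym:
  fixes c :: "'k::field"
  assumes char: "prime CHAR('k)" "CHAR('k) > 2" and c: "c * c = 1"
  shows "fock_ops c c shift sx0 sx1 sd0 sd1 (CHAR('k) - 1)"
proof
  show "odd CHAR('k)" using char by (simp add: prime_odd_nat)
  show "shift 0 = (1\<^sub>m (Suc 0) :: 'k mat)" by (rule eq_matI) (auto simp: shift_def)
  fix j
  show "of_nat (Suc j) \<noteq> (0::'k)" if "j < CHAR('k) - 1"
    unfolding of_nat_eq_0_iff_char_dvd using that by (auto dest: dvd_imp_le)
  show "shift j ^\<^sub>m CHAR('k) = (1\<^sub>m (dim_row (shift j :: 'k mat)) :: 'k mat)"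
    using shift_pow_CHAR [where 'a = 'k] char(2) by simp
  show "sx0 j * shift j = shift (Suc j) * (sx0 j :: 'k mat)"
    by (rule eq_matI) (auto simp: ops_mult shift_index less_Suc_eq_le le_Suc_eq binomial_eq_0)
  show "(sx0 j + sx1 j) * shift j = shift (Suc j) * (sx1 j :: 'k mat)"
  proof (rule eq_matI)
    fix a b assume "a < dim_row (shift (Suc j) * (sx1 j :: 'k mat))" "b < dim_col (shift (Suc j) * (sx1 j :: 'k mat))"
    then show "((sx0 j + sx1 j) * shift j) $$ (a,b) = (shift (Suc j) * (sx1 j :: 'k mat)) $$ (a,b)"
      by (cases a; cases "a = Suc j") (auto simp: mat_add_mult ops_mult shift_index less_Suc_eq_le binomial_eq_0 add.commute)
  qed simp_all
  show "shift j * (sd0 j + sd1 j) = sd0 j * (shift (Suc j) :: 'k mat)"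
  proof (rule eq_matI)
    fix a b assume "a < dim_row (sd0 j * (shift (Suc j) :: 'k mat))" "b < dim_col (sd0 j * (shift (Suc j) :: 'k mat))"
    then have ab: "a \<le> j" "b \<le> Suc j" by auto
    \<comment> \<open>From \<open>(b - a) * (b choose a) = b * (b - 1 choose a)\<close>, after
      adding \<open>(Suc j - b) * (b choose a)\<close> on both sides.\<close>
    have "(b choose a) * (Suc j - b) + (b - 1 choose a) * b = (Suc j - a) * (b choose a)"
    proof (cases "a \<le> b")
      case True
      then have "Suc j - a = (Suc j - b) + (b - a)" using ab by simp
      then show ?thesis using binomial_absorb_comp [of b a] by (simp add: algebra_simps)
    qed (use binomial_absorb_comp [of b a] in \<open>simp add: binomial_eq_0\<close>)
    then have "of_nat (b choose a) * of_nat (Suc j - b) + of_nat (b - 1 choose a) * of_nat b = (of_nat (Suc j - a) * of_nat (b choose a) :: 'k)"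
      by (simp only: flip: of_nat_mult of_nat_add)
    then show "(shift j * (sd0 j + sd1 j)) $$ (a,b) = (sd0 j * (shift (Suc j) :: 'k mat)) $$ (a,b)"
      using ab by (cases "b = Suc j") (auto simp: mat_mult_add ops_mult shift_index less_Suc_eq_le simp del: of_nat_Suc of_nat_diff)
  qed simp_all
  show "shift j * sd1 j = sd1 j * (shift (Suc j) :: 'k mat)"
  proof (rule eq_matI)
    fix a b assume "a < dim_row (sd1 j * (shift (Suc j) :: 'k mat))" "b < dim_col (sd1 j * (shift (Suc j) :: 'k mat))"
    then have ab: "a \<le> j" "b \<le> Suc j" by auto
    have "(b - 1 choose a) * b = Suc a * (b choose Suc a)"
      using binomial_absorption [of a b] by (simp add: mult.commute)
    then have "of_nat (b - 1 choose a) * of_nat b = (of_nat (Suc a) * of_nat (b choose Suc a) :: 'k)"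
      by (simp only: flip: of_nat_mult of_nat_add)
    then show "(shift j * sd1 j) $$ (a,b) = (sd1 j * (shift (Suc j) :: 'k mat)) $$ (a,b)"
      using ab by (auto simp: ops_mult shift_index less_Suc_eq_le simp del: of_nat_Suc of_nat_diff)
  qed simp_all
  show "sx0 j * sd0 j + sx1 j * sd1 j = of_nat (Suc j) \<cdot>\<^sub>m (1\<^sub>m (dim_row (shift (Suc j) :: 'k mat)) :: 'k mat)"
    by (rule eq_matI; auto simp: ops_mult ops_index less_Suc_eq_le le_Suc_eq of_nat_diff split: nat_diff_split_asm)
  show "sd0 0 * sx0 0 = (1\<^sub>m 1 :: 'k mat) \<and> sd0 0 * sx1 0 = (0\<^sub>m 1 1 :: 'k mat) \<and>
      sd1 0 * sx0 0 = (0\<^sub>m 1 1 :: 'k mat) \<and> sd1 0 * sx1 0 = (1\<^sub>m 1 :: 'k mat)"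
    by (intro conjI; rule eq_matI; simp add: ops_mult ops_index)
  show "sd0 (Suc j) * sx0 (Suc j) = 1\<^sub>m (dim_row (shift (Suc j) :: 'k mat)) + (c * c) \<cdot>\<^sub>m (sx0 j * sd0 j :: 'k mat)"
    "sd0 (Suc j) * sx1 (Suc j) = (c * c) \<cdot>\<^sub>m (sx1 j * sd0 j :: 'k mat)"
    "sd1 (Suc j) * sx0 (Suc j) = (c * c) \<cdot>\<^sub>m (sx0 j * sd1 j :: 'k mat)"
    "sd1 (Suc j) * sx1 (Suc j) = 1\<^sub>m (dim_row (shift (Suc j) :: 'k mat)) + (c * c) \<cdot>\<^sub>m (sx1 j * sd1 j :: 'k mat)"
    unfolding c mat_one_smult 
       apply (rule eq_matI; auto simp: ops_mult ops_index less_Suc_eq_le le_Suc_eq of_nat_diff)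
      apply (rule eq_matI; auto simp: ops_mult ops_index less_Suc_eq_le)
     apply (rule eq_matI; auto simp: ops_mult ops_index less_Suc_eq_le split: nat_diff_split_asm)
    apply (rule eq_matI; auto simp: ops_mult ops_index less_Suc_eq_le split: nat_diff_split_asm)
    done
  show "sx0 (Suc j) * sx1 j = (c * c) \<cdot>\<^sub>m (sx1 (Suc j) * sx0 j :: 'k mat)"
    "sx1 (Suc j) * sx0 j = (c * c) \<cdot>\<^sub>m (sx0 (Suc j) * sx1 j :: 'k mat)"
    unfolding c mat_one_smult by (rule eq_matI; auto simp: ops_mult ops_index less_Suc_eq_le)+
qed (use assms in \<open>auto simp: mat_one_smult\<close>)

text \<open>Conjugation gives \<open>W * T * U = T - 1\<close>. As \<open>g\<close> commutes with
  \<open>U\<close>, the traces of \<open>g * T\<close> and of \<open>g * (W * T * U)\<close> agree,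
  and their difference is the trace of \<open>g\<close>.\<close>

lemma trace_commutant_zero:
  fixes g :: "'a::comm_ring_1 mat"
  assumes g: "g \<in> carrier_mat n n" and U: "U \<in> carrier_mat n n" and W: "W \<in> carrier_mat n n" and T: "T \<in> carrier_mat n n"
    and WU: "W * U = 1\<^sub>m n" "U * W = 1\<^sub>m n" and comm: "g * U = U * g" and UT: "U * T = T * U + U"
  shows "trace g = 0"
proof -
  note [simp] = carrier_matD [OF g] carrier_matD [OF U] carrier_matD [OF W] carrier_matD [OF T]
  have gW: "U * (g * W) = g"
  proof -
    have "U * (g * W) = (U * g) * W" by (simp add: mat_mult_assoc)
    also have "\<dots> = g * (U * W)" unfolding comm [symmetric] by (simp add: mat_mult_assoc)
    finally show ?thesis using WU by simp
  qed
  have "g * T = g * (W * (U * T))"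
    using WU by (simp flip: mat_mult_assoc [of W U T])
  also have "\<dots> = g * (W * (T * U)) + g"
    unfolding UT using WU by (simp add: mat_mult_add)
  also have "trace \<dots> = trace (g * (W * (T * U))) + trace g" by (intro trace_add) simp_all
  also have "g * (W * (T * U)) = (g * (W * T)) * U" by (simp add: mat_mult_assoc)
  also have "trace \<dots> = trace (U * (g * (W * T)))" by (rule trace_mult_commute) simp_all
  also have "U * (g * (W * T)) = U * (g * W) * T" by (simp add: mat_mult_assoc)
  finally show ?thesis unfolding gW by simp
qed

text \<open>
  In the basis \<open>1, x, \<dots>, x\<^sup>p\<^sup>-\<^sup>1\<close> of \<open>k[x]/(x\<^sup>p - x)\<close> the matrix \<open>shift (p - 1)\<close> is the substitution
  \<open>x \<mapsto> x + 1\<close>, and \<open>T\<close> below is multiplication by \<open>x\<close>.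
\<close>

lemma shift_last_trace_zero:
  fixes g :: "'k::field mat"
  assumes char: "prime CHAR('k)" "CHAR('k) > 2" and g: "g \<in> carrier_mat CHAR('k) CHAR('k)"
    and comm: "g * shift (CHAR('k) - 1) = shift (CHAR('k) - 1) * g"
  shows "trace g = 0"
proof -
  define n where "n = CHAR('k) - 1"
  have p: "CHAR('k) = Suc n" "n > 1" using char by (auto simp: n_def)
  let ?U = "shift n :: 'k mat"
  have U: "?U \<in> carrier_mat (Suc n) (Suc n)" by (intro carrier_matI) simp_all
  have "?U ^\<^sub>m Suc n = 1\<^sub>m (Suc n)" using shift_pow_CHAR [where 'a = 'k and j = n] p by simp
  then have WU: "?U ^\<^sub>m n * ?U = 1\<^sub>m (Suc n)" by simp
  then have UW: "?U * ?U ^\<^sub>m n = 1\<^sub>m (Suc n)"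
    using mat_mult_left_right_inverse [OF pow_carrier_mat [OF U] U] by blast
  \<comment> \<open>In the last column \<open>x * x^n = x^p = x\<close>, hence the entry in row
    1.\<close>
  define T :: "'k mat" where "T = mat (Suc n) (Suc n) (\<lambda>(a,b). if a = (if b = n then 1 else Suc b) then 1 else 0)"
  have T: "T \<in> carrier_mat (Suc n) (Suc n)" by (simp add: T_def)
  have "?U * T = T * ?U + ?U"
  proof (rule eq_matI)
    fix a b assume "a < dim_row (T * ?U + ?U)" "b < dim_col (T * ?U + ?U)"
    then have ab: "a \<le> n" "b \<le> n" by auto
    have "?U * T = mat (Suc n) (Suc n) (\<lambda>(i,b). ?U $$ (i, if b = n then 1 else Suc b))"
      unfolding T_def by (subst mult_column_monomial) (use p in \<open>auto intro!: eq_matI\<close>)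
    then have 1: "(?U * T) $$ (a,b) = of_nat ((if b = n then 1 else Suc b) choose a)"
      using ab p by (auto simp: shift_index)
    have "(T * ?U) $$ (a,b) = (\<Sum>k<Suc n. (if a = (if k = n then 1 else Suc k) then 1 else 0) * of_nat (b choose k))"
      using ab by (subst index_mult_sum) (auto simp: T_def shift_index intro!: sum.cong)
    also have "\<dots> = (\<Sum>k<n. (if a = Suc k then 1 else 0) * of_nat (b choose k)) + (if a = 1 then of_nat (b choose n) else 0)"
      by simp
    also have "(\<Sum>k<n. (if a = Suc k then 1 else 0) * of_nat (b choose k) :: 'k) = (if a = 0 then 0 else of_nat (b choose (a - 1)))"
      using ab by (cases a) (auto simp: if_distrib [of "\<lambda>x. x * _"] cong: if_cong)
    finally have 2: "(T * ?U) $$ (a,b) = (if a = 0 then 0 else of_nat (b choose (a - 1))) + (if a = 1 then of_nat (b choose n) else 0)" .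
    \<comment> \<open>In the last column Pascal's rule produces the binomial coefficient of
      \<open>p\<close> over \<open>a\<close>, which must vanish for the wrap-around of
      \<open>T\<close> to be consistent.\<close>
    have 3: "of_nat (Suc n choose a) = (0::'k)" if "0 < a"
      unfolding of_nat_eq_0_iff_char_dvd using dvd_choose_prime [of a "CHAR('k)"] that ab p char by simp
    show "(?U * T) $$ (a,b) = (T * ?U + ?U) $$ (a,b)"
      using 1 2 3 ab by (cases a; cases "b = n") (auto simp: shift_index binomial_eq_0 add_ac)
  qed (simp_all add: T_def)
  then show ?thesis
    using trace_commutant_zero [OF _ U pow_carrier_mat [OF U] T WU UW] g comm unfolding p n_def [symmetric] by simp
qed

context
  fixes c :: "'k::field"
  assumes ch: "prime CHAR('k)" "CHAR('k) > 2" and c: "c * c = 1"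
begin

interpretation fock_ops c c shift sx0 sx1 sd0 sd1 "CHAR('k) - 1"
  by (rule fock_ops_sym [OF ch c])

text \<open>Every endomorphism commutes with the substitution and so has trace zero by
  \<open>shift_last_trace_zero\<close>; the parity only contributes a scalar.\<close>

lemma sym_last_negl: "1\<^sub>m (dim_row (S (CHAR('k) - 1))) \<in> negl (S (CHAR('k) - 1)) (S (CHAR('k) - 1))"
proof (rule neglI [OF Hom_id [OF S_objs]])
  let ?n = "CHAR('k) - 1"
  have p: "Suc ?n = CHAR('k)" using ch by simp
  fix g assume g: "g \<in> Hom (S ?n) (S ?n)"
  have gd: "dim_row g = Suc ?n" "dim_col g = Suc ?n" using Hom_dims [OF g] by simp_all
  have "c ^ ?n \<cdot>\<^sub>m (c ^ ?n \<cdot>\<^sub>m (g * shift ?n)) = c ^ ?n \<cdot>\<^sub>m (c ^ ?n \<cdot>\<^sub>m (shift ?n * g))"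
    using HomD [OF g] gd by (simp add: S_def mat_mult_smult mat_smult_mult)
  then have "g * shift ?n = shift ?n * g" unfolding mat_smult_smult cj mat_one_smult .
  then have "trace g = 0"
    by (intro shift_last_trace_zero [OF ch]) (use gd p in \<open>auto intro!: carrier_matI\<close>)
  moreover have "par (S ?n) * (1\<^sub>m (dim_row (S ?n)) * g) = c ^ ?n \<cdot>\<^sub>m g"
    unfolding S_def par_smult [OF V cj odd] using gd by (simp add: mat_smult_mult)
  ultimately show "trace (par (S ?n) * (1\<^sub>m (dim_row (S ?n)) * g)) = 0"
    using gd by (simp add: trace_smult)
qed

text \<open>The minimum records that every degree from \<open>p - 1\<close> on is represented by the
  same negligible block.\<close>

lemma power_split_shift:
  "power_split c (c \<cdot>\<^sub>m shift 1) n (c ^ min n (CHAR('k) - 1) \<cdot>\<^sub>m shift (min n (CHAR('k) - 1)))"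
  using split [of n] split_zero [OF sym_last_negl, of n] unfolding S_def X_def
  by (cases "n \<le> CHAR('k) - 1") (simp_all add: min_def)

lemma trace_par_power_shift:
  "trace (par (c ^ min n (CHAR('k) - 1) \<cdot>\<^sub>m shift (min n (CHAR('k) - 1)))) =
    (if n < CHAR('k) - 1 then c ^ n * of_nat (Suc n) else 0)"
  using trace_par_S [of "min n (CHAR('k) - 1)"] ch unfolding S_def
  by (auto simp: min_def not_less of_nat_diff simp del: of_nat_Suc)

end

subsection \<open>Exterior powers of a two-dimensional representation\<close>

text \<open>Exterior powers of a plane: sizes 1, 2, 1, 0. Degree 2 is the determinant, on which a
  unipotent matrix acts trivially.\<close>

definition "ev j = (if j = 1 then shift 1 else if j = 0 \<or> j = 2 then 1\<^sub>m 1 else 1\<^sub>m 0 :: 'a::comm_ring_1 mat)"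
text \<open>Left multiplication by the first basis vector \<open>e0\<close>, in the bases
  \<open>1\<close>, then \<open>e0, e1\<close>, then \<open>e0 \<and> e1\<close>. The minus sign in
  \<open>ex1\<close> comes from \<open>e1 \<and> e0\<close>; \<open>ed0\<close> and
  \<open>ed1\<close> are the contractions.\<close>

definition "ex0 j = (if j = 0 then bcol 0 else if j = 1 then brow 1
  else 0\<^sub>m (dim_row (ev (Suc j) :: 'a mat)) (dim_row (ev j :: 'a mat)) :: 'a::comm_ring_1 mat)"
definition "ex1 j = (if j = 0 then bcol 1 else if j = 1 then (-1) \<cdot>\<^sub>m brow 0
  else 0\<^sub>m (dim_row (ev (Suc j) :: 'a mat)) (dim_row (ev j :: 'a mat)) :: 'a::comm_ring_1 mat)"
definition "ed0 j = (if j = 0 then brow 0 else if j = 1 then bcol 1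
  else 0\<^sub>m (dim_row (ev j :: 'a mat)) (dim_row (ev (Suc j) :: 'a mat)) :: 'a::comm_ring_1 mat)"
definition "ed1 j = (if j = 0 then brow 1 else if j = 1 then (-1) \<cdot>\<^sub>m bcol 0
  else 0\<^sub>m (dim_row (ev j :: 'a mat)) (dim_row (ev (Suc j) :: 'a mat)) :: 'a::comm_ring_1 mat)"

text \<open>With \<open>\<epsilon> = - c\<close> the effective sign is \<open>-1\<close>, so the
  exterior algebra gives the exterior powers of the even block and the symmetric powers of the odd
  one. The chain runs to the empty matrix in degree 3, for which 1, 2 and 3 must be invertible; here
  \<open>p > 3\<close> enters.\<close>

lemma fock_ops_ext:
  fixes c :: "'k::field"
  assumes char: "prime CHAR('k)" "CHAR('k) > 3" and c: "c * c = 1"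
  shows "fock_ops c (- c) ev ex0 ex1 ed0 ed1 3"
proof
  note d = ev_def ex0_def ex1_def ed0_def ed1_def
  show "odd CHAR('k)" using char by (simp add: prime_odd_nat)
  show "- c * - c = 1" using c by simp
  have 3: "j < 3 \<longleftrightarrow> j = 0 \<or> j = 1 \<or> j = 2" and 2: "Suc j < 3 \<longleftrightarrow> j = 0 \<or> j = 1" for j :: nat by auto
  have [simp]: "shift (Suc 0) $$ (a,b) = (of_nat (b choose a) :: 'k)" if "a < 2" "b < 2" for a b
    using that by (simp add: shift_def)
  have [simp]: "brow i $$ (0,b) = (if b = i then 1 else 0 :: 'k)" "bcol i $$ (b,0) = (if b = i then 1 else 0 :: 'k)" if "b < 2" for b i
    using that by (simp_all add: brow_def bcol_def)
  have m1: "c * - c = -1" using c by simp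
  fix j :: nat
  show "dim_col (ev j :: 'k mat) = dim_row (ev j :: 'k mat)" by (simp add: d)
  show "of_nat (Suc j) \<noteq> (0::'k)" if "j < 3"
    unfolding of_nat_eq_0_iff_char_dvd using that char by (auto dest: dvd_imp_le)
  show "ev j ^\<^sub>m CHAR('k) = (1\<^sub>m (dim_row (ev j :: 'k mat)) :: 'k mat)"
    using shift_pow_CHAR [where 'a = 'k] char(2) by (simp add: d one_pow_mat)
  show "ex0 j \<in> carrier_mat (dim_row (ev (Suc j) :: 'k mat)) (dim_row (ev j :: 'k mat))"
    "ex1 j \<in> carrier_mat (dim_row (ev (Suc j) :: 'k mat)) (dim_row (ev j :: 'k mat))"
    "ed0 j \<in> carrier_mat (dim_row (ev j :: 'k mat)) (dim_row (ev (Suc j) :: 'k mat))"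
    "ed1 j \<in> carrier_mat (dim_row (ev j :: 'k mat)) (dim_row (ev (Suc j) :: 'k mat))"
    by (intro carrier_matI; simp add: d)+
  note e = d index_mult_sum numeral_2_eq_2 less_Suc_eq
  show "ex0 j * ev j = ev (Suc j) * (ex0 j :: 'k mat)" "(ex0 j + ex1 j) * ev j = ev (Suc j) * (ex1 j :: 'k mat)"
    "ev j * (ed0 j + ed1 j) = ed0 j * (ev (Suc j) :: 'k mat)" "ev j * ed1 j = ed1 j * (ev (Suc j) :: 'k mat)"
    "ex0 j * ed0 j + ex1 j * ed1 j = of_nat (Suc j) \<cdot>\<^sub>m (1\<^sub>m (dim_row (ev (Suc j) :: 'k mat)) :: 'k mat)"
    if "j < 3"
    using that unfolding 3 by (elim disjE; intro eq_matI; auto simp: e)+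
  show "ed0 0 * ex0 0 = (1\<^sub>m 1 :: 'k mat) \<and> ed0 0 * ex1 0 = (0\<^sub>m 1 1 :: 'k mat) \<and>
      ed1 0 * ex0 0 = (0\<^sub>m 1 1 :: 'k mat) \<and> ed1 0 * ex1 0 = (1\<^sub>m 1 :: 'k mat)"
    by (intro conjI; rule eq_matI; simp add: e)
  show "ed0 (Suc j) * ex0 (Suc j) = 1\<^sub>m (dim_row (ev (Suc j) :: 'k mat)) + (c * - c) \<cdot>\<^sub>m (ex0 j * ed0 j :: 'k mat)"
    "ed0 (Suc j) * ex1 (Suc j) = (c * - c) \<cdot>\<^sub>m (ex1 j * ed0 j :: 'k mat)"
    "ed1 (Suc j) * ex0 (Suc j) = (c * - c) \<cdot>\<^sub>m (ex0 j * ed1 j :: 'k mat)"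
    "ed1 (Suc j) * ex1 (Suc j) = 1\<^sub>m (dim_row (ev (Suc j) :: 'k mat)) + (c * - c) \<cdot>\<^sub>m (ex1 j * ed1 j :: 'k mat)"
    "ex0 (Suc j) * ex0 j = (c * - c) \<cdot>\<^sub>m (ex0 (Suc j) * ex0 j :: 'k mat)"
    "ex0 (Suc j) * ex1 j = (c * - c) \<cdot>\<^sub>m (ex1 (Suc j) * ex0 j :: 'k mat)"
    "ex1 (Suc j) * ex0 j = (c * - c) \<cdot>\<^sub>m (ex0 (Suc j) * ex1 j :: 'k mat)"
    "ex1 (Suc j) * ex1 j = (c * - c) \<cdot>\<^sub>m (ex1 (Suc j) * ex1 j :: 'k mat)"
    if "Suc j < 3"
    unfolding m1 using that unfolding 2 by (elim disjE; intro eq_matI; auto simp: e)+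
qed (use assms in \<open>auto simp: ev_def\<close>)

context
  fixes c :: "'k::field"
  assumes ch: "prime CHAR('k)" "CHAR('k) > 3" and c: "c * c = 1"
begin

interpretation fock_ops c "- c" ev ex0 ex1 ed0 ed1 3
  by (rule fock_ops_ext [OF ch c])

lemma ext_last_negl: "1\<^sub>m (dim_row (S 3)) \<in> negl (S 3) (S 3)"
proof (rule neglI [OF Hom_id [OF S_objs]])
  fix g assume "g \<in> Hom (S 3) (S 3)"
  then show "trace (par (S 3) * (1\<^sub>m (dim_row (S 3)) * g)) = 0"
    using S_objs [of 3] by (simp add: trace_def ev_def)
qed

lemma power_split_ext: "power_split (- c) (c \<cdot>\<^sub>m shift 1) n (c ^ min n 3 \<cdot>\<^sub>m ev (min n 3))"
  using split [of n] split_zero [OF ext_last_negl, of n] unfolding S_def X_def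
  by (cases "n \<le> 3") (simp_all add: min_def)

lemma trace_par_power_ext: "trace (par (c ^ min n 3 \<cdot>\<^sub>m ev (min n 3))) =
    (if n = 0 then 1 else if n = 1 then 2 * c else if n = 2 then 1 else 0)"
  using trace_par_S [of "min n 3"] c unfolding S_def
  by (auto simp: min_def ev_def power2_eq_square mult.commute)

end

subsection \<open>Powers of the odd line\<close>

definition odd_line :: "'k::field mat" where
  "odd_line = (-1) \<cdot>\<^sub>m 1\<^sub>m 1"

lemma dim_odd_line [simp]: "dim_row odd_line = Suc 0" "dim_col odd_line = Suc 0"
  by (simp_all add: odd_line_def)

context
  fixes K :: "'k::field itself"
  assumes ch: "prime CHAR('k)" "CHAR('k) > 2"
begin

private lemma odd_char: "odd CHAR('k)"
  using ch by (simp add: prime_odd_nat)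

lemma
  fixes c :: 'k
  assumes "c * c = 1"
  shows par_line: "par (c \<cdot>\<^sub>m 1\<^sub>m n) = c \<cdot>\<^sub>m 1\<^sub>m n"
    and line_obj: "c \<cdot>\<^sub>m 1\<^sub>m n \<in> rep_objs"
  using par_smult [of "1\<^sub>m n :: 'k mat" c] smult_obj [of "1\<^sub>m n :: 'k mat" c] assms odd_char by (simp_all add: one_pow_mat)

lemma odd_line_obj: "(odd_line :: 'k mat) \<in> rep_objs"
  unfolding odd_line_def by (rule line_obj) simp

lemma braid_odd_line: "braid odd_line odd_line = ((-1) \<cdot>\<^sub>m 1\<^sub>m 1 :: 'k mat)"
  using braid_smult [of "1\<^sub>m 1 :: 'k mat" "-1"] odd_char two_nz [OF ch(2)] by (simp add: odd_line_def one_pow_mat)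

lemma tpow_odd_line: "tpow odd_line n = ((-1) ^ n \<cdot>\<^sub>m 1\<^sub>m 1 :: 'k mat)"
  by (induction n) (simp_all add: mat_one_smult odd_line_def kron_smult_left mat_smult_smult)

text \<open>The self-braiding is \<open>-1\<close>, so every map on a tensor power is already
  antisymmetric and the exterior power is the full tensor power. The resulting series is that of
  \<open>(1 + z)^(-1)\<close>.\<close>

lemma ext_power_odd_line: "cat_dim ver (ext_power ver n (odd_line :: 'k mat)) = (-1) ^ n"
proof -
  let ?T = "tpow odd_line n :: 'k mat"
  have T: "?T \<in> rep_objs" by (rule tpow_obj [OF odd_line_obj])
  have "power_split (-1) odd_line n ?T"
    unfolding power_split_def
  proof (intro bexI conjI allI ballI impI)
    show i: "1\<^sub>m 1 \<in> rhom ?T ?T" "1\<^sub>m 1 \<in> rhom ?T ?T" using rhom_id [OF T] by simp_all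
    show "twisted (-1) odd_line n ?T (1\<^sub>m 1)"
      unfolding twisted_def by (simp add: place_def braid_odd_line kron_smult_left)
    fix Z a assume "a \<in> rhom ?T Z"
    then show "mor ?T Z (a * (1\<^sub>m 1 * 1\<^sub>m 1)) = mor ?T Z a" using rhom_dims [of a ?T Z] by simp
  qed simp
  then have "cat_dim ver (ext_power ver n (odd_line :: 'k mat)) = trace (par ?T)"
    by (rule cat_dim_ext_power [OF ch(2) odd_line_obj])
  also have "par ?T = (-1) ^ n \<cdot>\<^sub>m 1\<^sub>m 1"
    unfolding tpow_odd_line by (rule par_line) (simp flip: power_mult_distrib)
  finally show ?thesis by (simp add: trace_smult)
qed

lemma sym_power_odd_line:
  "cat_dim ver (sym_power ver n (odd_line :: 'k mat)) = (if n = 0 then 1 else if n = 1 then -1 else 0)"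
proof -
  \<comment> \<open>The chain ends with the empty matrix in degree 2; the commutation relation there
    holds because the braiding \<open>-1\<close> cancels the identity.\<close>
  define S :: "nat \<Rightarrow> 'k mat" where "S j = (if j = 0 then 1\<^sub>m 1 else if j = 1 then odd_line else 1\<^sub>m 0)" for j
  define m :: "nat \<Rightarrow> 'k mat" where "m j = (if j = 0 then 1\<^sub>m 1 else 0\<^sub>m 0 1)" for j
  define \<Delta> :: "nat \<Rightarrow> 'k mat" where "\<Delta> j = (if j = 0 then 1\<^sub>m 1 else 0\<^sub>m 1 0)" for j
  have empty: "(1\<^sub>m 0 :: 'k mat) \<in> rep_objs" using line_obj [of 1 0] by (simp add: mat_one_smult)
  have l2: "j < 2 \<longleftrightarrow> j = 0 \<or> j = 1" for j :: nat by auto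
  interpret fock odd_line S m \<Delta> 1 2
  proof
    show "(odd_line :: 'k mat) \<in> rep_objs" by (rule odd_line_obj)
    fix j :: nat assume "j < 2"
    then show "m j \<in> rhom (kron odd_line (S j)) (S (Suc j))" "\<Delta> j \<in> rhom (S (Suc j)) (kron odd_line (S j))"
      unfolding l2 using rhom_id [OF odd_line_obj] rhom_zero [OF kron_obj [OF odd_line_obj odd_line_obj] empty]
        rhom_zero [OF empty kron_obj [OF odd_line_obj odd_line_obj]]
      by (auto simp: S_def m_def \<Delta>_def)
  next
    fix j :: nat assume "j < 2"
    then show "m j * \<Delta> j = of_nat (Suc j) \<cdot>\<^sub>m 1\<^sub>m (dim_row (S (Suc j)))"
      unfolding l2 by (elim disjE; intro eq_matI; simp add: S_def m_def \<Delta>_def)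
    show "of_nat (Suc j) \<noteq> (0::'k)"
      using \<open>j < 2\<close> ch unfolding of_nat_eq_0_iff_char_dvd by (auto dest: dvd_imp_le)
  next
    fix j :: nat assume "Suc j < 2"
    then have j: "j = 0" by simp
    show "\<Delta> (Suc j) * m (Suc j) = 1\<^sub>m (dim_row odd_line * dim_row (S (Suc j))) + 1 \<cdot>\<^sub>m
       (kron (1\<^sub>m (dim_row odd_line)) (m j) * (kron (braid odd_line odd_line) (1\<^sub>m (dim_row (S j))) * kron (1\<^sub>m (dim_row odd_line)) (\<Delta> j)))"
      unfolding braid_odd_line j
      by (intro eq_matI; simp add: S_def m_def \<Delta>_def index_mult_sum)
    show "m (Suc j) * (kron (1\<^sub>m (dim_row odd_line)) (m j) * kron (braid odd_line odd_line) (1\<^sub>m (dim_row (S j)))) =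
      1 \<cdot>\<^sub>m (m (Suc j) * kron (1\<^sub>m (dim_row odd_line)) (m j))"
      unfolding braid_odd_line j by (intro eq_matI; simp add: S_def m_def \<Delta>_def)
  qed (use ch in \<open>simp_all add: S_def m_def \<Delta>_def\<close>)
  have "1\<^sub>m (dim_row (S 2)) \<in> negl (S 2) (S 2)"
    by (rule neglI [OF Hom_id]) (use empty in \<open>simp_all add: S_def trace_def\<close>)
  note z = split_zero [OF this]
  have "power_split 1 odd_line n (S (min n 2))"
    using split [of n] z [of n] by (cases "n \<le> 2") (simp_all add: min_def)
  then have "cat_dim ver (sym_power ver n (odd_line :: 'k mat)) = trace (par (S (min n 2)))"
    by (rule cat_dim_sym_power [OF ch(2) odd_line_obj])
  also have "\<dots> = (if n = 0 then 1 else if n = 1 then -1 else 0)"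
    using par_line [of 1 0] par_line [of 1 1] par_line [of "-1" 1]
    by (auto simp: min_def S_def odd_line_def trace_smult mat_one_smult trace_def)
  finally show ?thesis .
qed

end

section \<open>Powers with $p$-adic exponents\<close>

lemma padic_digit_less:
  assumes "t \<in> padic_ints p" "p > 0"
  shows "padic_digit p t j < p"
proof -
  have "0 \<le> t (Suc j)" "t (Suc j) < int p ^ Suc j" using assms(1) by (auto simp: padic_ints_def simp del: power_Suc)
  moreover have "int p ^ j * (t (Suc j) div int p ^ j) \<le> t (Suc j)"
    using assms(2) by (simp add: minus_mod_eq_mult_div [symmetric])
  ultimately have "int p ^ j * (t (Suc j) div int p ^ j) < int p ^ j * int p"
    by (simp add: mult.commute)
  then have "t (Suc j) div int p ^ j < int p" using assms(2) by simp
  then show ?thesis using assms(2) by (simp add: padic_digit_def nat_less_iff)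
qed

lemma padic_eqI:
  assumes s: "s \<in> padic_ints p" and t: "t \<in> padic_ints p" and p: "p > 0"
    and digits: "\<And>j. padic_digit p s j = padic_digit p t j"
  shows "s = t"
proof
  have split: "x (Suc n) = int p ^ n * int (padic_digit p x n) + x n" if "x \<in> padic_ints p" for x n
  proof -
    have "0 \<le> x (Suc n)" "x (Suc n) mod int p ^ n = x n" using that by (auto simp: padic_ints_def simp del: power_Suc)
    moreover have "int (padic_digit p x n) = x (Suc n) div int p ^ n"
      using \<open>0 \<le> x (Suc n)\<close> p by (simp add: padic_digit_def pos_imp_zdiv_nonneg_iff)
    ultimately show ?thesis by (metis mult_div_mod_eq)
  qed
  fix n show "s n = t n"
  proof (induction n)
    case 0
    have "s 0 \<in> {0..<int p ^ 0}" "t 0 \<in> {0..<int p ^ 0}" using s t unfolding padic_ints_def by blast+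
    then show ?case by simp
  next
    case (Suc n)
    then show ?case using split [OF s] split [OF t] digits by metis
  qed
qed

definition padic_of_int :: "nat \<Rightarrow> int \<Rightarrow> nat \<Rightarrow> int" where
  "padic_of_int p x = (\<lambda>n. x mod int p ^ n)"

lemma padic_of_int: "p > 0 \<Longrightarrow> padic_of_int p x \<in> padic_ints p"
  by (auto simp: padic_ints_def padic_of_int_def mod_mod_cancel simp del: power_Suc)
    (simp add: mod_mod_cancel)

lemma padic_mult_of_int: "padic_mult p (padic_of_int p x) (padic_of_int p y) = padic_of_int p (x * y)"
  by (simp add: padic_mult_def padic_of_int_def mod_mult_eq)

lemma padic_uminus_of_int: "padic_uminus p (padic_of_int p x) = padic_of_int p (- x)"
  by (simp add: padic_uminus_def padic_of_int_def mod_minus_eq)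

lemma padic_uminus_closed: "t \<in> padic_ints p \<Longrightarrow> p > 0 \<Longrightarrow> padic_uminus p t \<in> padic_ints p"
proof -
  assume t: "t \<in> padic_ints p" and p: "p > 0"
  have "(- t (Suc n)) mod int p ^ Suc n mod int p ^ n = (- t n) mod int p ^ n" for n
  proof -
    have "(- t (Suc n)) mod int p ^ Suc n mod int p ^ n = (- t (Suc n)) mod int p ^ n"
      by (simp add: mod_mod_cancel)
    also have "\<dots> = (- (t (Suc n) mod int p ^ n)) mod int p ^ n" by (simp only: mod_minus_eq)
    also have "t (Suc n) mod int p ^ n = t n" using t by (auto simp: padic_ints_def)
    finally show ?thesis .
  qed
  then show ?thesis using p by (auto simp: padic_ints_def padic_uminus_def simp del: power_Suc)
qed

lemma padic_uminus_inj:
  assumes "s \<in> padic_ints p" "t \<in> padic_ints p" "padic_uminus p s = padic_uminus p t"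
  shows "s = t"
proof
  fix n
  have "(- s n) mod int p ^ n = (- t n) mod int p ^ n"
    using fun_cong [OF assms(3), of n] by (simp add: padic_uminus_def)
  then have "(- (- s n)) mod int p ^ n = (- (- t n)) mod int p ^ n" by (rule mod_minus_cong)
  then show "s n = t n" using assms(1,2) by (auto simp: padic_ints_def)
qed

lemma padic_of_int_neq:
  assumes "\<not> int p ^ n dvd x - y"
  shows "padic_of_int p x \<noteq> padic_of_int p y"
  using assms unfolding padic_of_int_def fun_eq_iff by (auto simp: mod_eq_dvd_iff)

lemma of_nat_inj_less_CHAR:
  assumes "of_nat m = (of_nat n :: 'a::ring_1)" "m < CHAR('a)" "n < CHAR('a)"
  shows "m = n"
proof -
  have "False" if "i < l" "l < CHAR('a)" "of_nat i = (of_nat l :: 'a)" for i l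
    using of_nat_eq_iff_char_dvd [OF that(1), where 'a = 'a] that by (auto dest: dvd_imp_le)
  then show ?thesis using assms by (metis nat_neq_iff)
qed

lemma fps_binomial_nth:
  "fps_nth ((1 + fps_const a * fps_X) ^ n) j = of_nat (n choose j) * (a ^ j :: 'a::comm_ring_1)"
proof (induction n arbitrary: j)
  case 0
  then show ?case by (cases j) auto
next
  case (Suc n)
  have "fps_nth ((1 + fps_const a * fps_X) ^ Suc n) j =
      fps_nth ((1 + fps_const a * fps_X) ^ n) j + a * fps_nth (fps_X * (1 + fps_const a * fps_X) ^ n) j"
    by (simp add: distrib_right mult.assoc)
  then show ?case using Suc by (cases j) (simp_all add: algebra_simps)
qed

lemma one_plus_power: "\<exists>r. (1 + y) ^ d = 1 + of_nat d * y + y ^ 2 * (r :: 'a::comm_ring_1)"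
proof (induction d)
  case 0
  show ?case by (rule exI [of _ 0]) simp
next
  case (Suc d)
  then obtain r where "(1 + y) ^ d = 1 + of_nat d * y + y ^ 2 * r" by blast
  then have "(1 + y) ^ Suc d = 1 + of_nat (Suc d) * y + y ^ 2 * (r + of_nat d + y * r)"
    by (simp add: algebra_simps power2_eq_square)
  then show ?case by blast
qed

section \<open>The infinite product for p-adic exponents, for both signs at once\<close>

context
  fixes a :: "'k::field" and p :: nat and u :: "'k fps"
  assumes char: "CHAR('k) = p" and p: "prime p" and a: "a \<noteq> 0"
  defines "u \<equiv> fps_const a * fps_X"
begin

private lemma p1: "p > 1" using p by (rule prime_gt_1_nat)

private definition "factor t j = (1 + u ^ (p ^ j)) ^ padic_digit p t j"
private definition "partial t n = (\<Prod>i<n. factor t i)"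

private lemma u_power: "u ^ q = fps_X ^ q * fps_const (a ^ q)"
  by (simp add: u_def power_mult_distrib fps_const_power mult.commute)

text \<open>Below degree \<open>2 * p ^ j\<close> only the linear term of the \<open>j\<close>-th
  factor matters; \<open>one_plus_power\<close> leaves a remainder divisible by the square.\<close>

private lemma factor_mult_nth:
  assumes "n < 2 * p ^ j"
  shows "fps_nth (A * factor t j) n =
    fps_nth A n + (if n < p ^ j then 0 else of_nat (padic_digit p t j) * (a ^ (p ^ j) * fps_nth A (n - p ^ j)))"
proof -
  let ?d = "padic_digit p t j" and ?q = "p ^ j"
  obtain r where r: "factor t j = 1 + of_nat ?d * u ^ ?q + (u ^ ?q) ^ 2 * r"
    using one_plus_power [of "u ^ ?q" ?d] unfolding factor_def by blast
  have y2: "(u ^ ?q) ^ 2 = fps_X ^ (2 * ?q) * fps_const (a ^ (2 * ?q))"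
    by (metis power_mult mult.commute u_power)
  have "A * factor t j = A + fps_X ^ ?q * (of_nat ?d * (fps_const (a ^ ?q) * A)) + fps_X ^ (2 * ?q) * (fps_const (a ^ (2 * ?q)) * r * A)"
    unfolding r y2 unfolding u_power [of ?q] by (simp only: distrib_left distrib_right mult_1_right mult_ac)
  then show ?thesis using assms by (simp add: fps_X_power_mult_nth flip: fps_of_nat)
qed

private lemma partial_stable:
  assumes "n < p ^ k" "k \<le> m"
  shows "fps_nth (partial t m) n = fps_nth (partial t k) n"
  using assms(2)
proof (induction m rule: dec_induct)
  case (step m)
  have "n < p ^ m" using assms(1) step(1) power_increasing [of k m p] p1 by (simp add: less_le_trans)
  then show ?case
    using step(3) factor_mult_nth [of n m "partial t m" t] by (simp add: partial_def)
qed simp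

private lemma partial_0: "fps_nth (partial t m) 0 = 1"
  using partial_stable [of 0 0 m t] by (simp add: partial_def)

text \<open>Coefficients that are eventually constant mean convergence of the partial products.
  Their constant term is 1, so the limit is nonzero, as convergence of an infinite product
  requires.\<close>

lemma padic_binomial_eqI:
  assumes "\<And>n. \<exists>k. \<forall>m\<ge>k. fps_nth (partial t m) n = fps_nth F n"
  shows "padic_binomial u t = F"
proof -
  have "fps_nth F 0 = 1" using assms [of 0] partial_0 by auto
  then have "F \<noteq> 0" by auto
  have "(\<lambda>n. partial t n) \<longlonglongrightarrow> F"
    by (rule tendsto_fpsI) (use assms in \<open>auto simp: eventually_sequentially\<close>)
  then have "(\<lambda>n. \<Prod>i\<le>n. factor t i) \<longlonglongrightarrow> F"
    unfolding partial_def by (simp add: LIMSEQ_lessThan_iff_atMost)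
  then have "factor t has_prod F"
    using \<open>F \<noteq> 0\<close> by (simp add: has_prod_def raw_has_prod_def)
  then show ?thesis
    unfolding padic_binomial_def char factor_def [symmetric] by (rule has_prod_unique [symmetric])
qed

lemma padic_binomial_nth:
  assumes "n < p ^ k"
  shows "fps_nth (padic_binomial u t) n = fps_nth (partial t k) n"
proof -
  have less: "i < p ^ i" for i using p1 power_gt_expt [of p i] by simp
  have "padic_binomial u t = Abs_fps (\<lambda>n. fps_nth (partial t n) n)"
  proof (rule padic_binomial_eqI)
    fix i
    have "\<forall>m\<ge>i. fps_nth (partial t m) i = fps_nth (partial t i) i"
      using partial_stable [OF less] by blast
    then show "\<exists>k. \<forall>m\<ge>k. fps_nth (partial t m) i = fps_nth (Abs_fps (\<lambda>n. fps_nth (partial t n) n)) i"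
      unfolding fps_nth_Abs_fps by (rule exI)
  qed
  then have "fps_nth (padic_binomial u t) n = fps_nth (partial t n) n" by (simp only: fps_nth_Abs_fps)
  also have "\<dots> = fps_nth (partial t (max k n)) n"
    by (rule partial_stable [OF less, symmetric]) (rule max.cobounded2)
  also have "\<dots> = fps_nth (partial t k) n"
    by (rule partial_stable [OF assms]) (rule max.cobounded1)
  finally show ?thesis .
qed

text \<open>Once the earlier digits are known, the coefficient of degree \<open>p ^ j\<close>
  reveals the \<open>j\<close>-th digit, and a digit below \<open>p\<close> is determined by its
  image in the field. This gives the uniqueness behind the definite descriptions of the
  dimensions.\<close>

lemma padic_binomial_inj:
  assumes s: "s \<in> padic_ints p" and t: "t \<in> padic_ints p" and eq: "padic_binomial u s = padic_binomial u t"
  shows "s = t"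
proof (rule padic_eqI [OF s t])
  show "p > 0" using p1 by simp
  fix j show "padic_digit p s j = padic_digit p t j"
  proof (induction j rule: less_induct)
    case (less j)
    then have P: "partial s j = partial t j" by (simp add: partial_def factor_def)
    have "fps_nth (partial x (Suc j)) (p ^ j) = fps_nth (partial x j) (p ^ j) + of_nat (padic_digit p x j) * a ^ (p ^ j)" for x
      using factor_mult_nth [of "p ^ j" j "partial x j" x] partial_0 [of x j] p1 by (simp add: partial_def)
    moreover have "fps_nth (partial s (Suc j)) (p ^ j) = fps_nth (partial t (Suc j)) (p ^ j)"
      using padic_binomial_nth [of "p ^ j" "Suc j" s] padic_binomial_nth [of "p ^ j" "Suc j" t] eq p1 by simp
    ultimately have "(of_nat (padic_digit p s j) :: 'k) = of_nat (padic_digit p t j)"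
      using P a by simp
    then show ?case
      using of_nat_inj_less_CHAR [where 'a = 'k] padic_digit_less [OF s] padic_digit_less [OF t] p1 char by simp
  qed
qed

lemma padic_binomial_nat:
  assumes N: "N < p"
  shows "padic_binomial u (padic_of_int p (int N)) = (1 + u) ^ N"
proof (rule padic_binomial_eqI)
  let ?t = "padic_of_int p (int N)"
  have d: "padic_digit p ?t j = (if j = 0 then N else 0)" for j
  proof (cases j)
    case (Suc i)
    have "N < p ^ j" using N power_increasing [of 1 j p] Suc p1 by (simp add: less_le_trans del: power_Suc)
    moreover from this have "N < p ^ Suc j" using power_increasing [of j "Suc j" p] p1 by (simp add: less_le_trans del: power_Suc)
    ultimately show ?thesis using Suc
      by (simp add: padic_digit_def padic_of_int_def zmod_int zdiv_int flip: of_nat_power del: power_Suc)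
  qed (use N in \<open>simp add: padic_digit_def padic_of_int_def\<close>)
  have "partial ?t (Suc m) = (1 + u) ^ N" for m
    by (induction m) (simp_all add: partial_def factor_def d)
  then show "\<exists>k. \<forall>m\<ge>k. fps_nth (partial ?t m) n = fps_nth ((1 + u) ^ N) n" for n
    by (metis Suc_le_D)
qed

text \<open>All digits of \<open>-1\<close> are \<open>p - 1\<close>. Multiplied by
  \<open>1 + u\<close>, the partial product telescopes through the Frobenius to
  \<open>1 + u ^ (p ^ m)\<close>, which tends to 1; so the limit is the geometric series.\<close>

lemma padic_binomial_minus_one:
  "padic_binomial u (padic_of_int p (- 1)) = Abs_fps (\<lambda>n. (- a) ^ n)"
proof (rule padic_binomial_eqI)
  let ?t = "padic_of_int p (- 1)" and ?G = "Abs_fps (\<lambda>n. (- a) ^ n)"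
  have d: "padic_digit p ?t j = p - 1" for j
  proof -
    have "(- 1) mod (int p ^ Suc j) = int p ^ Suc j - 1"
      using p1 by (subst zmod_minus1) (auto simp del: power_Suc)
    also have "\<dots> = (int p - 1) * int p ^ j + (int p ^ j - 1)" by (simp add: algebra_simps)
    also have "\<dots> div int p ^ j = int p - 1"
      using p1 by (subst div_mult_self3) (auto intro: div_pos_pos_trivial)
    finally show ?thesis using p1 by (simp add: padic_digit_def padic_of_int_def nat_diff_distrib' del: power_Suc)
  qed
  have "(1 + u) * partial ?t m = 1 + u ^ (p ^ m)" for m
  proof (induction m)
    case (Suc m)
    have "(1 + u) * partial ?t (Suc m) = (1 + u ^ (p ^ m)) * (1 + u ^ (p ^ m)) ^ (p - 1)"
      using Suc by (simp add: partial_def factor_def d mult.assoc [symmetric])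
    also have "\<dots> = (1 + u ^ (p ^ m)) ^ p" using p1 by (simp flip: power_Suc)
    also have "\<dots> = 1 + u ^ (p ^ Suc m)"
    proof -
      have "(1 + u ^ (p ^ m)) ^ p = 1 ^ p + (u ^ (p ^ m)) ^ p"
        by (rule freshmans_dream) (simp_all add: p char)
      also have "(u ^ (p ^ m)) ^ p = u ^ (p ^ Suc m)" by (metis power_mult power_Suc2)
      finally show ?thesis by simp
    qed
    finally show ?case .
  qed (simp add: partial_def)
  moreover have G: "(1 + u) * ?G = 1"
  proof (rule fps_ext)
    fix n
    have "fps_nth ((1 + u) * ?G) n = (- a) ^ n + a * fps_nth (fps_X * ?G) n"
      unfolding u_def by (simp add: distrib_right mult.assoc)
    then show "fps_nth ((1 + u) * ?G) n = fps_nth 1 n" by (cases n) simp_all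
  qed
  ultimately have P: "partial ?t m = ?G + fps_X ^ (p ^ m) * (fps_const (a ^ (p ^ m)) * ?G)" for m
  proof -
    have "?G * ((1 + u) * partial ?t m) = partial ?t m" using G by (simp add: mult_ac)
    then have "partial ?t m = ?G * (1 + u ^ (p ^ m))" using \<open>\<And>m. (1 + u) * partial ?t m = 1 + u ^ (p ^ m)\<close> by simp
    then show ?thesis unfolding u_power by (simp add: algebra_simps)
  qed
  show "\<exists>k. \<forall>m\<ge>k. fps_nth (partial ?t m) n = fps_nth ?G n" for n
  proof (intro exI allI impI)
    fix m assume "n \<le> m"
    then have "n < p ^ m" using p1 power_gt_expt [of p m] by simp
    then show "fps_nth (partial ?t m) n = fps_nth ?G n" unfolding P by (simp add: fps_X_power_mult_nth)
  qed
qed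

end

section \<open>Recognising p-adic dimensions from their series\<close>

lemma Dim_plus_eqI:
  fixes C :: "('o,'m,'k::field) tensor_cat"
  assumes p: "prime CHAR('k)" and d: "d \<in> padic_ints CHAR('k)"
    and eq: "\<And>j. cat_dim C (sym_power C j X) = fps_nth (padic_binomial (- fps_X) (padic_uminus CHAR('k) d)) j"
  shows "Dim_plus C X = d"
  unfolding Dim_plus_def
proof (rule the_equality)
  have p0: "CHAR('k) > 0" using p by (rule prime_gt_0_nat)
  have u: "- fps_X = fps_const (- 1 :: 'k) * fps_X" by (simp flip: fps_const_neg)
  show *: "d \<in> padic_ints CHAR('k) \<and>
      Abs_fps (\<lambda>j. cat_dim C (sym_power C j X)) = padic_binomial (- fps_X) (padic_uminus CHAR('k) d)"
    using d by (simp add: eq fps_eq_iff)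
  fix e assume e: "e \<in> padic_ints CHAR('k) \<and>
      Abs_fps (\<lambda>j. cat_dim C (sym_power C j X)) = padic_binomial (- fps_X) (padic_uminus CHAR('k) e)"
  then have "padic_binomial (- fps_X :: 'k fps) (padic_uminus CHAR('k) e) = padic_binomial (- fps_X) (padic_uminus CHAR('k) d)"
    using * by simp
  then have "padic_uminus CHAR('k) e = padic_uminus CHAR('k) d"
    unfolding u using padic_binomial_inj [OF refl p, of "- 1"] padic_uminus_closed p0 d e by simp
  then show "e = d" using padic_uminus_inj d e by blast
qed

lemma Dim_minus_eqI:
  fixes C :: "('o,'m,'k::field) tensor_cat"
  assumes p: "prime CHAR('k)" and d: "d \<in> padic_ints CHAR('k)"
    and eq: "\<And>j. cat_dim C (ext_power C j X) = fps_nth (padic_binomial fps_X d) j"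
  shows "Dim_minus C X = d"
  unfolding Dim_minus_def
proof (rule the_equality)
  have u: "fps_X = fps_const (1 :: 'k) * fps_X" by simp
  show *: "d \<in> padic_ints CHAR('k) \<and> Abs_fps (\<lambda>j. cat_dim C (ext_power C j X)) = padic_binomial fps_X d"
    using d by (simp add: eq fps_eq_iff)
  fix e assume e: "e \<in> padic_ints CHAR('k) \<and> Abs_fps (\<lambda>j. cat_dim C (ext_power C j X)) = padic_binomial fps_X e"
  then have "padic_binomial (fps_X :: 'k fps) e = padic_binomial fps_X d" using * by simp
  then show "e = d" using padic_binomial_inj [OF refl p, of 1] d e by simp
qed

text \<open>Two descents with Pascal's rule: the inner binomial coefficients of \<open>p\<close>
  vanish, so those of \<open>p - 1\<close> are alternating signs and those of \<open>p - 2\<close>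
  are signed linear terms. This identifies the truncated series of the block with
  \<open>(1 - z)^(p - 2)\<close>.\<close>

lemma choose_CHAR_minus_two:
  assumes p: "prime CHAR('k::field)" "CHAR('k) > 2" and j: "j < CHAR('k) - 1"
  shows "of_nat (CHAR('k) - 2 choose j) = ((-1) ^ j * of_nat (Suc j) :: 'k)"
proof -
  define q where "q = CHAR('k) - 2"
  have q: "CHAR('k) = Suc (Suc q)" using p(2) by (simp add: q_def)
  have step: "of_nat (n choose Suc i) = of_nat (Suc n choose Suc i) - (of_nat (n choose i) :: 'k)" for n i
    unfolding binomial_Suc_Suc of_nat_add by (rule add_diff_cancel_left' [symmetric])
  have 1: "of_nat (Suc q choose i) = ((-1) ^ i :: 'k)" if "i \<le> Suc q" for i
    using that
  proof (induction i)
    case (Suc i)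
    have "CHAR('k) dvd (CHAR('k) choose Suc i)"
      by (rule dvd_choose_prime) (use Suc.prems p q in auto)
    then have "of_nat (Suc (Suc q) choose Suc i) = (0::'k)" unfolding of_nat_eq_0_iff_char_dvd q .
    moreover have "of_nat (Suc q choose i) = ((-1) ^ i :: 'k)" using Suc by simp
    ultimately have "of_nat (Suc q choose Suc i) = (0 - (-1) ^ i :: 'k)" by (simp only: step [of "Suc q"])
    then show ?case by (simp only: power_Suc) simp
  qed simp
  have "of_nat (q choose i) = ((-1) ^ i * of_nat (Suc i) :: 'k)" if "i \<le> q" for i
    using that
  proof (induction i)
    case (Suc i)
    have "of_nat (Suc q choose Suc i) = ((-1) ^ Suc i :: 'k)" using Suc.prems by (intro 1) simp
    moreover have "of_nat (q choose i) = ((-1) ^ i * of_nat (Suc i) :: 'k)" using Suc by simp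
    ultimately have "of_nat (q choose Suc i) = ((-1) ^ Suc i - (-1) ^ i * of_nat (Suc i) :: 'k)"
      by (simp only: step [of q])
    then show ?case by (simp add: algebra_simps)
  qed simp
  then show ?thesis unfolding q_def using j by simp
qed

section \<open>Failure of multiplicativity\<close>

lemma kron_odd_line: "kron (c \<cdot>\<^sub>m A) odd_line = (- c) \<cdot>\<^sub>m (A :: 'k::field mat)"
  by (simp add: odd_line_def kron_smult_left kron_smult_right mat_smult_smult)

lemma fps_binomial_nth_X:
  "fps_nth ((1 + fps_X) ^ n) j = (of_nat (n choose j) :: 'k::field)"
  "fps_nth ((1 - fps_X) ^ n) j = (of_nat (n choose j) * (- 1) ^ j :: 'k::field)"
  using fps_binomial_nth [of "1 :: 'k" n j] fps_binomial_nth [of "- 1 :: 'k" n j] by (simp_all flip: fps_const_neg)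

lemma padic_binomial_nat_X:
  assumes "prime CHAR('k::field)" "n < CHAR('k)"
  shows "padic_binomial (fps_X :: 'k fps) (padic_of_int CHAR('k) (int n)) = (1 + fps_X) ^ n"
    and "padic_binomial (- fps_X :: 'k fps) (padic_of_int CHAR('k) (int n)) = (1 - fps_X) ^ n"
  using padic_binomial_nat [OF refl assms(1), of 1 n] padic_binomial_nat [OF refl assms(1), of "- 1" n] assms(2)
  by (simp_all flip: fps_const_neg)

context
  fixes K :: "'k::field itself"
  assumes ch: "prime CHAR('k)" "CHAR('k) > 3"
begin

private lemma c2: "CHAR('k) > 2" using ch by simp

private lemma char0: "CHAR('k) > 0" using ch by simp

lemma shift_obj: "shift 1 \<in> (rep_objs :: 'k mat set)" "(-1) \<cdot>\<^sub>m shift 1 \<in> (rep_objs :: 'k mat set)"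
proof -
  interpret E: fock_ops "1 :: 'k" "1" shift sx0 sx1 sd0 sd1 "CHAR('k) - 1"
    by (rule fock_ops_sym [OF ch(1) c2]) simp
  interpret O: fock_ops "- 1 :: 'k" "- 1" shift sx0 sx1 sd0 sd1 "CHAR('k) - 1"
    by (rule fock_ops_sym [OF ch(1) c2]) simp
  show "shift 1 \<in> (rep_objs :: 'k mat set)" using E.X_obj by (simp add: E.X_def mat_one_smult)
  show "(-1) \<cdot>\<^sub>m shift 1 \<in> (rep_objs :: 'k mat set)" using O.X_obj by (simp add: O.X_def)
qed

lemma sym_power_shift:
  "cat_dim ver (sym_power ver n (shift 1 :: 'k mat)) = (if n < CHAR('k) - 1 then of_nat (Suc n) else 0)"
  using cat_dim_sym_power [OF c2 shift_obj(1), of n] power_split_shift [OF ch(1) c2, of 1 n]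
    trace_par_power_shift [OF ch(1) c2, of 1 n]
  by (simp add: mat_one_smult)

lemma ext_power_odd_shift:
  "cat_dim ver (ext_power ver n ((-1) \<cdot>\<^sub>m shift 1 :: 'k mat)) = (if n < CHAR('k) - 1 then (-1) ^ n * of_nat (Suc n) else 0)"
  using cat_dim_ext_power [OF c2 shift_obj(2) power_split_shift [OF ch(1) c2], of n]
    trace_par_power_shift [OF ch(1) c2, of "-1" n]
  by simp

lemma ext_power_shift:
  "cat_dim ver (ext_power ver n (shift 1 :: 'k mat)) = (if n = 0 then 1 else if n = 1 then 2 else if n = 2 then 1 else 0)"
  using cat_dim_ext_power [OF c2 shift_obj(1), of n] power_split_ext [OF ch, of 1 n] trace_par_power_ext [OF ch, of 1 n]
  by (simp add: mat_one_smult)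

lemma sym_power_odd_shift:
  "cat_dim ver (sym_power ver n ((-1) \<cdot>\<^sub>m shift 1 :: 'k mat)) = (if n = 0 then 1 else if n = 1 then - 2 else if n = 2 then 1 else 0)"
  using cat_dim_sym_power [OF c2 shift_obj(2), of n] power_split_ext [OF ch, of "-1" n] trace_par_power_ext [OF ch, of "-1" n]
  by simp

private lemma choose2: "(2 choose n) = (if n = 0 then 1 else if n = 1 then 2 else if n = 2 then 1 else 0)"
  by (auto simp: numeral_2_eq_2 binomial_eq_0)

private lemma choose1: "(1 choose n) = (if n = 0 then 1 else if n = 1 then 1 else 0)"
  by (auto simp: binomial_eq_0)

private lemma choose_top: "of_nat (CHAR('k) - 2 choose n) = (if n < CHAR('k) - 1 then (-1) ^ n * of_nat (Suc n) else 0 :: 'k)"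
proof (cases "n < CHAR('k) - 1")
  case True
  then show ?thesis using choose_CHAR_minus_two [OF ch(1) c2] by simp
next
  case False
  then have "CHAR('k) - 2 < n" using ch by simp
  then show ?thesis using False by (simp add: binomial_eq_0)
qed

text \<open>The dimensions are the coefficients of \<open>(1 - z)^n\<close>, an exponent with a
  single digit, so the series determines the negative of the dimension.\<close>

lemma Dim_plus_nat:
  assumes "\<And>j. cat_dim (ver :: 'k small_tensor_cat) (sym_power ver j X) = of_nat (n choose j) * (- 1) ^ j" "n < CHAR('k)"
  shows "Dim_plus (ver :: 'k small_tensor_cat) X = padic_of_int CHAR('k) (- int n)"
  by (rule Dim_plus_eqI [OF ch(1) padic_of_int [OF char0]])
    (simp add: assms padic_uminus_of_int padic_binomial_nat_X [OF ch(1)] fps_binomial_nth_X)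

lemma Dim_minus_nat:
  assumes "\<And>j. cat_dim (ver :: 'k small_tensor_cat) (ext_power ver j X) = of_nat (n choose j)" "n < CHAR('k)"
  shows "Dim_minus (ver :: 'k small_tensor_cat) X = padic_of_int CHAR('k) (int n)"
  by (rule Dim_minus_eqI [OF ch(1) padic_of_int [OF char0]])
    (simp add: assms padic_binomial_nat_X [OF ch(1)] fps_binomial_nth_X)

lemma Dim_plus_values:
  "Dim_plus ver (shift 1 :: 'k mat) = padic_of_int CHAR('k) (- int (CHAR('k) - 2))"
  "Dim_plus ver (odd_line :: 'k mat) = padic_of_int CHAR('k) (- int 1)"
  "Dim_plus ver ((-1) \<cdot>\<^sub>m shift 1 :: 'k mat) = padic_of_int CHAR('k) (- int 2)"
proof -
  have "(-1) ^ j * of_nat (Suc j) * (-1) ^ j = (of_nat (Suc j) :: 'k)" for j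
    by (simp add: mult.commute [of _ "of_nat (Suc j)"] mult.assoc flip: power_mult_distrib)
  then show "Dim_plus ver (shift 1 :: 'k mat) = padic_of_int CHAR('k) (- int (CHAR('k) - 2))"
    using ch by (intro Dim_plus_nat) (simp_all add: sym_power_shift [simplified] choose_top)
  show "Dim_plus ver (odd_line :: 'k mat) = padic_of_int CHAR('k) (- int 1)"
    using ch by (intro Dim_plus_nat; simp only: sym_power_odd_line [OF ch(1) c2] choose1; simp)
  show "Dim_plus ver ((-1) \<cdot>\<^sub>m shift 1 :: 'k mat) = padic_of_int CHAR('k) (- int 2)"
    using ch by (intro Dim_plus_nat; simp only: sym_power_odd_shift choose2; simp)
qed

lemma Dim_minus_values:
  "Dim_minus ver ((-1) \<cdot>\<^sub>m shift 1 :: 'k mat) = padic_of_int CHAR('k) (int (CHAR('k) - 2))"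
  "Dim_minus ver (odd_line :: 'k mat) = padic_of_int CHAR('k) (- 1)"
  "Dim_minus ver (shift 1 :: 'k mat) = padic_of_int CHAR('k) (int 2)"
proof -
  show "Dim_minus ver ((-1) \<cdot>\<^sub>m shift 1 :: 'k mat) = padic_of_int CHAR('k) (int (CHAR('k) - 2))"
    using ch by (intro Dim_minus_nat; simp only: ext_power_odd_shift choose_top; simp)
  show "Dim_minus ver (odd_line :: 'k mat) = padic_of_int CHAR('k) (- 1)"
  proof (rule Dim_minus_eqI [OF ch(1) padic_of_int [OF char0]])
    fix j
    have "padic_binomial (fps_X :: 'k fps) (padic_of_int CHAR('k) (- 1)) = Abs_fps (\<lambda>n. (- 1) ^ n)"
      using padic_binomial_minus_one [OF refl ch(1), of 1] by simp
    then show "cat_dim ver (ext_power ver j (odd_line :: 'k mat)) = fps_nth (padic_binomial fps_X (padic_of_int CHAR('k) (- 1))) j"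
      by (simp add: ext_power_odd_line [OF ch(1) c2])
  qed
  show "Dim_minus ver (shift 1 :: 'k mat) = padic_of_int CHAR('k) (int 2)"
    using ch by (intro Dim_minus_nat; simp only: ext_power_shift choose2; simp)
qed

end

theorem mainTheorem4:
  fixes p :: nat
  assumes "CHAR('k::alg_closed_field) = p" and "p \<ge> 5"
  shows "(\<exists>C :: 'k small_tensor_cat. symmetric_tensor_category C \<and>
            (\<exists>X\<in>Obj C. \<exists>Y\<in>Obj C.
               Dim_plus C (X \<boxtimes>\<^bsub>C\<^esub> Y) \<noteq> padic_mult p (Dim_plus C X) (Dim_plus C Y))) \<and>
         (\<exists>C :: 'k small_tensor_cat. symmetric_tensor_category C \<and>
            (\<exists>X\<in>Obj C. \<exists>Y\<in>Obj C.
               Dim_minus C (X \<boxtimes>\<^bsub>C\<^esub> Y) \<noteq> padic_mult p (Dim_minus C X) (Dim_minus C Y)))"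
proof -
  have ch: "prime CHAR('k)" "CHAR('k) > 3" "CHAR('k) > 2"
    using assms prime_CHAR_semidom [where 'a = 'k] by auto
  have cat: "symmetric_tensor_category (ver :: 'k small_tensor_cat)"
    by (rule ver_symmetric_tensor_category [OF ch(3)])
  note objs = shift_obj [OF ch(1,2)] odd_line_obj [OF ch(1,3)]
  have obj_ver: "Obj (ver :: 'k small_tensor_cat) = rep_objs" and tensor: "X \<boxtimes>\<^bsub>ver\<^esub> Y = kron X Y" for X Y :: "'k mat"
    by (simp_all add: ver_def)
  have XY: "kron (shift 1) odd_line = ((-1) \<cdot>\<^sub>m shift 1 :: 'k mat)" "kron ((-1) \<cdot>\<^sub>m shift 1) odd_line = (shift 1 :: 'k mat)"
    using kron_odd_line [of 1 "shift 1 :: 'k mat"] kron_odd_line [of "-1" "shift 1 :: 'k mat"] by (simp_all add: mat_one_smult)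
  \<comment> \<open>The differences of the two sides are \<open>-2 - (p - 2) = -p\<close> and
    \<open>2 + (p - 2) = p\<close>. The residues modulo \<open>p\<close> agree, so those modulo the
    square of \<open>p\<close> must be compared.\<close>
  have p: "int p ^ 2 > int p" using assms(2) by (simp add: power2_eq_square)
  have dvd: "\<not> int p ^ 2 dvd p" using p assms(2) by (auto dest: zdvd_imp_le)
  have "Dim_plus ver (shift 1 \<boxtimes>\<^bsub>ver\<^esub> (odd_line :: 'k mat)) \<noteq> padic_mult p (Dim_plus ver (shift 1 :: 'k mat)) (Dim_plus ver (odd_line :: 'k mat))"
    unfolding tensor XY Dim_plus_values [OF ch(1,2)] assms(1) padic_mult_of_int
    by (rule padic_of_int_neq [where n = 2]) (use assms dvd in \<open>simp add: of_nat_diff\<close>)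
  moreover have "Dim_minus ver (((-1) \<cdot>\<^sub>m shift 1) \<boxtimes>\<^bsub>ver\<^esub> (odd_line :: 'k mat)) \<noteq>
      padic_mult p (Dim_minus ver ((-1) \<cdot>\<^sub>m shift 1 :: 'k mat)) (Dim_minus ver (odd_line :: 'k mat))"
    unfolding tensor XY Dim_minus_values [OF ch(1,2)] assms(1) padic_mult_of_int
    by (rule padic_of_int_neq [where n = 2]) (use assms dvd in \<open>simp add: of_nat_diff\<close>)
  ultimately show ?thesis using cat objs obj_ver by blast
qed

end
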